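(* For any $\Phi_0\in\mathcal{H}$, the problem $$\Phi_t=\mathcal{A}\Phi\quad (t>0),\qquad \Phi(0)=\Phi_0,$$ admits a unique weak solution $\Phi:=e^{t\mathcal{A}}\Phi_0\in C(\mathbb{R}_+;\mathcal{H})$. Moreover, if $\Phi_0\in D(\mathcal{A})$, then $\Phi\in C(\mathbb{R}_+;D(\mathcal{A}))\cap C^1(\mathbb{R}_+;\mathcal{H})$.
   Context: Constants: $0<L_0<L$; $\rho_0,\rho_1,\rho_2,\alpha_1,\alpha_2,\beta_1,\beta_2,\kappa>0$; $\gamma\in\mathbb{R}\setminus\{0\}$. All functions are complex valued. Spaces: $\mathbb{V}_1=\{(u,y)\in H^1(0,L_0)\times H^1(L_0,L): u(0)=0,\ y(L)=0,\ u(L_0)=y(L_0)\}$; $\mathbb{W}_1=\{(u,y)\in (H^2(0,L_0)\times H^2(L_0,L))\cap\mathbb{V}_1: u_x(0)=y_x(L)=0,\ u_x(L_0)=y_x(L_0)\}$; $\mathbb{V}_2=\mathbb{V}_1\times L^2(0,L_0)$; $\mathbb{W}_2=\mathbb{W}_1\times H^1_0(0,L_0)$; $\mathbb{L}_2=L^2(0,L_0)\times L^2(L_0,L)\times L^2(0,L_0)$. With $\mathbb{L}_2$ identified with its dual, $\mathbb{W}_2\subset\mathbb{V}_2\subset\mathbb{L}_2\subset\mathbb{V}_2'\subset\mathbb{W}_2'$ (duals consist of bounded antilinear functionals; an element of $\mathbb{W}_2'$ belongs to $\mathbb{V}_2'$ if it extends to a bounded antilinear functional on $\mathbb{V}_2$).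 Forms: for $(u,y),(\hat u,\hat y)\in\mathbb{W}_1$, $a((u,y),(\hat u,\hat y))=\beta_1\int_0^{L_0}u_{xx}\overline{\hat u_{xx}}\,dx+\beta_2\int_{L_0}^L y_{xx}\overline{\hat y_{xx}}\,dx$; for $(u,y,\theta),(\hat u,\hat y,\hat\theta)\in\mathbb{W}_2$, $b((u,y,\theta),(\hat u,\hat y,\hat\theta))=\gamma\int_0^{L_0}(u_x\overline{\hat\theta_x}-\theta_x\overline{\hat u_x})\,dx+\kappa\int_0^{L_0}\theta_x\overline{\hat\theta_x}\,dx$; for $(u,y,\theta),(\hat u,\hat y,\hat\theta)\in\mathbb{V}_2$, $c((u,y,\theta),(\hat u,\hat y,\hat\theta))=\int_0^{L_0}(\rho_1u\overline{\hat u}+\alpha_1u_x\overline{\hat u_x})\,dx+\int_{L_0}^L(\rho_2y\overline{\hat y}+\alpha_2y_x\overline{\hat y_x})\,dx+\rho_0\int_0^{L_0}\theta\overline{\hat\theta}\,dx$. The forms $a$ and $c$ are used as the inner products of $\mathbb{W}_1$ and $\mathbb{V}_2$. Operators: $C:\mathbb{V}_2\to\mathbb{V}_2'$ is the isomorphism $\langle CU,\hat U\rangle=c(U,\hat U)$; $B:\mathbb{W}_2\to\mathbb{W}_2'$ is given by $\langle BU,\hat U\rangle=b(U,\hat U)$; $A_1:\mathbb{W}_1\to\mathbb{W}_2'$ is given by $\langle A_1Z,(\hat u,\hat y,\hat\theta)\rangle=a(Z,(\hat u,\hat y))$. Energy space $\mathcal{H}=\mathbb{W}_1\times\mathbb{V}_2$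 with inner product $\langle(\Phi_1,\Phi_2),(\hat\Phi_1,\hat\Phi_2)\rangle_{\mathcal{H}}=a(\Phi_1,\hat\Phi_1)+c(\Phi_2,\hat\Phi_2)$. Write $\Phi_1=(u,y)$, $\Phi_2=(v,z,\theta)$. Operator: $D(\mathcal{A})=\{(\Phi_1,\Phi_2)\in\mathbb{W}_1\times\mathbb{W}_2: B\Phi_2+A_1\Phi_1\in\mathbb{V}_2'\}$, $\mathcal{A}(\Phi_1,\Phi_2)=\big((v,z),-C^{-1}(B\Phi_2+A_1\Phi_1)\big)$. $(e^{t\mathcal{A}})_{t\ge0}$ denotes the $C_0$-semigroup of contractions on $\mathcal{H}$ generated by $\mathcal{A}$. $D(\mathcal{A})$ carries the graph norm. A weak (mild) solution is $\Phi\in C(\mathbb{R}_+;\mathcal{H})$ such that $\int_0^t\Phi(s)\,ds\in D(\mathcal{A})$ and $\Phi(t)=\Phi_0+\mathcal{A}\int_0^t\Phi(s)\,ds$ for all $t\ge0$. *)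

theory Defs
  imports "HOL-Analysis.Analysis"
begin

section \<open>Complex vector spaces\<close>

class complex_vector = real_vector +
  fixes scaleC :: "complex \<Rightarrow> 'a \<Rightarrow> 'a"  (infixr \<open>*\<^sub>C\<close> 75)
  assumes scaleC_add_right: "c *\<^sub>C (x + y) = c *\<^sub>C x + c *\<^sub>C y"
    and scaleC_add_left: "(c + d) *\<^sub>C x = c *\<^sub>C x + d *\<^sub>C x"
    and scaleC_scaleC: "c *\<^sub>C d *\<^sub>C x = (c * d) *\<^sub>C x"
    and scaleC_one: "1 *\<^sub>C x = x"
    and scaleR_scaleC: "r *\<^sub>R x = complex_of_real r *\<^sub>C x"

instantiation prod :: (complex_vector, complex_vector) complex_vector
begin

definition scaleC_prod :: "complex \<Rightarrow> 'a \<times> 'b \<Rightarrow> 'a \<times> 'b" where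
  "scaleC_prod c x = (c *\<^sub>C fst x, c *\<^sub>C snd x)"

instance
  by standard
    (auto simp: scaleC_prod_def prod_eq_iff scaleC_add_right scaleC_add_left scaleC_scaleC
      scaleC_one scaleR_scaleC)

end

text \<open>Below, a complex inner product space is a carrier set \<open>S\<close> together with a sesquilinear
  \<open>ip\<close> (linear in the first argument), and a normed space is a carrier together with a norm \<open>n\<close>.\<close>

definition ip_norm :: "('a \<Rightarrow> 'a \<Rightarrow> complex) \<Rightarrow> 'a \<Rightarrow> real" where
  "ip_norm ip x = sqrt (Re (ip x x))"

definition antilinear_on :: "'a::complex_vector set \<Rightarrow> ('a \<Rightarrow> complex) \<Rightarrow> bool" where
  "antilinear_on S F \<longleftrightarrow>
     (\<forall>x\<in>S. \<forall>y\<in>S. F (x + y) = F x + F y) \<and> (\<forall>c. \<forall>x\<in>S. F (c *\<^sub>C x) = cnj c * F x)"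

text \<open>Functionals are \<open>undefined\<close> off their domain, so that they are determined by their values
  on it.\<close>

definition antidual :: "'a::complex_vector set \<Rightarrow> ('a \<Rightarrow> real) \<Rightarrow> ('a \<Rightarrow> complex) set" where
  "antidual S n =
     {F \<in> extensional S. antilinear_on S F \<and> (\<exists>K. \<forall>x\<in>S. cmod (F x) \<le> K * n x)}"

definition linear_map_on :: "'a::complex_vector set \<Rightarrow> ('a \<Rightarrow> 'a) \<Rightarrow> bool" where
  "linear_map_on S f \<longleftrightarrow> (\<forall>x\<in>S. f x \<in> S) \<and>
     (\<forall>x\<in>S. \<forall>y\<in>S. f (x + y) = f x + f y) \<and> (\<forall>c. \<forall>x\<in>S. f (c *\<^sub>C x) = c *\<^sub>C f x)"


section \<open>Functions of time with values in a normed space\<close>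

definition norm_continuous ::
    "'a::real_vector set \<Rightarrow> ('a \<Rightarrow> real) \<Rightarrow> (real \<Rightarrow> 'a) \<Rightarrow> bool" where
  "norm_continuous S n f \<longleftrightarrow>
     (\<forall>t\<ge>0. f t \<in> S) \<and> (\<forall>t\<ge>0. ((\<lambda>s. n (f s - f t)) \<longlongrightarrow> 0) (at t within {0..}))"

definition norm_C1 :: "'a::real_vector set \<Rightarrow> ('a \<Rightarrow> real) \<Rightarrow> (real \<Rightarrow> 'a) \<Rightarrow> bool" where
  "norm_C1 S n f \<longleftrightarrow> (\<forall>t\<ge>0. f t \<in> S) \<and>
     (\<exists>f'. norm_continuous S n f' \<and>
       (\<forall>t\<ge>0. ((\<lambda>s. n ((1 / (s - t)) *\<^sub>R (f s - f t) - f' t)) \<longlongrightarrow> 0) (at t within {0..})))"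

text \<open>The Riemann integral: tagged division sums of mesh tending to zero converge to \<open>I\<close> in the
  norm \<open>n\<close>.\<close>

definition has_norm_integral ::
    "('a::real_vector \<Rightarrow> real) \<Rightarrow> (real \<Rightarrow> 'a) \<Rightarrow> 'a \<Rightarrow> real set \<Rightarrow> bool" where
  "has_norm_integral n f I J \<longleftrightarrow>
     (\<forall>\<epsilon>>0. \<exists>\<delta>>0. \<forall>P. P tagged_division_of J \<and> (\<lambda>x. ball x \<delta>) fine P \<longrightarrow>
        n ((\<Sum>(x, K)\<in>P. measure lborel K *\<^sub>R f x) - I) < \<epsilon>)"


section \<open>Contraction semigroups\<close>

definition C0_contraction_semigroup ::
    "'a::complex_vector set \<Rightarrow> ('a \<Rightarrow> real) \<Rightarrow> (real \<Rightarrow> 'a \<Rightarrow> 'a) \<Rightarrow> bool" where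
  "C0_contraction_semigroup S n T \<longleftrightarrow>
     (\<forall>t\<ge>0. linear_map_on S (T t)) \<and>
     (\<forall>x\<in>S. T 0 x = x) \<and>
     (\<forall>s\<ge>0. \<forall>t\<ge>0. \<forall>x\<in>S. T (s + t) x = T s (T t x)) \<and>
     (\<forall>x\<in>S. ((\<lambda>t. n (T t x - x)) \<longlongrightarrow> 0) (at_right 0)) \<and>
     (\<forall>t\<ge>0. \<forall>x\<in>S. n (T t x) \<le> n x)"

definition has_generator_value ::
    "('a::complex_vector \<Rightarrow> real) \<Rightarrow> (real \<Rightarrow> 'a \<Rightarrow> 'a) \<Rightarrow> 'a \<Rightarrow> 'a \<Rightarrow> bool" where
  "has_generator_value n T x y \<longleftrightarrow>
     ((\<lambda>h. n ((1 / h) *\<^sub>R (T h x - x) - y)) \<longlongrightarrow> 0) (at_right 0)"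

definition is_generator ::
    "'a::complex_vector set \<Rightarrow> ('a \<Rightarrow> real) \<Rightarrow> (real \<Rightarrow> 'a \<Rightarrow> 'a) \<Rightarrow> 'a set \<Rightarrow> ('a \<Rightarrow> 'a) \<Rightarrow> bool"
  where
  "is_generator S n T D A \<longleftrightarrow>
     D = {x \<in> S. \<exists>y\<in>S. has_generator_value n T x y} \<and>
     (\<forall>x\<in>D. A x \<in> S \<and> has_generator_value n T x (A x))"


section \<open>Square integrable functions\<close>

definition sq_integrable :: "(real \<Rightarrow> complex) \<Rightarrow> bool" where
  "sq_integrable f \<longleftrightarrow> f \<in> borel_measurable lborel \<and> integrable lborel (\<lambda>x. (cmod (f x))\<^sup>2)"

lemma sq_integrable_zero: "sq_integrable (\<lambda>x. 0)"
  by (simp add: sq_integrable_def)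

lemma sq_integrable_scale:
  assumes "sq_integrable f" shows "sq_integrable (\<lambda>x. c * f x)"
proof -
  have [measurable]: "f \<in> borel_measurable borel" using assms by (simp add: sq_integrable_def)
  have "(\<lambda>x. c * f x) \<in> borel_measurable borel" by measurable
  then show ?thesis using assms by (simp add: sq_integrable_def norm_mult power_mult_distrib)
qed

lemma sq_integrable_add:
  assumes "sq_integrable f" "sq_integrable g" shows "sq_integrable (\<lambda>x. f x + g x)"
proof -
  have m [measurable]: "f \<in> borel_measurable lborel" "g \<in> borel_measurable lborel"
    using assms by (auto simp: sq_integrable_def)
  have i: "integrable lborel (\<lambda>x. 2 * (cmod (f x))\<^sup>2 + 2 * (cmod (g x))\<^sup>2)"
    using assms by (auto simp: sq_integrable_def)
  have "integrable lborel (\<lambda>x. (cmod (f x + g x))\<^sup>2)"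
  proof (rule Bochner_Integration.integrable_bound[OF i])
    show "AE x in lborel. norm ((cmod (f x + g x))\<^sup>2)
        \<le> norm (2 * (cmod (f x))\<^sup>2 + 2 * (cmod (g x))\<^sup>2)"
    proof (rule AE_I2)
      fix x
      have "(cmod (f x + g x))\<^sup>2 \<le> (cmod (f x) + cmod (g x))\<^sup>2"
        by (simp add: norm_triangle_ineq power_mono)
      also have "\<dots> \<le> 2 * (cmod (f x))\<^sup>2 + 2 * (cmod (g x))\<^sup>2"
        using sum_squares_bound[of "cmod (f x)" "cmod (g x)"] by (simp add: power2_sum)
      finally show "norm ((cmod (f x + g x))\<^sup>2)
          \<le> norm (2 * (cmod (f x))\<^sup>2 + 2 * (cmod (g x))\<^sup>2)"
        by simp
    qed
  qed simp
  then show ?thesis by (simp add: sq_integrable_def)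
qed

definition l2_rel :: "(real \<Rightarrow> complex) \<Rightarrow> (real \<Rightarrow> complex) \<Rightarrow> bool" where
  "l2_rel f g \<longleftrightarrow> sq_integrable f \<and> sq_integrable g \<and> (AE x in lborel. f x = g x)"

text \<open>The type \<open>l2\<close> is \<open>L\<^sup>2\<close> of the real line; \<open>L\<^sup>2(a,b)\<close> is identified below with the subspace of
  those classes that vanish almost everywhere off \<open>(a,b)\<close> (extension by zero).\<close>

quotient_type l2 = "real \<Rightarrow> complex" / partial: l2_rel
proof (rule part_equivpI)
  show "\<exists>f. l2_rel f f" using sq_integrable_zero by (auto simp: l2_rel_def)
  show "symp l2_rel" by (rule sympI) (auto simp: l2_rel_def)
  show "transp l2_rel" by (rule transpI) (auto simp: l2_rel_def)
qed

instantiation l2 :: complex_vector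
begin

lift_definition zero_l2 :: l2 is "\<lambda>x. 0"
  by (simp add: l2_rel_def sq_integrable_zero)

lift_definition plus_l2 :: "l2 \<Rightarrow> l2 \<Rightarrow> l2" is "\<lambda>f g x. f x + g x"
  by (auto simp: l2_rel_def sq_integrable_add)

lift_definition scaleC_l2 :: "complex \<Rightarrow> l2 \<Rightarrow> l2" is "\<lambda>c f x. c * f x"
  by (auto simp: l2_rel_def sq_integrable_scale)

definition scaleR_l2 :: "real \<Rightarrow> l2 \<Rightarrow> l2" where
  "scaleR_l2 r f = complex_of_real r *\<^sub>C f"

definition uminus_l2 :: "l2 \<Rightarrow> l2" where
  "uminus_l2 f = (- 1) *\<^sub>C f"

definition minus_l2 :: "l2 \<Rightarrow> l2 \<Rightarrow> l2" where
  "minus_l2 f g = f + - g"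

instance
proof
  fix f g h :: l2 and c d :: complex and r s :: real
  have add: "c *\<^sub>C (f + g) = c *\<^sub>C f + c *\<^sub>C g" for c and f g :: l2
    by transfer (auto simp: l2_rel_def algebra_simps intro!: sq_integrable_add sq_integrable_scale)
  have addl: "(c + d) *\<^sub>C f = c *\<^sub>C f + d *\<^sub>C f" for c d and f :: l2
    by transfer (auto simp: l2_rel_def algebra_simps intro!: sq_integrable_add sq_integrable_scale)
  have mult: "c *\<^sub>C d *\<^sub>C f = (c * d) *\<^sub>C f" for c d and f :: l2
    by transfer (auto simp: l2_rel_def algebra_simps intro!: sq_integrable_scale)
  have one: "1 *\<^sub>C f = f" for f :: l2
    by transfer (auto simp: l2_rel_def)
  show "f + g + h = f + (g + h)"
    by transfer (auto simp: l2_rel_def algebra_simps intro!: sq_integrable_add)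
  show "f + g = g + f"
    by transfer (auto simp: l2_rel_def algebra_simps intro!: sq_integrable_add)
  show "0 + f = f"
    by transfer (auto simp: l2_rel_def)
  show "- f + f = 0"
    unfolding uminus_l2_def by transfer (auto simp: l2_rel_def sq_integrable_zero)
  show "f - g = f + - g"
    by (simp add: minus_l2_def)
  show "c *\<^sub>C (f + g) = c *\<^sub>C f + c *\<^sub>C g" "(c + d) *\<^sub>C f = c *\<^sub>C f + d *\<^sub>C f"
    "c *\<^sub>C d *\<^sub>C f = (c * d) *\<^sub>C f" "1 *\<^sub>C f = f" "r *\<^sub>R f = complex_of_real r *\<^sub>C f"
    by (rule add addl mult one scaleR_l2_def)+
  show "r *\<^sub>R (f + g) = r *\<^sub>R f + r *\<^sub>R g" "(r + s) *\<^sub>R f = r *\<^sub>R f + s *\<^sub>R f"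
    "r *\<^sub>R s *\<^sub>R f = (r * s) *\<^sub>R f" "1 *\<^sub>R f = f"
    by (simp_all add: scaleR_l2_def add addl mult one)
qed

end

lift_definition vanishes_off :: "real \<Rightarrow> real \<Rightarrow> l2 \<Rightarrow> bool"
  is "\<lambda>a b f. AE x in lborel. x \<notin> {a<..<b} \<longrightarrow> f x = 0"
  by (auto simp: l2_rel_def elim: eventually_elim2)

lift_definition represented_by :: "real \<Rightarrow> real \<Rightarrow> l2 \<Rightarrow> (real \<Rightarrow> complex) \<Rightarrow> bool"
  is "\<lambda>a b f F. AE x in lborel. x \<in> {a<..<b} \<longrightarrow> f x = F x"
  by (auto simp: l2_rel_def fun_eq_iff elim: eventually_elim2)

definition L2 :: "real \<Rightarrow> real \<Rightarrow> l2 set" where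
  "L2 a b = {f. vanishes_off a b f}"

lift_definition l2_ip :: "real \<Rightarrow> real \<Rightarrow> l2 \<Rightarrow> l2 \<Rightarrow> complex"
  is "\<lambda>a b f g. (LINT x:{a<..<b}|lborel. f x * cnj (g x))"
proof -
  have cnj [measurable]: "cnj \<in> borel_measurable borel"
    by (intro borel_measurable_continuous_onI continuous_on_cnj continuous_on_id)
  fix a b :: real and f f' g g' :: "real \<Rightarrow> complex"
  assume "l2_rel f f'" "l2_rel g g'"
  then have [measurable]: "f \<in> borel_measurable borel" "f' \<in> borel_measurable borel"
      "g \<in> borel_measurable borel" "g' \<in> borel_measurable borel"
    and ae: "AE x in lborel. f x = f' x" "AE x in lborel. g x = g' x"
    by (auto simp: l2_rel_def sq_integrable_def)
  show "(LINT x:{a<..<b}|lborel. f x * cnj (g x)) = (LINT x:{a<..<b}|lborel. f' x * cnj (g' x))"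
    unfolding set_lebesgue_integral_def
  proof (rule integral_cong_AE)
    show "AE x in lborel. indicat_real {a<..<b} x *\<^sub>R (f x * cnj (g x)) =
        indicat_real {a<..<b} x *\<^sub>R (f' x * cnj (g' x))"
      using ae by eventually_elim simp
  qed measurable
qed


section \<open>Sobolev spaces on an interval\<close>

text \<open>\<open>C\<^sub>c\<^sup>\<infinity>(a,b)\<close> with complex values.\<close>

definition test_function :: "real \<Rightarrow> real \<Rightarrow> (real \<Rightarrow> complex) \<Rightarrow> bool" where
  "test_function a b \<phi> \<longleftrightarrow>
     (\<forall>k. ((\<lambda>f x. vector_derivative f (at x)) ^^ k) \<phi> differentiable_on UNIV) \<and>
     (\<exists>c d. a < c \<and> d < b \<and> (\<forall>x. x \<notin> {c..d} \<longrightarrow> \<phi> x = 0))"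

lemma test_function_measurable [measurable_dest]:
  assumes "test_function a b \<phi>"
  shows "\<phi> \<in> borel_measurable borel"
    and "(\<lambda>x. vector_derivative \<phi> (at x)) \<in> borel_measurable borel"
proof -
  have d: "((\<lambda>f x. vector_derivative f (at x)) ^^ k) \<phi> differentiable_on UNIV" for k
    using assms by (auto simp: test_function_def)
  show "\<phi> \<in> borel_measurable borel"
    using d[of 0] by (auto intro!: borel_measurable_continuous_onI differentiable_imp_continuous_on)
  show "(\<lambda>x. vector_derivative \<phi> (at x)) \<in> borel_measurable borel"
    using d[of 1] by (auto intro!: borel_measurable_continuous_onI differentiable_imp_continuous_on)
qed

lift_definition has_weak_deriv :: "real \<Rightarrow> real \<Rightarrow> l2 \<Rightarrow> l2 \<Rightarrow> bool"
  is "\<lambda>a b f g. \<forall>\<phi>. test_function a b \<phi> \<longrightarrow>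
       (LINT x:{a<..<b}|lborel. f x * vector_derivative \<phi> (at x)) =
       - (LINT x:{a<..<b}|lborel. g x * \<phi> x)"
proof -
  fix a b :: real and f f' g g' :: "real \<Rightarrow> complex"
  have cong: "(LINT x:{a<..<b}|lborel. h x * k x) = (LINT x:{a<..<b}|lborel. h' x * k x)"
    if "l2_rel h h'" and [measurable]: "k \<in> borel_measurable borel" for h h' k
    using that(1) unfolding l2_rel_def set_lebesgue_integral_def
    by (intro integral_cong_AE) (auto simp: sq_integrable_def elim: eventually_mono)
  assume "l2_rel f f'" "l2_rel g g'"
  then show "(\<forall>\<phi>. test_function a b \<phi> \<longrightarrow>
       (LINT x:{a<..<b}|lborel. f x * vector_derivative \<phi> (at x)) =
       - (LINT x:{a<..<b}|lborel. g x * \<phi> x)) =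
     (\<forall>\<phi>. test_function a b \<phi> \<longrightarrow>
       (LINT x:{a<..<b}|lborel. f' x * vector_derivative \<phi> (at x)) =
       - (LINT x:{a<..<b}|lborel. g' x * \<phi> x))"
    by (intro all_cong1 imp_cong refl)
      (simp add: cong[of f f'] cong[of g g'] test_function_measurable)
qed

definition H1 :: "real \<Rightarrow> real \<Rightarrow> l2 set" where
  "H1 a b = {f \<in> L2 a b. \<exists>g\<in>L2 a b. has_weak_deriv a b f g}"

definition weak_deriv :: "real \<Rightarrow> real \<Rightarrow> l2 \<Rightarrow> l2" where
  "weak_deriv a b f = (THE g. g \<in> L2 a b \<and> has_weak_deriv a b f g)"

definition H2 :: "real \<Rightarrow> real \<Rightarrow> l2 set" where
  "H2 a b = {f \<in> H1 a b. weak_deriv a b f \<in> H1 a b}"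

definition H1_ip :: "real \<Rightarrow> real \<Rightarrow> l2 \<Rightarrow> l2 \<Rightarrow> complex" where
  "H1_ip a b f g = l2_ip a b f g + l2_ip a b (weak_deriv a b f) (weak_deriv a b g)"

text \<open>The closure of the test functions in \<open>H\<^sup>1(a,b)\<close>.\<close>

definition H1_0 :: "real \<Rightarrow> real \<Rightarrow> l2 set" where
  "H1_0 a b = {f \<in> H1 a b. \<forall>\<epsilon>>0. \<exists>g\<in>H1 a b. \<exists>\<phi>.
     test_function a b \<phi> \<and> represented_by a b g \<phi> \<and> ip_norm (H1_ip a b) (f - g) < \<epsilon>}"

text \<open>The value at \<open>x\<close> in \<open>[a,b]\<close> of the continuous representative of an \<open>H\<^sup>1(a,b)\<close> function.\<close>

definition val :: "real \<Rightarrow> real \<Rightarrow> l2 \<Rightarrow> real \<Rightarrow> complex" where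
  "val a b f x =
     (THE z. \<exists>F. continuous_on {a..b} F \<and> represented_by a b f F \<and> F x = z)"


section \<open>The thermoelastic transmission problem\<close>

record beam =
  len\<^sub>0 :: real  \<comment> \<open>\<open>L\<^sub>0\<close>\<close>
  len :: real  \<comment> \<open>\<open>L\<close>\<close>
  \<rho>\<^sub>0 :: real
  \<rho>\<^sub>1 :: real
  \<rho>\<^sub>2 :: real
  \<alpha>\<^sub>1 :: real
  \<alpha>\<^sub>2 :: real
  \<beta>\<^sub>1 :: real
  \<beta>\<^sub>2 :: real
  \<kappa> :: real
  \<gamma> :: real

definition V1 :: "beam \<Rightarrow> (l2 \<times> l2) set" where
  "V1 p = {(u, y). u \<in> H1 0 (len\<^sub>0 p) \<and> y \<in> H1 (len\<^sub>0 p) (len p) \<and>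
     val 0 (len\<^sub>0 p) u 0 = 0 \<and> val (len\<^sub>0 p) (len p) y (len p) = 0 \<and>
     val 0 (len\<^sub>0 p) u (len\<^sub>0 p) = val (len\<^sub>0 p) (len p) y (len\<^sub>0 p)}"

text \<open>Spatial derivatives on the left part \<open>(0,L\<^sub>0)\<close> and on the right part \<open>(L\<^sub>0,L)\<close>.\<close>

abbreviation dl :: "beam \<Rightarrow> l2 \<Rightarrow> l2" where
  "dl p \<equiv> weak_deriv 0 (len\<^sub>0 p)"

abbreviation dr :: "beam \<Rightarrow> l2 \<Rightarrow> l2" where
  "dr p \<equiv> weak_deriv (len\<^sub>0 p) (len p)"

definition W1 :: "beam \<Rightarrow> (l2 \<times> l2) set" where
  "W1 p = {(u, y) \<in> V1 p. u \<in> H2 0 (len\<^sub>0 p) \<and> y \<in> H2 (len\<^sub>0 p) (len p) \<and>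
     val 0 (len\<^sub>0 p) (dl p u) 0 = 0 \<and> val (len\<^sub>0 p) (len p) (dr p y) (len p) = 0 \<and>
     val 0 (len\<^sub>0 p) (dl p u) (len\<^sub>0 p) = val (len\<^sub>0 p) (len p) (dr p y) (len\<^sub>0 p)}"

definition V2 :: "beam \<Rightarrow> (l2 \<times> l2 \<times> l2) set" where
  "V2 p = {(u, y, \<theta>). (u, y) \<in> V1 p \<and> \<theta> \<in> L2 0 (len\<^sub>0 p)}"

definition W2 :: "beam \<Rightarrow> (l2 \<times> l2 \<times> l2) set" where
  "W2 p = {(u, y, \<theta>). (u, y) \<in> W1 p \<and> \<theta> \<in> H1_0 0 (len\<^sub>0 p)}"

abbreviation ipl :: "beam \<Rightarrow> l2 \<Rightarrow> l2 \<Rightarrow> complex" where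
  "ipl p \<equiv> l2_ip 0 (len\<^sub>0 p)"

abbreviation ipr :: "beam \<Rightarrow> l2 \<Rightarrow> l2 \<Rightarrow> complex" where
  "ipr p \<equiv> l2_ip (len\<^sub>0 p) (len p)"

definition form_a :: "beam \<Rightarrow> l2 \<times> l2 \<Rightarrow> l2 \<times> l2 \<Rightarrow> complex" where
  "form_a p = (\<lambda>(u, y) (u', y').
     \<beta>\<^sub>1 p * ipl p (dl p (dl p u)) (dl p (dl p u')) +
     \<beta>\<^sub>2 p * ipr p (dr p (dr p y)) (dr p (dr p y')))"

definition form_b :: "beam \<Rightarrow> l2 \<times> l2 \<times> l2 \<Rightarrow> l2 \<times> l2 \<times> l2 \<Rightarrow> complex" where
  "form_b p = (\<lambda>(u, y, \<theta>) (u', y', \<theta>').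
     \<gamma> p * (ipl p (dl p u) (dl p \<theta>') - ipl p (dl p \<theta>) (dl p u')) +
     \<kappa> p * ipl p (dl p \<theta>) (dl p \<theta>'))"

definition form_c :: "beam \<Rightarrow> l2 \<times> l2 \<times> l2 \<Rightarrow> l2 \<times> l2 \<times> l2 \<Rightarrow> complex" where
  "form_c p = (\<lambda>(u, y, \<theta>) (u', y', \<theta>').
     (\<rho>\<^sub>1 p * ipl p u u' + \<alpha>\<^sub>1 p * ipl p (dl p u) (dl p u')) +
     (\<rho>\<^sub>2 p * ipr p y y' + \<alpha>\<^sub>2 p * ipr p (dr p y) (dr p y')) +
     \<rho>\<^sub>0 p * ipl p \<theta> \<theta>')"

definition V2_dual :: "beam \<Rightarrow> (l2 \<times> l2 \<times> l2 \<Rightarrow> complex) set" where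
  "V2_dual p = antidual (V2 p) (ip_norm (form_c p))"

definition op_C :: "beam \<Rightarrow> l2 \<times> l2 \<times> l2 \<Rightarrow> (l2 \<times> l2 \<times> l2 \<Rightarrow> complex)" where
  "op_C p U = restrict (form_c p U) (V2 p)"

definition op_B :: "beam \<Rightarrow> l2 \<times> l2 \<times> l2 \<Rightarrow> (l2 \<times> l2 \<times> l2 \<Rightarrow> complex)" where
  "op_B p U = restrict (form_b p U) (W2 p)"

definition op_A1 :: "beam \<Rightarrow> l2 \<times> l2 \<Rightarrow> (l2 \<times> l2 \<times> l2 \<Rightarrow> complex)" where
  "op_A1 p Z = (\<lambda>(u, y, \<theta>)\<in>W2 p. form_a p Z (u, y))"

text \<open>\<open>F\<close> is an extension in \<open>V\<^sub>2'\<close> of the functional \<open>G\<close> on \<open>W\<^sub>2\<close>.\<close>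

definition extends_to :: "beam \<Rightarrow> (l2 \<times> l2 \<times> l2 \<Rightarrow> complex) \<Rightarrow> (l2 \<times> l2 \<times> l2 \<Rightarrow> complex) \<Rightarrow> bool"
  where "extends_to p G F \<longleftrightarrow> F \<in> V2_dual p \<and> (\<forall>U\<in>W2 p. F U = G U)"

type_synonym state = "(l2 \<times> l2) \<times> (l2 \<times> l2 \<times> l2)"

definition energy_space :: "beam \<Rightarrow> state set" where
  "energy_space p = W1 p \<times> V2 p"

definition energy_ip :: "beam \<Rightarrow> state \<Rightarrow> state \<Rightarrow> complex" where
  "energy_ip p \<Phi> \<Psi> = form_a p (fst \<Phi>) (fst \<Psi>) + form_c p (snd \<Phi>) (snd \<Psi>)"

abbreviation energy_norm :: "beam \<Rightarrow> state \<Rightarrow> real" where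
  "energy_norm p \<equiv> ip_norm (energy_ip p)"

text \<open>\<open>B \<Phi>\<^sub>2 + A\<^sub>1 \<Phi>\<^sub>1\<close> as a functional on \<open>W\<^sub>2\<close>.\<close>

definition op_BA :: "beam \<Rightarrow> state \<Rightarrow> (l2 \<times> l2 \<times> l2 \<Rightarrow> complex)" where
  "op_BA p \<Phi> = (\<lambda>U\<in>W2 p. op_B p (snd \<Phi>) U + op_A1 p (fst \<Phi>) U)"

definition dom_A :: "beam \<Rightarrow> state set" where
  "dom_A p = {\<Phi> \<in> W1 p \<times> W2 p. \<exists>F. extends_to p (op_BA p \<Phi>) F}"

definition op_A :: "beam \<Rightarrow> state \<Rightarrow> state" where
  "op_A p = (\<lambda>(\<Phi>\<^sub>1, (v, z, \<theta>)).
     ((v, z), - the_inv_into (V2 p) (op_C p) (THE F. extends_to p (op_BA p (\<Phi>\<^sub>1, (v, z, \<theta>))) F)))"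

definition graph_norm :: "beam \<Rightarrow> state \<Rightarrow> real" where
  "graph_norm p \<Phi> = energy_norm p \<Phi> + energy_norm p (op_A p \<Phi>)"

definition generated_semigroup :: "beam \<Rightarrow> (real \<Rightarrow> state \<Rightarrow> state) \<Rightarrow> bool" where
  "generated_semigroup p T \<longleftrightarrow>
     C0_contraction_semigroup (energy_space p) (energy_norm p) T \<and>
     is_generator (energy_space p) (energy_norm p) T (dom_A p) (op_A p)"

text \<open>The semigroup \<open>e\<^sup>t\<^sup>A\<close>. It is determined by its generator for \<open>t \<ge> 0\<close> on the energy space only,
  whence the choice operator.\<close>

definition semigroup_A :: "beam \<Rightarrow> real \<Rightarrow> state \<Rightarrow> state" where
  "semigroup_A p = (SOME T. generated_semigroup p T)"

definition weak_solution :: "beam \<Rightarrow> state \<Rightarrow> (real \<Rightarrow> state) \<Rightarrow> bool" where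
  "weak_solution p \<Phi>\<^sub>0 \<Phi> \<longleftrightarrow>
     norm_continuous (energy_space p) (energy_norm p) \<Phi> \<and>
     (\<forall>t\<ge>0. \<exists>I. has_norm_integral (energy_norm p) \<Phi> I {0..t} \<and> I \<in> dom_A p \<and>
        \<Phi> t = \<Phi>\<^sub>0 + op_A p I)"

end

theory Submission
  imports Defs
begin

text \<open>The energy space is a complex Hilbert space on which \<open>\<A>\<close> is dissipative:
  \<open>Re \<langle>\<A>\<Phi>, \<Phi>\<rangle> = - \<kappa> \<parallel>\<theta>\<^sub>x\<parallel>\<^sup>2\<close>, as the coupling terms with \<open>\<gamma>\<close> cancel. For every \<open>l > 0\<close> the range of \<open>I - l \<A>\<close> is
  the whole space: eliminating \<open>\<Phi>\<^sub>1 = F\<^sub>1 + l (v, z)\<close> leaves the coercive problem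
  \<open>c(\<Phi>\<^sub>2, U) + l b(\<Phi>\<^sub>2, U) + l\<^sup>2 a((v, z), U\<^sub>1) = c(F\<^sub>2, U) - l a(F\<^sub>1, U\<^sub>1)\<close> on \<open>W\<^sub>2\<close>, solved by Lax--Milgram.
  So \<open>\<A>\<close> generates a contraction semigroup by Lumer--Phillips, obtained here from the Yosida
  approximations. A difference \<open>w\<close> of weak solutions has a primitive \<open>W\<close> with \<open>W' = \<A> W\<close>, \<open>W(0) = 0\<close>;
  by dissipativity \<open>\<parallel>W\<parallel>\<close> is nonincreasing, whence uniqueness.\<close>

section \<open>Closed subspaces of Hilbert spaces\<close>

text \<open>The abstract theory lives on a complete inner product type, whereas the spaces of the
  problem are carrier sets inside products of \<open>l2\<close> with norms of their own. The bridge
  is \<open>J\<close>, a vector of weighted derivatives whose norm is the energy norm. Its image is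
  closed because every Sobolev condition is kept as a closed condition on a function together with
  its weak derivatives, and because boundary values are continuous in that graph norm.
  Orthogonality, Riesz and Lax--Milgram are real, with \<open>inner\<close> the real part of the
  complex product: an antilinear functional is recovered from its real part by testing with
  \<open>\<i> *\<^sub>C U\<close>, and complex linearity of the semigroup holds because
  multiplication by a scalar commutes with \<A>. Two choices in the definitions must be made unique:
  the extension behind \<open>op_A\<close>, which rests on the density of W_2 in V_2, and
  \<open>semigroup_A\<close>, for which a generator has to determine its semigroup. No elliptic
  regularity enters, since the domain of \<A> is itself described by the weak form.\<close>

lemma subspace_closure:
  fixes S :: "'a::real_normed_vector set"
  assumes "subspace S" shows "subspace (closure S)"
proof (rule subspaceI)
  show "0 \<in> closure S" using subspace_0[OF assms] closure_subset by blast
  show "x + y \<in> closure S" if xy: "x \<in> closure S" "y \<in> closure S" for x y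
  proof -
    obtain f g where "\<And>n. f n \<in> S" "f \<longlonglongrightarrow> x" "\<And>n. g n \<in> S" "g \<longlonglongrightarrow> y"
      using xy unfolding closure_sequential by blast
    then show ?thesis unfolding closure_sequential
      by (intro exI[of _ "\<lambda>n. f n + g n"]) (auto intro: tendsto_add subspace_add[OF assms])
  qed
  show "c *\<^sub>R x \<in> closure S" if xy: "x \<in> closure S" for c x
  proof -
    obtain f where "\<And>n. f n \<in> S" "f \<longlonglongrightarrow> x" using xy unfolding closure_sequential by blast
    then show ?thesis unfolding closure_sequential
      by (intro exI[of _ "\<lambda>n. c *\<^sub>R f n"]) (auto intro: tendsto_intros subspace_scale[OF assms])
  qed
qed

text \<open>The functional \<open>f\<close> is linear on \<open>M\<close> only, so it is represented
  by minimising the quadratic functional \<open>Q\<close> over \<open>M\<close>: minimising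
  sequences are Cauchy by the parallelogram law, and the first variation at the minimiser is the
  claimed identity.\<close>

lemma riesz_on_closed_subspace:
  fixes f :: "'a::{real_inner,complete_space} \<Rightarrow> real"
  assumes M: "subspace M" "closed M"
    and add: "\<And>x y. x \<in> M \<Longrightarrow> y \<in> M \<Longrightarrow> f (x + y) = f x + f y"
    and scale: "\<And>c x. x \<in> M \<Longrightarrow> f (c *\<^sub>R x) = c * f x"
    and bound: "\<And>x. x \<in> M \<Longrightarrow> \<bar>f x\<bar> \<le> K * norm x"
  obtains v where "v \<in> M" "\<And>y. y \<in> M \<Longrightarrow> inner v y = f y"
proof -
  define Q where "Q x = (norm x)\<^sup>2 / 2 - f x" for x
  have Qlow: "- (K\<^sup>2 / 2) \<le> Q x" if "x \<in> M" for x
  proof -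
    have "0 \<le> (norm x - K)\<^sup>2" by simp
    then have "K * norm x \<le> (norm x)\<^sup>2 / 2 + K\<^sup>2 / 2" by (simp add: power2_diff algebra_simps)
    then show ?thesis using bound[OF that] unfolding Q_def by linarith
  qed
  define d where "d = Inf (Q ` M)"
  have bdd: "bdd_below (Q ` M)" using Qlow by (auto intro!: bdd_belowI)
  have zero: "0 \<in> M" using M(1) subspace_0 by blast
  have dle: "d \<le> Q x" if "x \<in> M" for x unfolding d_def using bdd that by (auto intro: cInf_lower)
  have "\<exists>x\<in>M. Q x < d + 1 / Suc n" for n
  proof -
    have "Inf (Q ` M) < d + 1 / Suc n" by (simp add: d_def)
    then show ?thesis using zero cInf_lessD[of "Q ` M"] by blast
  qed
  then obtain X where X: "\<And>n. X n \<in> M" "\<And>n. Q (X n) < d + 1 / Suc n" by metis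
  \<comment> \<open>Parallelogram law. The linear part of \<open>Q\<close> is affine and cancels at
    the midpoint, so near-minimal values of \<open>Q\<close> force near points.\<close>
  have par: "(norm (x - y))\<^sup>2 = 4 * (Q x + Q y - 2 * Q ((1/2) *\<^sub>R (x + y)))" if "x \<in> M" "y \<in> M" for x y
  proof -
    have "f ((1/2) *\<^sub>R (x + y)) = (f x + f y) / 2"
      using that M(1) by (simp add: scale add subspace_add)
    moreover have "(norm (x - y))\<^sup>2 + (norm (x + y))\<^sup>2 = 2 * (norm x)\<^sup>2 + 2 * (norm y)\<^sup>2"
      by (simp add: power2_norm_eq_inner inner_diff_left inner_diff_right inner_add_left inner_add_right)
    moreover have "(norm ((1/2) *\<^sub>R (x + y)))\<^sup>2 = (norm (x + y))\<^sup>2 / 4"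
      unfolding norm_scaleR power_mult_distrib by (simp add: power2_eq_square)
    ultimately show ?thesis
      unfolding Q_def by (auto simp: field_simps simp del: scaleR_add_right)
  qed
  have cau: "(norm (X m - X n))\<^sup>2 \<le> 4 * (1 / Suc m + 1 / Suc n)" for m n
  proof -
    have "(1/2) *\<^sub>R (X m + X n) \<in> M" using X M(1) by (simp add: subspace_add subspace_scale)
    then have "d \<le> Q ((1/2) *\<^sub>R (X m + X n))" by (rule dle)
    then show ?thesis using par[OF X(1)[of m] X(1)[of n]] X(2)[of m] X(2)[of n] by argo
  qed
  have "Cauchy X"
  proof (rule metric_CauchyI)
    fix e :: real assume e: "e > 0"
    obtain N where N: "1 / real (Suc N) < e\<^sup>2 / 8"
      using e nat_approx_posE[of "e\<^sup>2 / 8"] by (auto simp: )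
    have "dist (X m) (X n) < e" if "m \<ge> N" "n \<ge> N" for m n
    proof -
      have "1 / real (Suc m) \<le> 1 / real (Suc N)" "1 / real (Suc n) \<le> 1 / real (Suc N)"
        using that by (auto simp: field_simps)
      then have "(norm (X m - X n))\<^sup>2 < e\<^sup>2" using cau[of m n] N by argo
      then show ?thesis using e by (simp add: dist_norm power2_less_imp_less)
    qed
    then show "\<exists>N. \<forall>m\<ge>N. \<forall>n\<ge>N. dist (X m) (X n) < e" by blast
  qed
  then obtain v where v: "X \<longlonglongrightarrow> v" using Cauchy_convergent_iff convergent_def by blast
  have vM: "v \<in> M" using M(2) X(1) v closed_sequentially by blast
  have fdiff: "f (x - y) = f x - f y" if "x \<in> M" "y \<in> M" for x y
    using add[of "x - y" y] that M(1) by (simp add: subspace_diff)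
  have "(\<lambda>n. f (X n) - f v) \<longlonglongrightarrow> 0"
  proof (rule Lim_null_comparison)
    show "\<forall>\<^sub>F n in sequentially. norm (f (X n) - f v) \<le> K * norm (X n - v)"
      using bound[OF subspace_diff[OF M(1) X(1) vM]] by (simp add: fdiff X(1) vM)
    show "(\<lambda>n. K * norm (X n - v)) \<longlonglongrightarrow> 0"
      using tendsto_mult[OF tendsto_const[of K] tendsto_norm[OF tendsto_diff[OF v tendsto_const[of v]]]] by simp
  qed
  then have "(\<lambda>n. f (X n)) \<longlonglongrightarrow> f v" by (simp add: LIM_zero_iff)
  then have "(\<lambda>n. Q (X n)) \<longlonglongrightarrow> Q v" unfolding Q_def using v by (intro tendsto_intros) auto
  moreover have "(\<lambda>n. d + 1 / Suc n) \<longlonglongrightarrow> d + 0"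
    by (intro tendsto_intros) (use LIMSEQ_inverse_real_of_nat in \<open>simp add: inverse_eq_divide\<close>)
  ultimately have Qv: "Q v \<le> d"
    using X(2) LIMSEQ_le[of "\<lambda>n. Q (X n)" "Q v" "\<lambda>n. d + 1 / Suc n" "d + 0"] by (metis add.right_neutral less_imp_le)
  have "inner v y = f y" if y: "y \<in> M" for y
  proof (rule ccontr)
    assume ne: "inner v y \<noteq> f y"
    define b where "b = inner v y - f y"
    have var: "0 \<le> t * b + t\<^sup>2 * (norm y)\<^sup>2 / 2" for t
    proof -
      have "v + t *\<^sub>R y \<in> M" using vM y M(1) by (simp add: subspace_add subspace_scale)
      then have "Q v \<le> Q (v + t *\<^sub>R y)" using dle Qv by force
      also have "Q (v + t *\<^sub>R y) = Q v + (t * b + t\<^sup>2 * (norm y)\<^sup>2 / 2)"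
      proof -
        have "f (v + t *\<^sub>R y) = f v + t * f y" using vM y M(1) by (simp add: add scale subspace_scale)
        moreover have "(norm (v + t *\<^sub>R y))\<^sup>2 = (norm v)\<^sup>2 + 2 * (t * inner v y) + t\<^sup>2 * (norm y)\<^sup>2"
          unfolding power2_norm_eq_inner
          by (simp add: inner_add_left inner_add_right inner_commute[of y v] power2_eq_square distrib_left mult.assoc)
        ultimately show ?thesis unfolding Q_def b_def by (simp add: right_diff_distrib)
      qed
      finally show ?thesis by simp
    qed
    have yne: "y \<noteq> 0" using ne scale[of 0 0] zero by auto
    \<comment> \<open>The minimiser of the quadratic in \<open>var\<close>, whose value there is
      \<open>- b\<^sup>2 / (2 * (norm y)\<^sup>2)\<close>, hence negative when \<open>b\<close> is
      not 0.\<close>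
    define t where "t = - b / (norm y)\<^sup>2"
    have "t * (norm y)\<^sup>2 = - b" using yne by (simp add: t_def)
    then have "t\<^sup>2 * (norm y)\<^sup>2 = - (t * b)" by (simp add: power2_eq_square mult.assoc)
    moreover have "t * b = - (b\<^sup>2 / (norm y)\<^sup>2)" by (simp add: t_def power2_eq_square)
    moreover have "b\<^sup>2 / (norm y)\<^sup>2 > 0" using ne yne by (simp add: b_def)
    ultimately show False using var[of t] by linarith
  qed
  then show ?thesis using vM that by blast
qed

text \<open>The Riesz representative of \<open>inner x\<close> restricted to \<open>M\<close>;
  linearity and the norm bound follow from its uniqueness and from Cauchy--Schwarz.\<close>

lemma orthogonal_projection_exists:
  fixes M :: "'a::{real_inner,complete_space} set"
  assumes M: "subspace M" "closed M"
  obtains P where "bounded_linear P" "\<And>x. P x \<in> M" "\<And>x. x \<in> M \<Longrightarrow> P x = x"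
    "\<And>x y. y \<in> M \<Longrightarrow> inner (P x) y = inner x y"
proof -
  have "\<exists>v\<in>M. \<forall>y\<in>M. inner v y = inner x y" for x
    by (rule riesz_on_closed_subspace[OF M, where f = "inner x" and K = "norm x"])
      (auto simp: inner_add_right Cauchy_Schwarz_ineq2)
  then obtain P where P: "\<And>x. P x \<in> M" "\<And>x y. y \<in> M \<Longrightarrow> inner (P x) y = inner x y" by metis
  have eqI: "v = w" if "v \<in> M" "w \<in> M" "\<And>y. y \<in> M \<Longrightarrow> inner v y = inner w y" for v w
    using that(3)[of "v - w"] subspace_diff[OF M(1) that(1,2)]
    by (metis eq_iff_diff_eq_0 inner_diff_left inner_eq_zero_iff)
  have "bounded_linear P"
  proof (rule bounded_linear_intro)
    show "P (x + y) = P x + P y" for x y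
      by (rule eqI) (auto simp: P inner_add_left M(1) subspace_add)
    show "P (r *\<^sub>R x) = r *\<^sub>R P x" for r x
      by (rule eqI) (auto simp: P M(1) subspace_scale)
    show "norm (P x) \<le> norm x * 1" for x
    proof -
      have "norm (P x) * norm (P x) = inner x (P x)"
        using P(2)[of "P x" x] P(1) by (simp add: power2_norm_eq_inner flip: power2_eq_square)
      also have "\<dots> \<le> norm x * norm (P x)" by (rule norm_cauchy_schwarz)
      finally have "norm (P x) * norm (P x) \<le> norm x * norm (P x)" .
      then show ?thesis by (cases "P x = 0") auto
    qed
  qed
  moreover have "P x = x" if "x \<in> M" for x
    by (rule eqI) (auto simp: P that)
  ultimately show ?thesis using that P by blast
qed

text \<open>After projection to \<open>M\<close>, the equation is the fixed point equation of the
  damped iteration \<open>F\<close>, which is a contraction for a small step length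
  \<open>r\<close>. Coercivity is asked on \<open>M\<close> only, and \<open>G\<close> may be
  nonsymmetric, as the coupled beam problem requires.\<close>

lemma lax_milgram_on_closed_subspace:
  fixes M :: "'a::{real_inner,complete_space} set"
  assumes M: "subspace M" "closed M" and G: "bounded_linear G" and c: "c > 0"
    and coercive: "\<And>x. x \<in> M \<Longrightarrow> c * (norm x)\<^sup>2 \<le> inner (G x) x"
  obtains x where "x \<in> M" "\<And>y. y \<in> M \<Longrightarrow> inner (G x) y = inner f y"
proof -
  obtain P where P: "bounded_linear P" "\<And>x. P x \<in> M" "\<And>x. x \<in> M \<Longrightarrow> P x = x"
    "\<And>x y. y \<in> M \<Longrightarrow> inner (P x) y = inner x y"
    using orthogonal_projection_exists[OF M] by metis
  interpret G: bounded_linear G by fact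
  interpret P: bounded_linear P by fact
  have PG: "bounded_linear (\<lambda>x. P (G x))" using P(1) G by (rule bounded_linear_compose)
  obtain K0 where K0: "\<And>x. norm (P (G x)) \<le> norm x * K0" using bounded_linear.bounded[OF PG] by blast
  \<comment> \<open>The term \<open>c + 1\<close> makes \<open>K\<close> larger than
    \<open>c\<close>, so that \<open>q\<close> below lies strictly between 0 and 1.\<close>
  define K where "K = max K0 (c + 1)"
  have K: "norm (P (G x)) \<le> K * norm x" for x
    using K0[of x] mult_left_mono[of K0 K "norm x"] by (simp add: K_def mult.commute)
  have Kc: "K > c" "K > 0" using c by (auto simp: K_def)
  \<comment> \<open>This step length minimises \<open>1 - 2 * r * c + r\<^sup>2 * K\<^sup>2\<close>,
    the squared contraction factor; the minimum is \<open>q\<close>.\<close>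
  define r where "r = c / K\<^sup>2"
  define q where "q = 1 - (c / K)\<^sup>2"
  have cK: "(c / K)\<^sup>2 > 0" "(c / K)\<^sup>2 < 1" using Kc c by (auto simp: power_less_one_iff)
  have q: "0 \<le> q" "q < 1" using cK by (auto simp: q_def)
  have contr: "norm (x - r *\<^sub>R P (G x)) \<le> sqrt q * norm x" if x: "x \<in> M" for x
  proof -
    have "(norm (x - r *\<^sub>R P (G x)))\<^sup>2 = (norm x)\<^sup>2 - 2 * r * inner (P (G x)) x + r\<^sup>2 * (norm (P (G x)))\<^sup>2"
      unfolding power2_norm_eq_inner
      by (simp add: inner_diff_left inner_diff_right inner_commute[of x "P (G x)"] right_diff_distrib power2_eq_square)
    also have "\<dots> \<le> (norm x)\<^sup>2 - 2 * r * (c * (norm x)\<^sup>2) + r\<^sup>2 * (K * norm x)\<^sup>2"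
    proof -
      have "r \<ge> 0" using c by (simp add: r_def)
      then have "r * (c * (norm x)\<^sup>2) \<le> r * inner (P (G x)) x"
        using coercive[OF x] P(4)[OF x, of "G x"] by (simp add: mult_left_mono)
      moreover have "r\<^sup>2 * (norm (P (G x)))\<^sup>2 \<le> r\<^sup>2 * (K * norm x)\<^sup>2"
        by (intro mult_left_mono power_mono K) auto
      ultimately show ?thesis by linarith
    qed
    also have "\<dots> = q * (norm x)\<^sup>2" using Kc by (simp add: q_def r_def field_simps power2_eq_square)
    also have "\<dots> = (sqrt q * norm x)\<^sup>2" using q by (simp add: power_mult_distrib)
    finally show ?thesis by (rule power2_le_imp_le) (use q in simp)
  qed
  define F where "F x = x - r *\<^sub>R (P (G x) - P f)" for x
  have "\<exists>!x\<in>M. F x = x"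
  proof (rule Banach_fix[where c = "sqrt q"])
    show "complete M" using M(2) by (simp add: complete_eq_closed)
    show "M \<noteq> {}" using M(1) subspace_0 by blast
    show "0 \<le> sqrt q" "sqrt q < 1" using q by auto
    show "F ` M \<subseteq> M" using M(1) P(2) by (auto simp: F_def intro!: subspace_diff subspace_scale)
    show "dist (F x) (F y) \<le> sqrt q * dist x y" if "x \<in> M" "y \<in> M" for x y
    proof -
      have "F x - F y = (x - y) - r *\<^sub>R P (G (x - y))"
        by (simp add: F_def G.diff P.diff algebra_simps)
      then show ?thesis using contr[of "x - y"] that M(1) by (simp add: dist_norm subspace_diff)
    qed
  qed
  then obtain x where x: "x \<in> M" "F x = x" by blast
  have "r > 0" using c Kc by (simp add: r_def)
  then have "P (G x) = P f" using x(2) by (simp add: F_def)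
  then have "inner (G x) y = inner f y" if "y \<in> M" for y using P(4)[OF that] by metis
  then show ?thesis using x(1) that by blast
qed

section \<open>Maximal dissipative operators\<close>

text \<open>The function \<open>(norm (u t))\<^sup>2 - 2 * c * t\<close> has nonpositive derivative.
  With \<open>c = 0\<close> this yields contraction and uniqueness, with positive \<open>c\<close>
  the comparison of two Yosida approximations.\<close>

lemma norm_sq_growth:
  fixes u u' :: "real \<Rightarrow> 'a::real_inner"
  assumes T: "0 \<le> T" and u: "\<And>t. t \<in> {0..T} \<Longrightarrow> (u has_vector_derivative u' t) (at t within {0..T})"
    and growth: "\<And>t. t \<in> {0..T} \<Longrightarrow> inner (u' t) (u t) \<le> c"
  shows "(norm (u T))\<^sup>2 \<le> (norm (u 0))\<^sup>2 + 2 * c * T"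
proof -
  have d: "((\<lambda>t. inner (u t) (u t) - 2 * c * t) has_real_derivative 2 * inner (u' t) (u t) - 2 * c) (at t within {0..T})"
    if "t \<in> {0..T}" for t
  proof -
    have "((\<lambda>t. inner (u t) (u t)) has_real_derivative 2 * inner (u' t) (u t)) (at t within {0..T})"
      using has_derivative_inner[OF u[OF that, unfolded has_vector_derivative_def] u[OF that, unfolded has_vector_derivative_def]]
      unfolding has_field_derivative_def
      by (rule has_derivative_eq_rhs) (auto simp: inner_commute algebra_simps)
    from DERIV_diff[OF this DERIV_cmult[OF DERIV_ident, of "2 * c"]] show ?thesis by simp
  qed
  have "inner (u T) (u T) - 2 * c * T \<le> inner (u 0) (u 0) - 2 * c * 0"
  proof (rule DERIV_nonpos_imp_decreasing_open[OF T])
    show "continuous_on {0..T} (\<lambda>t. inner (u t) (u t) - 2 * c * t)"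
      unfolding continuous_on_eq_continuous_within using DERIV_continuous[OF d] by blast
    show "\<exists>y. ((\<lambda>t. inner (u t) (u t) - 2 * c * t) has_real_derivative y) (at x) \<and> y \<le> 0" if "0 < x" "x < T" for x
    proof -
      have "at x within {0..T} = at x" using that by (simp add: at_within_Icc_at)
      then show ?thesis using d[of x] growth[of x] that
        by (intro exI[of _ "2 * inner (u' x) (u x) - 2 * c"]) auto
    qed
  qed
  then show ?thesis by (simp add: power2_norm_eq_inner)
qed

lemma norm_nonincreasing_if_dissipative:
  fixes u u' :: "real \<Rightarrow> 'a::real_inner"
  assumes "0 \<le> T" and "\<And>t. t \<in> {0..T} \<Longrightarrow> (u has_vector_derivative u' t) (at t within {0..T})"
    and "\<And>t. t \<in> {0..T} \<Longrightarrow> inner (u' t) (u t) \<le> 0"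
  shows "norm (u T) \<le> norm (u 0)"
proof (rule power2_le_imp_le)
  show "(norm (u T))\<^sup>2 \<le> (norm (u 0))\<^sup>2" using norm_sq_growth[OF assms] by simp
qed simp

text \<open>Connects derivatives with the difference quotients in which \<open>norm_C1\<close> and
  \<open>has_generator_value\<close> are phrased.\<close>

lemma has_vector_derivative_iff_quotient:
  "(f has_vector_derivative d) (at t within S) \<longleftrightarrow>
    ((\<lambda>s. (1 / (s - t)) *\<^sub>R (f s - f t)) \<longlongrightarrow> d) (at t within S)"
proof -
  have "norm (f s - f t - (s - t) *\<^sub>R d) / norm (s - t) = norm ((1 / (s - t)) *\<^sub>R (f s - f t) - d)"
    if "s \<noteq> t" for s
  proof -
    have "(1 / (s - t)) *\<^sub>R (f s - f t) - d = (1 / (s - t)) *\<^sub>R (f s - f t - (s - t) *\<^sub>R d)"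
      using that by (simp add: scaleR_diff_right)
    then show ?thesis by (simp add: divide_inverse mult.commute)
  qed
  then have "((\<lambda>s. norm (f s - f t - (s - t) *\<^sub>R d) / norm (s - t)) \<longlongrightarrow> 0) (at t within S) \<longleftrightarrow>
      ((\<lambda>s. norm ((1 / (s - t)) *\<^sub>R (f s - f t) - d)) \<longlongrightarrow> 0) (at t within S)"
    by (intro Lim_cong_within) auto
  then show ?thesis
    unfolding has_vector_derivative_def has_derivative_iff_norm
    by (simp add: bounded_linear_scaleR_left tendsto_norm_zero_iff LIM_zero_iff)
qed

section \<open>Calculus on half-lines and linear evolution equations with a bounded operator\<close>

lemma at_within_atLeast_eq_Icc:
  fixes t :: real assumes "t \<in> {a..}" shows "at t within {a..} = at t within {a..t + 1}"
  by (rule at_within_nhd[of _ "{..<t + 1}"]) auto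

lemma integral_has_vector_derivative_atLeast:
  fixes f :: "real \<Rightarrow> 'a::banach"
  assumes "continuous_on {a..} f" "a \<le> t"
  shows "((\<lambda>t. integral {a..t} f) has_vector_derivative f t) (at t within {a..})"
proof -
  have "continuous_on {a..t + 1} f" using assms(1) by (rule continuous_on_subset) auto
  then have "((\<lambda>t. integral {a..t} f) has_vector_derivative f t) (at t within {a..t + 1})"
    using assms(2) by (intro integral_has_vector_derivative) auto
  then show ?thesis using assms(2) by (simp add: at_within_atLeast_eq_Icc)
qed

lemma continuous_on_atLeastI:
  fixes f :: "real \<Rightarrow> 'a::topological_space"
  assumes "\<And>T. continuous_on {a..T} f" shows "continuous_on {a..} f"
  unfolding continuous_on_def
proof
  fix t assume t: "t \<in> {a..}"
  have "t \<in> {a..t + 1}" using t by simp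
  then have "(f \<longlongrightarrow> f t) (at t within {a..t + 1})" using assms[of "t + 1"] unfolding continuous_on_def by blast
  then show "(f \<longlongrightarrow> f t) (at t within {a..})" using at_within_atLeast_eq_Icc[OF t] by simp
qed

lemma has_integral_translate:
  fixes f :: "real \<Rightarrow> 'a::banach"
  assumes "f integrable_on {a + s..b + s}"
  shows "integral {a..b} (\<lambda>r. f (s + r)) = integral {a + s..b + s} f"
proof -
  have "(f has_integral integral {a + s..b + s} f) (cbox (a + s) (b + s))"
    using assms by (simp add: integrable_integral)
  then have "((f \<circ> (+) s) has_integral integral {a + s..b + s} f) (cbox a b)"
    by (simp only: has_integral_shift_cbox_iff)
  then show ?thesis by (simp add: o_def integral_unique)
qed

text \<open>The solution is the exponential series of \<open>B\<close> applied to \<open>x\<close>.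
  Termwise differentiation is justified by uniform convergence on each \<open>{0..T}\<close>; the
  Yosida approximations are solved in this way.\<close>

lemma bounded_linear_ode_solution:
  fixes B :: "'a::banach \<Rightarrow> 'a"
  assumes B: "bounded_linear B"
  obtains u where "u 0 = x"
    "\<And>T t. t \<in> {0..T} \<Longrightarrow> (u has_vector_derivative B (u t)) (at t within {0..T})"
proof -
  interpret B: bounded_linear B by fact
  obtain K where K: "K > 0" "\<And>y. norm (B y) \<le> norm y * K" using B.pos_bounded by blast
  define c where "c n = (B ^^ n) x" for n
  have c: "norm (c n) \<le> K ^ n * norm x" for n
  proof (induction n)
    case (Suc n)
    have "norm (c (Suc n)) \<le> norm (c n) * K" using K(2) by (simp add: c_def)
    also have "\<dots> \<le> K ^ n * norm x * K" using Suc K(1) by (intro mult_right_mono) auto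
    finally show ?case by (simp add: mult_ac)
  qed (simp add: c_def)
  define f where "f n t = (t ^ n / fact n) *\<^sub>R c n" for n and t :: real
  \<comment> \<open>For \<open>n = 0\<close> the factor \<open>real n\<close> is 0, so the truncated
    subtraction in the exponent does no harm.\<close>
  define f' where "f' n t = (real n * t ^ (n - 1) / fact n) *\<^sub>R c n" for n and t :: real
  have f'_Suc: "f' (Suc n) t = B (f n t)" for n t
  proof -
    have "(1 + real n) * t ^ n / ((1 + real n) * fact n) = t ^ n / fact n"
      by (subst mult_divide_mult_cancel_left) auto
    then show ?thesis by (simp add: f'_def f_def c_def B.scaleR)
  qed
  have fbound: "norm (f n t) \<le> (K * R) ^ n / fact n * norm x" if "t \<in> {0..R}" for n t R
  proof -
    have "norm (f n t) = t ^ n / fact n * norm (c n)" using that by (simp add: f_def)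
    also have "\<dots> \<le> R ^ n / fact n * (K ^ n * norm x)"
      using that c[of n] by (intro mult_mono divide_right_mono power_mono) auto
    finally show ?thesis by (simp add: power_mult_distrib mult_ac)
  qed
  have sumR: "summable (\<lambda>n. (K * R) ^ n / fact n * norm x)" for R
    using summable_mult2[OF summable_exp[of "K * R"], of "norm x"] by (simp add: divide_inverse mult_ac)
  have sumf: "summable (\<lambda>n. f n t)" if "t \<ge> 0" for t
    by (rule summable_comparison_test'[OF sumR[of t], where N = 0]) (use fbound[of t t] that in auto)
  define u where "u t = (\<Sum>n. f n t)" for t
  have f'sums: "(\<lambda>n. f' n t) sums B (u t)" if "t \<ge> 0" for t
  proof -
    have "(\<lambda>n. B (f n t)) sums B (u t)"
      unfolding u_def using B.sums[OF summable_sums[OF sumf[OF that]]] .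
    then have "(\<lambda>n. f' (Suc n) t) sums B (u t)" by (simp add: f'_Suc)
    then show ?thesis using sums_Suc_iff[of "\<lambda>n. f' n t"] by (simp add: f'_def)
  qed
  have "(u has_vector_derivative B (u t)) (at t within {0..T})" if t: "t \<in> {0..T}" for T t
  proof -
    have df: "(f n has_derivative (\<lambda>h. h *\<^sub>R f' n s)) (at s within {0..T})" for n s
    proof -
      have "((\<lambda>s. s ^ n / fact n) has_real_derivative real n * s ^ (n - 1) / fact n) (at s within {0..T})"
        by (auto intro!: derivative_eq_intros)
      from has_vector_derivative_scaleR[OF this has_vector_derivative_const[of "c n"]]
      show ?thesis unfolding f_def f'_def has_vector_derivative_def by simp
    qed
    \<comment> \<open>The differentiated series is \<open>B\<close> applied to the original one,
      shifted by one index; hence the majorant starts with 0 and then is \<open>K\<close> times the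
      majorant of \<open>f\<close>.\<close>
    define M where "M n = (case n of 0 \<Rightarrow> 0 | Suc m \<Rightarrow> K * ((K * T) ^ m / fact m * norm x))" for n
    have "summable M"
      unfolding summable_Suc_iff[of M, symmetric] M_def using summable_mult[OF sumR[of T], of K] by simp
    have ul: "uniform_limit {0..T} (\<lambda>n s. \<Sum>i<n. f' i s) (\<lambda>s. \<Sum>i. f' i s) sequentially"
    proof (rule Weierstrass_m_test)
      show "summable M" by fact
      show "norm (f' n s) \<le> M n" if "s \<in> {0..T}" for n s
      proof (cases n)
        case (Suc m)
        have "norm (f' n s) \<le> norm (f m s) * K" unfolding Suc f'_Suc by (rule K)
        also have "\<dots> \<le> (K * T) ^ m / fact m * norm x * K"
          using fbound[OF that] K(1) by (intro mult_right_mono) auto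
        finally show ?thesis by (simp add: M_def Suc mult_ac)
      qed (simp add: f'_def M_def)
    qed
    have sf': "(\<Sum>i. f' i s) = B (u s)" if "s \<in> {0..T}" for s
      using f'sums[of s] that by (simp add: sums_iff)
    have "\<exists>g. \<forall>s\<in>{0..T}. (\<lambda>n. f n s) sums g s \<and> (g has_derivative (\<lambda>h. h *\<^sub>R B (u s))) (at s within {0..T})"
    proof (rule has_derivative_series)
      show "\<forall>\<^sub>F n in sequentially. \<forall>s\<in>{0..T}. \<forall>h. norm ((\<Sum>i<n. h *\<^sub>R f' i s) - h *\<^sub>R B (u s)) \<le> e * norm h"
        if "e > 0" for e
      proof -
        have "\<forall>\<^sub>F n in sequentially. \<forall>s\<in>{0..T}. dist (\<Sum>i<n. f' i s) (\<Sum>i. f' i s) < e"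
          using ul that by (auto simp: uniform_limit_iff)
        then show ?thesis
        proof eventually_elim
          case (elim n)
          show ?case
          proof (intro ballI allI)
            fix s h assume s: "s \<in> {0..T}"
            have "norm ((\<Sum>i<n. h *\<^sub>R f' i s) - h *\<^sub>R B (u s)) = norm h * norm ((\<Sum>i<n. f' i s) - B (u s))"
              by (simp add: scaleR_sum_right[symmetric] scaleR_diff_right[symmetric] del: scaleR_diff_right)
            also have "\<dots> \<le> norm h * e"
              using bspec[OF elim s] sf'[OF s] by (intro mult_left_mono) (auto simp: dist_norm)
            finally show "norm ((\<Sum>i<n. h *\<^sub>R f' i s) - h *\<^sub>R B (u s)) \<le> e * norm h" by (simp add: mult.commute)
          qed
        qed
      qed
    qed (use t df sumf[of t] in \<open>auto simp: summable_sums\<close>)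
    then obtain g where g: "\<And>s. s \<in> {0..T} \<Longrightarrow> (\<lambda>n. f n s) sums g s"
      "\<And>s. s \<in> {0..T} \<Longrightarrow> (g has_derivative (\<lambda>h. h *\<^sub>R B (u s))) (at s within {0..T})" by blast
    have "g s = u s" if "s \<in> {0..T}" for s using g(1)[OF that] by (simp add: u_def sums_iff)
    then show ?thesis using g(2)[OF t] t unfolding has_vector_derivative_def
      using has_derivative_transform[of t "{0..T}" u g] by auto
  qed
  moreover have "u 0 = x"
  proof -
    have "f n 0 = (if n = 0 then x else 0)" for n by (auto simp: f_def c_def)
    then show ?thesis using suminf_finite[of "{0}" "\<lambda>n. f n 0"] by (simp add: u_def)
  qed
  ultimately show ?thesis using that by blast
qed

text \<open>The setting of Lumer--Phillips. The range condition is a surjectivity statement for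
  every \<open>l\<close>; closedness of \<open>A\<close> and density of \<open>D\<close> are drawn
  from it in \<open>closed_operator\<close> and \<open>dense_domain\<close>.\<close>

locale max_dissipative =
  fixes D :: "'a::{real_inner,banach} set" and A :: "'a \<Rightarrow> 'a"
  assumes subspace_D: "subspace D"
    and A_add: "\<And>x y. x \<in> D \<Longrightarrow> y \<in> D \<Longrightarrow> A (x + y) = A x + A y"
    and A_scale: "\<And>c x. x \<in> D \<Longrightarrow> A (c *\<^sub>R x) = c *\<^sub>R A x"
    and dissipative: "\<And>x. x \<in> D \<Longrightarrow> inner (A x) x \<le> 0"
    and range: "\<And>l f. l > 0 \<Longrightarrow> \<exists>x\<in>D. x - l *\<^sub>R A x = f"
begin

section \<open>Resolvents, closedness of the operator and density of its domain\<close>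

lemma D_closed_ops:
  "0 \<in> D" "x \<in> D \<Longrightarrow> y \<in> D \<Longrightarrow> x + y \<in> D" "x \<in> D \<Longrightarrow> y \<in> D \<Longrightarrow> x - y \<in> D" "x \<in> D \<Longrightarrow> c *\<^sub>R x \<in> D"
  using subspace_D by (auto simp: subspace_0 subspace_add subspace_diff subspace_scale)

lemma A_diff: "x \<in> D \<Longrightarrow> y \<in> D \<Longrightarrow> A (x - y) = A x - A y"
  using A_add[of "x - y" y] D_closed_ops by auto

lemma A_zero: "A 0 = 0"
  using A_scale[of 0 0] D_closed_ops by simp

definition resolv :: "real \<Rightarrow> 'a \<Rightarrow> 'a" where
  "resolv l f = (SOME x. x \<in> D \<and> x - l *\<^sub>R A x = f)"

lemma resolv:
  assumes "l > 0"
  shows "resolv l f \<in> D" "resolv l f - l *\<^sub>R A (resolv l f) = f"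
  using someI_ex[of "\<lambda>x. x \<in> D \<and> x - l *\<^sub>R A x = f"] range[OF assms, of f]
  unfolding resolv_def by blast+

text \<open>Pairing \<open>x - l *\<^sub>R A x\<close> with \<open>x\<close> drops the dissipative
  term with the right sign. Injectivity and contractivity of the resolvent both come from
  this.\<close>

lemma norm_le_norm_resolvent_arg:
  assumes "l > 0" "x \<in> D" shows "norm x \<le> norm (x - l *\<^sub>R A x)"
proof -
  have "(norm x)\<^sup>2 \<le> inner (x - l *\<^sub>R A x) x"
    using dissipative[OF assms(2)] assms(1)
    by (simp add: inner_diff_left power2_norm_eq_inner mult_le_0_iff)
  also have "\<dots> \<le> norm (x - l *\<^sub>R A x) * norm x" by (rule norm_cauchy_schwarz)
  finally show ?thesis by (cases "x = 0") (auto simp: power2_eq_square)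
qed

lemma resolv_unique:
  assumes "l > 0" "x \<in> D" shows "resolv l (x - l *\<^sub>R A x) = x"
proof -
  let ?r = "resolv l (x - l *\<^sub>R A x)"
  have r: "?r \<in> D" "?r - l *\<^sub>R A ?r = x - l *\<^sub>R A x" using resolv[OF assms(1)] by blast+
  have "(?r - x) - l *\<^sub>R A (?r - x) = 0"
    using r assms by (simp add: A_diff algebra_simps)
  then show ?thesis using norm_le_norm_resolvent_arg[OF assms(1), of "?r - x"] r assms D_closed_ops by simp
qed

lemma resolv_contraction: "l > 0 \<Longrightarrow> norm (resolv l f) \<le> norm f"
  using norm_le_norm_resolvent_arg[of l "resolv l f"] resolv[of l f] by simp

lemma bounded_linear_resolv:
  assumes l: "l > 0" shows "bounded_linear (resolv l)"
proof (rule bounded_linear_intro)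
  show "resolv l (f + g) = resolv l f + resolv l g" for f g
  proof -
    have "(resolv l f + resolv l g) - l *\<^sub>R A (resolv l f + resolv l g) =
        (resolv l f - l *\<^sub>R A (resolv l f)) + (resolv l g - l *\<^sub>R A (resolv l g))"
      using resolv(1)[OF l] by (simp add: A_add scaleR_add_right)
    then show ?thesis
      using resolv_unique[OF l, of "resolv l f + resolv l g"] resolv[OF l] D_closed_ops by simp
  qed
  show "resolv l (c *\<^sub>R f) = c *\<^sub>R resolv l f" for c f
  proof -
    have "c *\<^sub>R resolv l f - l *\<^sub>R A (c *\<^sub>R resolv l f) = c *\<^sub>R (resolv l f - l *\<^sub>R A (resolv l f))"
      using resolv(1)[OF l] by (simp add: A_scale scaleR_diff_right)
    then show ?thesis using resolv_unique[OF l, of "c *\<^sub>R resolv l f"] resolv[OF l] D_closed_ops by simp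
  qed
  show "norm (resolv l f) \<le> norm f * 1" for f using resolv_contraction[OF l] by simp
qed

text \<open>The graph of \<open>A\<close> consists of the pairs for which
  \<open>resolv 1 (x - A x) = x\<close>, a condition that involves only a bounded operator and
  therefore survives limits.\<close>

lemma closed_operator:
  assumes x: "\<And>n. x n \<in> D" "(\<lambda>n. x n) \<longlonglongrightarrow> z" and Ax: "(\<lambda>n. A (x n)) \<longlonglongrightarrow> y"
  shows "z \<in> D" "A z = y"
proof -
  interpret bounded_linear "resolv 1" by (rule bounded_linear_resolv) simp
  have "(\<lambda>n. resolv 1 (x n - A (x n))) \<longlonglongrightarrow> resolv 1 (z - y)"
    by (intro tendsto tendsto_intros x Ax)
  moreover have "resolv 1 (x n - A (x n)) = x n" for n
    using resolv_unique[OF _ x(1), of 1] by simp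
  ultimately have z: "resolv 1 (z - y) = z" using x(2) LIMSEQ_unique by fastforce
  then show "z \<in> D" using resolv(1)[of 1 "z - y"] by simp
  show "A z = y" using resolv(2)[of 1 "z - y"] z by simp
qed

text \<open>The residual \<open>x - P x\<close> is orthogonal to \<open>D\<close> and equals
  \<open>d - A d\<close> for some \<open>d\<close> in \<open>D\<close>. Pairing with
  \<open>d\<close> gives \<open>inner d d = inner (A d) d\<close>, so \<open>d = 0\<close> by
  dissipativity and the residual vanishes.\<close>

lemma dense_domain: "closure D = UNIV"
proof (rule ccontr)
  assume "closure D \<noteq> UNIV"
  then obtain x where x: "x \<notin> closure D" by blast
  obtain P where P: "bounded_linear P" "\<And>x. P x \<in> closure D" "\<And>x. x \<in> closure D \<Longrightarrow> P x = x"
    "\<And>x y. y \<in> closure D \<Longrightarrow> inner (P x) y = inner x y"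
    using orthogonal_projection_exists[of "closure D"] subspace_closure[OF subspace_D] by blast
  obtain d where d: "d \<in> D" "d - A d = x - P x" using range[of 1 "x - P x"] by auto
  have "inner (d - A d) d = 0" using d P(4)[of d x] closure_subset[of D] by (auto simp: inner_diff_left)
  then have "d = 0" using dissipative[OF d(1)] inner_ge_zero[of d] by (simp add: inner_diff_left)
  then show False using d(2) A_zero x P(2)[of x] by simp
qed

text \<open>The Yosida approximation of \<open>A\<close>, which is \<open>A\<close> composed with
  the resolvent (\<open>yosida_eq\<close>), in a form that is visibly bounded.\<close>

definition yosida :: "real \<Rightarrow> 'a \<Rightarrow> 'a" where
  "yosida l f = (1 / l) *\<^sub>R (resolv l f - f)"

lemma yosida_eq: "l > 0 \<Longrightarrow> yosida l f = A (resolv l f)"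
proof -
  assume l: "l > 0"
  then have "resolv l f - f = l *\<^sub>R A (resolv l f)" using resolv(2)[of l f] by (metis add_diff_cancel_left' diff_add_cancel)
  then show ?thesis using l by (simp add: yosida_def)
qed

lemma yosida_split: "l > 0 \<Longrightarrow> f = resolv l f - l *\<^sub>R yosida l f"
  by (simp add: yosida_def)

lemma bounded_linear_yosida: "l > 0 \<Longrightarrow> bounded_linear (yosida l)"
  unfolding yosida_def
  by (intro bounded_linear_const_scaleR bounded_linear_sub bounded_linear_resolv bounded_linear_ident)

lemma yosida_dissipative:
  assumes l: "l > 0" shows "inner (yosida l f) f \<le> 0"
proof -
  have "inner (yosida l f) f = inner (A (resolv l f)) (resolv l f) - l * inner (yosida l f) (yosida l f)"
    by (subst (2) yosida_split[OF l]) (simp add: inner_diff_right yosida_eq[OF l])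
  also have "\<dots> \<le> 0" using dissipative[OF resolv(1)[OF l]] l by (smt (verit) inner_ge_zero mult_nonneg_nonneg)
  finally show ?thesis .
qed

text \<open>On \<open>D\<close> the resolvent commutes with \<open>A\<close>, so the approximation
  is the resolvent of \<open>A x\<close>; this bound does not depend on \<open>l\<close>.\<close>

lemma norm_yosida_le:
  assumes "l > 0" "x \<in> D" shows "norm (yosida l x) \<le> norm (A x)"
proof -
  interpret bounded_linear "resolv l" by (rule bounded_linear_resolv) fact
  have "resolv l x - l *\<^sub>R resolv l (A x) = x"
    using resolv_unique[OF assms] by (simp add: diff scaleR)
  then have "resolv l x - x = l *\<^sub>R resolv l (A x)" by (simp add: algebra_simps)
  then have "yosida l x = resolv l (A x)"
    using assms by (simp add: yosida_def)
  then show ?thesis using resolv_contraction[OF assms(1)] by simp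
qed

text \<open>On \<open>D\<close> the error is at most \<open>l n * norm (A x)\<close>; density and
  contractivity do the rest. The argument \<open>y n\<close> is allowed to vary because later the
  resolvents act on the integrals of the approximate solutions, which vary as well.\<close>

lemma resolv_tendsto_id:
  assumes l: "\<And>n. l n > 0" "l \<longlonglongrightarrow> 0" and y: "y \<longlonglongrightarrow> z"
  shows "(\<lambda>n. resolv (l n) (y n)) \<longlonglongrightarrow> z"
proof -
  have Dcase: "(\<lambda>n. resolv (l n) x - x) \<longlonglongrightarrow> 0" if "x \<in> D" for x
  proof (rule Lim_null_comparison)
    show "\<forall>\<^sub>F n in sequentially. norm (resolv (l n) x - x) \<le> l n * norm (A x)"
    proof (rule always_eventually, rule allI)
      fix n
      have "resolv (l n) x - x = l n *\<^sub>R yosida (l n) x" using l(1)[of n] by (simp add: yosida_def)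
      then show "norm (resolv (l n) x - x) \<le> l n * norm (A x)"
        using norm_yosida_le[OF l(1) that] l(1)[of n] by (simp add: mult_left_mono)
    qed
    show "(\<lambda>n. l n * norm (A x)) \<longlonglongrightarrow> 0" using tendsto_mult_left_zero[OF l(2)] .
  qed
  show ?thesis
  proof (rule LIMSEQ_I)
    fix e :: real assume e: "e > 0"
    obtain x where x: "x \<in> D" "dist x z < e / 4"
      using dense_domain e closure_approachable[of z D] by (metis UNIV_I divide_pos_pos zero_less_numeral)
    obtain N1 where N1: "\<And>n. n \<ge> N1 \<Longrightarrow> norm (resolv (l n) x - x) < e / 4"
      using LIMSEQ_D[OF Dcase[OF x(1)], of "e / 4"] e by auto
    obtain N2 where N2: "\<And>n. n \<ge> N2 \<Longrightarrow> norm (y n - z) < e / 4"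
      using LIMSEQ_D[OF y, of "e / 4"] e by auto
    have "norm (resolv (l n) (y n) - z) < e" if "n \<ge> max N1 N2" for n
    proof -
      interpret bounded_linear "resolv (l n)" by (rule bounded_linear_resolv) (rule l)
      have "norm (y n - x) < e / 2"
        using N2[of n] that x(2) norm_triangle_ineq[of "y n - z" "z - x"] by (auto simp: dist_norm norm_minus_commute)
      then have "norm (resolv (l n) (y n - x)) < e / 2"
        using resolv_contraction[OF l(1), of n "y n - x"] by linarith
      moreover have "resolv (l n) (y n) - z = resolv (l n) (y n - x) + (resolv (l n) x - x) + (x - z)"
        by (simp add: diff)
      moreover have "norm (resolv (l n) (y n - x) + (resolv (l n) x - x) + (x - z)) \<le>
        norm (resolv (l n) (y n - x)) + norm (resolv (l n) x - x) + norm (x - z)"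
        by (intro norm_triangle_le add_mono order_refl norm_triangle_ineq)
      ultimately show ?thesis using N1[of n] that x(2) by (auto simp: dist_norm)
    qed
    then show "\<exists>no. \<forall>n\<ge>no. norm (resolv (l n) (y n) - z) < e" by blast
  qed
qed

text \<open>The time-integrated equation, meaningful for data outside \<open>D\<close>. It is the
  counterpart, on a Banach type and with the library integral, of
  \<open>weak_solution\<close>.\<close>

definition mild :: "'a \<Rightarrow> (real \<Rightarrow> 'a) \<Rightarrow> bool" where
  "mild x u \<longleftrightarrow> continuous_on {0..} u \<and>
     (\<forall>t\<ge>0. integral {0..t} u \<in> D \<and> u t = x + A (integral {0..t} u))"

section \<open>Mild solutions: linearity, uniqueness, limits and existence\<close>

lemma mild_integrable: "mild x u \<Longrightarrow> 0 \<le> s \<Longrightarrow> u integrable_on {s..t}"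
  unfolding mild_def by (intro integrable_continuous_real) (auto intro: continuous_on_subset)

lemma mild_add:
  assumes u: "mild x u" and v: "mild y v" shows "mild (x + y) (\<lambda>t. u t + v t)"
  unfolding mild_def
proof (intro conjI allI impI)
  show "continuous_on {0..} (\<lambda>t. u t + v t)" using u v by (auto simp: mild_def intro: continuous_intros)
  fix t :: real assume t: "0 \<le> t"
  have i: "integral {0..t} (\<lambda>t. u t + v t) = integral {0..t} u + integral {0..t} v"
    using u v by (intro Henstock_Kurzweil_Integration.integral_add mild_integrable) auto
  show "integral {0..t} (\<lambda>t. u t + v t) \<in> D" using t u v unfolding i mild_def by (auto intro: D_closed_ops)
  show "u t + v t = x + y + A (integral {0..t} (\<lambda>t. u t + v t))"
    using t u v unfolding i mild_def by (subst A_add) auto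
qed

text \<open>A bounded operator commutes with the integral, so commuting with \<open>A\<close> is all
  that is required. This later yields invariance of a closed subspace and complex linearity of the
  semigroup.\<close>

lemma mild_linear_image:
  assumes u: "mild x u" and F: "bounded_linear F"
    and FD: "\<And>x. x \<in> D \<Longrightarrow> F x \<in> D" "\<And>x. x \<in> D \<Longrightarrow> A (F x) = F (A x)"
  shows "mild (F x) (\<lambda>t. F (u t))"
  unfolding mild_def
proof (intro conjI allI impI)
  interpret bounded_linear F by fact
  show "continuous_on {0..} (\<lambda>t. F (u t))" using u by (auto simp: mild_def intro: continuous_on)
  fix t :: real assume t: "0 \<le> t"
  have i: "integral {0..t} (\<lambda>t. F (u t)) = F (integral {0..t} u)"
    using integral_linear[OF mild_integrable[OF u, of 0 t] F] by (simp add: o_def)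
  show "integral {0..t} (\<lambda>t. F (u t)) \<in> D" using t u FD unfolding i mild_def by auto
  show "F (u t) = F x + A (integral {0..t} (\<lambda>t. F (u t)))"
    using t u FD unfolding i mild_def by (metis add)
qed

lemma mild_scale: "mild x u \<Longrightarrow> mild (c *\<^sub>R x) (\<lambda>t. c *\<^sub>R u t)"
  by (rule mild_linear_image) (auto simp: bounded_linear_scaleR_right D_closed_ops A_scale)

lemma mild_diff: "mild x u \<Longrightarrow> mild y v \<Longrightarrow> mild (x - y) (\<lambda>t. u t - v t)"
  using mild_add[of x u "- y" "\<lambda>t. - v t"] mild_scale[of y v "-1"] by simp

lemma mild_zero:
  assumes u: "mild 0 u" and t: "0 \<le> t" shows "u t = 0"
proof -
  define w where "w s = integral {0..s} u" for s
  have w: "w s \<in> D" "A (w s) = u s" if "0 \<le> s" for s using u that by (auto simp: mild_def w_def)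
  have "norm (w s) \<le> norm (w 0)" if s: "0 \<le> s" for s
  proof (rule norm_nonincreasing_if_dissipative[OF s])
    fix r assume r: "r \<in> {0..s}"
    have "continuous_on {0..s} u" using u by (auto simp: mild_def intro: continuous_on_subset)
    then show "(w has_vector_derivative u r) (at r within {0..s})"
      unfolding w_def using r by (rule integral_has_vector_derivative)
    show "inner (u r) (w r) \<le> 0" using w[of r] dissipative[of "w r"] r by auto
  qed
  then have "w t = 0" using t by (simp add: w_def)
  then show ?thesis using w(2)[OF t] A_zero by simp
qed

lemma mild_unique: "mild x u \<Longrightarrow> mild x v \<Longrightarrow> 0 \<le> t \<Longrightarrow> u t = v t"
  using mild_zero[of "\<lambda>t. u t - v t" t] mild_diff[of x u x v] by simp

text \<open>Uniform convergence carries over to the integrals, and closedness of \<open>A\<close>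
  passes the integrated equation to the limit.\<close>

lemma mild_limit:
  assumes u: "\<And>n. mild (x n) (u n)" and x: "x \<longlonglongrightarrow> z"
    and lim: "\<And>T. uniform_limit {0..T} u U sequentially"
  shows "mild z U"
  unfolding mild_def
proof (intro conjI allI impI)
  have cu: "continuous_on {0..T} (u n)" for T n
    using u[of n] by (auto simp: mild_def intro: continuous_on_subset)
  then show "continuous_on {0..} U"
    by (intro continuous_on_atLeastI uniform_limit_theorem[OF _ lim]) auto
  fix t :: real assume t: "0 \<le> t"
  obtain I J where IJ: "\<And>n. (u n has_integral I n) {0..t}" "(U has_integral J) {0..t}" "I \<longlonglongrightarrow> J"
    using uniform_limit_integral[OF lim[of t] cu] by auto
  have I: "I n \<in> D" "A (I n) = u n t - x n" for n
    using u[of n] t integral_unique[OF IJ(1)[of n]] by (auto simp: mild_def)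
  have "(\<lambda>n. u n t) \<longlonglongrightarrow> U t" using tendsto_uniform_limitI[OF lim[of t]] t by simp
  then have "(\<lambda>n. A (I n)) \<longlonglongrightarrow> U t - z" unfolding I by (intro tendsto_intros x)
  from closed_operator[OF I(1) IJ(3) this] integral_unique[OF IJ(2)]
  show "integral {0..t} U \<in> D" "U t = z + A (integral {0..t} U)" by auto
qed

text \<open>Yosida approximations with \<open>l n\<close> tending to 0. For a datum in
  \<open>D\<close> the approximate derivatives stay bounded by \<open>norm (A x)\<close>, and this
  makes the approximate solutions uniformly Cauchy on bounded intervals, with squared distance of
  order \<open>l n + l m\<close>.\<close>

lemma mild_exists_on_domain:
  assumes x: "x \<in> D"
  obtains u where "mild x u" "\<And>t. 0 \<le> t \<Longrightarrow> norm (u t) \<le> norm x"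
proof -
  define l :: "nat \<Rightarrow> real" where "l n = inverse (real (Suc n))" for n
  have l: "l n > 0" for n by (simp add: l_def)
  have l0: "l \<longlonglongrightarrow> 0" unfolding l_def by (rule LIMSEQ_inverse_real_of_nat)
  have "\<exists>u. u 0 = x \<and> (\<forall>T t. t \<in> {0..T} \<longrightarrow> (u has_vector_derivative yosida (l n) (u t)) (at t within {0..T}))" for n
    using bounded_linear_ode_solution[OF bounded_linear_yosida[OF l]] by metis
  then obtain u where u0: "\<And>n. u n 0 = x"
    and du: "\<And>n T t. t \<in> {0..T} \<Longrightarrow> (u n has_vector_derivative yosida (l n) (u n t)) (at t within {0..T})"
    by metis
  have norm_u: "norm (u n t) \<le> norm x" if "0 \<le> t" for n t
    using norm_nonincreasing_if_dissipative[OF that du yosida_dissipative[OF l]] by (simp add: u0)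
  \<comment> \<open>The image of the solution under the approximate operator solves the same
    evolution equation, so its norm does not exceed its initial value.\<close>
  have norm_Yu: "norm (yosida (l n) (u n t)) \<le> norm (A x)" if "0 \<le> t" for n t
  proof -
    have "norm (yosida (l n) (u n t)) \<le> norm (yosida (l n) (u n 0))"
      by (rule norm_nonincreasing_if_dissipative[OF that _ yosida_dissipative[OF l]])
        (rule bounded_linear.has_vector_derivative[OF bounded_linear_yosida[OF l] du])
    then show ?thesis using norm_yosida_le[OF l[of n] x] by (simp add: u0)
  qed
  define a where "a = norm (A x)"
  have est: "(norm (u n t - u m t))\<^sup>2 \<le> 4 * (l n + l m) * a\<^sup>2 * t" if t: "0 \<le> t" for n m t
  proof -
    have "(norm (u n t - u m t))\<^sup>2 \<le> (norm (u n 0 - u m 0))\<^sup>2 + 2 * (2 * (l n + l m) * a\<^sup>2) * t"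
    proof (rule norm_sq_growth[OF t])
      fix s assume s: "s \<in> {0..t}"
      show "((\<lambda>t. u n t - u m t) has_vector_derivative yosida (l n) (u n s) - yosida (l m) (u m s)) (at s within {0..t})"
        by (intro has_vector_derivative_diff du s)
      let ?y = "yosida (l n) (u n s)" and ?z = "yosida (l m) (u m s)"
      let ?p = "resolv (l n) (u n s)" and ?q = "resolv (l m) (u m s)"
      \<comment> \<open>Each solution is split into its resolvent minus \<open>l\<close> times its
        Yosida derivative. On the difference of the resolvents dissipativity of \<open>A\<close>
        applies; the remainder carries the small factors \<open>l n\<close> and
        \<open>l m\<close>.\<close>
      have "u n s - u m s = (?p - l n *\<^sub>R ?y) - (?q - l m *\<^sub>R ?z)"
        using yosida_split[OF l[of n], of "u n s"] yosida_split[OF l[of m], of "u m s"] by simp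
      also have "\<dots> = (?p - ?q) - (l n *\<^sub>R ?y - l m *\<^sub>R ?z)" by simp
      finally have "inner (?y - ?z) (u n s - u m s) =
          inner (?y - ?z) (?p - ?q) - inner (?y - ?z) (l n *\<^sub>R ?y - l m *\<^sub>R ?z)"
        by (simp only: inner_diff_right)
      moreover have "inner (?y - ?z) (?p - ?q) \<le> 0"
        using dissipative[of "?p - ?q"] resolv(1)[OF l] D_closed_ops by (simp add: yosida_eq[OF l] A_diff)
      moreover have "- inner (?y - ?z) (l n *\<^sub>R ?y - l m *\<^sub>R ?z) \<le> (2 * a) * ((l n + l m) * a)"
      proof -
        have yz: "norm ?y \<le> a" "norm ?z \<le> a" using norm_Yu s by (auto simp: a_def)
        have "norm (?y - ?z) \<le> 2 * a" using norm_triangle_ineq4[of ?y ?z] yz by simp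
        moreover have "norm (l n *\<^sub>R ?y - l m *\<^sub>R ?z) \<le> (l n + l m) * a"
        proof -
          have "norm (l n *\<^sub>R ?y) \<le> l n * a" "norm (l m *\<^sub>R ?z) \<le> l m * a"
            using yz l[of n] l[of m] by simp_all
          then show ?thesis
            using norm_triangle_ineq4[of "l n *\<^sub>R ?y" "l m *\<^sub>R ?z"] unfolding distrib_right by linarith
        qed
        ultimately have "norm (?y - ?z) * norm (l n *\<^sub>R ?y - l m *\<^sub>R ?z) \<le> (2 * a) * ((l n + l m) * a)"
          by (intro mult_mono) (auto simp: a_def)
        then show ?thesis using Cauchy_Schwarz_ineq2[of "?y - ?z" "l n *\<^sub>R ?y - l m *\<^sub>R ?z"] by linarith
      qed
      ultimately show "inner (?y - ?z) (u n s - u m s) \<le> 2 * (l n + l m) * a\<^sup>2"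
        by (simp add: power2_eq_square mult_ac)
    qed
    then show ?thesis by (simp add: u0 algebra_simps)
  qed
  have "uniformly_Cauchy_on {0..T} u" for T
  proof (rule uniformly_Cauchy_onI)
    fix e :: real assume e: "e > 0"
    have "(\<lambda>n. 8 * l n * a\<^sup>2 * \<bar>T\<bar>) \<longlonglongrightarrow> 8 * 0 * a\<^sup>2 * \<bar>T\<bar>" by (intro tendsto_intros l0)
    then have "\<forall>\<^sub>F n in sequentially. 8 * l n * a\<^sup>2 * \<bar>T\<bar> < e\<^sup>2" using e by (intro order_tendstoD) auto
    then obtain N where N: "8 * l N * a\<^sup>2 * \<bar>T\<bar> < e\<^sup>2" by (auto simp: eventually_sequentially)
    have "dist (u m t) (u n t) < e" if "t \<in> {0..T}" "m \<ge> N" "n \<ge> N" for m n t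
    proof -
      have ll: "l m \<le> l N" "l n \<le> l N" using that by (auto simp: l_def field_simps)
      have le: "4 * (l m + l n) * a\<^sup>2 * t \<le> 8 * l N * a\<^sup>2 * \<bar>T\<bar>"
      proof (rule mult_mono)
        show "4 * (l m + l n) * a\<^sup>2 \<le> 8 * l N * a\<^sup>2"
          using ll by (intro mult_right_mono) auto
      qed (use that l[of N] in auto)
      have "(norm (u m t - u n t))\<^sup>2 \<le> 4 * (l m + l n) * a\<^sup>2 * t" by (rule est) (use that in simp)
      also note le
      also note N
      finally show ?thesis unfolding dist_norm by (rule power2_less_imp_less) (use e in simp)
    qed
    then show "\<exists>N. \<forall>t\<in>{0..T}. \<forall>m\<ge>N. \<forall>n\<ge>N. dist (u m t) (u n t) < e" by blast
  qed
  then have lim: "uniform_limit {0..T} u (\<lambda>t. lim (\<lambda>n. u n t)) sequentially" for T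
    using Cauchy_uniformly_convergent uniformly_convergent_uniform_limit_iff by blast
  define U where "U t = lim (\<lambda>n. u n t)" for t
  have lim: "uniform_limit {0..T} u U sequentially" for T using lim unfolding U_def .
  have pt: "(\<lambda>n. u n t) \<longlonglongrightarrow> U t" if "0 \<le> t" for t
    using tendsto_uniform_limitI[OF lim[of t]] that by simp
  have cu: "continuous_on {0..T} (u n)" for T n
    unfolding continuous_on_eq_continuous_within using has_vector_derivative_continuous[OF du] by blast
  have "mild x U" unfolding mild_def
  proof (intro conjI allI impI)
    show "continuous_on {0..} U"
      using cu by (intro continuous_on_atLeastI uniform_limit_theorem[OF _ lim]) auto
    fix t :: real assume t: "0 \<le> t"
    obtain I J where IJ: "\<And>n. (u n has_integral I n) {0..t}" "(U has_integral J) {0..t}" "I \<longlonglongrightarrow> J"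
      using uniform_limit_integral[OF lim[of t] cu] by auto
    \<comment> \<open>The approximate equation integrated over \<open>{0..t}\<close>: the bounded
      operator moves out of the integral and is then written as \<open>A\<close> of a resolvent, so
      that closedness of \<open>A\<close> can be used.\<close>
    have "A (resolv (l n) (I n)) = u n t - x" for n
    proof -
      have "((\<lambda>s. yosida (l n) (u n s)) has_integral u n t - u n 0) {0..t}"
        by (rule fundamental_theorem_of_calculus[OF t du])
      moreover have "((\<lambda>s. yosida (l n) (u n s)) has_integral yosida (l n) (I n)) {0..t}"
        using has_integral_linear[OF IJ(1) bounded_linear_yosida[OF l]] by (simp add: o_def)
      ultimately show ?thesis using has_integral_unique by (metis u0 yosida_eq[OF l])
    qed
    then have "(\<lambda>n. A (resolv (l n) (I n))) \<longlonglongrightarrow> U t - x" by (auto intro!: tendsto_intros pt[OF t])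
    from closed_operator[OF resolv(1)[OF l] resolv_tendsto_id[OF l l0 IJ(3)] this] integral_unique[OF IJ(2)]
    show "integral {0..t} U \<in> D" "U t = x + A (integral {0..t} U)" by auto
  qed
  moreover have "norm (U t) \<le> norm x" if "0 \<le> t" for t
    using LIMSEQ_le_const2[OF tendsto_norm[OF pt[OF that]]] norm_u[OF that] by blast
  ultimately show ?thesis using that by blast
qed

text \<open>Density of \<open>D\<close> reduces to the previous case: differences of mild solutions
  are mild, so the solutions for approximating data are at most as far apart as the data, uniformly
  in time.\<close>

lemma mild_exists:
  obtains u where "mild x u" "\<And>t. 0 \<le> t \<Longrightarrow> norm (u t) \<le> norm x"
proof -
  obtain X where X: "\<And>n. X n \<in> D" "X \<longlonglongrightarrow> x" using dense_domain closure_sequential[of x D] by auto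
  have "\<exists>u. mild (X n) u" for n using mild_exists_on_domain[OF X(1)[of n]] by blast
  then obtain u where u: "\<And>n. mild (X n) (u n)" by metis
  have est: "dist (u m t) (u n t) \<le> dist (X m) (X n)" if t: "0 \<le> t" for m n t
  proof -
    obtain v where v: "mild (X m - X n) v" "\<And>t. 0 \<le> t \<Longrightarrow> norm (v t) \<le> norm (X m - X n)"
      using mild_exists_on_domain[OF D_closed_ops(3)[OF X(1)[of m] X(1)[of n]]] by blast
    then show ?thesis using mild_unique[OF v(1) mild_diff[OF u u] t] t v(2)[OF t] by (simp add: dist_norm)
  qed
  have "uniformly_Cauchy_on {0..T} u" for T
  proof (rule uniformly_Cauchy_onI)
    fix e :: real assume "e > 0"
    then obtain N where "\<And>m n. m \<ge> N \<Longrightarrow> n \<ge> N \<Longrightarrow> dist (X m) (X n) < e"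
      using metric_CauchyD[OF LIMSEQ_imp_Cauchy[OF X(2)]] by metis
    then show "\<exists>N. \<forall>t\<in>{0..T}. \<forall>m\<ge>N. \<forall>n\<ge>N. dist (u m t) (u n t) < e"
      using est by (meson atLeastAtMost_iff order_le_less_trans)
  qed
  then have "uniform_limit {0..T} u (\<lambda>t. lim (\<lambda>n. u n t)) sequentially" for T
    using Cauchy_uniformly_convergent uniformly_convergent_uniform_limit_iff by blast
  then obtain U where lim: "\<And>T. uniform_limit {0..T} u U sequentially" by metis
  have "norm (U t) \<le> norm x" if "0 \<le> t" for t
  proof (rule LIMSEQ_le)
    have "norm (u n t) \<le> norm (X n)" for n
    proof -
      obtain v where v: "mild (X n) v" "\<And>t. 0 \<le> t \<Longrightarrow> norm (v t) \<le> norm (X n)"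
        using mild_exists_on_domain[OF X(1)[of n]] by blast
      then show ?thesis using mild_unique[OF u v(1) that] v(2)[OF that] by simp
    qed
    then show "\<exists>N. \<forall>n\<ge>N. norm (u n t) \<le> norm (X n)" by blast
    show "(\<lambda>n. norm (u n t)) \<longlonglongrightarrow> norm (U t)"
      using tendsto_norm[OF tendsto_uniform_limitI[OF lim[of t]]] that by simp
    show "(\<lambda>n. norm (X n)) \<longlonglongrightarrow> norm x" by (rule tendsto_norm[OF X(2)])
  qed
  then show ?thesis using that mild_limit[OF u X(2) lim] by blast
qed

text \<open>By \<open>mild_unique\<close> the chosen function is determined for nonnegative times;
  its values at negative times carry no meaning.\<close>

definition sg :: "real \<Rightarrow> 'a \<Rightarrow> 'a" where
  "sg t x = (SOME u. mild x u \<and> (\<forall>t\<ge>0. norm (u t) \<le> norm x)) t"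

lemma sg_mild: "mild x (\<lambda>t. sg t x)" and sg_contraction: "0 \<le> t \<Longrightarrow> norm (sg t x) \<le> norm x"
proof -
  have "\<exists>u. mild x u \<and> (\<forall>t\<ge>0. norm (u t) \<le> norm x)" using mild_exists[of x] by metis
  from someI_ex[OF this] show "mild x (\<lambda>t. sg t x)" "0 \<le> t \<Longrightarrow> norm (sg t x) \<le> norm x"
    unfolding sg_def by auto
qed

section \<open>The semigroup of mild solutions, its generator, and its determination by the
  generator\<close>

lemma sg_eq_mild: "mild x u \<Longrightarrow> 0 \<le> t \<Longrightarrow> u t = sg t x"
  using mild_unique sg_mild by blast

lemma continuous_on_sg: "continuous_on {0..} (\<lambda>t. sg t x)"
  using sg_mild[of x] by (simp add: mild_def)

lemma sg_integral: "0 \<le> t \<Longrightarrow> integral {0..t} (\<lambda>s. sg s x) \<in> D"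
  "0 \<le> t \<Longrightarrow> A (integral {0..t} (\<lambda>s. sg s x)) = sg t x - x"
  using sg_mild[of x] unfolding mild_def by auto

lemma sg_zero: "sg 0 x = x"
  using sg_integral(2)[of 0 x] A_zero by simp

lemma bounded_linear_sg: "0 \<le> t \<Longrightarrow> bounded_linear (sg t)"
proof (rule bounded_linear_intro)
  assume t: "0 \<le> t"
  show "sg t (x + y) = sg t x + sg t y" for x y
    using sg_eq_mild[OF mild_add[OF sg_mild sg_mild] t] by simp
  show "sg t (c *\<^sub>R x) = c *\<^sub>R sg t x" for c x
    using sg_eq_mild[OF mild_scale[OF sg_mild] t] by simp
  show "norm (sg t x) \<le> norm x * 1" for x using sg_contraction[OF t] by simp
qed

lemma sg_commute:
  assumes "bounded_linear F" "\<And>x. x \<in> D \<Longrightarrow> F x \<in> D" "\<And>x. x \<in> D \<Longrightarrow> A (F x) = F (A x)" "0 \<le> t"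
  shows "F (sg t x) = sg t (F x)"
  using sg_eq_mild[OF mild_linear_image[OF sg_mild assms(1-3)] assms(4)] by simp

text \<open>The solution shifted by \<open>s\<close> is mild with initial value
  \<open>sg s x\<close>, since its integral is a difference of two integrals in \<open>D\<close>;
  uniqueness of mild solutions concludes.\<close>

lemma sg_add:
  assumes t: "0 \<le> t" and s: "0 \<le> s" shows "sg (s + t) x = sg t (sg s x)"
proof -
  have "mild (sg s x) (\<lambda>t. sg (s + t) x)" unfolding mild_def
  proof (intro conjI allI impI)
    show "continuous_on {0..} (\<lambda>t. sg (s + t) x)"
      by (rule continuous_on_compose2[OF continuous_on_sg]) (use s in \<open>auto intro!: continuous_intros\<close>)
    fix t :: real assume t: "0 \<le> t"
    let ?w = "\<lambda>t. integral {0..t} (\<lambda>s. sg s x)"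
    have int: "(\<lambda>s. sg s x) integrable_on {r..q}" if "0 \<le> r" for r q using mild_integrable[OF sg_mild that] .
    have "integral {0..t} (\<lambda>t. sg (s + t) x) = integral {0 + s..t + s} (\<lambda>s. sg s x)"
      by (rule has_integral_translate) (use s int in auto)
    also have "\<dots> = ?w (t + s) - ?w s"
      using Henstock_Kurzweil_Integration.integral_combine[of 0 s "t + s" "\<lambda>s. sg s x"] t s int
      by (simp add: eq_diff_eq add.commute)
    finally have i: "integral {0..t} (\<lambda>t. sg (s + t) x) = ?w (t + s) - ?w s" .
    show "integral {0..t} (\<lambda>t. sg (s + t) x) \<in> D"
      unfolding i using t s by (auto intro!: D_closed_ops sg_integral)
    show "sg (s + t) x = sg s x + A (integral {0..t} (\<lambda>t. sg (s + t) x))"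
      unfolding i using t s by (subst A_diff) (auto simp: sg_integral add.commute)
  qed
  then show ?thesis using sg_eq_mild t by blast
qed

text \<open>The candidate \<open>v\<close>, obtained by integrating the semigroup along
  \<open>A x\<close>, is differentiable by construction and satisfies
  \<open>A (v t) = sg t (A x)\<close>. Once it is recognised as a mild solution, uniqueness
  transfers these properties to \<open>sg t x\<close>.\<close>

lemma sg_domain:
  assumes x: "x \<in> D" and t: "0 \<le> t"
  shows "sg t x \<in> D" "A (sg t x) = sg t (A x)"
    "((\<lambda>t. sg t x) has_vector_derivative sg t (A x)) (at t within {0..})"
proof -
  define w where "w t = integral {0..t} (\<lambda>s. sg s (A x))" for t
  define v where "v t = x + w t" for t
  have dw: "(w has_vector_derivative sg t (A x)) (at t within {0..})" if "0 \<le> t" for t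
    unfolding w_def using integral_has_vector_derivative_atLeast[OF continuous_on_sg that] .
  have "continuous_on {0..} w"
    unfolding continuous_on_eq_continuous_within using has_vector_derivative_continuous[OF dw] by auto
  then have cv: "continuous_on {0..} v" unfolding v_def by (intro continuous_intros)
  have v: "v t \<in> D" "A (v t) = sg t (A x)" if "0 \<le> t" for t
    using sg_integral[OF that, of "A x"] x by (simp_all add: v_def w_def D_closed_ops A_add)
  have "mild x v" unfolding mild_def
  proof (intro conjI allI impI)
    show "continuous_on {0..} v" by fact
    fix t :: real assume t: "0 \<le> t"
    \<comment> \<open>This is \<open>v - A v\<close>, so \<open>v\<close> is the resolvent of
      \<open>q\<close> at parameter 1. The bounded resolvent can be taken out of the integral, which
      puts the integral of \<open>v\<close> into \<open>D\<close> even though \<open>A\<close> is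
      unbounded.\<close>
    define q where "q s = v s - sg s (A x)" for s
    have iv: "v integrable_on {0..t}" by (intro integrable_continuous_real continuous_on_subset[OF cv]) auto
    have isg: "(\<lambda>s. sg s (A x)) integrable_on {0..t}" by (intro mild_integrable[OF sg_mild]) auto
    have iq: "q integrable_on {0..t}" unfolding q_def by (intro integrable_diff iv isg)
    have "resolv 1 (q s) = v s" if "s \<in> {0..t}" for s
      using resolv_unique[of 1 "v s"] v[of s] that by (simp add: q_def)
    then have "integral {0..t} v = integral {0..t} (resolv 1 \<circ> q)"
      by (intro Henstock_Kurzweil_Integration.integral_cong) simp
    also have "\<dots> = resolv 1 (integral {0..t} q)" by (intro integral_linear iq bounded_linear_resolv) simp
    finally have V: "integral {0..t} v = resolv 1 (integral {0..t} q)" .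
    show "integral {0..t} v \<in> D" unfolding V by (rule resolv) simp
    have "integral {0..t} v - A (integral {0..t} v) = integral {0..t} q"
      using resolv(2)[of 1 "integral {0..t} q"] unfolding V by simp
    also have "\<dots> = integral {0..t} v - w t"
      unfolding q_def w_def by (rule Henstock_Kurzweil_Integration.integral_diff[OF iv isg])
    finally show "v t = x + A (integral {0..t} v)" by (simp add: v_def)
  qed
  then have sv: "sg t x = v t" if "0 \<le> t" for t using sg_eq_mild that by fastforce
  show "sg t x \<in> D" "A (sg t x) = sg t (A x)" using v[OF t] sv[OF t] by auto
  have "(v has_vector_derivative sg t (A x)) (at t within {0..})"
    unfolding v_def using has_vector_derivative_add[OF has_vector_derivative_const dw[OF t]] by simp
  then show "((\<lambda>t. sg t x) has_vector_derivative sg t (A x)) (at t within {0..})"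
    by (rule has_vector_derivative_transform[rotated 2]) (use t sv in auto)
qed

text \<open>From left to right, the averages of the orbit over \<open>{0..h}\<close> lie in
  \<open>D\<close> and tend to \<open>x\<close>, while \<open>A\<close> maps them to the difference
  quotients, which tend to \<open>y\<close>; closedness of \<open>A\<close> gives the claim. The
  converse is \<open>sg_domain\<close> at time 0.\<close>

lemma sg_generator:
  "((\<lambda>h. (1 / h) *\<^sub>R (sg h x - x)) \<longlongrightarrow> y) (at_right 0) \<longleftrightarrow> x \<in> D \<and> A x = y"
proof
  assume "x \<in> D \<and> A x = y"
  then have "((\<lambda>t. sg t x) has_vector_derivative y) (at 0 within {0<..})"
    using has_vector_derivative_within_subset[OF sg_domain(3)[of x 0], of "{0<..}"]
    by (auto simp: sg_zero subset_iff)
  then show "((\<lambda>h. (1 / h) *\<^sub>R (sg h x - x)) \<longlongrightarrow> y) (at_right 0)"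
    unfolding has_vector_derivative_iff_quotient by (simp add: sg_zero)
next
  assume lim: "((\<lambda>h. (1 / h) *\<^sub>R (sg h x - x)) \<longlongrightarrow> y) (at_right 0)"
  let ?w = "\<lambda>t. integral {0..t} (\<lambda>s. sg s x)"
  have "(?w has_vector_derivative sg 0 x) (at 0 within {0<..})"
    by (rule has_vector_derivative_within_subset[OF integral_has_vector_derivative_atLeast[OF continuous_on_sg]]) auto
  then have w: "((\<lambda>h. (1 / h) *\<^sub>R ?w h) \<longlongrightarrow> x) (at_right 0)"
    unfolding has_vector_derivative_iff_quotient by (simp add: sg_zero)
  define h :: "nat \<Rightarrow> real" where "h n = inverse (real (Suc n))" for n
  have h: "h n > 0" for n by (simp add: h_def)
  have hr: "filterlim h (at_right 0) sequentially"
    using LIMSEQ_inverse_real_of_nat h unfolding h_def[abs_def]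
    by (auto simp: filterlim_at)
  have "A ((1 / h n) *\<^sub>R ?w (h n)) = (1 / h n) *\<^sub>R (sg (h n) x - x)" for n
    using sg_integral[of "h n" x] h[of n] by (simp add: A_scale)
  then have "(\<lambda>n. A ((1 / h n) *\<^sub>R ?w (h n))) \<longlonglongrightarrow> y" using filterlim_compose[OF lim hr] by simp
  moreover have "(1 / h n) *\<^sub>R ?w (h n) \<in> D" for n using sg_integral[of "h n" x] h[of n] D_closed_ops by auto
  ultimately show "x \<in> D \<and> A x = y"
    using closed_operator[OF _ filterlim_compose[OF w hr]] by blast
qed

text \<open>The integral of an orbit of \<open>S\<close> lies in the domain of the generator of
  \<open>S\<close>, with value \<open>S t x - x\<close>. By \<open>gen\<close> this generator is
  contained in \<open>A\<close>, so orbits of \<open>S\<close> are mild solutions and uniqueness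
  applies.\<close>

lemma semigroup_eq_sg:
  assumes lin: "\<And>t. 0 \<le> t \<Longrightarrow> bounded_linear (S t)"
    and contr: "\<And>t x. 0 \<le> t \<Longrightarrow> norm (S t x) \<le> norm x"
    and zero: "\<And>x. S 0 x = x"
    and add: "\<And>s t x. 0 \<le> s \<Longrightarrow> 0 \<le> t \<Longrightarrow> S (s + t) x = S s (S t x)"
    and cont: "\<And>x. ((\<lambda>t. S t x) \<longlongrightarrow> x) (at_right 0)"
    and gen: "\<And>x y. ((\<lambda>h. (1 / h) *\<^sub>R (S h x - x)) \<longlongrightarrow> y) (at_right 0) \<Longrightarrow> x \<in> D \<and> A x = y"
    and t: "0 \<le> t"
  shows "S t x = sg t x"
proof -
  \<comment> \<open>Contractivity reduces a time increment at any point, in either direction, to one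
    at 0: the distance of \<open>S r x\<close> and \<open>S s x\<close> is at most that of
    \<open>S (s - r) x\<close> and \<open>x\<close>.\<close>
  have continuous: "continuous_on {0..} (\<lambda>t. S t x)"
  proof (rule continuous_onI)
    fix t e :: real assume t: "t \<in> {0..}" and e: "e > 0"
    have "\<forall>\<^sub>F h in at_right 0. dist (S h x) x < e" using cont[of x] e by (rule tendstoD)
    then obtain d where d: "d > 0" "\<And>h. 0 < h \<Longrightarrow> h < d \<Longrightarrow> dist (S h x) x < e"
      by (auto simp: eventually_at_right_field)
    have main: "dist (S r x) (S s x) \<le> e" if "0 \<le> r" "r \<le> s" "s - r < d" for r s
    proof (cases "r = s")
      case False
      have "S s x = S r (S (s - r) x)" using add[of r "s - r" x] that by simp
      then have "S s x - S r x = S r (S (s - r) x - x)" using linear_diff[OF bounded_linear.linear[OF lin[OF that(1)]]] by simp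
      then have "norm (S s x - S r x) \<le> norm (S (s - r) x - x)" using contr[OF that(1)] by metis
      also have "\<dots> < e" using d(2)[of "s - r"] that False by (simp add: dist_norm)
      finally show ?thesis by (simp add: dist_norm norm_minus_commute)
    qed (use e in auto)
    have "dist (S s x) (S t x) \<le> e" if "s \<in> {0..}" "dist s t < d" for s
      using main[of s t] main[of t s] that t by (cases "s \<le> t") (auto simp: dist_real_def dist_commute)
    then show "\<exists>d>0. \<forall>s\<in>{0..}. dist s t < d \<longrightarrow> dist (S s x) (S t x) \<le> e" using d(1) by blast
  qed
  let ?w = "\<lambda>t. integral {0..t} (\<lambda>s. S s x)"
  have int: "(\<lambda>s. S s x) integrable_on {r..q}" if "0 \<le> r" for r q
    by (intro integrable_continuous_real continuous_on_subset[OF continuous]) (use that in auto)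
  have "mild x (\<lambda>t. S t x)" unfolding mild_def
  proof (intro conjI allI impI)
    show "continuous_on {0..} (\<lambda>t. S t x)" by fact
    fix t :: real assume t: "0 \<le> t"
    have dw: "((\<lambda>h. (1 / h) *\<^sub>R (?w (t + h) - ?w t)) \<longlongrightarrow> S t x) (at_right 0)" if "0 \<le> t" for t
    proof -
      have "(?w has_vector_derivative S t x) (at t within {t<..})"
        using that by (intro has_vector_derivative_within_subset[OF integral_has_vector_derivative_atLeast[OF continuous]]) auto
      then have "((\<lambda>s. (1 / (s - t)) *\<^sub>R (?w s - ?w t)) \<longlongrightarrow> S t x) (at_right t)"
        unfolding has_vector_derivative_iff_quotient .
      then show ?thesis unfolding at_right_to_0[of t] filterlim_filtermap by (simp add: add.commute)
    qed
    \<comment> \<open>Applying \<open>S h\<close> shifts the interval of integration by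
      \<open>h\<close>. What survives are strips of width \<open>h\<close> at the two ends, which
      after division by \<open>h\<close> tend to \<open>S t x\<close> and \<open>x\<close>.\<close>
    have eq: "S h (?w t) - ?w t = (?w (t + h) - ?w t) - (?w (0 + h) - ?w 0)" if h: "0 < h" for h
    proof -
      have "S h (?w t) = integral {0..t} (S h \<circ> (\<lambda>s. S s x))"
        using h by (intro integral_linear[symmetric] int lin) auto
      also have "\<dots> = integral {0..t} (\<lambda>s. S (h + s) x)"
        using add h by (intro Henstock_Kurzweil_Integration.integral_cong) auto
      also have "\<dots> = integral {0 + h..t + h} (\<lambda>s. S s x)"
        by (rule has_integral_translate) (use h int in auto)
      also have "\<dots> = ?w (t + h) - ?w h"
        using Henstock_Kurzweil_Integration.integral_combine[of 0 h "t + h" "\<lambda>s. S s x"] t h int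
        by (simp add: eq_diff_eq add.commute)
      finally show ?thesis by simp
    qed
    have "((\<lambda>h. (1 / h) *\<^sub>R (?w (t + h) - ?w t) - (1 / h) *\<^sub>R (?w (0 + h) - ?w 0)) \<longlongrightarrow> S t x - S 0 x) (at_right 0)"
      using dw[OF t] dw[of 0] by (intro tendsto_diff) simp_all
    then have "((\<lambda>h. (1 / h) *\<^sub>R (S h (?w t) - ?w t)) \<longlongrightarrow> S t x - x) (at_right 0)"
      unfolding zero
    proof (rule Lim_transform_eventually)
      show "\<forall>\<^sub>F h in at_right 0. (1 / h) *\<^sub>R (?w (t + h) - ?w t) - (1 / h) *\<^sub>R (?w (0 + h) - ?w 0) =
          (1 / h) *\<^sub>R (S h (?w t) - ?w t)"
        using eventually_at_right_less[of "0::real"]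
        by eventually_elim (simp only: eq scaleR_diff_right)
    qed
    from gen[OF this] show "?w t \<in> D" "S t x = x + A (?w t)" by auto
  qed
  then show ?thesis using sg_eq_mild t by blast
qed

end

section \<open>The Hilbert space of square integrable functions\<close>

lemma sq_integrable_mult_cnj:
  assumes f: "sq_integrable f" and g: "sq_integrable g"
  shows "integrable lborel (\<lambda>x. f x * cnj (g x))"
proof -
  have [measurable]: "f \<in> borel_measurable borel" "g \<in> borel_measurable borel" "cnj \<in> borel_measurable borel"
    using f g by (auto simp: sq_integrable_def intro!: borel_measurable_continuous_onI continuous_on_cnj continuous_on_id)
  have "integrable lborel (\<lambda>x. (cmod (f x))\<^sup>2 + (cmod (g x))\<^sup>2)"
    using f g by (auto simp: sq_integrable_def)
  then show ?thesis
  proof (rule Bochner_Integration.integrable_bound)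
    show "AE x in lborel. norm (f x * cnj (g x)) \<le> norm ((cmod (f x))\<^sup>2 + (cmod (g x))\<^sup>2)"
    proof (rule AE_I2)
      fix x
      have "2 * (cmod (f x) * cmod (g x)) \<le> (cmod (f x))\<^sup>2 + (cmod (g x))\<^sup>2"
        using sum_squares_bound[of "cmod (f x)" "cmod (g x)"] by (simp add: mult.assoc)
      moreover have "0 \<le> cmod (f x) * cmod (g x)" by simp
      ultimately have "cmod (f x) * cmod (g x) \<le> (cmod (f x))\<^sup>2 + (cmod (g x))\<^sup>2" by linarith
      then show "norm (f x * cnj (g x)) \<le> norm ((cmod (f x))\<^sup>2 + (cmod (g x))\<^sup>2)"
        by (simp add: norm_mult)
    qed
  qed simp
qed

section \<open>Representatives of classes and the product on the whole line\<close>

lemma sq_integrable_rep: "sq_integrable (rep_l2 f)"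
  using Quotient3_rep_reflp[OF Quotient3_l2, of f] by (simp add: l2_rel_def)

lemma rep_abs_l2: "sq_integrable f \<Longrightarrow> AE x in lborel. rep_l2 (abs_l2 f) x = f x"
  using Quotient3_rep_abs[OF Quotient3_l2, of f] by (simp add: l2_rel_def)

lemma abs_rep_l2: "abs_l2 (rep_l2 f) = f"
  using Quotient3_abs_rep[OF Quotient3_l2] .

lemma l2_rel_rep: "l2_rel (rep_l2 f) (rep_l2 f)"
  using sq_integrable_rep by (simp add: l2_rel_def)

lemma l2_eqI: "AE x in lborel. rep_l2 f x = rep_l2 g x \<Longrightarrow> f = g"
  using Quotient3_rel[OF Quotient3_l2, of "rep_l2 f" "rep_l2 g"] sq_integrable_rep
  by (simp add: l2_rel_def abs_rep_l2)

lemma measurable_rep_l2 [measurable]: "rep_l2 f \<in> borel_measurable borel"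
  using sq_integrable_rep[of f] by (simp add: sq_integrable_def)

lemma rep_zero_l2: "AE x in lborel. rep_l2 0 x = 0"
  unfolding zero_l2_def by (rule rep_abs_l2) (rule sq_integrable_zero)

lemma rep_add_l2: "AE x in lborel. rep_l2 (f + g) x = rep_l2 f x + rep_l2 g x"
  using rep_abs_l2[OF sq_integrable_add[OF sq_integrable_rep[of f] sq_integrable_rep[of g]]]
    plus_l2.abs_eq[OF l2_rel_rep l2_rel_rep, of f g] by (simp add: abs_rep_l2)

lemma rep_scaleC_l2: "AE x in lborel. rep_l2 (c *\<^sub>C f) x = c * rep_l2 f x"
  using rep_abs_l2[OF sq_integrable_scale[OF sq_integrable_rep[of f]], of c]
    scaleC_l2.abs_eq[OF l2_rel_rep, of c f] by (simp add: abs_rep_l2)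

lemma scaleC_neg_one: "(- 1) *\<^sub>C x = - (x :: 'a::complex_vector)"
  using scaleR_scaleC[of "-1" x] by simp

lemma rep_diff_l2: "AE x in lborel. rep_l2 (f - g) x = rep_l2 f x - rep_l2 g x"
  using rep_add_l2[of f "- g"] rep_scaleC_l2[of "-1" g] by eventually_elim (simp add: scaleC_neg_one)

text \<open>The product over the whole line. It agrees with \<open>l2_ip a b\<close> as soon as one
  factor vanishes off the interval (\<open>l2_ip_eq_cip\<close>), so a single Hilbert space serves
  both parts of the beam.\<close>

definition cip :: "l2 \<Rightarrow> l2 \<Rightarrow> complex" where
  "cip f g = (LINT x|lborel. rep_l2 f x * cnj (rep_l2 g x))"

lemma integrable_cip: "integrable lborel (\<lambda>x. rep_l2 f x * cnj (rep_l2 g x))"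
  by (intro sq_integrable_mult_cnj sq_integrable_rep)

lemma cip_AE_cong:
  assumes "AE x in lborel. rep_l2 f x * cnj (rep_l2 g x) = F x" "F \<in> borel_measurable borel"
  shows "cip f g = integral\<^sup>L lborel F"
  unfolding cip_def using assms borel_measurable_integrable[OF integrable_cip[of f g]]
  by (intro integral_cong_AE) auto

lemma cip_add_left: "cip (f + g) h = cip f h + cip g h"
proof -
  have "cip (f + g) h = (LINT x|lborel. rep_l2 f x * cnj (rep_l2 h x) + rep_l2 g x * cnj (rep_l2 h x))"
  proof (rule cip_AE_cong)
    show "AE x in lborel. rep_l2 (f + g) x * cnj (rep_l2 h x) = rep_l2 f x * cnj (rep_l2 h x) + rep_l2 g x * cnj (rep_l2 h x)"
      using rep_add_l2[of f g] by eventually_elim (simp add: distrib_right)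
  qed (use borel_measurable_integrable[OF integrable_cip] in \<open>simp add: borel_measurable_add\<close>)
  then show ?thesis by (simp add: cip_def integrable_cip)
qed

lemma cip_scaleC_left: "cip (c *\<^sub>C f) g = c * cip f g"
proof -
  have "cip (c *\<^sub>C f) g = (LINT x|lborel. c * (rep_l2 f x * cnj (rep_l2 g x)))"
  proof (rule cip_AE_cong)
    show "AE x in lborel. rep_l2 (c *\<^sub>C f) x * cnj (rep_l2 g x) = c * (rep_l2 f x * cnj (rep_l2 g x))"
      using rep_scaleC_l2[of c f] by eventually_elim (simp add: mult.assoc)
  qed (use borel_measurable_integrable[OF integrable_cip[of f g]] in \<open>simp add: borel_measurable_times\<close>)
  then show ?thesis by (simp add: cip_def)
qed

lemma cip_commute: "cip g f = cnj (cip f g)"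
proof -
  have "cip g f = (LINT x|lborel. cnj (rep_l2 f x * cnj (rep_l2 g x)))"
    unfolding cip_def by (intro Bochner_Integration.integral_cong) auto
  then show ?thesis by (simp only: Bochner_Integration.integral_cnj cip_def)
qed

lemma cip_add_right: "cip f (g + h) = cip f g + cip f h"
  using cip_add_left[of g h f] by (metis cip_commute complex_cnj_add)

lemma cip_scaleC_right: "cip f (c *\<^sub>C g) = cnj c * cip f g"
  using cip_scaleC_left[of c g f] by (metis cip_commute complex_cnj_mult)

lemma cip_self: "cip f f = complex_of_real (LINT x|lborel. (cmod (rep_l2 f x))\<^sup>2)"
  unfolding cip_def by (simp add: complex_norm_square flip: integral_complex_of_real del: of_real_power)

instantiation l2 :: real_inner
begin

definition inner_l2 :: "l2 \<Rightarrow> l2 \<Rightarrow> real" where "inner_l2 f g = Re (cip f g)"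
definition norm_l2 :: "l2 \<Rightarrow> real" where "norm_l2 f = sqrt (inner f f)"
definition dist_l2 :: "l2 \<Rightarrow> l2 \<Rightarrow> real" where "dist_l2 f g = norm (f - g)"
definition sgn_l2 :: "l2 \<Rightarrow> l2" where "sgn_l2 f = f /\<^sub>R norm f"
definition uniformity_l2 :: "(l2 \<times> l2) filter" where
  "uniformity_l2 = (INF e\<in>{0<..}. principal {(x, y). dist x y < e})"
definition open_l2 :: "l2 set \<Rightarrow> bool" where
  "open_l2 U \<longleftrightarrow> (\<forall>x\<in>U. eventually (\<lambda>(x', y). x' = x \<longrightarrow> y \<in> U) uniformity)"

instance
proof
  fix f g h :: l2 and r :: real
  show "inner f g = inner g f" unfolding inner_l2_def by (subst cip_commute) simp
  show "inner (f + g) h = inner f h + inner g h" by (simp add: inner_l2_def cip_add_left)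
  show "inner (r *\<^sub>R f) g = r * inner f g" by (simp add: inner_l2_def scaleR_scaleC cip_scaleC_left)
  show "0 \<le> inner f f" by (simp add: inner_l2_def cip_self)
  show "inner f f = 0 \<longleftrightarrow> f = 0"
  proof
    assume "inner f f = 0"
    then have "(LINT x|lborel. (cmod (rep_l2 f x))\<^sup>2) = 0" by (simp add: inner_l2_def cip_self)
    then have "AE x in lborel. (cmod (rep_l2 f x))\<^sup>2 = 0"
      using sq_integrable_rep[of f] by (subst (asm) integral_nonneg_eq_0_iff_AE) (auto simp: sq_integrable_def)
    then show "f = 0" using rep_zero_l2 by (intro l2_eqI) (auto elim: eventually_elim2)
  next
    assume "f = 0"
    have "cip 0 g = 0" for g using cip_scaleC_left[of 0 0 g] scaleR_scaleC[of 0 "0::l2"] by simp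
    with \<open>f = 0\<close> show "inner f f = 0" by (simp add: inner_l2_def)
  qed
qed (rule norm_l2_def dist_l2_def sgn_l2_def uniformity_l2_def open_l2_def)+

end

lemma norm_l2_squared: "(norm f)\<^sup>2 = (LINT x|lborel. (cmod (rep_l2 f x))\<^sup>2)" for f :: l2
  using power2_norm_eq_inner[of f] by (simp add: inner_l2_def cip_self)

lemma norm_l2_squared_AE:
  fixes f :: l2
  assumes "AE x in lborel. rep_l2 f x = F x" "F \<in> borel_measurable borel"
  shows "(norm f)\<^sup>2 = (LINT x|lborel. (cmod (F x))\<^sup>2)"
  unfolding norm_l2_squared using assms by (intro integral_cong_AE) (auto elim: eventually_mono)

text \<open>The sum of the series is a common majorant, integrable by monotone convergence.
  \<open>enn2real\<close> sends the value infinity to 0, which matters only on a null set.\<close>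

lemma nn_integral_finite_imp_AE_bound:
  fixes g :: "nat \<Rightarrow> 'a \<Rightarrow> real"
  assumes g: "\<And>k. integrable M (g k)" "\<And>k x. 0 \<le> g k x" and s: "summable (\<lambda>k. \<integral>x. g k x \<partial>M)"
  obtains h where "integrable M h" "\<And>x. 0 \<le> h x" "AE x in M. \<forall>k. g k x \<le> h x"
proof -
  have [measurable]: "g k \<in> borel_measurable M" for k using g(1) by auto
  define H where "H x = (\<Sum>k. ennreal (g k x))" for x
  have Hm [measurable]: "H \<in> borel_measurable M" unfolding H_def by measurable
  have "(\<integral>\<^sup>+x. H x \<partial>M) = (\<Sum>k. \<integral>\<^sup>+x. ennreal (g k x) \<partial>M)"
    unfolding H_def by (rule nn_integral_suminf) measurable
  also have "\<dots> = (\<Sum>k. ennreal (\<integral>x. g k x \<partial>M))"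
    using g by (simp add: nn_integral_eq_integral)
  also have "\<dots> = ennreal (\<Sum>k. \<integral>x. g k x \<partial>M)"
    using g(2) s by (intro suminf_ennreal2) (auto intro!: Bochner_Integration.integral_nonneg)
  finally have fin: "(\<integral>\<^sup>+x. H x \<partial>M) < \<infinity>" by simp
  then have ae: "AE x in M. H x \<noteq> \<infinity>" by (intro nn_integral_PInf_AE) auto
  have "(\<integral>\<^sup>+x. ennreal (enn2real (H x)) \<partial>M) = (\<integral>\<^sup>+x. H x \<partial>M)"
    using ae by (intro nn_integral_cong_AE) (auto simp: ennreal_enn2real_if elim!: eventually_mono)
  then have "integrable M (\<lambda>x. enn2real (H x))"
    using fin by (intro integrableI_nonneg) auto
  moreover have "AE x in M. \<forall>k. g k x \<le> enn2real (H x)"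
    using ae
  proof eventually_elim
    case (elim x)
    have "ennreal (g k x) \<le> H x" for k
      unfolding H_def using sum_le_suminf[of "\<lambda>k. ennreal (g k x)" "{k}"] by (simp add: summableI)
    then show ?case using elim g(2) by (metis enn2real_ennreal enn2real_mono infinity_ennreal_def top.not_eq_extremum)
  qed
  ultimately show ?thesis using that by simp
qed

lemma geometric_steps_converge:
  fixes f :: "nat \<Rightarrow> 'a::banach"
  assumes "\<And>k. norm (f (Suc k) - f k) \<le> c * (1/2) ^ k"
  shows "f \<longlonglongrightarrow> lim f" "norm (lim f - f k) \<le> 2 * c * (1/2) ^ k"
proof -
  have step: "norm (f (k + n) - f k) \<le> 2 * c * (1/2) ^ k - 2 * c * (1/2) ^ (k + n)" for k n
  proof (induction n)
    case (Suc n)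
    have "norm (f (k + Suc n) - f k) \<le> norm (f (k + n) - f k) + norm (f (Suc (k + n)) - f (k + n))"
      using norm_triangle_ineq[of "f (k + n) - f k" "f (Suc (k + n)) - f (k + n)"] by simp
    also have "\<dots> \<le> 2 * c * (1/2) ^ k - 2 * c * (1/2) ^ (k + n) + c * (1/2) ^ (k + n)"
      using Suc assms[of "k + n"] by simp
    finally show ?case by simp
  qed simp
  have c: "0 \<le> c" using order_trans[OF norm_ge_zero assms[of 0]] by simp
  then have bound: "norm (f (k + n) - f k) \<le> 2 * c * (1/2) ^ k" for k n
    using step[of k n] by (smt (verit) mult_nonneg_nonneg zero_le_power divide_nonneg_nonneg)
  have small: "(\<lambda>k. 2 * c * (1/2) ^ k) \<longlonglongrightarrow> 0"
    using tendsto_mult_right_zero[OF LIMSEQ_power_zero[of "1/2::real"], of "2 * c"] by simp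
  have "Cauchy f"
  proof (rule metric_CauchyI)
    fix e :: real assume "e > 0"
    then obtain N where N: "2 * c * (1/2) ^ N < e / 2"
      using order_tendstoD(2)[OF small, of "e / 2"] by (auto simp: eventually_sequentially)
    have "dist (f m) (f n) < e" if "N \<le> m" "N \<le> n" for m n
    proof -
      have "norm (f m - f N) < e / 2" "norm (f n - f N) < e / 2"
        using bound[of N "m - N"] bound[of N "n - N"] N that by auto
      then show ?thesis using norm_triangle_ineq4[of "f m - f N" "f n - f N"] by (simp add: dist_norm)
    qed
    then show "\<exists>N. \<forall>m\<ge>N. \<forall>n\<ge>N. dist (f m) (f n) < e" by blast
  qed
  then show lim: "f \<longlonglongrightarrow> lim f" by (simp add: Cauchy_convergent_iff convergent_LIMSEQ_iff)
  have "(\<lambda>n. norm (f (k + n) - f k)) \<longlonglongrightarrow> norm (lim f - f k)"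
    using LIMSEQ_ignore_initial_segment[OF lim, of k] by (intro tendsto_intros) (simp add: add.commute)
  then show "norm (lim f - f k) \<le> 2 * c * (1/2) ^ k"
    by (rule LIMSEQ_le_const2) (use bound in auto)
qed

text \<open>Riesz--Fischer: a fast subsequence converges almost everywhere with a square integrable
  rate, its pointwise limit is the limit in norm, and a Cauchy sequence follows any convergent
  subsequence.\<close>

instance l2 :: banach
proof
  fix X :: "nat \<Rightarrow> l2" assume X: "Cauchy X"
  have "\<exists>N. \<forall>m\<ge>N. \<forall>n\<ge>N. norm (X m - X n) < (1/8) ^ k" for k
    using X unfolding Cauchy_def dist_norm by (meson zero_less_power zero_less_divide_iff zero_less_numeral zero_less_one)
  then obtain N where N: "\<And>k m n. N k \<le> m \<Longrightarrow> N k \<le> n \<Longrightarrow> norm (X m - X n) < (1/8) ^ k" by metis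
  \<comment> \<open>The partial sum dominates \<open>N k\<close>, and the summand \<open>k\<close>
    makes the indices strictly increasing.\<close>
  define r where "r k = (\<Sum>j\<le>k. N j) + k" for k
  have r: "strict_mono r" by (rule strict_monoI_Suc) (simp add: r_def)
  have rN: "N k \<le> r k" for k unfolding r_def by (rule trans_le_add1) (rule member_le_sum; simp)
  define f where "f k = rep_l2 (X (r k))" for k
  have [measurable]: "f k \<in> borel_measurable borel" for k by (simp add: f_def)
  \<comment> \<open>The weight \<open>4 ^ k\<close> turns a common bound \<open>h\<close> of all
    \<open>g k\<close> into pointwise steps of size at most \<open>sqrt (h x) * (1/2) ^ k\<close>.
    The rate \<open>(1/8) ^ k\<close> of the subsequence leaves integrals of size
    \<open>(1/2) ^ k\<close>, which are summable.\<close>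
  define g where "g k x = 4 ^ k * (cmod (f (Suc k) x - f k x))\<^sup>2" for k x
  have norm_diff: "(norm (X (r k) - X (r j)))\<^sup>2 = (LINT x|lborel. (cmod (f k x - f j x))\<^sup>2)" for k j
    by (rule norm_l2_squared_AE) (simp_all add: f_def rep_diff_l2)
  have int_diff: "integrable lborel (\<lambda>x. (cmod (f k x - f j x))\<^sup>2)" for k j
    using sq_integrable_add[OF sq_integrable_rep[of "X (r k)"] sq_integrable_scale[OF sq_integrable_rep[of "X (r j)"], of "-1"]]
    by (simp add: f_def sq_integrable_def)
  obtain h where h: "integrable lborel h" "\<And>x. 0 \<le> h x" "AE x in lborel. \<forall>k. g k x \<le> h x"
  proof (rule nn_integral_finite_imp_AE_bound)
    show "integrable lborel (g k)" for k unfolding g_def by (intro integrable_mult_right int_diff)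
    show "0 \<le> g k x" for k x by (simp add: g_def)
    show "summable (\<lambda>k. \<integral>x. g k x \<partial>lborel)"
    proof (rule summable_comparison_test')
      show "summable (\<lambda>k. (1/2::real) ^ k)" by (rule summable_geometric) simp
      fix k :: nat
      have le: "norm (X (r (Suc k)) - X (r k)) \<le> (1/8) ^ k"
        using N[of k "r (Suc k)" "r k"] rN[of k] strict_monoD[OF r, of k "Suc k"] by simp
      have "(norm (X (r (Suc k)) - X (r k)))\<^sup>2 \<le> ((1/8) ^ k)\<^sup>2" by (rule power_mono[OF le]) simp
      also have "\<dots> \<le> (1/8) ^ k" by (simp add: power2_eq_square mult_le_cancel_right1 power_le_one)
      finally have "(LINT x|lborel. g k x) \<le> 4 ^ k * (1/8) ^ k"
        unfolding g_def by (simp add: norm_diff)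
      then show "norm (LINT x|lborel. g k x) \<le> (1/2) ^ k"
        by (simp add: g_def Bochner_Integration.integral_nonneg flip: power_mult_distrib)
    qed
  qed blast
  define F where "F x = lim (\<lambda>k. f k x)" for x
  have [measurable]: "F \<in> borel_measurable borel" unfolding F_def by (rule borel_measurable_lim_metric) simp
  have close: "AE x in lborel. \<forall>k. (cmod (F x - f k x))\<^sup>2 \<le> 4 * h x * (1/4) ^ k"
    using h(3)
  proof eventually_elim
    case (elim x)
    have "cmod (f (Suc k) x - f k x) \<le> sqrt (h x) * (1/2) ^ k" for k
    proof (rule power2_le_imp_le)
      have "4 ^ k * (cmod (f (Suc k) x - f k x))\<^sup>2 \<le> h x" using elim by (simp add: g_def)
      then have "(cmod (f (Suc k) x - f k x))\<^sup>2 \<le> h x / 4 ^ k" by (simp add: field_simps)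
      also have "\<dots> = (sqrt (h x) * (1/2) ^ k)\<^sup>2"
      proof -
        have "(4::real) ^ k = 2 ^ k * 2 ^ k" by (simp flip: power_mult_distrib)
        then show ?thesis using h(2)[of x] by (simp add: power_mult_distrib power_divide) (simp add: power2_eq_square)
      qed
      finally show "(cmod (f (Suc k) x - f k x))\<^sup>2 \<le> (sqrt (h x) * (1/2) ^ k)\<^sup>2" .
    qed (use h(2) in simp)
    from geometric_steps_converge(2)[OF this]
    have "cmod (F x - f k x) \<le> 2 * sqrt (h x) * (1/2) ^ k" for k unfolding F_def .
    then have "(cmod (F x - f k x))\<^sup>2 \<le> (2 * sqrt (h x) * (1/2) ^ k)\<^sup>2" for k by (rule power_mono) simp
    also have "(2 * sqrt (h x) * (1/2) ^ k)\<^sup>2 = 4 * h x * (1/4) ^ k" for k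
    proof -
      have "(4::real) ^ k = 2 ^ k * 2 ^ k" by (simp flip: power_mult_distrib)
      then show ?thesis using h(2)[of x] by (simp add: power_mult_distrib power_divide) (simp add: power2_eq_square)
    qed
    finally show ?case by blast
  qed
  have sqF: "sq_integrable F"
  proof -
    have "integrable lborel (\<lambda>x. (cmod (F x - f 0 x))\<^sup>2)"
    proof (rule Bochner_Integration.integrable_bound[OF integrable_mult_right[OF h(1), of 4]])
      show "AE x in lborel. norm ((cmod (F x - f 0 x))\<^sup>2) \<le> norm (4 * h x)"
        using close by eventually_elim (use h(2) in \<open>auto dest: spec[of _ 0]\<close>)
    qed measurable
    then have "sq_integrable (\<lambda>x. F x - f 0 x)" by (simp add: sq_integrable_def)
    from sq_integrable_add[OF this sq_integrable_rep[of "X (r 0)"]] show ?thesis by (simp add: f_def)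
  qed
  define Y where "Y = abs_l2 F"
  have YF: "AE x in lborel. rep_l2 Y x = F x" unfolding Y_def by (rule rep_abs_l2[OF sqF])
  have bound: "(norm (X (r k) - Y))\<^sup>2 \<le> 4 * (LINT x|lborel. h x) * (1/4) ^ k" for k
  proof -
    have "(norm (Y - X (r k)))\<^sup>2 = (LINT x|lborel. (cmod (F x - f k x))\<^sup>2)"
      by (rule norm_l2_squared_AE) (use rep_diff_l2[of Y "X (r k)"] YF in \<open>auto simp: f_def elim: eventually_elim2\<close>)
    also have "\<dots> \<le> (LINT x|lborel. 4 * h x * (1/4) ^ k)"
    proof (rule integral_mono_AE')
      show "integrable lborel (\<lambda>x. 4 * h x * (1/4) ^ k)" using h(1) by auto
      show "AE x in lborel. (cmod (F x - f k x))\<^sup>2 \<le> 4 * h x * (1/4) ^ k" using close by eventually_elim blast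
      show "AE x in lborel. 0 \<le> 4 * h x * (1/4) ^ k" using h(2) by simp
    qed
    finally show ?thesis by (simp add: norm_minus_commute)
  qed
  have "(\<lambda>k. (norm (X (r k) - Y))\<^sup>2) \<longlonglongrightarrow> 0"
  proof (rule Lim_null_comparison)
    show "\<forall>\<^sub>F k in sequentially. norm ((norm (X (r k) - Y))\<^sup>2) \<le> 4 * (LINT x|lborel. h x) * (1/4) ^ k"
      using bound by (auto intro!: always_eventually simp del: power_mono_iff)
    show "(\<lambda>k. 4 * (LINT x|lborel. h x) * (1/4) ^ k) \<longlonglongrightarrow> 0"
      using tendsto_mult_right_zero[OF LIMSEQ_power_zero[of "1/4::real"], of "4 * (LINT x|lborel. h x)"] by simp
  qed
  then have "(\<lambda>k. norm (X (r k) - Y)) \<longlonglongrightarrow> 0"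
    using tendsto_real_sqrt[of "\<lambda>k. (norm (X (r k) - Y))\<^sup>2" 0] by simp
  then have "(X \<circ> r) \<longlonglongrightarrow> Y" by (simp add: tendsto_norm_zero_iff LIM_zero_iff o_def)
  then show "convergent X" using Cauchy_converges_subseq[OF X r, of Y] by (auto simp: convergent_def)
qed

section \<open>Test functions\<close>

text \<open>\<open>test_function\<close> speaks of iterated \<open>vector_derivative\<close>, for
  which products and compositions are unwieldy. Here the derivative is existentially quantified, so
  closure properties follow by induction on the order.\<close>

primrec differentiable_upto :: "nat \<Rightarrow> (real \<Rightarrow> real) \<Rightarrow> bool" where
  "differentiable_upto 0 f \<longleftrightarrow> True"
| "differentiable_upto (Suc k) f \<longleftrightarrow> (\<exists>f'. (\<forall>x. (f has_real_derivative f' x) (at x)) \<and> differentiable_upto k f')"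

lemma differentiable_upto_pred: "differentiable_upto (Suc k) f \<Longrightarrow> differentiable_upto k f"
proof (induction k arbitrary: f)
  case (Suc k)
  from Suc.prems obtain f' where f': "\<forall>x. (f has_real_derivative f' x) (at x)" "differentiable_upto (Suc k) f'"
    by (subst (asm) differentiable_upto.simps) blast
  then show ?case using Suc.IH[OF f'(2)] by auto
qed simp

lemma differentiable_upto_const: "differentiable_upto k (\<lambda>x. c)"
proof (induction k arbitrary: c)
  case (Suc k)
  then show ?case by (auto intro!: exI[of _ "\<lambda>x. 0"])
qed simp

lemma differentiable_upto_add:
  "differentiable_upto k f \<Longrightarrow> differentiable_upto k g \<Longrightarrow> differentiable_upto k (\<lambda>x. f x + g x)"
proof (induction k arbitrary: f g)
  case (Suc k)
  then obtain f' g' where "\<forall>x. (f has_real_derivative f' x) (at x)" "differentiable_upto k f'"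
    "\<forall>x. (g has_real_derivative g' x) (at x)" "differentiable_upto k g'" by auto
  then show ?case using Suc.IH by (auto intro!: exI[of _ "\<lambda>x. f' x + g' x"] DERIV_add)
qed simp

lemma differentiable_upto_mult:
  "differentiable_upto k f \<Longrightarrow> differentiable_upto k g \<Longrightarrow> differentiable_upto k (\<lambda>x. f x * g x)"
proof (induction k arbitrary: f g)
  case (Suc k)
  note prev = differentiable_upto_pred[OF Suc.prems(1)] differentiable_upto_pred[OF Suc.prems(2)]
  from Suc.prems obtain f' g' where *: "\<forall>x. (f has_real_derivative f' x) (at x)" "differentiable_upto k f'"
    "\<forall>x. (g has_real_derivative g' x) (at x)" "differentiable_upto k g'" by auto
  have "((\<lambda>x. f x * g x) has_real_derivative f' x * g x + g' x * f x) (at x)" for x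
    using * by (intro DERIV_mult) auto
  moreover have "differentiable_upto k (\<lambda>x. f' x * g x + g' x * f x)"
    by (intro differentiable_upto_add Suc.IH prev *)
  ultimately show ?case by (auto intro!: exI[of _ "\<lambda>x. f' x * g x + g' x * f x"])
qed simp

lemma differentiable_upto_affine:
  "differentiable_upto k f \<Longrightarrow> differentiable_upto k (\<lambda>x. f (m * x + c))"
proof (induction k arbitrary: f)
  case (Suc k)
  then obtain f' where f': "\<forall>x. (f has_real_derivative f' x) (at x)" "differentiable_upto k f'" by auto
  have "((\<lambda>x. f (m * x + c)) has_real_derivative f' (m * x + c) * m) (at x)" for x
    by (rule DERIV_chain2[of f]) (use f' in \<open>auto intro!: derivative_eq_intros\<close>)
  moreover have "differentiable_upto k (\<lambda>x. f' (m * x + c) * m)"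
    using differentiable_upto_mult[OF Suc.IH[OF f'(2)] differentiable_upto_const[of k m]] .
  ultimately show ?case by (auto intro!: exI[of _ "\<lambda>x. f' (m * x + c) * m"])
qed simp

lemma differentiable_upto_derivative:
  assumes "\<And>k. differentiable_upto k f"
  obtains f' where "\<And>x. (f has_real_derivative f' x) (at x)" "\<And>k. differentiable_upto k f'"
proof -
  obtain f' where f': "\<And>x. (f has_real_derivative f' x) (at x)" using assms[of 1] by auto
  have "differentiable_upto k f'" for k
  proof -
    obtain g where g: "\<forall>x. (f has_real_derivative g x) (at x)" "differentiable_upto k g" using assms[of "Suc k"] by auto
    then have "g = f'" using DERIV_unique f' by blast
    then show ?thesis using g by simp
  qed
  then show ?thesis using that f' by blast
qed

definition smooth_supported :: "real \<Rightarrow> real \<Rightarrow> (real \<Rightarrow> real) \<Rightarrow> bool" where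
  "smooth_supported a b f \<longleftrightarrow> (\<forall>k. differentiable_upto k f) \<and>
     (\<exists>c d. a < c \<and> d < b \<and> (\<forall>x. x \<notin> {c..d} \<longrightarrow> f x = 0))"

lemma smooth_supported_continuous: "smooth_supported a b f \<Longrightarrow> continuous_on UNIV f"
proof -
  assume "smooth_supported a b f"
  then have "differentiable_upto (Suc 0) f" unfolding smooth_supported_def by blast
  then obtain f' where "\<forall>x. (f has_real_derivative f' x) (at x)" by auto
  then show ?thesis by (auto intro!: continuous_at_imp_continuous_on DERIV_isCont)
qed

lemma test_function_of_real:
  assumes "smooth_supported a b f" shows "test_function a b (\<lambda>x. complex_of_real (f x))"
proof -
  have "\<exists>g. (\<forall>k. differentiable_upto k g) \<and>
      ((\<lambda>f x. vector_derivative f (at x)) ^^ n) (\<lambda>x. complex_of_real (f x)) = (\<lambda>x. complex_of_real (g x))" for n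
  proof (induction n)
    case 0
    then show ?case using assms by (auto simp: smooth_supported_def)
  next
    case (Suc n)
    then obtain g where g: "\<And>k. differentiable_upto k g"
      "((\<lambda>f x. vector_derivative f (at x)) ^^ n) (\<lambda>x. complex_of_real (f x)) = (\<lambda>x. complex_of_real (g x))" by blast
    obtain g' where g': "\<And>x. (g has_real_derivative g' x) (at x)" "\<And>k. differentiable_upto k g'"
      using differentiable_upto_derivative[OF g(1)] by blast
    have "vector_derivative (\<lambda>x. complex_of_real (g x)) (at x) = complex_of_real (g' x)" for x
      by (intro vector_derivative_at has_vector_derivative_of_real)
        (use g'(1) in \<open>simp add: has_real_derivative_iff_has_vector_derivative\<close>)
    then show ?case using g(2) g'(2) by auto
  qed
  moreover have "(\<lambda>x. complex_of_real (g x)) differentiable_on UNIV" if g: "\<And>k. differentiable_upto k g" for g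
  proof -
    obtain g' where "\<And>x. (g has_real_derivative g' x) (at x)" using differentiable_upto_derivative[OF g] by blast
    then have "((\<lambda>x. complex_of_real (g x)) has_vector_derivative complex_of_real (g' x)) (at x)" for x
      by (intro has_vector_derivative_of_real) (simp add: has_real_derivative_iff_has_vector_derivative)
    then show ?thesis by (auto simp: differentiable_on_def intro: differentiableI_vector differentiable_at_withinI)
  qed
  ultimately have "((\<lambda>f x. vector_derivative f (at x)) ^^ n) (\<lambda>x. complex_of_real (f x)) differentiable_on UNIV" for n
    by metis
  then show ?thesis using assms unfolding test_function_def smooth_supported_def by auto
qed

text \<open>Differentiating \<open>exp (- 1 / x)\<close> produces negative powers of
  \<open>x\<close>; with the exponent \<open>m\<close> as a parameter the family is closed under
  differentiation up to linear combinations, which makes smoothness a plain induction.\<close>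

definition flat_step :: "nat \<Rightarrow> real \<Rightarrow> real" where
  "flat_step m x = (if x \<le> 0 then 0 else inverse x ^ m * exp (- inverse x))"

lemma flat_step_has_derivative:
  "(flat_step m has_real_derivative flat_step (m + 2) x - real m * flat_step (m + 1) x) (at x)"
proof (cases x "0::real" rule: linorder_cases)
  case less
  have "((\<lambda>x. 0) has_real_derivative 0) (at x)" by simp
  then have "(flat_step m has_real_derivative 0) (at x)"
    by (rule has_field_derivative_transform_within_open[where S = "{..<0}"]) (use less in \<open>auto simp: flat_step_def\<close>)
  then show ?thesis using less by (simp add: flat_step_def)
next
  case greater
  have "((\<lambda>x. inverse x ^ m * exp (- inverse x)) has_real_derivative
      inverse x ^ (m + 2) * exp (- inverse x) - real m * (inverse x ^ (m + 1) * exp (- inverse x))) (at x)"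
  proof -
    have ip: "((\<lambda>x. inverse x ^ m) has_real_derivative - real m * inverse x ^ (m + 1)) (at x)"
    proof (induction m)
      case (Suc m)
      have "((\<lambda>x. inverse x * inverse x ^ m) has_real_derivative
          - (inverse x ^ Suc (Suc 0)) * inverse x ^ m + (- real m * inverse x ^ (m + 1)) * inverse x) (at x)"
        using greater by (intro DERIV_mult DERIV_inverse Suc) simp
      then show ?case by (simp add: algebra_simps)
    qed simp
    have "((\<lambda>x. exp (- inverse x)) has_real_derivative exp (- inverse x) * inverse x ^ 2) (at x)"
      using greater by (auto intro!: derivative_eq_intros simp: power2_eq_square)
    from DERIV_mult[OF ip this] show ?thesis by (simp add: algebra_simps power2_eq_square)
  qed
  then have "(flat_step m has_real_derivative
      inverse x ^ (m + 2) * exp (- inverse x) - real m * (inverse x ^ (m + 1) * exp (- inverse x))) (at x)"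
    by (rule has_field_derivative_transform_within_open[where S = "{0<..}"]) (use greater in \<open>auto simp: flat_step_def\<close>)
  then show ?thesis using greater by (simp add: flat_step_def)
next
  case equal
  \<comment> \<open>To the right of 0 the difference quotient is \<open>inverse h ^ Suc m\<close>
    divided by \<open>exp (inverse h)\<close>, and the exponential wins; to the left it is
    identically 0.\<close>
  have "((\<lambda>h. (flat_step m (0 + h) - flat_step m 0) / h) \<longlongrightarrow> 0) (at_right 0)"
  proof (rule Lim_transform_eventually)
    have "((\<lambda>h. inverse h ^ Suc m / exp (inverse h)) \<longlongrightarrow> (0::real)) (at_right 0)"
      using filterlim_compose[OF tendsto_power_div_exp_0[of "Suc m"] filterlim_inverse_at_top_right] .
    then show "((\<lambda>h. inverse h ^ Suc m / exp (inverse h)) \<longlongrightarrow> (0::real)) (at_right 0)" .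
    show "\<forall>\<^sub>F h in at_right 0. inverse h ^ Suc m / exp (inverse h) = (flat_step m (0 + h) - flat_step m 0) / h"
      using eventually_at_right_less[of "0::real"]
      by eventually_elim (simp add: flat_step_def exp_minus divide_inverse mult_ac)
  qed
  moreover have "((\<lambda>h. (flat_step m (0 + h) - flat_step m 0) / h) \<longlongrightarrow> 0) (at_left 0)"
  proof (rule Lim_transform_eventually[OF tendsto_const])
    show "\<forall>\<^sub>F h in at_left 0. 0 = (flat_step m (0 + h) - flat_step m 0) / h"
      by (rule eventually_at_leftI[of "-1"]) (simp_all add: flat_step_def)
  qed
  ultimately have "(flat_step m has_real_derivative 0) (at 0)" unfolding DERIV_def by (rule filterlim_split_at[rotated])
  then show ?thesis using equal by (simp add: flat_step_def)
qed

lemma differentiable_upto_flat_step: "differentiable_upto k (flat_step m)"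
proof (induction k arbitrary: m)
  case (Suc k)
  have "differentiable_upto k (\<lambda>x. flat_step (m + 2) x + (- real m) * flat_step (m + 1) x)"
    by (intro differentiable_upto_add differentiable_upto_mult differentiable_upto_const Suc)
  then show ?case using flat_step_has_derivative[of m]
    by (auto intro!: exI[of _ "\<lambda>x. flat_step (m + 2) x - real m * flat_step (m + 1) x"])
qed simp

text \<open>The shift by 1 keeps the support inside \<open>{c + 1 / n..d - 1 / n}\<close>. As
  \<open>flat_step 0\<close> tends to 1 at infinity, the plateaus tend to the indicator of the open
  interval.\<close>

definition plateau :: "real \<Rightarrow> real \<Rightarrow> nat \<Rightarrow> real \<Rightarrow> real" where
  "plateau c d n x = flat_step 0 (real n * (x - c) - 1) * flat_step 0 (real n * (d - x) - 1)"

section \<open>Smooth plateaus and the fundamental lemmas of the calculus of variations\<close>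

lemma flat_step_0_bounds: "0 \<le> flat_step 0 x" "flat_step 0 x \<le> 1"
proof -
  show "0 \<le> flat_step 0 x" by (simp add: flat_step_def)
  have "- inverse x \<le> 0" if "0 < x" using that by simp
  then show "flat_step 0 x \<le> 1" unfolding flat_step_def by (simp del: neg_le_0_iff_le)
qed

lemma smooth_supported_plateau:
  assumes "a \<le> c" "d \<le> b" "0 < n" shows "smooth_supported a b (plateau c d n)"
proof -
  have "differentiable_upto k (plateau c d n)" for k
  proof -
    have "differentiable_upto k (\<lambda>x. flat_step 0 (real n * x + (- real n * c - 1)) * flat_step 0 (- real n * x + (real n * d - 1)))"
      by (intro differentiable_upto_mult differentiable_upto_affine differentiable_upto_flat_step)
    then show ?thesis unfolding plateau_def[abs_def] by (simp add: algebra_simps)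
  qed
  moreover have "plateau c d n x = 0" if "x \<notin> {c + 1 / n..d - 1 / n}" for x
    using that assms by (auto simp: plateau_def flat_step_def field_simps)
  moreover have "a < c + 1 / n" "d - 1 / n < b" proof -
    have "0 < 1 / real n" using assms by simp
    then show "a < c + 1 / n" "d - 1 / n < b" using assms by linarith+
  qed
  ultimately show ?thesis unfolding smooth_supported_def by blast
qed

lemma plateau_tendsto_indicator: "(\<lambda>n. plateau c d (Suc n) x) \<longlonglongrightarrow> indicator {c<..<d} x"
proof (cases "x \<in> {c<..<d}")
  case True
  have one: "(\<lambda>n. flat_step 0 (real (Suc n) * e - 1)) \<longlonglongrightarrow> 1" if "e > 0" for e
  proof -
    have lim: "filterlim (\<lambda>n. real (Suc n) * e - 1) at_top sequentially"
      using filterlim_tendsto_add_at_top[OF tendsto_const[of "-1"]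
          filterlim_at_top_mult_tendsto_pos[OF tendsto_const[of e] that filterlim_compose[OF filterlim_real_sequentially filterlim_Suc]]]
      by simp
    have "(\<lambda>n. exp (- inverse (real (Suc n) * e - 1))) \<longlonglongrightarrow> exp (- 0)"
      by (intro tendsto_intros filterlim_compose[OF tendsto_inverse_0_at_top lim] ) (rule filterlim_ident)
    then have "(\<lambda>n. exp (- inverse (real (Suc n) * e - 1))) \<longlonglongrightarrow> 1" by simp
    moreover have "\<forall>\<^sub>F n in sequentially. real (Suc n) * e - 1 > 0"
      using lim unfolding filterlim_at_top_dense by blast
    then have "\<forall>\<^sub>F n in sequentially. exp (- inverse (real (Suc n) * e - 1)) = flat_step 0 (real (Suc n) * e - 1)"
      by eventually_elim (simp add: flat_step_def)
    ultimately show ?thesis by (rule Lim_transform_eventually)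
  qed
  have "(\<lambda>n. plateau c d (Suc n) x) \<longlonglongrightarrow> 1 * 1"
    unfolding plateau_def using True by (intro tendsto_mult one) auto
  then show ?thesis using True by simp
next
  case False
  have "plateau c d (Suc n) x = 0" for n
  proof -
    have "real (Suc n) * (x - c) - 1 \<le> 0 \<or> real (Suc n) * (d - x) - 1 \<le> 0"
      using False mult_nonneg_nonpos[of "real (Suc n)" "x - c"] mult_nonneg_nonpos[of "real (Suc n)" "d - x"]
      by (cases "x \<le> c") auto
    then show ?thesis by (auto simp: plateau_def flat_step_def)
  qed
  then show ?thesis using False by simp
qed

text \<open>Sets over which \<open>f\<close> has integral 0 form a Dynkin system: complements work
  because the whole line is the increasing union of bounded intervals. It contains the
  intersection-stable family of open intervals, hence all Borel sets.\<close>

lemma AE_zero_if_interval_integrals_zero: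
  fixes f :: "real \<Rightarrow> complex"
  assumes f: "integrable lborel f" and zero: "\<And>c d. (LINT x:{c<..<d}|lborel. f x) = 0"
  shows "AE x in lborel. f x = 0"
proof (rule sigma_finite_measure.density_zero[OF sigma_finite_lborel f])
  fix A assume "A \<in> sets (lborel :: real measure)"
  then have A: "A \<in> sigma_sets UNIV (range (\<lambda>(a, b). box a b :: real set))"
    by (simp add: borel_eq_box)
  have "Int_stable (range (\<lambda>(a, b). box a b :: real set))"
  proof (rule Int_stableI)
    fix S T assume "S \<in> range (\<lambda>(a, b). box a b :: real set)" "T \<in> range (\<lambda>(a, b). box a b :: real set)"
    then obtain a b c d where "S = {a<..<b}" "T = {c<..<d}" by auto
    then have "S \<inter> T = (\<lambda>(a, b). box a b) (max a c, min b d)" by auto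
    then show "S \<inter> T \<in> range (\<lambda>(a, b). box a b :: real set)" by blast
  qed
  moreover have "range (\<lambda>(a, b). box a b :: real set) \<subseteq> Pow UNIV" by simp
  ultimately show "(LINT x:A|lborel. f x) = 0" using A
  proof (induction rule: sigma_sets_induct_disjoint)
    case (basic A)
    then show ?case using zero by auto
  next
    case empty
    show ?case by (simp add: set_lebesgue_integral_def)
  next
    case (compl A)
    have A: "A \<in> sets borel" using compl(1) by (simp add: borel_eq_box)
    have si: "set_integrable lborel B f" if "B \<in> sets borel" for B
      unfolding set_integrable_def using f that by (intro integrable_mult_indicator) auto
    have "(\<lambda>n. LINT x:{- real n<..<real n}|lborel. f x) \<longlonglongrightarrow> (LINT x:(\<Union>n. {- real n<..<real n})|lborel. f x)"
      by (rule set_integral_cont_up) (auto simp: incseq_def intro: si)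
    moreover have "(\<Union>n. {- real n<..<real n}) = UNIV"
    proof -
      have "\<exists>n. x \<in> {- real n<..<real n}" for x
      proof -
        obtain n where "\<bar>x\<bar> < real n" using reals_Archimedean2 by blast
        then show ?thesis by (intro exI[of _ n]) auto
      qed
      then show ?thesis by blast
    qed
    ultimately have "(LINT x:UNIV|lborel. f x) = 0" by (simp only: zero LIMSEQ_const_iff)
    moreover have "(LINT x:UNIV|lborel. f x) = (LINT x:(UNIV - A) \<union> A|lborel. f x)"
      by (rule arg_cong[where f = "\<lambda>S. LINT x:S|lborel. f x"]) auto
    moreover have "\<dots> = (LINT x:UNIV - A|lborel. f x) + (LINT x:A|lborel. f x)"
      using A by (intro set_integral_Un si) auto
    ultimately show ?case using compl.IH by (metis add_0_right)
  next
    case (union A)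
    have A: "A n \<in> sets borel" for n using union(2) by (auto simp: borel_eq_box)
    have si: "set_integrable lborel B f" if "B \<in> sets borel" for B
      unfolding set_integrable_def using f that by (intro integrable_mult_indicator) auto
    have "(LINT x:(\<Union>n. A n)|lborel. f x) = (\<Sum>n. LINT x:A n|lborel. f x)"
      by (rule lebesgue_integral_countable_add) (use A union(1) in \<open>auto simp: disjoint_family_on_def intro!: si\<close>)
    then show ?case using union by simp
  qed
qed

text \<open>The plateaus are admissible, bounded by 1 and converge to indicators, so by dominated
  convergence all integrals over subintervals vanish.\<close>

lemma AE_zero_if_orthogonal_to_smooth:
  fixes h :: "real \<Rightarrow> complex"
  assumes h: "set_integrable lborel {a<..<b} h"
    and orth: "\<And>w. smooth_supported a b w \<Longrightarrow> (LINT x:{a<..<b}|lborel. h x * complex_of_real (w x)) = 0"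
  shows "AE x in lborel. x \<in> {a<..<b} \<longrightarrow> h x = 0"
proof -
  define H where "H x = indicator {a<..<b} x *\<^sub>R h x" for x
  have H: "integrable lborel H" using h by (simp add: set_integrable_def H_def[abs_def])
  then have [measurable]: "H \<in> borel_measurable borel" by auto
  have pm: "(\<lambda>x. complex_of_real (plateau c d n x)) \<in> borel_measurable borel" if "a \<le> c" "d \<le> b" "0 < n" for c d n
    using smooth_supported_continuous[OF smooth_supported_plateau[OF that]]
    by (intro borel_measurable_continuous_onI continuous_intros)
  have main: "(LINT x:{c<..<d}|lborel. H x) = 0" if cd: "a \<le> c" "d \<le> b" for c d
  proof -
    have "(\<lambda>n. LINT x|lborel. complex_of_real (plateau c d (Suc n) x) * H x) \<longlonglongrightarrow>
        (LINT x|lborel. complex_of_real (indicator {c<..<d} x) * H x)"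
    proof (rule integral_dominated_convergence[where w = "\<lambda>x. norm (H x)"])
      show "integrable lborel (\<lambda>x. norm (H x))" using H by simp
      show "AE x in lborel. (\<lambda>n. complex_of_real (plateau c d (Suc n) x) * H x) \<longlonglongrightarrow> complex_of_real (indicator {c<..<d} x) * H x"
        by (intro AE_I2 tendsto_intros plateau_tendsto_indicator)
      show "AE x in lborel. norm (complex_of_real (plateau c d (Suc n) x) * H x) \<le> norm (H x)" for n
      proof (rule AE_I2)
        fix x
        have "\<bar>plateau c d (Suc n) x\<bar> \<le> 1"
          using flat_step_0_bounds by (auto simp: plateau_def abs_mult intro!: mult_le_one)
        then show "norm (complex_of_real (plateau c d (Suc n) x) * H x) \<le> norm (H x)"
          by (simp add: norm_mult mult_left_le_one_le)
      qed
    qed (use pm[OF cd] in measurable)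
    moreover have "(LINT x|lborel. complex_of_real (plateau c d (Suc n) x) * H x) = 0" for n
      using orth[OF smooth_supported_plateau[OF cd, of "Suc n"]]
      unfolding set_lebesgue_integral_def H_def by (simp add: mult.commute)
    ultimately have "0 = (LINT x|lborel. complex_of_real (indicator {c<..<d} x) * H x)"
      by (simp only: LIMSEQ_const_iff)
    then show ?thesis unfolding set_lebesgue_integral_def scaleR_conv_of_real by simp
  qed
  have "(LINT x:{c<..<d}|lborel. H x) = 0" for c d
  proof -
    have "(LINT x:{c<..<d}|lborel. H x) = (LINT x:{max a c<..<min b d}|lborel. H x)"
      unfolding set_lebesgue_integral_def H_def
      by (intro Bochner_Integration.integral_cong) (auto simp: indicator_def)
    then show ?thesis using main by simp
  qed
  then have "AE x in lborel. H x = 0" by (rule AE_zero_if_interval_integrals_zero[OF H])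
  then show ?thesis by eventually_elim (auto simp: H_def)
qed

text \<open>The vanishing total integral is exactly what makes the primitive return to 0 on the
  right of the support.\<close>

lemma smooth_supported_primitive:
  assumes v: "smooth_supported a b v" and zero: "integral {a..b} v = 0"
  shows "smooth_supported a b (\<lambda>x. integral {a..x} v)" "((\<lambda>x. integral {a..x} v) has_real_derivative v x) (at x)"
proof -
  obtain c d where cd: "a < c" "d < b" "\<And>x. x \<notin> {c..d} \<Longrightarrow> v x = 0" using v unfolding smooth_supported_def by blast
  have cont: "continuous_on S v" for S using smooth_supported_continuous[OF v] continuous_on_subset by blast
  let ?\<phi> = "\<lambda>x. integral {a..x} v"
  have left: "?\<phi> x = 0" if "x < c" for x
    by (rule integral_unique, rule has_integral_is_0) (use cd that in auto)
  have right: "?\<phi> x = 0" if "d < x" for x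
  proof (cases "x \<le> a")
    case True
    then show ?thesis using left cd by auto
  next
    case False
    let ?m = "max x b"
    have tail: "integral {y..?m} v = 0" if "d < y" for y
      by (rule integral_unique, rule has_integral_is_0) (use cd that in auto)
    have "a \<le> b" if "\<not> b < a" using that by simp
    have "integral {a..x} v + integral {x..?m} v = integral {a..?m} v"
      using False by (intro Henstock_Kurzweil_Integration.integral_combine integrable_continuous_real cont) auto
    moreover have "integral {a..?m} v = 0"
    proof (cases "a \<le> b")
      case True
      have "integral {a..b} v + integral {b..?m} v = integral {a..?m} v"
        using True by (intro Henstock_Kurzweil_Integration.integral_combine integrable_continuous_real cont) auto
      then show ?thesis using tail[of b] cd zero by simp
    next
      case False
      then have "d < a" using cd by simp
      then show ?thesis using tail[of a] by simp
    qed
    ultimately show ?thesis using tail[OF that] by simp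
  qed
  have deriv: "(?\<phi> has_real_derivative v x) (at x)" for x
  proof (cases "x < c")
    case True
    have "(?\<phi> has_real_derivative 0) (at x)"
      by (rule has_field_derivative_transform_within_open[of "\<lambda>x. 0" _ _ "{..<c}"]) (use True left in auto)
    then show ?thesis using True cd by auto
  next
    case False
    have "(?\<phi> has_vector_derivative v x) (at x within {a..x + 1})"
      using False cd by (intro integral_has_vector_derivative cont) auto
    moreover have "at x within {a..x + 1} = at x" using False cd by (simp add: at_within_Icc_at)
    ultimately show ?thesis by (simp add: has_real_derivative_iff_has_vector_derivative)
  qed
  then show "(?\<phi> has_real_derivative v x) (at x)" .
  have "differentiable_upto k ?\<phi>" for k
  proof (cases k)
    case (Suc j)
    then show ?thesis using deriv v unfolding smooth_supported_def by auto
  qed simp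
  moreover have "?\<phi> x = 0" if "x \<notin> {c..d}" for x using left[of x] right[of x] that by (cases "x < c") auto
  ultimately show "smooth_supported a b ?\<phi>" unfolding smooth_supported_def using cd by blast
qed

lemma smooth_supported_add:
  assumes "smooth_supported a b f" "smooth_supported a b g" shows "smooth_supported a b (\<lambda>x. f x + g x)"
proof -
  obtain c d where cd: "a < c" "d < b" "\<And>x. x \<notin> {c..d} \<Longrightarrow> f x = 0" using assms(1) unfolding smooth_supported_def by blast
  obtain c' d' where cd': "a < c'" "d' < b" "\<And>x. x \<notin> {c'..d'} \<Longrightarrow> g x = 0" using assms(2) unfolding smooth_supported_def by blast
  have "f x + g x = 0" if "x \<notin> {min c c'..max d d'}" for x
  proof -
    have "x \<notin> {c..d}" "x \<notin> {c'..d'}" using that by auto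
    then show ?thesis using cd(3) cd'(3) by simp
  qed
  moreover have "a < min c c'" "max d d' < b" using cd cd' by auto
  ultimately show ?thesis using assms unfolding smooth_supported_def by (blast intro: differentiable_upto_add)
qed

lemma smooth_supported_cmult:
  assumes "smooth_supported a b f" shows "smooth_supported a b (\<lambda>x. r * f x)"
proof -
  have "differentiable_upto k (\<lambda>x. r * f x)" for k
    using assms unfolding smooth_supported_def by (intro differentiable_upto_mult differentiable_upto_const) blast
  moreover obtain c d where "a < c" "d < b" "\<And>x. x \<notin> {c..d} \<Longrightarrow> f x = 0"
    using assms unfolding smooth_supported_def by blast
  ultimately show ?thesis unfolding smooth_supported_def by (metis mult_zero_right)
qed

lemma set_integrable_mult_continuous:
  fixes h g :: "real \<Rightarrow> complex"
  assumes h: "set_integrable lborel {a<..<b} h" and g: "continuous_on UNIV g"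
  shows "set_integrable lborel {a<..<b} (\<lambda>x. h x * g x)"
proof -
  have "bounded (g ` {a..b})"
    by (intro compact_imp_bounded compact_continuous_image continuous_on_subset[OF g]) auto
  then obtain B where B: "\<And>x. x \<in> {a..b} \<Longrightarrow> norm (g x) \<le> B" unfolding bounded_iff by blast
  have [measurable]: "g \<in> borel_measurable borel" by (rule borel_measurable_continuous_onI[OF g])
  have hm [measurable]: "(\<lambda>x. indicator {a<..<b} x *\<^sub>R h x) \<in> borel_measurable borel"
    using h unfolding set_integrable_def by auto
  have "integrable lborel (\<lambda>x. (indicator {a<..<b} x *\<^sub>R h x) * g x)"
  proof (rule Bochner_Integration.integrable_bound)
    show "integrable lborel (\<lambda>x. B *\<^sub>R (indicator {a<..<b} x *\<^sub>R h x))"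
      using h unfolding set_integrable_def by (intro integrable_scaleR_right)
    show "AE x in lborel. norm ((indicator {a<..<b} x *\<^sub>R h x) * g x) \<le> norm (B *\<^sub>R (indicator {a<..<b} x *\<^sub>R h x))"
    proof (rule AE_I2)
      fix x
      show "norm ((indicator {a<..<b} x *\<^sub>R h x) * g x) \<le> norm (B *\<^sub>R (indicator {a<..<b} x *\<^sub>R h x))"
      proof (cases "x \<in> {a<..<b}")
        case True
        then have "norm (g x) \<le> \<bar>B\<bar>" using B[of x] by force
        then show ?thesis using True by (simp add: norm_mult mult.commute mult_right_mono)
      qed simp
    qed
  qed measurable
  then show ?thesis unfolding set_integrable_def by simp
qed

lemma set_integrable_continuous:
  fixes g :: "real \<Rightarrow> 'a::{banach, second_countable_topology}"
  assumes g: "continuous_on UNIV g" shows "set_integrable lborel {a<..<b} g"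
proof -
  have "set_integrable lborel {a..b} g"
    unfolding set_integrable_def by (intro borel_integrable_compact continuous_on_subset[OF g]) auto
  then show ?thesis by (rule set_integrable_subset) auto
qed

text \<open>Du Bois-Reymond: a test function minus a suitable multiple of one fixed bump
  \<open>\<eta>\<close> has integral 0 and hence is the derivative of a test function. So
  \<open>h\<close> minus its mean \<open>C\<close> with respect to \<open>\<eta>\<close> is
  orthogonal to every smooth supported function.\<close>

lemma AE_const_if_orthogonal_to_derivatives:
  fixes h :: "real \<Rightarrow> complex"
  assumes ab: "a < b" and h: "set_integrable lborel {a<..<b} h"
    and orth: "\<And>w v. smooth_supported a b w \<Longrightarrow> (\<And>x. (w has_real_derivative v x) (at x)) \<Longrightarrow>
      (LINT x:{a<..<b}|lborel. h x * complex_of_real (v x)) = 0"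
  obtains C where "AE x in lborel. x \<in> {a<..<b} \<longrightarrow> h x = C"
proof -
  \<comment> \<open>With this \<open>n\<close> both factors of the plateau are positive at the
    midpoint of the interval, so the bump is not identically 0 and can be normalised.\<close>
  obtain n :: nat where n: "0 < n" "2 / real n < b - a"
  proof -
    obtain n :: nat where "2 / (b - a) < real n" using reals_Archimedean2 by blast
    moreover from this have "0 < real n" using ab by (smt (verit) divide_pos_pos)
    ultimately show ?thesis using that[of n] ab by (simp add: field_simps)
  qed
  define \<eta> where "\<eta> = plateau a b n"
  have \<eta>: "smooth_supported a b \<eta>" unfolding \<eta>_def using n by (intro smooth_supported_plateau) auto
  have cont: "continuous_on S f" if "smooth_supported a b f" for f S
    using smooth_supported_continuous[OF that] continuous_on_subset by blast
  have ccont: "continuous_on UNIV (\<lambda>x. complex_of_real (f x))" if "smooth_supported a b f" for f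
    by (intro continuous_intros cont that)
  define I where "I = integral {a..b} \<eta>"
  have "I \<noteq> 0"
  proof
    assume "I = 0"
    moreover have "0 \<le> \<eta> x" for x by (simp add: \<eta>_def plateau_def flat_step_0_bounds)
    ultimately have "\<forall>x\<in>{a..b}. \<eta> x = 0"
      using integral_eq_0_iff[of a b \<eta>] cont[OF \<eta>] ab by (simp add: I_def)
    moreover have "(a + b) / 2 \<in> {a..b}" using ab by simp
    ultimately have "\<eta> ((a + b) / 2) = 0" by blast
    moreover have "0 < real n * ((a + b) / 2 - a) - 1" "0 < real n * (b - (a + b) / 2) - 1"
      using n ab by (auto simp: field_simps)
    ultimately show False by (simp add: \<eta>_def plateau_def flat_step_def)
  qed
  define C where "C = (LINT x:{a<..<b}|lborel. h x * complex_of_real (\<eta> x)) / complex_of_real I"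
  have "AE x in lborel. x \<in> {a<..<b} \<longrightarrow> h x - C = 0"
  proof (rule AE_zero_if_orthogonal_to_smooth)
    show "set_integrable lborel {a<..<b} (\<lambda>x. h x - C)"
      by (intro set_integral_diff h set_integrable_continuous continuous_intros)
    fix w assume w: "smooth_supported a b w"
    define J where "J = integral {a..b} w"
    define v where "v x = w x + (- J / I) * \<eta> x" for x
    have v: "smooth_supported a b v" unfolding v_def by (intro smooth_supported_add smooth_supported_cmult w \<eta>)
    have "integral {a..b} v = integral {a..b} w + integral {a..b} (\<lambda>x. (- J / I) * \<eta> x)"
      unfolding v_def
      by (intro Henstock_Kurzweil_Integration.integral_add integrable_continuous_real cont w \<eta> smooth_supported_cmult)
    also have "\<dots> = J + (- J / I) * I"
      unfolding integral_mult_right J_def[symmetric] I_def[symmetric] by (rule refl)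
    finally have v0: "integral {a..b} v = 0" using \<open>I \<noteq> 0\<close> by simp
    have hw: "set_integrable lborel {a<..<b} (\<lambda>x. h x * complex_of_real (w x))"
      and h\<eta>: "set_integrable lborel {a<..<b} (\<lambda>x. h x * complex_of_real (\<eta> x))"
      by (intro set_integrable_mult_continuous h ccont w \<eta>)+
    have "h x * complex_of_real (v x) = h x * complex_of_real (w x) - (J / I) * (h x * complex_of_real (\<eta> x))" for x
      by (simp add: v_def algebra_simps)
    then have "(LINT x:{a<..<b}|lborel. h x * complex_of_real (w x) - (J / I) * (h x * complex_of_real (\<eta> x))) = 0"
      using orth[OF smooth_supported_primitive[OF v v0]] by (simp only:)
    moreover have "(LINT x:{a<..<b}|lborel. h x * complex_of_real (w x) - (J / I) * (h x * complex_of_real (\<eta> x))) =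
        (LINT x:{a<..<b}|lborel. h x * complex_of_real (w x)) - (LINT x:{a<..<b}|lborel. (J / I) * (h x * complex_of_real (\<eta> x)))"
      by (rule set_integral_diff(2)[OF hw set_integrable_mult_right[OF h\<eta>]])
    ultimately have e: "(LINT x:{a<..<b}|lborel. h x * complex_of_real (w x)) =
        (J / I) * (LINT x:{a<..<b}|lborel. h x * complex_of_real (\<eta> x))"
      by (simp only: set_integral_mult_right right_minus_eq)
    have "(LINT x:{a<..<b}|lborel. complex_of_real (w x)) = complex_of_real (LINT x:{a<..<b}|lborel. w x)"
      unfolding set_lebesgue_integral_def by (simp add: scaleR_conv_of_real flip: integral_complex_of_real of_real_mult)
    also have "(LINT x:{a<..<b}|lborel. w x) = integral {a<..<b} w"
      by (intro set_borel_integral_eq_integral set_integrable_continuous cont w)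
    also have "\<dots> = J" by (simp add: J_def integral_open_interval_real)
    finally have J: "(LINT x:{a<..<b}|lborel. complex_of_real (w x)) = J" .
    have "(LINT x:{a<..<b}|lborel. (h x - C) * complex_of_real (w x)) =
        (LINT x:{a<..<b}|lborel. h x * complex_of_real (w x) - C * complex_of_real (w x))"
      by (simp only: left_diff_distrib)
    also have "\<dots> = (LINT x:{a<..<b}|lborel. h x * complex_of_real (w x)) - (LINT x:{a<..<b}|lborel. C * complex_of_real (w x))"
      by (rule set_integral_diff(2)[OF hw set_integrable_mult_right[OF set_integrable_continuous[OF ccont[OF w]]]])
    also have "\<dots> = (LINT x:{a<..<b}|lborel. h x * complex_of_real (w x)) - C * J"
      by (simp only: set_integral_mult_right J)
    finally show "(LINT x:{a<..<b}|lborel. (h x - C) * complex_of_real (w x)) = 0"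
      by (simp add: e C_def)
  qed
  then show ?thesis using that[of C] by simp
qed

text \<open>Neither \<open>F\<close> nor \<open>G\<close> need be differentiable everywhere, so the
  formula comes from Fubini for \<open>p t * q x\<close> on the triangle \<open>t < x\<close>,
  integrated in the two possible orders.\<close>

lemma set_integral_by_parts:
  fixes p q F G :: "real \<Rightarrow> complex"
  assumes ab: "a \<le> b"
    and p: "set_integrable lborel {a<..<b} p" and q: "set_integrable lborel {a<..<b} q"
    and F: "\<And>x. x \<in> {a..b} \<Longrightarrow> F x = F a + (LINT t:{a<..<x}|lborel. p t)"
    and G: "\<And>x. x \<in> {a..b} \<Longrightarrow> G x = G a + (LINT t:{a<..<x}|lborel. q t)"
  shows "(LINT x:{a<..<b}|lborel. p x * G x) + (LINT x:{a<..<b}|lborel. F x * q x) = F b * G b - F a * G a"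
proof -
  define P where "P x = indicator {a<..<b} x *\<^sub>R p x" for x
  define Q where "Q x = indicator {a<..<b} x *\<^sub>R q x" for x
  have P: "integrable lborel P" and Q: "integrable lborel Q"
    using p q by (simp_all add: set_integrable_def P_def[abs_def] Q_def[abs_def])
  have [measurable]: "P \<in> borel_measurable borel" "Q \<in> borel_measurable borel" using P Q by auto
  have FP: "(LINT t|lborel. indicator {..<x} t *\<^sub>R P t) = F x - F a" if "x \<in> {a..b}" for x
  proof -
    have "(LINT t|lborel. indicator {..<x} t *\<^sub>R P t) = (LINT t:{a<..<x}|lborel. p t)"
      unfolding set_lebesgue_integral_def P_def using that
      by (intro Bochner_Integration.integral_cong) (auto simp: indicator_def)
    then show ?thesis using F[OF that] by simp
  qed
  have GQ: "(LINT t|lborel. indicator {..<x} t *\<^sub>R Q t) = G x - G a" if "x \<in> {a..b}" for x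
  proof -
    have "(LINT t|lborel. indicator {..<x} t *\<^sub>R Q t) = (LINT t:{a<..<x}|lborel. q t)"
      unfolding set_lebesgue_integral_def Q_def using that
      by (intro Bochner_Integration.integral_cong) (auto simp: indicator_def)
    then show ?thesis using G[OF that] by simp
  qed
  have totP: "(LINT t|lborel. P t) = F b - F a"
  proof -
    have "(LINT t|lborel. indicator {..<b} t *\<^sub>R P t) = (LINT t|lborel. P t)"
      by (intro Bochner_Integration.integral_cong) (auto simp: indicator_def P_def)
    then show ?thesis using FP[of b] ab by simp
  qed
  have totQ: "(LINT t|lborel. Q t) = G b - G a"
  proof -
    have "(LINT t|lborel. indicator {..<b} t *\<^sub>R Q t) = (LINT t|lborel. Q t)"
      by (intro Bochner_Integration.integral_cong) (auto simp: indicator_def Q_def)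
    then show ?thesis using GQ[of b] ab by simp
  qed
  \<comment> \<open>Integrating over \<open>x\<close> leaves \<open>P t * (G b - G t)\<close>,
    integrating over \<open>t\<close> leaves \<open>(F x - F a) * Q x\<close>; see \<open>k1\<close>
    and \<open>k2\<close>.\<close>
  define k where "k t x = indicator {(t, x). t < x} (t, x) *\<^sub>R (P t * Q x)" for t x :: real
  have PQ: "integrable (lborel \<Otimes>\<^sub>M lborel) (\<lambda>(t, x). P t * Q x)"
  proof (rule lborel_pair.Fubini_integrable)
    show "(\<lambda>(t, x). P t * Q x) \<in> borel_measurable (lborel \<Otimes>\<^sub>M lborel)" by measurable
    show "integrable lborel (\<lambda>t. LINT x|lborel. norm (case (t, x) of (t, x) \<Rightarrow> P t * Q x))"
      using P by (simp add: norm_mult)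
    show "AE t in lborel. integrable lborel (\<lambda>x. case (t, x) of (t, x) \<Rightarrow> P t * Q x)" using Q by simp
  qed
  have K: "integrable (lborel \<Otimes>\<^sub>M lborel) (\<lambda>(t, x). k t x)"
  proof -
    have "{(t, x). t < (x::real)} = {z \<in> space (lborel \<Otimes>\<^sub>M lborel). fst z < snd z}" by (auto simp: space_pair_measure)
    also have "\<dots> \<in> sets (lborel \<Otimes>\<^sub>M lborel)" by measurable
    finally have "{(t, x). t < (x::real)} \<in> sets (lborel \<Otimes>\<^sub>M lborel)" .
    from integrable_mult_indicator[OF this PQ] show ?thesis by (simp add: k_def case_prod_unfold)
  qed
  have k1: "(LINT x|lborel. k t x) = P t * (G b - G t)" for t
  proof (cases "t \<in> {a<..<b}")
    case True
    have "(LINT x|lborel. k t x) = (LINT x|lborel. P t * (Q x - indicator {..<t} x *\<^sub>R Q x))"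
      by (intro integral_cong_AE) (use AE_lborel_singleton[of t] in \<open>auto simp: k_def indicator_def elim!: eventually_mono\<close>)
    also have "\<dots> = P t * (LINT x|lborel. Q x - indicator {..<t} x *\<^sub>R Q x)" by simp
    also have "(LINT x|lborel. Q x - indicator {..<t} x *\<^sub>R Q x) = G b - G t"
    proof (subst Bochner_Integration.integral_diff)
      show "(LINT x|lborel. Q x) - (LINT x|lborel. indicator {..<t} x *\<^sub>R Q x) = G b - G t"
        using GQ[of t] True by (simp add: totQ)
    qed (use Q in \<open>auto intro: integrable_mult_indicator\<close>)
    finally show ?thesis .
  qed (auto simp: k_def P_def)
  have k2: "(LINT t|lborel. k t x) = (F x - F a) * Q x" for x
  proof (cases "x \<in> {a<..<b}")
    case True
    have "(LINT t|lborel. k t x) = (LINT t|lborel. (indicator {..<x} t *\<^sub>R P t) * Q x)"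
      by (intro Bochner_Integration.integral_cong) (auto simp: k_def indicator_def)
    also have "\<dots> = (LINT t|lborel. indicator {..<x} t *\<^sub>R P t) * Q x" by (rule integral_mult_left_zero)
    finally show ?thesis using FP[of x] True by simp
  qed (auto simp: k_def Q_def)
  have fub: "(LINT t|lborel. P t * (G b - G t)) = (LINT x|lborel. (F x - F a) * Q x)"
    using lborel_pair.Fubini_integral[OF K] by (simp only: k1 k2)
  have i1: "integrable lborel (\<lambda>t. P t * (G b - G t))" using lborel_pair.integrable_fst[OF K] by (simp only: k1)
  have i2: "integrable lborel (\<lambda>x. (F x - F a) * Q x)" using lborel_pair.integrable_snd[OF K] by (simp only: k2)
  have "(LINT x:{a<..<b}|lborel. p x * G x) = (LINT t|lborel. P t * G b - P t * (G b - G t))"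
    unfolding set_lebesgue_integral_def by (intro Bochner_Integration.integral_cong) (auto simp: P_def algebra_simps)
  also have "\<dots> = (F b - F a) * G b - (LINT t|lborel. P t * (G b - G t))"
    using i1 P by (subst Bochner_Integration.integral_diff) (auto simp: totP)
  finally have e1: "(LINT x:{a<..<b}|lborel. p x * G x) = (F b - F a) * G b - (LINT t|lborel. P t * (G b - G t))" .
  have "(LINT x:{a<..<b}|lborel. F x * q x) = (LINT x|lborel. F a * Q x + (F x - F a) * Q x)"
    unfolding set_lebesgue_integral_def by (intro Bochner_Integration.integral_cong) (auto simp: Q_def algebra_simps)
  also have "\<dots> = F a * (G b - G a) + (LINT x|lborel. (F x - F a) * Q x)"
    using i2 Q by (subst Bochner_Integration.integral_add) (auto simp: totQ)
  finally show ?thesis unfolding e1 fub by (simp add: algebra_simps)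
qed

lemma set_integral_derivative:
  fixes \<phi> :: "real \<Rightarrow> complex"
  assumes d: "\<And>x. (\<phi> has_vector_derivative \<phi>' x) (at x)" and c: "continuous_on UNIV \<phi>'" and "a \<le> x"
  shows "\<phi> x = \<phi> a + (LINT t:{a<..<x}|lborel. \<phi>' t)"
proof -
  have [measurable]: "\<phi>' \<in> borel_measurable borel" by (rule borel_measurable_continuous_onI[OF c])
  have "(LINT t|lborel. indicator {a..x} t *\<^sub>R \<phi>' t) = \<phi> x - \<phi> a"
  proof (rule integral_FTC_atLeastAtMost)
    show "(\<phi> has_vector_derivative \<phi>' t) (at t within {a..x})" for t
      by (rule has_vector_derivative_at_within[OF d])
    show "continuous_on {a..x} \<phi>'" by (rule continuous_on_subset[OF c]) simp
  qed fact
  moreover have "(LINT t:{a<..<x}|lborel. \<phi>' t) = (LINT t|lborel. indicator {a..x} t *\<^sub>R \<phi>' t)"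
    unfolding set_lebesgue_integral_def
  proof (rule integral_cong_AE)
    show "AE t in lborel. indicator {a<..<x} t *\<^sub>R \<phi>' t = indicator {a..x} t *\<^sub>R \<phi>' t"
      using AE_lborel_singleton[of a] AE_lborel_singleton[of x] by eventually_elim (auto simp: indicator_def)
  qed measurable
  ultimately show ?thesis by simp
qed

section \<open>Weak derivatives on an interval\<close>

lemma cip_diff_left: "cip (f - g) h = cip f h - cip g h"
  using cip_add_left[of "f - g" g h] by simp

lemma cip_diff_right: "cip f (g - h) = cip f g - cip f h"
  using cip_add_right[of f "g - h" h] by simp

lemma cip_scaleR_left: "cip (r *\<^sub>R f) g = r * cip f g"
  by (simp add: scaleR_scaleC cip_scaleC_left)

lemma cip_scaleR_right: "cip f (r *\<^sub>R g) = r * cip f g"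
  by (simp add: scaleR_scaleC cip_scaleC_right)

lemma cip_zero [simp]: "cip 0 g = 0" "cip f 0 = 0"
  using cip_diff_left[of 0 0 g] cip_diff_right[of f 0 0] by simp_all

lemma norm_scaleC_l2: "norm (c *\<^sub>C f) = cmod c * norm f" for f :: l2
proof -
  have "cip (c *\<^sub>C f) (c *\<^sub>C f) = complex_of_real ((cmod c)\<^sup>2) * cip f f"
    by (simp only: cip_scaleC_left cip_scaleC_right complex_norm_square mult_ac)
  then have "inner (c *\<^sub>C f) (c *\<^sub>C f) = (cmod c)\<^sup>2 * inner f f" by (simp add: inner_l2_def)
  then show ?thesis by (simp add: norm_eq_sqrt_inner real_sqrt_mult)
qed

lemma cip_Cauchy_Schwarz: "cmod (cip f g) \<le> norm f * norm g"
proof (cases "cip f g = 0")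
  case False
  define c where "c = cnj (cip f g) / cmod (cip f g)"
  have c: "cmod c = 1" using False by (simp add: c_def norm_divide)
  have "complex_of_real (cmod (cip f g)) = c * cip f g"
    using False by (simp add: c_def complex_norm_square[symmetric] power2_eq_square mult.commute)
  then have "cmod (cip f g) = Re (cip (c *\<^sub>C f) g)" by (metis Re_complex_of_real cip_scaleC_left)
  also have "\<dots> \<le> norm (c *\<^sub>C f) * norm g" using norm_cauchy_schwarz[of "c *\<^sub>C f" g] by (simp add: inner_l2_def)
  finally show ?thesis by (simp add: norm_scaleC_l2 c)
qed simp

lemma bounded_linear_cip_left: "bounded_linear (\<lambda>f. cip f g)"
  by (rule bounded_linear_intro[where K = "norm g"])
    (simp_all add: cip_add_left cip_scaleR_left scaleR_conv_of_real cip_Cauchy_Schwarz)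

text \<open>\<open>abs_l2\<close> is meaningful for square integrable arguments only. Here
  continuity on the whole line provides this, as it bounds the function on the bounded
  interval.\<close>

definition restrict_l2 :: "real \<Rightarrow> real \<Rightarrow> (real \<Rightarrow> complex) \<Rightarrow> l2" where
  "restrict_l2 a b \<phi> = abs_l2 (\<lambda>t. indicator {a<..<b} t * \<phi> t)"

lemma rep_restrict_l2:
  assumes "continuous_on UNIV \<phi>"
  shows "AE t in lborel. rep_l2 (restrict_l2 a b \<phi>) t = indicator {a<..<b} t * \<phi> t"
  unfolding restrict_l2_def
proof (rule rep_abs_l2)
  have [measurable]: "\<phi> \<in> borel_measurable borel" by (rule borel_measurable_continuous_onI[OF assms])
  have "set_integrable lborel {a<..<b} (\<lambda>t. (cmod (\<phi> t))\<^sup>2)"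
    by (intro set_integrable_continuous continuous_intros assms)
  moreover have "indicator {a<..<b} t *\<^sub>R (cmod (\<phi> t))\<^sup>2 = (cmod (indicator {a<..<b} t * \<phi> t))\<^sup>2" for t
    by (simp add: indicator_def)
  ultimately show "sq_integrable (\<lambda>t. indicator {a<..<b} t * \<phi> t)"
    unfolding set_integrable_def sq_integrable_def by simp
qed

lemma vanishes_off_rep: "vanishes_off a b f \<longleftrightarrow> (AE x in lborel. x \<notin> {a<..<b} \<longrightarrow> rep_l2 f x = 0)"
  using vanishes_off.abs_eq[OF l2_rel_rep[of f]] by (simp only: abs_rep_l2)

lemma represented_by_rep: "represented_by a b f F \<longleftrightarrow> (AE x in lborel. x \<in> {a<..<b} \<longrightarrow> rep_l2 f x = F x)"
  using represented_by.abs_eq[OF l2_rel_rep[of f]] by (simp only: abs_rep_l2)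

lemma l2_ip_rep: "l2_ip a b f g = (LINT x:{a<..<b}|lborel. rep_l2 f x * cnj (rep_l2 g x))"
  using l2_ip.abs_eq[OF l2_rel_rep[of f] l2_rel_rep[of g]] by (simp only: abs_rep_l2)

lemma has_weak_deriv_rep: "has_weak_deriv a b f g \<longleftrightarrow>
    (\<forall>\<phi>. test_function a b \<phi> \<longrightarrow> (LINT x:{a<..<b}|lborel. rep_l2 f x * vector_derivative \<phi> (at x)) =
       - (LINT x:{a<..<b}|lborel. rep_l2 g x * \<phi> x))"
  using has_weak_deriv.abs_eq[OF l2_rel_rep[of f] l2_rel_rep[of g]] by (simp only: abs_rep_l2)

lemma restrict_l2_in_L2:
  assumes "continuous_on UNIV \<phi>" shows "restrict_l2 a b \<phi> \<in> L2 a b"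
  unfolding L2_def mem_Collect_eq vanishes_off_rep
  using rep_restrict_l2[OF assms, of a b] by eventually_elim (auto simp: indicator_def)

lemma cip_restrict_l2:
  assumes "continuous_on UNIV \<phi>"
  shows "cip f (restrict_l2 a b \<phi>) = (LINT t:{a<..<b}|lborel. rep_l2 f t * cnj (\<phi> t))"
  unfolding set_lebesgue_integral_def
proof (rule cip_AE_cong)
  have [measurable]: "(\<lambda>t. cnj (\<phi> t)) \<in> borel_measurable borel"
    by (rule borel_measurable_continuous_onI) (intro continuous_intros assms)
  show "AE t in lborel. rep_l2 f t * cnj (rep_l2 (restrict_l2 a b \<phi>) t) =
      indicator {a<..<b} t *\<^sub>R (rep_l2 f t * cnj (\<phi> t))"
    using rep_restrict_l2[OF assms, of a b] by eventually_elim (auto simp: indicator_def)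
  show "(\<lambda>t. indicator {a<..<b} t *\<^sub>R (rep_l2 f t * cnj (\<phi> t))) \<in> borel_measurable borel" by measurable
qed

lemma l2_eqI_L2:
  assumes "f \<in> L2 a b" "g \<in> L2 a b" "AE x in lborel. x \<in> {a<..<b} \<longrightarrow> rep_l2 f x = rep_l2 g x"
  shows "f = g"
proof (rule l2_eqI)
  have "AE x in lborel. x \<notin> {a<..<b} \<longrightarrow> rep_l2 f x = 0" "AE x in lborel. x \<notin> {a<..<b} \<longrightarrow> rep_l2 g x = 0"
    using assms(1,2) by (simp_all only: L2_def mem_Collect_eq vanishes_off_rep)
  with assms(3) show "AE x in lborel. rep_l2 f x = rep_l2 g x" by eventually_elim auto
qed

lemma measurable_cnj [measurable (raw)]:
  "f \<in> borel_measurable M \<Longrightarrow> (\<lambda>x. cnj (f x)) \<in> borel_measurable M"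
  by (rule measurable_compose[where g = cnj])
    (auto intro!: borel_measurable_continuous_onI continuous_on_cnj continuous_on_id)

lemma l2_ip_eq_cip:
  assumes "f \<in> L2 a b \<or> g \<in> L2 a b" shows "l2_ip a b f g = cip f g"
  unfolding l2_ip_rep set_lebesgue_integral_def
proof (rule cip_AE_cong[symmetric])
  show "AE x in lborel. rep_l2 f x * cnj (rep_l2 g x) = indicator {a<..<b} x *\<^sub>R (rep_l2 f x * cnj (rep_l2 g x))"
    using assms
  proof
    assume "f \<in> L2 a b"
    then have "AE x in lborel. x \<notin> {a<..<b} \<longrightarrow> rep_l2 f x = 0"
      by (simp only: L2_def mem_Collect_eq vanishes_off_rep)
    then show ?thesis by eventually_elim (auto simp: indicator_def)
  next
    assume "g \<in> L2 a b"
    then have "AE x in lborel. x \<notin> {a<..<b} \<longrightarrow> rep_l2 g x = 0"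
      by (simp only: L2_def mem_Collect_eq vanishes_off_rep)
    then show ?thesis by eventually_elim (auto simp: indicator_def)
  qed
  show "(\<lambda>x. indicator {a<..<b} x *\<^sub>R (rep_l2 f x * cnj (rep_l2 g x))) \<in> borel_measurable borel" by measurable
qed

lemma L2_subspace: "subspace (L2 a b)" and L2_scaleC: "f \<in> L2 a b \<Longrightarrow> c *\<^sub>C f \<in> L2 a b"
proof -
  have zero: "0 \<in> L2 a b"
    unfolding L2_def mem_Collect_eq vanishes_off_rep using rep_zero_l2 by eventually_elim auto
  have add: "f + g \<in> L2 a b" if "f \<in> L2 a b" "g \<in> L2 a b" for f g
  proof -
    have "AE x in lborel. x \<notin> {a<..<b} \<longrightarrow> rep_l2 f x = 0" "AE x in lborel. x \<notin> {a<..<b} \<longrightarrow> rep_l2 g x = 0"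
      using that by (simp_all only: L2_def mem_Collect_eq vanishes_off_rep)
    with rep_add_l2[of f g] show ?thesis
      unfolding L2_def mem_Collect_eq vanishes_off_rep by eventually_elim auto
  qed
  have scale: "c *\<^sub>C f \<in> L2 a b" if "f \<in> L2 a b" for c f
  proof -
    have "AE x in lborel. x \<notin> {a<..<b} \<longrightarrow> rep_l2 f x = 0"
      using that by (simp_all only: L2_def mem_Collect_eq vanishes_off_rep)
    with rep_scaleC_l2[of c f] show ?thesis
      unfolding L2_def mem_Collect_eq vanishes_off_rep by eventually_elim auto
  qed
  show "subspace (L2 a b)" unfolding subspace_def using zero add scale by (auto simp: scaleR_scaleC)
  show "f \<in> L2 a b \<Longrightarrow> c *\<^sub>C f \<in> L2 a b" by (rule scale)
qed

text \<open>Vanishing off the interval becomes a family of linear equations, each with a continuous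
  left-hand side; this gives \<open>L2_closed\<close>. For the converse, countably many intervals
  cover the complement up to the two endpoints.\<close>

lemma L2_iff_norm_zero: "f \<in> L2 a b \<longleftrightarrow> (\<forall>c d. {c<..<d} \<inter> {a<..<b} = {} \<longrightarrow> cip f (restrict_l2 c d (\<lambda>_. 1)) = 0)"
proof
  assume f: "f \<in> L2 a b"
  then have ae: "AE x in lborel. x \<notin> {a<..<b} \<longrightarrow> rep_l2 f x = 0"
    by (simp only: L2_def mem_Collect_eq vanishes_off_rep)
  show "\<forall>c d. {c<..<d} \<inter> {a<..<b} = {} \<longrightarrow> cip f (restrict_l2 c d (\<lambda>_. 1)) = 0"
  proof (intro allI impI)
    fix c d assume disj: "{c<..<d} \<inter> {a<..<b} = {}"
    have "cip f (restrict_l2 c d (\<lambda>_. 1)) = (LINT t|lborel. indicator {c<..<d} t *\<^sub>R (rep_l2 f t * cnj 1))"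
      by (simp add: cip_restrict_l2 set_lebesgue_integral_def)
    also have "\<dots> = 0"
    proof (rule integral_eq_zero_AE)
      show "AE t in lborel. indicator {c<..<d} t *\<^sub>R (rep_l2 f t * cnj 1) = 0"
        using ae by eventually_elim (use disj in \<open>auto simp: indicator_def\<close>)
    qed
    finally show "cip f (restrict_l2 c d (\<lambda>_. 1)) = 0" by simp
  qed
next
  assume zero: "\<forall>c d. {c<..<d} \<inter> {a<..<b} = {} \<longrightarrow> cip f (restrict_l2 c d (\<lambda>_. 1)) = 0"
  have piece: "AE x in lborel. x \<in> {c<..<d} \<longrightarrow> rep_l2 f x = 0" if disj: "{c<..<d} \<inter> {a<..<b} = {}" for c d
  proof -
    let ?h = "\<lambda>x. indicator {c<..<d} x *\<^sub>R rep_l2 f x"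
    have "integrable lborel (\<lambda>x. rep_l2 f x * cnj (rep_l2 (restrict_l2 c d (\<lambda>_. 1)) x))" by (rule integrable_cip)
    then have "integrable lborel ?h"
    proof (rule integrable_cong_AE_imp)
      show "AE x in lborel. rep_l2 f x * cnj (rep_l2 (restrict_l2 c d (\<lambda>_. 1)) x) = ?h x"
        using rep_restrict_l2[of "\<lambda>_. 1" c d] by (auto simp: indicator_def elim!: eventually_mono)
    qed measurable
    then have "AE x in lborel. ?h x = 0"
    proof (rule AE_zero_if_interval_integrals_zero)
      fix r s
      have "(LINT x:{r<..<s}|lborel. ?h x) = (LINT t:{max c r<..<min d s}|lborel. rep_l2 f t * cnj 1)"
        unfolding set_lebesgue_integral_def by (intro Bochner_Integration.integral_cong) (auto simp: indicator_def)
      also have "\<dots> = cip f (restrict_l2 (max c r) (min d s) (\<lambda>_. 1))" by (simp add: cip_restrict_l2)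
      also have "\<dots> = 0"
      proof -
        have "{max c r<..<min d s} \<inter> {a<..<b} = {}" using disj by auto
        then show ?thesis using zero by blast
      qed
      finally show "(LINT x:{r<..<s}|lborel. ?h x) = 0" .
    qed
    then show ?thesis by eventually_elim auto
  qed
  show "f \<in> L2 a b"
  proof (cases "a < b")
    case True
    have "AE x in lborel. \<forall>n::nat. x \<in> {- real n<..<a} \<longrightarrow> rep_l2 f x = 0"
      unfolding AE_all_countable by (intro allI piece) auto
    moreover have "AE x in lborel. \<forall>n::nat. x \<in> {b<..<real n} \<longrightarrow> rep_l2 f x = 0"
      unfolding AE_all_countable by (intro allI piece) auto
    ultimately show ?thesis
      unfolding L2_def mem_Collect_eq vanishes_off_rep
      using AE_lborel_singleton[of a] AE_lborel_singleton[of b]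
    proof eventually_elim
      case (elim x)
      obtain n m :: nat where "- x < real n" "x < real m" using reals_Archimedean2 by metis
      then show ?case using elim(1)[rule_format, of n] elim(2)[rule_format, of m] elim(3,4) True
        by (cases "x < a") auto
    qed
  next
    case False
    have "AE x in lborel. \<forall>n::nat. x \<in> {- real n<..<real n} \<longrightarrow> rep_l2 f x = 0"
      unfolding AE_all_countable using False by (intro allI piece) auto
    then show ?thesis unfolding L2_def mem_Collect_eq vanishes_off_rep
    proof eventually_elim
      case (elim x)
      obtain n :: nat where "\<bar>x\<bar> < real n" using reals_Archimedean2 by metis
      then have "x \<in> {- real n<..<real n}" by (simp add: abs_less_iff)
      then show ?case using elim by blast
    qed
  qed
qed

lemma L2_closed: "closed (L2 a b)"
proof -
  have "L2 a b = (\<Inter>(c, d)\<in>{(c, d). {c<..<d} \<inter> {a<..<b} = {}}. {f. cip f (restrict_l2 c d (\<lambda>_. 1)) = 0})"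
    by (auto simp: L2_iff_norm_zero)
  also have "closed \<dots>"
    by (intro closed_INT ballI) (auto intro!: closed_Collect_eq linear_continuous_on bounded_linear_cip_left continuous_intros)
  finally show ?thesis .
qed

section \<open>Weak derivatives as a closed linear relation\<close>

lemma test_function_C1:
  assumes "test_function a b \<phi>"
  shows "continuous_on UNIV \<phi>" "continuous_on UNIV (\<lambda>x. vector_derivative \<phi> (at x))"
    "(\<phi> has_vector_derivative vector_derivative \<phi> (at x)) (at x)" "\<phi> a = 0" "\<phi> b = 0"
proof -
  have d: "((\<lambda>f x. vector_derivative f (at x)) ^^ k) \<phi> differentiable_on UNIV" for k
    using assms by (auto simp: test_function_def)
  show "continuous_on UNIV \<phi>" "continuous_on UNIV (\<lambda>x. vector_derivative \<phi> (at x))"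
    using differentiable_imp_continuous_on[OF d[of 0]] differentiable_imp_continuous_on[OF d[of 1]] by simp_all
  show "(\<phi> has_vector_derivative vector_derivative \<phi> (at x)) (at x)"
    using d[of 0] by (simp add: differentiable_on_def vector_derivative_works)
  show "\<phi> a = 0" "\<phi> b = 0" using assms by (auto simp: test_function_def)
qed

text \<open>Each test function contributes one linear equation against fixed vectors of
  \<open>l2\<close>, which makes linearity and stability under limits immediate. The conjugates undo
  the conjugation in the second argument of \<open>cip\<close>.\<close>

lemma has_weak_deriv_cip: "has_weak_deriv a b f g \<longleftrightarrow>
    (\<forall>\<phi>. test_function a b \<phi> \<longrightarrow> cip f (restrict_l2 a b (\<lambda>x. cnj (vector_derivative \<phi> (at x)))) =
       - cip g (restrict_l2 a b (\<lambda>x. cnj (\<phi> x))))"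
proof -
  have "(LINT x:{a<..<b}|lborel. rep_l2 f x * \<psi> x) = cip f (restrict_l2 a b (\<lambda>x. cnj (\<psi> x)))"
    if "continuous_on UNIV \<psi>" for f \<psi>
    by (subst cip_restrict_l2) (auto intro!: continuous_intros that)
  then show ?thesis unfolding has_weak_deriv_rep using test_function_C1 by auto
qed

text \<open>The graph of the weak derivative. Limits are taken in the graph, and working with it
  avoids the description operator in \<open>weak_deriv\<close>.\<close>

definition wd :: "real \<Rightarrow> real \<Rightarrow> l2 \<Rightarrow> l2 \<Rightarrow> bool" where
  "wd a b f g \<longleftrightarrow> f \<in> L2 a b \<and> g \<in> L2 a b \<and> has_weak_deriv a b f g"

lemma wd_add: "wd a b f g \<Longrightarrow> wd a b f' g' \<Longrightarrow> wd a b (f + f') (g + g')"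
  unfolding wd_def has_weak_deriv_cip by (auto simp: cip_add_left intro: subspace_add[OF L2_subspace])

lemma wd_scaleC: "wd a b f g \<Longrightarrow> wd a b (c *\<^sub>C f) (c *\<^sub>C g)"
  unfolding wd_def has_weak_deriv_cip by (auto simp: cip_scaleC_left intro: L2_scaleC)

lemma wd_scaleR: "wd a b f g \<Longrightarrow> wd a b (r *\<^sub>R f) (r *\<^sub>R g)"
  unfolding scaleR_scaleC by (rule wd_scaleC)

lemma wd_zero: "wd a b 0 0"
  unfolding wd_def has_weak_deriv_cip using subspace_0[OF L2_subspace] by auto

lemma wd_diff: "wd a b f g \<Longrightarrow> wd a b f' g' \<Longrightarrow> wd a b (f - f') (g - g')"
  using wd_add[of a b f g "- f'" "- g'"] wd_scaleR[of a b f' g' "-1"] by simp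

lemma wd_limit:
  assumes "\<And>n. wd a b (f n) (g n)" "f \<longlonglongrightarrow> F" "g \<longlonglongrightarrow> G" shows "wd a b F G"
  unfolding wd_def has_weak_deriv_cip
proof (intro conjI allI impI)
  show "F \<in> L2 a b" "G \<in> L2 a b"
    using closed_sequentially[OF L2_closed _ assms(2)] closed_sequentially[OF L2_closed _ assms(3)] assms(1)
    unfolding wd_def by blast+
  fix \<phi> assume \<phi>: "test_function a b \<phi>"
  let ?d = "restrict_l2 a b (\<lambda>x. cnj (vector_derivative \<phi> (at x)))" and ?e = "restrict_l2 a b (\<lambda>x. cnj (\<phi> x))"
  have "(\<lambda>n. cip (f n) ?d) \<longlonglongrightarrow> cip F ?d"
    by (rule bounded_linear.tendsto[OF bounded_linear_cip_left assms(2)])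
  moreover have "(\<lambda>n. cip (f n) ?d) \<longlonglongrightarrow> - cip G ?e"
  proof -
    have "cip (f n) ?d = - cip (g n) ?e" for n using assms(1)[of n] \<phi> unfolding wd_def has_weak_deriv_cip by blast
    then show ?thesis by (simp add: tendsto_minus bounded_linear.tendsto[OF bounded_linear_cip_left assms(3)])
  qed
  ultimately show "cip F ?d = - cip G ?e" by (rule LIMSEQ_unique)
qed

lemma L2_orthogonal_to_test_functions:
  assumes f: "f \<in> L2 a b" and orth: "\<And>\<phi>. test_function a b \<phi> \<Longrightarrow> cip f (restrict_l2 a b \<phi>) = 0"
  shows "f = 0"
proof -
  have int: "set_integrable lborel {a<..<b} (rep_l2 f)"
    using integrable_cip[of f "restrict_l2 a b (\<lambda>_. 1)"] unfolding set_integrable_def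
  proof (rule integrable_cong_AE_imp)
    show "AE x in lborel. rep_l2 f x * cnj (rep_l2 (restrict_l2 a b (\<lambda>_. 1)) x) = indicator {a<..<b} x *\<^sub>R rep_l2 f x"
      using rep_restrict_l2[of "\<lambda>_. 1" a b] by (auto simp: indicator_def elim!: eventually_mono)
  qed measurable
  have "AE x in lborel. x \<in> {a<..<b} \<longrightarrow> rep_l2 f x = 0"
  proof (rule AE_zero_if_orthogonal_to_smooth[OF int])
    fix w assume w: "smooth_supported a b w"
    have "continuous_on UNIV (\<lambda>x. complex_of_real (w x))"
      by (intro continuous_intros smooth_supported_continuous[OF w])
    from cip_restrict_l2[OF this, of f a b] orth[OF test_function_of_real[OF w]]
    show "(LINT x:{a<..<b}|lborel. rep_l2 f x * complex_of_real (w x)) = 0" by simp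
  qed
  then have "AE x in lborel. x \<in> {a<..<b} \<longrightarrow> rep_l2 f x = rep_l2 0 x"
    using rep_zero_l2 by eventually_elim simp
  then show ?thesis using l2_eqI_L2[OF f subspace_0[OF L2_subspace]] by blast
qed

lemma test_function_cnj:
  assumes "test_function a b \<phi>" shows "test_function a b (\<lambda>x. cnj (\<phi> x))"
proof -
  let ?D = "\<lambda>f x. vector_derivative f (at x) :: complex"
  have d: "(?D ^^ k) \<phi> differentiable_on UNIV" for k using assms by (auto simp: test_function_def)
  have d': "((\<lambda>x. cnj ((?D ^^ k) \<phi> x)) has_vector_derivative cnj ((?D ^^ Suc k) \<phi> x)) (at x)" for k x
    by (rule has_vector_derivative_cnj) (use d[of k] in \<open>simp add: differentiable_on_def vector_derivative_works\<close>)
  have iter: "(?D ^^ k) (\<lambda>x. cnj (\<phi> x)) = (\<lambda>x. cnj ((?D ^^ k) \<phi> x))" for k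
  proof (induction k)
    case (Suc k)
    show ?case using Suc vector_derivative_at[OF d'[of k]] by auto
  qed simp
  have "(?D ^^ k) (\<lambda>x. cnj (\<phi> x)) differentiable_on UNIV" for k
    unfolding iter differentiable_on_def using differentiableI_vector[OF d'[of k]] by simp
  then show ?thesis using assms unfolding test_function_def by (metis complex_cnj_zero)
qed

lemma wd_unique:
  assumes "wd a b f g" "wd a b f g'" shows "g = g'"
proof -
  have w: "wd a b 0 (g - g')" using wd_diff[OF assms] by simp
  have "cip (g - g') (restrict_l2 a b \<phi>) = 0" if "test_function a b \<phi>" for \<phi>
    using w test_function_cnj[OF that] unfolding wd_def has_weak_deriv_cip by force
  then show ?thesis using L2_orthogonal_to_test_functions[of "g - g'" a b] w unfolding wd_def by auto
qed

lemma H1_iff_wd: "f \<in> H1 a b \<longleftrightarrow> (\<exists>g. wd a b f g)"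
  by (auto simp: H1_def wd_def)

lemma weak_deriv_eq: "wd a b f g \<Longrightarrow> weak_deriv a b f = g"
  unfolding weak_deriv_def by (rule the_equality) (use wd_unique in \<open>auto simp: wd_def\<close>)

lemma wd_weak_deriv: "f \<in> H1 a b \<Longrightarrow> wd a b f (weak_deriv a b f)"
  using weak_deriv_eq H1_iff_wd by metis

lemma wd_H1: "wd a b f g \<Longrightarrow> f \<in> H1 a b"
  using H1_iff_wd by blast

text \<open>Writing the primitive as a product with an indicator makes Cauchy--Schwarz available: it
  is Hoelder continuous of order 1/2, with constant \<open>norm g\<close>.\<close>

definition prim :: "real \<Rightarrow> l2 \<Rightarrow> real \<Rightarrow> complex" where
  "prim a g x = cip g (restrict_l2 a x (\<lambda>_. 1))"

section \<open>Primitives and continuous representatives\<close>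

lemma set_integrable_rep: "set_integrable lborel {a<..<b} (rep_l2 f)"
  using integrable_cip[of f "restrict_l2 a b (\<lambda>_. 1)"] unfolding set_integrable_def
proof (rule integrable_cong_AE_imp)
  show "AE x in lborel. rep_l2 f x * cnj (rep_l2 (restrict_l2 a b (\<lambda>_. 1)) x) = indicator {a<..<b} x *\<^sub>R rep_l2 f x"
    using rep_restrict_l2[of "\<lambda>_. 1" a b] by (auto simp: indicator_def elim!: eventually_mono)
qed measurable

lemma prim_eq: "prim a g x = (LINT t:{a<..<x}|lborel. rep_l2 g t)"
  by (simp add: prim_def cip_restrict_l2)

lemma prim_self: "prim a g a = 0"
  by (simp add: prim_eq set_lebesgue_integral_def)

lemma norm_restrict_l2_one:
  assumes "x \<le> y" shows "norm (restrict_l2 x y (\<lambda>_. 1)) = sqrt (y - x)"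
proof -
  have "(norm (restrict_l2 x y (\<lambda>_. 1)))\<^sup>2 = (LINT t|lborel. (cmod (indicator {x<..<y} t * 1))\<^sup>2)"
    by (rule norm_l2_squared_AE[OF rep_restrict_l2]) auto
  also have "\<dots> = (LINT t|lborel. indicator {x<..<y} t)"
    by (intro Bochner_Integration.integral_cong) (auto simp: indicator_def)
  also have "\<dots> = y - x" using assms by simp
  finally show ?thesis by (metis norm_ge_zero real_sqrt_unique)
qed

lemma prim_diff_bound:
  assumes "a \<le> x" "x \<le> y" shows "cmod (prim a g y - prim a g x) \<le> sqrt (y - x) * norm g"
proof -
  have "restrict_l2 a y (\<lambda>_. 1) - restrict_l2 a x (\<lambda>_. 1) = restrict_l2 x y (\<lambda>_. 1)"
  proof (rule l2_eqI)
    have one: "continuous_on UNIV (\<lambda>_::real. 1::complex)" by simp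
    show "AE t in lborel. rep_l2 (restrict_l2 a y (\<lambda>_. 1) - restrict_l2 a x (\<lambda>_. 1)) t = rep_l2 (restrict_l2 x y (\<lambda>_. 1)) t"
      using rep_diff_l2[of "restrict_l2 a y (\<lambda>_. 1)" "restrict_l2 a x (\<lambda>_. 1)"] rep_restrict_l2[OF one, of a y]
        rep_restrict_l2[OF one, of a x] rep_restrict_l2[OF one, of x y] AE_lborel_singleton[of x]
      by eventually_elim (use assms in \<open>auto simp: indicator_def\<close>)
  qed
  then have "prim a g y - prim a g x = cip g (restrict_l2 x y (\<lambda>_. 1))"
    unfolding prim_def by (simp flip: cip_diff_right)
  then show ?thesis
    using cip_Cauchy_Schwarz[of g "restrict_l2 x y (\<lambda>_. 1)"] norm_restrict_l2_one[OF assms(2)]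
    by (simp add: mult.commute)
qed

lemma continuous_on_prim: "continuous_on {a..} (prim a g)"
proof (rule continuous_onI)
  fix x e :: real assume x: "x \<in> {a..}" and e: "0 < e"
  define d where "d = (e / (norm g + 1))\<^sup>2"
  have d: "d > 0" using e by (simp add: d_def add_nonneg_eq_0_iff)
  have "dist (prim a g y) (prim a g x) \<le> e" if y: "y \<in> {a..}" "dist y x < d" for y
  proof -
    have "dist (prim a g y) (prim a g x) \<le> sqrt \<bar>y - x\<bar> * norm g"
      using prim_diff_bound[of a x y g] prim_diff_bound[of a y x g] x y
      by (cases "x \<le> y") (auto simp: dist_norm norm_minus_commute)
    also have "\<dots> \<le> sqrt d * (norm g + 1)"
      using y by (intro mult_mono) (auto simp: dist_real_def)
    also have "\<dots> = e" using e by (simp add: d_def real_sqrt_abs abs_of_nonneg add_nonneg_eq_0_iff)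
    finally show ?thesis .
  qed
  then show "\<exists>d>0. \<forall>y\<in>{a..}. dist y x < d \<longrightarrow> dist (prim a g y) (prim a g x) \<le> e" using d by blast
qed

lemma prim_by_parts:
  assumes ab: "a \<le> b" and d: "\<And>x. (\<phi> has_vector_derivative \<phi>' x) (at x)" and c: "continuous_on UNIV \<phi>'"
  shows "(LINT x:{a<..<b}|lborel. rep_l2 g x * \<phi> x) + (LINT x:{a<..<b}|lborel. (k + prim a g x) * \<phi>' x) =
    (k + prim a g b) * \<phi> b - k * \<phi> a"
proof -
  have "(LINT x:{a<..<b}|lborel. rep_l2 g x * \<phi> x) + (LINT x:{a<..<b}|lborel. (k + prim a g x) * \<phi>' x) =
    (k + prim a g b) * \<phi> b - (k + prim a g a) * \<phi> a"
  proof (rule set_integral_by_parts[OF ab set_integrable_rep set_integrable_continuous[OF c]])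
    show "k + prim a g x = k + prim a g a + (LINT t:{a<..<x}|lborel. rep_l2 g t)" for x
      by (simp add: prim_self prim_eq)
    show "\<phi> x = \<phi> a + (LINT t:{a<..<x}|lborel. \<phi>' t)" if "x \<in> {a..b}" for x
      using that by (intro set_integral_derivative d c) simp
  qed
  then show ?thesis by (simp add: prim_self)
qed

lemma measurable_indicator_prim [measurable]: "(\<lambda>x. indicator {a<..<b} x *\<^sub>R prim a g x) \<in> borel_measurable borel"
proof -
  have "continuous_on {a<..<b} (prim a g)" by (rule continuous_on_subset[OF continuous_on_prim]) auto
  then show ?thesis by (intro borel_measurable_continuous_on_indicator) auto
qed

lemma set_integrable_prim: "set_integrable lborel {a<..<b} (prim a g)"
proof -
  have "set_integrable lborel {a..b} (prim a g)"
    unfolding set_integrable_def by (intro borel_integrable_compact continuous_on_subset[OF continuous_on_prim]) auto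
  then show ?thesis by (rule set_integrable_subset) auto
qed

text \<open>Integration by parts for the primitive of \<open>g\<close>; the boundary terms vanish
  since test functions are 0 at both ends.\<close>

lemma has_weak_derivI:
  assumes ab: "a \<le> b" and f: "AE x in lborel. x \<in> {a<..<b} \<longrightarrow> rep_l2 f x = k + prim a g x"
  shows "has_weak_deriv a b f g"
  unfolding has_weak_deriv_rep
proof (intro allI impI)
  fix \<phi> assume t: "test_function a b \<phi>"
  let ?\<phi>' = "\<lambda>x. vector_derivative \<phi> (at x)"
  note C1 = test_function_C1[OF t]
  have [measurable]: "?\<phi>' \<in> borel_measurable borel" by (rule borel_measurable_continuous_onI[OF C1(2)])
  have "(LINT x:{a<..<b}|lborel. rep_l2 f x * ?\<phi>' x) = (LINT x:{a<..<b}|lborel. (k + prim a g x) * ?\<phi>' x)"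
    unfolding set_lebesgue_integral_def
  proof (rule integral_cong_AE)
    show "AE x in lborel. indicator {a<..<b} x *\<^sub>R (rep_l2 f x * ?\<phi>' x) =
        indicator {a<..<b} x *\<^sub>R ((k + prim a g x) * ?\<phi>' x)"
      using f by eventually_elim (auto simp: indicator_def)
    have "(\<lambda>x. (indicator {a<..<b} x *\<^sub>R k + indicator {a<..<b} x *\<^sub>R prim a g x) * ?\<phi>' x) \<in> borel_measurable lborel"
      by measurable
    then show "(\<lambda>x. indicator {a<..<b} x *\<^sub>R ((k + prim a g x) * ?\<phi>' x)) \<in> borel_measurable lborel"
      by (simp add: scaleR_add_right algebra_simps)
  qed measurable
  then show "(LINT x:{a<..<b}|lborel. rep_l2 f x * ?\<phi>' x) = - (LINT x:{a<..<b}|lborel. rep_l2 g x * \<phi> x)"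
    using prim_by_parts[OF ab C1(3) C1(2), of g k] C1(4,5) by (simp add: eq_neg_iff_add_eq_0 add.commute)
qed

text \<open>By the definition of the weak derivative and \<open>prim_by_parts\<close>, the
  difference of \<open>f\<close> and the primitive of \<open>g\<close> is orthogonal to all
  derivatives of smooth supported functions, hence constant.\<close>

lemma has_weak_derivD:
  assumes ab: "a < b" and wd: "has_weak_deriv a b f g"
  obtains k where "AE x in lborel. x \<in> {a<..<b} \<longrightarrow> rep_l2 f x = k + prim a g x"
proof -
  have "set_integrable lborel {a<..<b} (\<lambda>x. rep_l2 f x - prim a g x)"
    by (intro set_integral_diff set_integrable_rep set_integrable_prim)
  moreover have "(LINT x:{a<..<b}|lborel. (rep_l2 f x - prim a g x) * complex_of_real (v x)) = 0"
    if w: "smooth_supported a b w" and v: "\<And>x. (w has_real_derivative v x) (at x)" for w v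
  proof -
    let ?\<phi> = "\<lambda>x. complex_of_real (w x)" and ?\<phi>' = "\<lambda>x. complex_of_real (v x)"
    note t = test_function_of_real[OF w]
    have d: "(?\<phi> has_vector_derivative ?\<phi>' x) (at x)" for x
      by (intro has_vector_derivative_of_real) (use v in \<open>simp add: has_real_derivative_iff_has_vector_derivative\<close>)
    then have vd: "vector_derivative ?\<phi> (at x) = ?\<phi>' x" for x by (rule vector_derivative_at)
    have c: "continuous_on UNIV ?\<phi>'" using test_function_C1(2)[OF t] by (simp only: vd)
    have e1: "(LINT x:{a<..<b}|lborel. rep_l2 f x * ?\<phi>' x) = - (LINT x:{a<..<b}|lborel. rep_l2 g x * ?\<phi> x)"
      using wd t unfolding has_weak_deriv_rep vd[symmetric] by blast
    have e2: "(LINT x:{a<..<b}|lborel. rep_l2 g x * ?\<phi> x) + (LINT x:{a<..<b}|lborel. prim a g x * ?\<phi>' x) = 0"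
      using prim_by_parts[OF less_imp_le[OF ab] d c, of g 0] test_function_C1(4,5)[OF t] by simp
    have e3: "(LINT x:{a<..<b}|lborel. (rep_l2 f x - prim a g x) * ?\<phi>' x) =
        (LINT x:{a<..<b}|lborel. rep_l2 f x * ?\<phi>' x) - (LINT x:{a<..<b}|lborel. prim a g x * ?\<phi>' x)"
      unfolding left_diff_distrib
      by (rule set_integral_diff(2)) (intro set_integrable_mult_continuous set_integrable_rep set_integrable_prim c)+
    have "(LINT x:{a<..<b}|lborel. (rep_l2 f x - prim a g x) * ?\<phi>' x) =
        - ((LINT x:{a<..<b}|lborel. rep_l2 g x * ?\<phi> x) + (LINT x:{a<..<b}|lborel. prim a g x * ?\<phi>' x))"
      unfolding e3 e1 by simp
    then show ?thesis by (simp only: e2 minus_zero)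
  qed
  ultimately obtain k where "AE x in lborel. x \<in> {a<..<b} \<longrightarrow> rep_l2 f x - prim a g x = k"
    using AE_const_if_orthogonal_to_derivatives[OF ab, of "\<lambda>x. rep_l2 f x - prim a g x"] by blast
  then have "AE x in lborel. x \<in> {a<..<b} \<longrightarrow> rep_l2 f x = k + prim a g x"
    by eventually_elim (simp add: diff_eq_eq)
  then show ?thesis using that by blast
qed

text \<open>The set of disagreement inside the interval is open and null, hence empty; continuity
  reaches the endpoints. This makes the value selected in \<open>val\<close> unique.\<close>

lemma continuous_on_AE_eq_imp_eq:
  fixes F G :: "real \<Rightarrow> complex"
  assumes ab: "a < b" and F: "continuous_on {a..b} F" and G: "continuous_on {a..b} G"
    and ae: "AE x in lborel. x \<in> {a<..<b} \<longrightarrow> F x = G x" and x: "x \<in> {a..b}"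
  shows "F x = G x"
proof -
  define U where "U = {x \<in> {a<..<b}. F x - G x \<in> - {0}}"
  have "continuous_on {a<..<b} (\<lambda>x. F x - G x)"
    by (rule continuous_on_subset[of "{a..b}"]) (auto intro: continuous_intros F G)
  then have "open U" unfolding U_def by (rule continuous_open_preimage[unfolded vimage_def Int_def mem_Collect_eq]) auto
  have "AE x in lborel. x \<notin> U" using ae by eventually_elim (auto simp: U_def)
  then have "U \<in> null_sets lborel"
    using \<open>open U\<close> by (subst AE_iff_null_sets) auto
  then have "negligible U" by (auto simp: negligible_iff_null_sets intro: null_sets_completionI)
  then have "U = {}" using open_not_negligible[OF \<open>open U\<close>] by blast
  then have eq: "y \<in> {a<..<b} \<Longrightarrow> F y = G y" for y by (auto simp: U_def)
  have cl: "closure {a<..<b} = {a..b}" using ab by simp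
  have "F x - G x = 0"
  proof (rule continuous_constant_on_closure[of "{a<..<b}" "\<lambda>x. F x - G x"])
    show "continuous_on (closure {a<..<b}) (\<lambda>x. F x - G x)" unfolding cl by (intro continuous_intros F G)
  qed (use eq x cl in auto)
  then show ?thesis by simp
qed

lemma val_eqI:
  assumes ab: "a < b" and F: "continuous_on {a..b} F"
    and ae: "AE x in lborel. x \<in> {a<..<b} \<longrightarrow> rep_l2 f x = F x" and x: "x \<in> {a..b}"
  shows "val a b f x = F x"
  unfolding val_def represented_by_rep
proof (rule the_equality)
  show "\<exists>F'. continuous_on {a..b} F' \<and> (AE x in lborel. x \<in> {a<..<b} \<longrightarrow> rep_l2 f x = F' x) \<and> F' x = F x"
    using F ae by blast
  fix z assume "\<exists>F'. continuous_on {a..b} F' \<and> (AE x in lborel. x \<in> {a<..<b} \<longrightarrow> rep_l2 f x = F' x) \<and> F' x = z"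
  then obtain F' where F': "continuous_on {a..b} F'" "AE x in lborel. x \<in> {a<..<b} \<longrightarrow> rep_l2 f x = F' x" "F' x = z" by blast
  have "AE x in lborel. x \<in> {a<..<b} \<longrightarrow> F' x = F x" using F'(2) ae by eventually_elim auto
  then show "z = F x" using continuous_on_AE_eq_imp_eq[OF ab F'(1) F _ x] F'(3) by simp
qed

lemma wd_val:
  assumes ab: "a < b" and wd: "wd a b f g"
  shows "\<And>x. x \<in> {a..b} \<Longrightarrow> val a b f x = val a b f a + prim a g x"
    and "AE x in lborel. x \<in> {a<..<b} \<longrightarrow> rep_l2 f x = val a b f x"
    and "continuous_on {a..b} (val a b f)"
proof -
  obtain k where k: "AE x in lborel. x \<in> {a<..<b} \<longrightarrow> rep_l2 f x = k + prim a g x"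
    using has_weak_derivD[OF ab] wd unfolding wd_def by blast
  have c: "continuous_on {a..b} (\<lambda>x. k + prim a g x)"
    by (intro continuous_intros continuous_on_subset[OF continuous_on_prim]) auto
  have v: "val a b f x = k + prim a g x" if "x \<in> {a..b}" for x using val_eqI[OF ab c k that] .
  have "val a b f a = k" using v[of a] ab by (simp add: prim_self)
  then show "\<And>x. x \<in> {a..b} \<Longrightarrow> val a b f x = val a b f a + prim a g x" using v by simp
  show "AE x in lborel. x \<in> {a<..<b} \<longrightarrow> rep_l2 f x = val a b f x" using k by eventually_elim (auto simp: v)
  show "continuous_on {a..b} (val a b f)" using c by (rule continuous_on_cong[THEN iffD1, rotated 2]) (auto simp: v)
qed

section \<open>Point evaluation: linearity, trace estimate, Poincare inequality\<close>

lemma val_add: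
  assumes "a < b" "wd a b f g" "wd a b f' g'" "x \<in> {a..b}"
  shows "val a b (f + f') x = val a b f x + val a b f' x"
proof (rule val_eqI[OF assms(1) _ _ assms(4)])
  show "continuous_on {a..b} (\<lambda>x. val a b f x + val a b f' x)"
    by (intro continuous_on_add wd_val(3)[OF assms(1,2)] wd_val(3)[OF assms(1,3)])
  show "AE x in lborel. x \<in> {a<..<b} \<longrightarrow> rep_l2 (f + f') x = val a b f x + val a b f' x"
    using rep_add_l2[of f f'] wd_val(2)[OF assms(1,2)] wd_val(2)[OF assms(1,3)] by eventually_elim simp
qed

lemma val_scaleC:
  assumes "a < b" "wd a b f g" "x \<in> {a..b}"
  shows "val a b (c *\<^sub>C f) x = c * val a b f x"
proof (rule val_eqI[OF assms(1) _ _ assms(3)])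
  show "continuous_on {a..b} (\<lambda>x. c * val a b f x)"
    by (intro continuous_on_mult_left wd_val(3)[OF assms(1,2)])
  show "AE x in lborel. x \<in> {a<..<b} \<longrightarrow> rep_l2 (c *\<^sub>C f) x = c * val a b f x"
    using rep_scaleC_l2[of c f] wd_val(2)[OF assms(1,2)] by eventually_elim simp
qed

lemma val_diff:
  assumes "a < b" "wd a b f g" "wd a b f' g'" "x \<in> {a..b}"
  shows "val a b (f - f') x = val a b f x - val a b f' x"
  using val_add[OF assms(1) wd_diff[OF assms(2,3)] assms(3,4)] by simp

lemma val_zero: "a < b \<Longrightarrow> x \<in> {a..b} \<Longrightarrow> val a b 0 x = 0"
  using val_diff[OF _ wd_zero wd_zero, of a b x] by simp

lemma val_osc:
  assumes "a < b" "wd a b f g" "x \<in> {a..b}" "y \<in> {a..b}"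
  shows "cmod (val a b f x - val a b f y) \<le> sqrt (b - a) * norm g"
proof -
  have *: "cmod (val a b f y - val a b f x) \<le> sqrt (b - a) * norm g" if "x \<in> {a..b}" "y \<in> {a..b}" "x \<le> y" for x y
  proof -
    have "cmod (val a b f y - val a b f x) = cmod (prim a g y - prim a g x)"
      unfolding wd_val(1)[OF assms(1,2) that(1)] wd_val(1)[OF assms(1,2) that(2)] by simp
    also have "\<dots> \<le> sqrt (y - x) * norm g" using that by (intro prim_diff_bound) auto
    also have "\<dots> \<le> sqrt (b - a) * norm g" using that by (intro mult_right_mono) auto
    finally show ?thesis .
  qed
  show ?thesis using *[of x y] *[of y x] assms by (cases "x \<le> y") (auto simp: norm_minus_commute)
qed

lemma norm_wd_squared:
  assumes "a < b" "wd a b f g"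
  shows "(norm f)\<^sup>2 = (LINT x:{a<..<b}|lborel. (cmod (val a b f x))\<^sup>2)"
    and "set_integrable lborel {a<..<b} (\<lambda>x. (cmod (val a b f x))\<^sup>2)"
proof -
  have v: "AE x in lborel. x \<notin> {a<..<b} \<longrightarrow> rep_l2 f x = 0"
    using assms(2) by (simp add: wd_def L2_def vanishes_off_rep)
  have c: "continuous_on {a..b} (\<lambda>x. (cmod (val a b f x))\<^sup>2)" by (intro continuous_intros wd_val(3)[OF assms])
  have "set_integrable lborel {a..b} (\<lambda>x. (cmod (val a b f x))\<^sup>2)"
    unfolding set_integrable_def by (intro borel_integrable_compact c) auto
  then show si: "set_integrable lborel {a<..<b} (\<lambda>x. (cmod (val a b f x))\<^sup>2)" by (rule set_integrable_subset) auto
  show "(norm f)\<^sup>2 = (LINT x:{a<..<b}|lborel. (cmod (val a b f x))\<^sup>2)"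
    unfolding norm_l2_squared set_lebesgue_integral_def
  proof (rule integral_cong_AE)
    show "AE x in lborel. (cmod (rep_l2 f x))\<^sup>2 = indicator {a<..<b} x *\<^sub>R (cmod (val a b f x))\<^sup>2"
      using v wd_val(2)[OF assms] by eventually_elim (auto simp: indicator_def)
    show "(\<lambda>x. indicator {a<..<b} x *\<^sub>R (cmod (val a b f x))\<^sup>2) \<in> borel_measurable lborel"
      using si unfolding set_integrable_def by auto
  qed measurable
qed

text \<open>The oscillation bound compares the value at \<open>x\<close> with the value at any
  \<open>y\<close>; the squared inequality is then averaged over \<open>y\<close>. It shows that
  point evaluation is continuous in the graph norm, so that boundary conditions are closed.\<close>

lemma trace_bound:
  assumes ab: "a < b" and wd: "wd a b f g" and x: "x \<in> {a..b}"
  shows "(b - a) * (cmod (val a b f x))\<^sup>2 \<le> 2 * (norm f)\<^sup>2 + 2 * ((b - a) * norm g)\<^sup>2"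
proof -
  let ?K = "2 * (b - a) * (norm g)\<^sup>2"
  have le: "(cmod (val a b f x))\<^sup>2 \<le> 2 * (cmod (val a b f y))\<^sup>2 + ?K" if "y \<in> {a..b}" for y
  proof -
    let ?s = "sqrt (b - a) * norm g"
    have "cmod (val a b f x) \<le> cmod (val a b f y) + ?s"
      using val_osc[OF ab wd x that] norm_triangle_ineq2[of "val a b f x" "val a b f y"] by linarith
    then have "(cmod (val a b f x))\<^sup>2 \<le> (cmod (val a b f y) + ?s)\<^sup>2" by (intro power_mono) auto
    also have "\<dots> \<le> 2 * (cmod (val a b f y))\<^sup>2 + 2 * ?s\<^sup>2"
      using sum_squares_bound[of "cmod (val a b f y)" ?s] by (simp add: power2_sum)
    also have "?s\<^sup>2 = (b - a) * (norm g)\<^sup>2" using ab by (simp add: power_mult_distrib)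
    finally show ?thesis by (simp only: mult.assoc)
  qed
  have ci: "set_integrable lborel {a<..<b} (\<lambda>_. r)" for r :: real
    by (intro set_integrable_continuous continuous_intros)
  have cv: "(LINT y:{a<..<b}|lborel. r) = (b - a) * r" for r :: real
    using ab by (simp add: set_lebesgue_integral_def)
  have "(LINT y:{a<..<b}|lborel. (cmod (val a b f x))\<^sup>2) \<le> (LINT y:{a<..<b}|lborel. 2 * (cmod (val a b f y))\<^sup>2 + ?K)"
    by (rule set_integral_mono) (use le in \<open>auto intro!: ci set_integral_add norm_wd_squared(2)[OF ab wd] set_integrable_mult_right\<close>)
  also have "\<dots> = 2 * (norm f)\<^sup>2 + (b - a) * ?K"
    by (subst set_integral_add(2)[OF set_integrable_mult_right[OF norm_wd_squared(2)[OF ab wd]] ci])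
      (simp only: set_integral_mult_right cv norm_wd_squared(1)[OF ab wd])
  finally show ?thesis unfolding cv by (simp add: power_mult_distrib power2_eq_square mult_ac)
qed

text \<open>By \<open>val_osc\<close> a single zero anywhere in the closed interval bounds
  \<open>f\<close> pointwise. In V_1 each part of the beam has one at its outer end.\<close>

lemma poincare:
  assumes ab: "a < b" and wd: "wd a b f g" and x: "x \<in> {a..b}" "val a b f x = 0"
  shows "norm f \<le> (b - a) * norm g"
proof -
  have ci: "set_integrable lborel {a<..<b} (\<lambda>_. r)" for r :: real
    by (intro set_integrable_continuous continuous_intros)
  have "(norm f)\<^sup>2 \<le> (LINT y:{a<..<b}|lborel. (sqrt (b - a) * norm g)\<^sup>2)"
    unfolding norm_wd_squared(1)[OF ab wd]
  proof (rule set_integral_mono[OF norm_wd_squared(2)[OF ab wd] ci])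
    fix y assume "y \<in> {a<..<b}"
    then have "cmod (val a b f y) \<le> sqrt (b - a) * norm g" using val_osc[OF ab wd, of y x] x by simp
    then show "(cmod (val a b f y))\<^sup>2 \<le> (sqrt (b - a) * norm g)\<^sup>2" by (rule power_mono) simp
  qed
  also have "\<dots> = ((b - a) * norm g)\<^sup>2"
    using ab by (simp add: set_lebesgue_integral_def power_mult_distrib power2_eq_square)
  finally show ?thesis by (rule power2_le_imp_le) (use ab in simp)
qed

lemma val_tendsto:
  assumes ab: "a < b" and wd: "\<And>n. wd a b (f n) (g n)" and lim: "f \<longlonglongrightarrow> F" "g \<longlonglongrightarrow> G" and x: "x \<in> {a..b}"
  shows "(\<lambda>n. val a b (f n) x) \<longlonglongrightarrow> val a b F x"
proof -
  have W: "wd a b F G" by (rule wd_limit[OF wd lim])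
  let ?e = "\<lambda>n. (2 * (norm (f n - F))\<^sup>2 + 2 * ((b - a) * norm (g n - G))\<^sup>2) / (b - a)"
  have "(\<lambda>n. (cmod (val a b (f n) x - val a b F x))\<^sup>2) \<longlonglongrightarrow> 0"
  proof (rule Lim_null_comparison)
    have "(cmod (val a b (f n) x - val a b F x))\<^sup>2 \<le> ?e n" for n
      using trace_bound[OF ab wd_diff[OF wd W] x] ab
      by (simp add: val_diff[OF ab wd W x] pos_le_divide_eq mult.commute)
    then show "\<forall>\<^sub>F n in sequentially. norm ((cmod (val a b (f n) x - val a b F x))\<^sup>2) \<le> ?e n" by simp
    have "?e \<longlonglongrightarrow> (2 * (norm (F - F))\<^sup>2 + 2 * ((b - a) * norm (G - G))\<^sup>2) / (b - a)"
      using ab by (intro tendsto_intros lim) auto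
    then show "?e \<longlonglongrightarrow> 0" by simp
  qed
  then have "(\<lambda>n. cmod (val a b (f n) x - val a b F x)) \<longlonglongrightarrow> 0"
    using tendsto_real_sqrt[of "\<lambda>n. (cmod (val a b (f n) x - val a b F x))\<^sup>2" 0] by simp
  then show ?thesis by (simp add: tendsto_norm_zero_iff LIM_zero_iff)
qed

lemma cnj_scaleR: "cnj (r *\<^sub>R z) = r *\<^sub>R cnj z"
  by (simp add: scaleR_conv_of_real)

lemma wd_by_parts:
  assumes ab: "a < b" and f: "wd a b f g" and h: "wd a b h k"
  shows "cip g h + cip f k = val a b f b * cnj (val a b h b) - val a b f a * cnj (val a b h a)"
proof -
  have "(LINT x:{a<..<b}|lborel. rep_l2 g x * cnj (val a b h x)) + (LINT x:{a<..<b}|lborel. val a b f x * cnj (rep_l2 k x)) =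
      val a b f b * cnj (val a b h b) - val a b f a * cnj (val a b h a)"
  proof (rule set_integral_by_parts[OF less_imp_le[OF ab] set_integrable_rep])
    show "set_integrable lborel {a<..<b} (\<lambda>x. cnj (rep_l2 k x))"
      using Bochner_Integration.integrable_cnj[OF set_integrable_rep[of a b k, unfolded set_integrable_def]]
      unfolding set_integrable_def by (simp only: cnj_scaleR)
    show "val a b f x = val a b f a + (LINT t:{a<..<x}|lborel. rep_l2 g t)" if "x \<in> {a..b}" for x
      using wd_val(1)[OF ab f that] by (simp add: prim_eq)
    show "cnj (val a b h x) = cnj (val a b h a) + (LINT t:{a<..<x}|lborel. cnj (rep_l2 k t))" if "x \<in> {a..b}" for x
    proof -
      have "(LINT t:{a<..<x}|lborel. cnj (rep_l2 k t)) = cnj (LINT t:{a<..<x}|lborel. rep_l2 k t)"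
        unfolding set_lebesgue_integral_def cnj_scaleR[symmetric] by (rule Bochner_Integration.integral_cnj)
      then show ?thesis using wd_val(1)[OF ab h that] by (simp add: prim_eq)
    qed
  qed
  moreover have "cip g h = (LINT x:{a<..<b}|lborel. rep_l2 g x * cnj (val a b h x))"
    and "cip f k = (LINT x:{a<..<b}|lborel. val a b f x * cnj (rep_l2 k x))"
  proof -
    have m: "(\<lambda>x. indicator {a<..<b} x *\<^sub>R val a b f x) \<in> borel_measurable borel" if "wd a b f g" for f g
      by (rule borel_measurable_continuous_on_indicator) (auto intro: continuous_on_subset[OF wd_val(3)[OF ab that]])
    note [measurable] = m[OF f] m[OF h]
    have "(\<lambda>x. rep_l2 g x * cnj (indicator {a<..<b} x *\<^sub>R val a b h x)) \<in> borel_measurable borel"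
      "(\<lambda>x. (indicator {a<..<b} x *\<^sub>R val a b f x) * cnj (rep_l2 k x)) \<in> borel_measurable borel" by measurable
    then have mm: "(\<lambda>x. indicator {a<..<b} x *\<^sub>R (rep_l2 g x * cnj (val a b h x))) \<in> borel_measurable borel"
      "(\<lambda>x. indicator {a<..<b} x *\<^sub>R (val a b f x * cnj (rep_l2 k x))) \<in> borel_measurable borel" by simp_all
    have g0: "AE x in lborel. x \<notin> {a<..<b} \<longrightarrow> rep_l2 g x = 0" and k0: "AE x in lborel. x \<notin> {a<..<b} \<longrightarrow> rep_l2 k x = 0"
      using f h by (simp_all add: wd_def L2_def vanishes_off_rep)
    show "cip g h = (LINT x:{a<..<b}|lborel. rep_l2 g x * cnj (val a b h x))"
      unfolding set_lebesgue_integral_def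
    proof (rule cip_AE_cong[OF _ mm(1)])
      show "AE x in lborel. rep_l2 g x * cnj (rep_l2 h x) = indicator {a<..<b} x *\<^sub>R (rep_l2 g x * cnj (val a b h x))"
        using g0 wd_val(2)[OF ab h] by eventually_elim (auto simp: indicator_def)
    qed
    show "cip f k = (LINT x:{a<..<b}|lborel. val a b f x * cnj (rep_l2 k x))"
      unfolding set_lebesgue_integral_def
    proof (rule cip_AE_cong[OF _ mm(2)])
      show "AE x in lborel. rep_l2 f x * cnj (rep_l2 k x) = indicator {a<..<b} x *\<^sub>R (val a b f x * cnj (rep_l2 k x))"
        using k0 wd_val(2)[OF ab f] by eventually_elim (auto simp: indicator_def)
    qed
  qed
  ultimately show ?thesis by simp
qed

lemma wd_restrict_C1:
  assumes ab: "a < b" and d: "\<And>x. (\<phi> has_vector_derivative \<phi>' x) (at x)" and c: "continuous_on UNIV \<phi>'"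
  shows "wd a b (restrict_l2 a b \<phi>) (restrict_l2 a b \<phi>')"
    and "x \<in> {a..b} \<Longrightarrow> val a b (restrict_l2 a b \<phi>) x = \<phi> x"
proof -
  have c0: "continuous_on UNIV \<phi>"
    using d by (auto intro!: continuous_at_imp_continuous_on has_vector_derivative_continuous)
  have prim: "prim a (restrict_l2 a b \<phi>') x = \<phi> x - \<phi> a" if "x \<in> {a..b}" for x
  proof -
    have [measurable]: "\<phi>' \<in> borel_measurable borel" by (rule borel_measurable_continuous_onI[OF c])
    have "prim a (restrict_l2 a b \<phi>') x = (LINT t:{a<..<x}|lborel. \<phi>' t)"
      unfolding prim_eq set_lebesgue_integral_def
    proof (rule integral_cong_AE)
      show "AE t in lborel. indicator {a<..<x} t *\<^sub>R rep_l2 (restrict_l2 a b \<phi>') t = indicator {a<..<x} t *\<^sub>R \<phi>' t"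
        using rep_restrict_l2[OF c, of a b] by eventually_elim (use that in \<open>auto simp: indicator_def\<close>)
    qed measurable
    then show ?thesis using set_integral_derivative[OF d c, of a x] that by simp
  qed
  have "AE x in lborel. x \<in> {a<..<b} \<longrightarrow> rep_l2 (restrict_l2 a b \<phi>) x = \<phi> a + prim a (restrict_l2 a b \<phi>') x"
    using rep_restrict_l2[OF c0, of a b] by eventually_elim (simp add: prim)
  then have "has_weak_deriv a b (restrict_l2 a b \<phi>) (restrict_l2 a b \<phi>')"
    using ab by (intro has_weak_derivI) auto
  then show "wd a b (restrict_l2 a b \<phi>) (restrict_l2 a b \<phi>')"
    unfolding wd_def using restrict_l2_in_L2 c c0 by blast
  show "val a b (restrict_l2 a b \<phi>) x = \<phi> x" if "x \<in> {a..b}"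
  proof (rule val_eqI[OF ab _ _ that])
    show "continuous_on {a..b} \<phi>" by (rule continuous_on_subset[OF c0]) simp
    show "AE x in lborel. x \<in> {a<..<b} \<longrightarrow> rep_l2 (restrict_l2 a b \<phi>) x = \<phi> x"
      using rep_restrict_l2[OF c0, of a b] by eventually_elim simp
  qed
qed

section \<open>Dissipative operators on a normed carrier set\<close>

text \<open>\<open>has_norm_integral\<close> asks for one mesh size, the library integral only for a
  gauge. Uniform continuity on the compact interval supplies the constant mesh.\<close>

lemma riemann_sums_uniform:
  fixes f :: "real \<Rightarrow> 'a::banach"
  assumes f: "continuous_on {0..t} f" and t: "0 \<le> t" and e: "\<epsilon> > 0"
  obtains \<delta> where "\<delta> > 0" "\<And>P. P tagged_division_of {0..t} \<Longrightarrow> (\<lambda>x. ball x \<delta>) fine P \<Longrightarrow>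
      norm ((\<Sum>(x, K)\<in>P. measure lborel K *\<^sub>R f x) - integral {0..t} f) < \<epsilon>"
proof -
  \<comment> \<open>Dividing by \<open>t + 1\<close> keeps \<open>\<eta> * t\<close> below
    \<open>\<epsilon>\<close> also when \<open>t = 0\<close>.\<close>
  define \<eta> where "\<eta> = \<epsilon> / (t + 1)"
  have eta: "\<eta> > 0" "\<eta> * t < \<epsilon>" using e t by (auto simp: \<eta>_def field_simps)
  have "uniformly_continuous_on {0..t} f" by (rule compact_uniformly_continuous[OF f]) simp
  then obtain \<delta> where d: "\<delta> > 0" "\<And>x y. x \<in> {0..t} \<Longrightarrow> y \<in> {0..t} \<Longrightarrow> dist y x < \<delta> \<Longrightarrow> dist (f y) (f x) < \<eta>"
    using eta(1) unfolding uniformly_continuous_on_def by metis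
  have "norm ((\<Sum>(x, K)\<in>P. measure lborel K *\<^sub>R f x) - integral {0..t} f) < \<epsilon>"
    if P: "P tagged_division_of {0..t}" and fine: "(\<lambda>x. ball x \<delta>) fine P" for P
  proof -
    have P': "P tagged_division_of cbox 0 t" using P by simp
    have int: "f integrable_on cbox 0 t" using f by (simp add: integrable_continuous_real)
    have "integral {0..t} f = (\<Sum>(x, K)\<in>P. integral K f)"
      using integral_combine_tagged_division_topdown[OF int P'] by simp
    then have "(\<Sum>(x, K)\<in>P. measure lborel K *\<^sub>R f x) - integral {0..t} f =
        (\<Sum>(x, K)\<in>P. measure lborel K *\<^sub>R f x - integral K f)"
      by (simp add: sum_subtractf split_def)
    also have "norm \<dots> \<le> (\<Sum>(x, K)\<in>P. \<eta> * measure lborel K)"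
    proof (rule sum_norm_le, clarify)
      fix x K assume xK: "(x, K) \<in> P"
      obtain u v where K: "K = cbox u v" using tagged_division_ofD(4)[OF P xK] by blast
      have Ksub: "K \<subseteq> {0..t}" "x \<in> K" using tagged_division_ofD(2,3)[OF P xK] by auto
      have ball: "K \<subseteq> ball x \<delta>" using fine xK unfolding fine_def by blast
      have intK: "f integrable_on K"
        unfolding K by (rule integrable_continuous) (use continuous_on_subset[OF f] Ksub K in blast)
      have uv: "u \<le> v" using Ksub(2) unfolding K by simp
      have "((\<lambda>s. f x - f s) has_integral (measure lborel K *\<^sub>R f x - integral K f)) (cbox u v)"
        using has_integral_diff[OF has_integral_const[of "f x" u v] integrable_integral[OF intK[unfolded K]]]
        unfolding K .
      then have "norm (measure lborel K *\<^sub>R f x - integral K f) \<le> \<eta> * measure lborel (cbox u v)"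
      proof (rule has_integral_bound[rotated])
        show "0 \<le> \<eta>" using eta by simp
        show "norm (f x - f s) \<le> \<eta>" if "s \<in> cbox u v" for s
          using d(2)[of s x] that Ksub ball unfolding K by (auto simp: dist_norm subset_iff less_imp_le)
      qed
      then show "norm (measure lborel K *\<^sub>R f x - integral K f) \<le> \<eta> * measure lborel K" unfolding K .
    qed
    also have "\<dots> = \<eta> * (\<Sum>(x, K)\<in>P. measure lborel K)" by (simp add: sum_distrib_left split_def)
    also have "\<dots> = \<eta> * t" using additive_content_tagged_division[OF P'] t by simp
    finally show ?thesis using eta(2) by simp
  qed
  then show ?thesis using that d(1) by blast
qed

definition complex_subspace :: "'a::complex_vector set \<Rightarrow> bool" where
  "complex_subspace S \<longleftrightarrow> 0 \<in> S \<and> (\<forall>x\<in>S. \<forall>y\<in>S. x + y \<in> S) \<and> (\<forall>c. \<forall>x\<in>S. c *\<^sub>C x \<in> S)"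

lemma complex_subspaceD:
  assumes "complex_subspace S"
  shows "0 \<in> S" "x \<in> S \<Longrightarrow> y \<in> S \<Longrightarrow> x + y \<in> S" "x \<in> S \<Longrightarrow> c *\<^sub>C x \<in> S" "x \<in> S \<Longrightarrow> r *\<^sub>R x \<in> S"
    "x \<in> S \<Longrightarrow> y \<in> S \<Longrightarrow> x - y \<in> S"
proof -
  show 1: "0 \<in> S" "x \<in> S \<Longrightarrow> y \<in> S \<Longrightarrow> x + y \<in> S" "x \<in> S \<Longrightarrow> c *\<^sub>C x \<in> S" for x y c
    using assms by (auto simp: complex_subspace_def)
  show 2: "x \<in> S \<Longrightarrow> r *\<^sub>R x \<in> S" for r x using 1(3) by (simp add: scaleR_scaleC)
  show "x \<in> S \<Longrightarrow> y \<in> S \<Longrightarrow> x - y \<in> S" using 1(2)[of x "- y"] 2[of y "-1"] by simp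
qed

text \<open>\<open>J\<close> embeds the carrier isometrically as a closed real subspace of a complete inner product type.
  Below, \<open>A\<close> is extended by \<open>0\<close> on the orthogonal complement of that subspace.\<close>

locale dissipative_transfer =
  fixes H :: "'s::complex_vector set" and n :: "'s \<Rightarrow> real" and J :: "'s \<Rightarrow> 'e::{real_inner,banach}"
    and D :: "'s set" and A :: "'s \<Rightarrow> 's"
  assumes H: "complex_subspace H" and D: "complex_subspace D" "D \<subseteq> H"
    and J_add: "\<And>x y. x \<in> H \<Longrightarrow> y \<in> H \<Longrightarrow> J (x + y) = J x + J y"
    and J_scale: "\<And>r x. x \<in> H \<Longrightarrow> J (r *\<^sub>R x) = r *\<^sub>R J x"
    and J_scaleC: "\<And>c x. x \<in> H \<Longrightarrow> norm (J (c *\<^sub>C x)) = cmod c * norm (J x)"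
    and J_zero: "\<And>x. x \<in> H \<Longrightarrow> J x = 0 \<Longrightarrow> x = 0"
    and n_J: "\<And>x. x \<in> H \<Longrightarrow> n x = norm (J x)"
    and closed_J: "closed (J ` H)"
    and A_H: "\<And>x. x \<in> D \<Longrightarrow> A x \<in> H"
    and A_add: "\<And>x y. x \<in> D \<Longrightarrow> y \<in> D \<Longrightarrow> A (x + y) = A x + A y"
    and A_scaleC: "\<And>c x. x \<in> D \<Longrightarrow> A (c *\<^sub>C x) = c *\<^sub>C A x"
    and dissipative: "\<And>x. x \<in> D \<Longrightarrow> inner (J (A x)) (J x) \<le> 0"
    and range: "\<And>l f. l > 0 \<Longrightarrow> f \<in> H \<Longrightarrow> \<exists>x\<in>D. x - l *\<^sub>R A x = f"
begin

lemmas H_ops = complex_subspaceD[OF H]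
lemmas D_ops = complex_subspaceD[OF D(1)]

lemma D_H: "x \<in> D \<Longrightarrow> x \<in> H" using D(2) by blast

lemma A_scale: "x \<in> D \<Longrightarrow> A (r *\<^sub>R x) = r *\<^sub>R A x"
  by (simp add: scaleR_scaleC A_scaleC)

lemma J_diff: "x \<in> H \<Longrightarrow> y \<in> H \<Longrightarrow> J (x - y) = J x - J y"
  using J_add[of x "(-1) *\<^sub>R y"] J_scale[of y "-1"] H_ops(4)[of y "-1"] by simp

lemma A_diff: "x \<in> D \<Longrightarrow> y \<in> D \<Longrightarrow> A (x - y) = A x - A y"
  using A_add[of x "(-1) *\<^sub>R y"] A_scale[of y "-1"] D_ops(4)[of y "-1"] by simp

lemma J_0: "J 0 = 0" using J_scale[OF H_ops(1), of 0] by simp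

lemma inj_J: "inj_on J H"
proof (rule inj_onI)
  fix x y assume xy: "x \<in> H" "y \<in> H" "J x = J y"
  have "x - y = 0" by (rule J_zero) (use xy H_ops J_diff in auto)
  then show "x = y" by simp
qed

definition proj :: "'e \<Rightarrow> 'e" where
  "proj = (SOME P. bounded_linear P \<and> (\<forall>x. P x \<in> J ` H) \<and> (\<forall>x\<in>J ` H. P x = x) \<and>
     (\<forall>x. \<forall>y\<in>J ` H. inner (P x) y = inner x y))"

lemma subspace_JH: "subspace (J ` H)"
  unfolding subspace_def
proof (intro conjI ballI allI)
  show "0 \<in> J ` H" using J_0 H_ops(1) by (metis imageI)
  show "x + y \<in> J ` H" if "x \<in> J ` H" "y \<in> J ` H" for x y
    using that by (auto simp flip: J_add intro: H_ops)
  show "c *\<^sub>R x \<in> J ` H" if "x \<in> J ` H" for c x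
    using that by (auto simp flip: J_scale intro: H_ops)
qed

lemma proj: "bounded_linear proj" "proj x \<in> J ` H" "x \<in> J ` H \<Longrightarrow> proj x = x"
  "y \<in> J ` H \<Longrightarrow> inner (proj x) y = inner x y"
proof -
  have "\<exists>P. bounded_linear P \<and> (\<forall>x. P x \<in> J ` H) \<and> (\<forall>x\<in>J ` H. P x = x) \<and>
     (\<forall>x. \<forall>y\<in>J ` H. inner (P x) y = inner x y)"
    using orthogonal_projection_exists[OF subspace_JH closed_J] by metis
  from someI_ex[OF this, folded proj_def]
  show "bounded_linear proj" "proj x \<in> J ` H" "x \<in> J ` H \<Longrightarrow> proj x = x"
    "y \<in> J ` H \<Longrightarrow> inner (proj x) y = inner x y" by blast+
qed

text \<open>A total linear left inverse of \<open>J\<close>: composing with the projection makes it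
  0 on the orthogonal complement of the image.\<close>

definition pull :: "'e \<Rightarrow> 's" where "pull e = inv_into H J (proj e)"

lemma pull_H: "pull e \<in> H" unfolding pull_def by (rule inv_into_into[OF proj(2)])

lemma J_pull: "J (pull e) = proj e" unfolding pull_def by (rule f_inv_into_f[OF proj(2)])

lemma pull_J: "x \<in> H \<Longrightarrow> pull (J x) = x"
  unfolding pull_def using proj(3)[of "J x"] inv_into_f_f[OF inj_J] by simp

lemma J_eqD: "x \<in> H \<Longrightarrow> y \<in> H \<Longrightarrow> J x = J y \<Longrightarrow> x = y"
  using inj_J by (simp add: inj_on_def)

lemma pull_eqI: "x \<in> H \<Longrightarrow> proj e = J x \<Longrightarrow> pull e = x"
  using J_eqD[OF pull_H] J_pull by metis

lemma proj_add: "proj (x + y) = proj x + proj y" and proj_scale: "proj (r *\<^sub>R x) = r *\<^sub>R proj x"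
  and proj_diff: "proj (x - y) = proj x - proj y"
  using linear_add linear_scale linear_diff bounded_linear.linear[OF proj(1)] by blast+

lemma pull_add: "pull (x + y) = pull x + pull y"
  by (rule pull_eqI) (simp_all add: H_ops pull_H J_add J_pull proj_add)

lemma pull_scale: "pull (r *\<^sub>R x) = r *\<^sub>R pull x"
  by (rule pull_eqI) (simp_all add: H_ops pull_H J_scale J_pull proj_scale)

lemma proj_JH: "x \<in> H \<Longrightarrow> proj (J x) = J x" by (rule proj(3)) simp

lemma pull_proj: "pull (proj x) = pull x"
  unfolding pull_def by (simp add: proj(2,3))

definition ext_dom :: "'e set" where "ext_dom = {e. pull e \<in> D}"
definition ext_A :: "'e \<Rightarrow> 'e" where "ext_A e = J (A (pull e))"

sublocale ext: max_dissipative ext_dom ext_A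
proof
  show "subspace ext_dom"
  proof -
    have "pull 0 = 0" using pull_scale[of 0 0] by simp
    then show ?thesis unfolding subspace_def ext_dom_def by (auto simp: pull_add pull_scale D_ops)
  qed
  show "ext_A (x + y) = ext_A x + ext_A y" if "x \<in> ext_dom" "y \<in> ext_dom" for x y
    using that by (simp add: ext_A_def ext_dom_def pull_add A_add J_add A_H)
  show "ext_A (c *\<^sub>R x) = c *\<^sub>R ext_A x" if "x \<in> ext_dom" for c x
    using that by (simp add: ext_A_def ext_dom_def pull_scale A_scale J_scale A_H)
  show "inner (ext_A x) x \<le> 0" if "x \<in> ext_dom" for x
  proof -
    have "inner (ext_A x) x = inner (proj x) (ext_A x)"
      using that proj(4)[of "ext_A x" x] by (simp add: ext_A_def ext_dom_def A_H inner_commute)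
    also have "\<dots> = inner (J (A (pull x))) (J (pull x))" by (simp add: ext_A_def J_pull inner_commute)
    also have "\<dots> \<le> 0" using that by (intro dissipative) (simp add: ext_dom_def)
    finally show ?thesis .
  qed
  show "\<exists>x\<in>ext_dom. x - l *\<^sub>R ext_A x = f" if l: "l > 0" for l f
  proof -
    obtain x where x: "x \<in> D" "x - l *\<^sub>R A x = pull f" using range[OF l pull_H] by blast
    \<comment> \<open>The projection of \<open>f\<close> is handled by the range condition on the
      carrier. The orthogonal part of \<open>f\<close> is kept as it is, since \<open>ext_A\<close>
      does not see it.\<close>
    let ?e = "J x + (f - proj f)"
    have "proj ?e = J x" using x D_H by (simp add: proj_add proj_diff proj_JH proj(2,3))
    then have p: "pull ?e = x" using x D_H by (intro pull_eqI) auto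
    have "J x - l *\<^sub>R J (A x) = J (x - l *\<^sub>R A x)"
      by (simp only: J_diff[OF D_H[OF x(1)] H_ops(4)[OF A_H[OF x(1)]]] J_scale[OF A_H[OF x(1)]])
    then have "?e - l *\<^sub>R ext_A ?e = f" unfolding ext_A_def p using x(2) J_pull by (simp add: algebra_simps)
    then show ?thesis using x p unfolding ext_dom_def by (intro bexI[of _ ?e]) auto
  qed
qed

lemma J_ext_dom: "x \<in> H \<Longrightarrow> J x \<in> ext_dom \<longleftrightarrow> x \<in> D" and ext_A_J: "x \<in> H \<Longrightarrow> ext_A (J x) = J (A x)"
  by (simp_all add: ext_dom_def ext_A_def pull_J)

text \<open>The projection commutes with \<open>ext_A\<close> on its domain, hence with the
  semigroup, so the image of the carrier is invariant.\<close>

lemma sg_JH: "0 \<le> t \<Longrightarrow> x \<in> H \<Longrightarrow> ext.sg t (J x) \<in> J ` H"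
proof -
  assume t: "0 \<le> t" and x: "x \<in> H"
  have "proj (ext.sg t (J x)) = ext.sg t (proj (J x))"
    using t by (intro ext.sg_commute proj(1)) (auto simp: ext_dom_def ext_A_def pull_proj proj_JH A_H)
  then show ?thesis using proj(2)[of "ext.sg t (J x)"] proj_JH[OF x] by simp
qed

definition flow :: "real \<Rightarrow> 's \<Rightarrow> 's" where "flow t x = pull (ext.sg t (J x))"

section \<open>The flow on the carrier, its generator and its uniqueness\<close>

lemma flow_H: "flow t x \<in> H" by (simp add: flow_def pull_H)

lemma J_flow: "0 \<le> t \<Longrightarrow> x \<in> H \<Longrightarrow> J (flow t x) = ext.sg t (J x)"
  using sg_JH[of t x] by (simp add: flow_def J_pull proj(3))

lemma flow_zero: "x \<in> H \<Longrightarrow> flow 0 x = x"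
  by (simp add: flow_def ext.sg_zero pull_J)

lemma flow_add: "0 \<le> s \<Longrightarrow> 0 \<le> t \<Longrightarrow> x \<in> H \<Longrightarrow> flow (s + t) x = flow s (flow t x)"
  unfolding flow_def using ext.sg_add[of s t "J x"] sg_JH[of t x] by (simp add: add.commute J_pull proj(3))

text \<open>The target type of \<open>J\<close> has no complex structure in this locale.
  Multiplication by \<open>c\<close> is transported to the bounded real linear map \<open>F\<close>,
  which commutes with \<open>ext_A\<close>, and \<open>sg_commute\<close> applies.\<close>

lemma flow_scaleC:
  assumes t: "0 \<le> t" and x: "x \<in> H" shows "flow t (c *\<^sub>C x) = c *\<^sub>C flow t x"
proof -
  define F where "F e = J (c *\<^sub>C pull e)" for e
  obtain B where B: "\<And>x. norm (proj x) \<le> norm x * B" using bounded_linear.bounded[OF proj(1)] by blast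
  have F: "bounded_linear F"
  proof (rule bounded_linear_intro)
    show "F (x + y) = F x + F y" for x y by (simp add: F_def pull_add scaleC_add_right J_add H_ops pull_H)
    show "F (r *\<^sub>R x) = r *\<^sub>R F x" for r x
    proof -
      have "c *\<^sub>C (r *\<^sub>R pull x) = r *\<^sub>R (c *\<^sub>C pull x)"
        by (simp add: scaleR_scaleC scaleC_scaleC mult.commute)
      then show ?thesis by (simp add: F_def pull_scale J_scale H_ops pull_H)
    qed
    show "norm (F x) \<le> norm x * (B * cmod c)" for x
      using mult_right_mono[OF B[of x], of "cmod c"] by (simp add: F_def J_scaleC pull_H J_pull mult_ac)
  qed
  have FJ: "F (J x) = J (c *\<^sub>C x)" if "x \<in> H" for x using that by (simp add: F_def pull_J)
  have pF: "pull (F e) = c *\<^sub>C pull e" for e by (simp add: F_def pull_J H_ops pull_H)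
  have "F (ext.sg t (J x)) = ext.sg t (F (J x))"
  proof (rule ext.sg_commute[OF F _ _ t])
    show "F e \<in> ext_dom" if "e \<in> ext_dom" for e using that by (simp add: ext_dom_def pF D_ops)
    show "ext_A (F e) = F (ext_A e)" if "e \<in> ext_dom" for e
      using that by (simp add: ext_dom_def ext_A_def pF A_scaleC FJ A_H)
  qed
  then have "ext.sg t (J (c *\<^sub>C x)) = F (ext.sg t (J x))" by (simp add: FJ x)
  then show ?thesis unfolding flow_def by (simp add: pF)
qed

lemma flow_linear: "0 \<le> t \<Longrightarrow> linear_map_on H (flow t)"
  unfolding linear_map_on_def
proof (intro conjI ballI allI)
  assume t: "0 \<le> t"
  show "flow t x \<in> H" for x by (rule flow_H)
  show "flow t (x + y) = flow t x + flow t y" if "x \<in> H" "y \<in> H" for x y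
    using linear_add[OF bounded_linear.linear[OF ext.bounded_linear_sg[OF t]]] that
    by (simp add: flow_def J_add pull_add)
  show "flow t (c *\<^sub>C x) = c *\<^sub>C flow t x" if "x \<in> H" for c x using flow_scaleC[OF t that] .
qed

lemma n_diff: "x \<in> H \<Longrightarrow> y \<in> H \<Longrightarrow> n (x - y) = norm (J x - J y)"
  by (simp add: n_J H_ops J_diff)

lemma flow_continuous: "x \<in> H \<Longrightarrow> norm_continuous H n (\<lambda>t. flow t x)"
  unfolding norm_continuous_def
proof (intro conjI allI impI)
  assume x: "x \<in> H"
  fix t :: real assume t: "0 \<le> t"
  show "flow t x \<in> H" by (rule flow_H)
  have "((\<lambda>s. ext.sg s (J x)) \<longlongrightarrow> ext.sg t (J x)) (at t within {0..})"
    using ext.continuous_on_sg[of "J x"] t unfolding continuous_on_def by auto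
  then have "((\<lambda>s. norm (ext.sg s (J x) - ext.sg t (J x))) \<longlongrightarrow> 0) (at t within {0..})"
    by (simp add: LIM_zero_iff tendsto_norm_zero_iff)
  then show "((\<lambda>s. n (flow s x - flow t x)) \<longlongrightarrow> 0) (at t within {0..})"
    by (rule Lim_transform_within[OF _ zero_less_one]) (use x t in \<open>auto simp: n_diff flow_H J_flow\<close>)
qed

lemma quotient_norm:
  assumes "x \<in> H" "y \<in> H" "z \<in> H" shows "n (r *\<^sub>R (x - y) - z) = norm (r *\<^sub>R (J x - J y) - J z)"
  using assms by (simp add: n_J J_diff J_scale H_ops)

lemma flow_generator_value:
  assumes "x \<in> H" "y \<in> H"
  shows "has_generator_value n flow x y \<longleftrightarrow> x \<in> D \<and> A x = y"
proof -
  have "has_generator_value n flow x y \<longleftrightarrow>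
      ((\<lambda>h. norm ((1 / h) *\<^sub>R (ext.sg h (J x) - J x) - J y)) \<longlongrightarrow> 0) (at_right 0)"
    unfolding has_generator_value_def
    by (rule filterlim_cong[OF refl refl])
      (auto simp: eventually_at_filter quotient_norm flow_H J_flow assms)
  also have "\<dots> \<longleftrightarrow> ((\<lambda>h. (1 / h) *\<^sub>R (ext.sg h (J x) - J x)) \<longlongrightarrow> J y) (at_right 0)"
    by (simp add: tendsto_norm_zero_iff LIM_zero_iff)
  also have "\<dots> \<longleftrightarrow> x \<in> D \<and> A x = y"
    unfolding ext.sg_generator using assms by (auto simp: J_ext_dom ext_A_J dest: J_eqD[OF A_H])
  finally show ?thesis .
qed

lemma flow_is_generated: "C0_contraction_semigroup H n flow" "is_generator H n flow D A"
proof -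
  show "C0_contraction_semigroup H n flow"
    unfolding C0_contraction_semigroup_def
  proof (intro conjI allI impI ballI)
    show "linear_map_on H (flow t)" if "0 \<le> t" for t using flow_linear[OF that] .
    show "flow 0 x = x" if "x \<in> H" for x using flow_zero[OF that] .
    show "flow (s + t) x = flow s (flow t x)" if "0 \<le> s" "0 \<le> t" "x \<in> H" for s t x using flow_add[OF that] .
    show "((\<lambda>t. n (flow t x - x)) \<longlongrightarrow> 0) (at_right 0)" if "x \<in> H" for x
    proof -
      have "((\<lambda>s. n (flow s x - flow 0 x)) \<longlongrightarrow> 0) (at 0 within {0..})"
        using flow_continuous[OF that] unfolding norm_continuous_def by blast
      then have "((\<lambda>s. n (flow s x - flow 0 x)) \<longlongrightarrow> 0) (at 0 within {0<..})"
        by (rule tendsto_within_subset) auto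
      then show ?thesis by (simp add: flow_zero that)
    qed
    show "n (flow t x) \<le> n x" if "0 \<le> t" "x \<in> H" for t x
      using ext.sg_contraction[OF that(1)] that by (simp add: n_J flow_H J_flow)
  qed
  show "is_generator H n flow D A"
    unfolding is_generator_def using flow_generator_value D_H A_H by blast
qed

text \<open>\<open>T\<close> is extended to the whole type by the identity on the orthogonal
  complement, matching the extension of \<open>A\<close> by 0. The extension \<open>S\<close> then
  satisfies the hypotheses of \<open>semigroup_eq_sg\<close>.\<close>

lemma semigroup_eq_flow:
  assumes sg: "C0_contraction_semigroup H n T" and gen: "is_generator H n T D A" and t: "0 \<le> t" and x: "x \<in> H"
  shows "T t x = flow t x"
proof -
  note sg' = sg[unfolded C0_contraction_semigroup_def]
  have lin: "\<And>t. 0 \<le> t \<Longrightarrow> linear_map_on H (T t)" using sg' by blast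
  have TH: "T t x \<in> H" if "0 \<le> t" "x \<in> H" for t x using lin[OF that(1)] that(2) unfolding linear_map_on_def by blast
  define S where "S t e = J (T t (pull e)) + (e - proj e)" for t e
  have pullS: "pull (S t e) = T t (pull e)" if "0 \<le> t" for t e
    using that by (intro pull_eqI) (auto simp: S_def proj_add proj_diff proj_JH TH pull_H proj(2,3))
  have "S t (J x) = ext.sg t (J x)"
  proof (rule ext.semigroup_eq_sg[OF _ _ _ _ _ _ t])
    \<comment> \<open>Pythagoras: the component in the image is contracted by \<open>T\<close>, the
      orthogonal one is unchanged.\<close>
    have contr: "norm (S t e) \<le> norm e" if t: "0 \<le> t" for t e
    proof -
      have orth: "inner y (e - proj e) = 0" if "y \<in> J ` H" for y
        using proj(4)[OF that, of e] by (simp add: inner_diff_right inner_commute)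
      have pyth: "(norm (y + (e - proj e)))\<^sup>2 = (norm y)\<^sup>2 + (norm (e - proj e))\<^sup>2" if "y \<in> J ` H" for y
        unfolding power2_norm_eq_inner inner_add_left inner_add_right
        using orth[OF that] by (simp add: inner_commute)
      have "norm (J (T t (pull e))) \<le> norm (proj e)"
      proof -
        have "n (T t (pull e)) \<le> n (pull e)" using sg' t pull_H by blast
        then show ?thesis by (simp add: n_J TH[OF t] pull_H J_pull)
      qed
      then have le: "(norm (J (T t (pull e))))\<^sup>2 \<le> (norm (proj e))\<^sup>2" by (rule power_mono) simp
      have S: "(norm (S t e))\<^sup>2 = (norm (J (T t (pull e))))\<^sup>2 + (norm (e - proj e))\<^sup>2"
        unfolding S_def by (rule pyth) (use TH[OF t pull_H] in simp)
      have "proj e + (e - proj e) = e" by simp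
      then have "(norm e)\<^sup>2 = (norm (proj e))\<^sup>2 + (norm (e - proj e))\<^sup>2" using pyth[OF proj(2)[of e]] by (simp only:)
      with le S have "(norm (S t e))\<^sup>2 \<le> (norm e)\<^sup>2" by linarith
      then show ?thesis by (rule power2_le_imp_le) simp
    qed
    show "norm (S t e) \<le> norm e" if "0 \<le> t" for t e using contr[OF that] .
    show "bounded_linear (S t)" if t: "0 \<le> t" for t
    proof (rule bounded_linear_intro)
      show "S t (x + y) = S t x + S t y" for x y
        using lin[OF t] pull_H unfolding linear_map_on_def by (simp add: S_def pull_add proj_add J_add TH[OF t])
      show "S t (r *\<^sub>R x) = r *\<^sub>R S t x" for r x
      proof -
        have "T t (r *\<^sub>R pull x) = r *\<^sub>R T t (pull x)"
          using lin[OF t] pull_H unfolding linear_map_on_def by (simp add: scaleR_scaleC)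
        then show ?thesis
          by (simp add: S_def pull_scale proj_scale J_scale TH[OF t] pull_H scaleR_add_right scaleR_diff_right)
      qed
      show "norm (S t x) \<le> norm x * 1" for x using contr[OF t, of x] by simp
    qed
    show "S 0 e = e" for e
    proof -
      have "T 0 (pull e) = pull e" using sg' pull_H by blast
      then show ?thesis by (simp add: S_def J_pull)
    qed
    show "S (s + t) e = S s (S t e)" if "0 \<le> s" "0 \<le> t" for s t e
    proof -
      have "T (s + t) (pull e) = T s (T t (pull e))" using sg' that pull_H by blast
      moreover have "S t e - proj (S t e) = e - proj e"
        using J_pull[of "S t e"] pullS[OF that(2), of e] by (simp add: S_def)
      ultimately show ?thesis using pullS[OF that(2), of e] unfolding S_def[of "s + t"] S_def[of s] by simp
    qed
    have SJ: "S h e - e = J (T h (pull e)) - J (pull e)" for h e by (simp add: S_def J_pull)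
    show "((\<lambda>t. S t e) \<longlongrightarrow> e) (at_right 0)" for e
    proof -
      have "((\<lambda>t. n (T t (pull e) - pull e)) \<longlongrightarrow> 0) (at_right 0)" using sg' pull_H by blast
      then have "((\<lambda>t. norm (S t e - e)) \<longlongrightarrow> 0) (at_right 0)"
      proof (rule Lim_transform_eventually)
        show "\<forall>\<^sub>F h in at_right 0. n (T h (pull e) - pull e) = norm (S h e - e)"
          using eventually_at_right_less[of "0::real"] by eventually_elim (simp add: SJ n_diff TH pull_H)
      qed
      then show ?thesis by (simp add: tendsto_norm_zero_iff LIM_zero_iff)
    qed
    show "e \<in> ext_dom \<and> ext_A e = y" if lim: "((\<lambda>h. (1 / h) *\<^sub>R (S h e - e)) \<longlongrightarrow> y) (at_right 0)" for e y
    proof -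
      have "((\<lambda>h. (1 / h) *\<^sub>R (J (T h (pull e)) - J (pull e))) \<longlongrightarrow> y) (at_right 0)" using lim by (simp only: SJ)
      moreover have "\<forall>\<^sub>F h in at_right 0. (1 / h) *\<^sub>R (J (T h (pull e)) - J (pull e)) \<in> J ` H"
        using eventually_at_right_less[of "0::real"]
        by eventually_elim (use subspace_JH TH pull_H in \<open>auto intro!: subspace_scale subspace_diff\<close>)
      \<comment> \<open>The quotients stay in the closed image of \<open>J\<close>, so their limit
        comes from a carrier element, and that element is a generator value of
        \<open>T\<close>.\<close>
      ultimately have y: "y \<in> J ` H"
        by (intro Lim_in_closed_set[OF closed_J]) (auto simp: trivial_limit_at_right_real)
      then obtain z where z: "z \<in> H" "y = J z" by blast
      have gval: "has_generator_value n T (pull e) z"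
      proof -
        have "((\<lambda>h. norm ((1 / h) *\<^sub>R (J (T h (pull e)) - J (pull e)) - J z)) \<longlongrightarrow> 0) (at_right 0)"
          using lim unfolding SJ z(2) by (simp add: tendsto_norm_zero_iff LIM_zero_iff)
        then show ?thesis unfolding has_generator_value_def
        proof (rule Lim_transform_eventually)
          show "\<forall>\<^sub>F h in at_right 0. norm ((1 / h) *\<^sub>R (J (T h (pull e)) - J (pull e)) - J z) =
              n ((1 / h) *\<^sub>R (T h (pull e) - pull e) - z)"
            using eventually_at_right_less[of "0::real"]
            by eventually_elim (simp add: quotient_norm TH pull_H z(1))
        qed
      qed
      then have eD: "pull e \<in> D" using gen z(1) pull_H unfolding is_generator_def by blast
      then have gval': "has_generator_value n T (pull e) (A (pull e))" using gen unfolding is_generator_def by blast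
      have lim': "((\<lambda>h. (1 / h) *\<^sub>R (J (T h (pull e)) - J (pull e))) \<longlongrightarrow> J w) (at_right 0)"
        if "has_generator_value n T (pull e) w" "w \<in> H" for w
      proof -
        have "((\<lambda>h. norm ((1 / h) *\<^sub>R (J (T h (pull e)) - J (pull e)) - J w)) \<longlongrightarrow> 0) (at_right 0)"
          using that(1) unfolding has_generator_value_def
        proof (rule Lim_transform_eventually)
          show "\<forall>\<^sub>F h in at_right 0. n ((1 / h) *\<^sub>R (T h (pull e) - pull e) - w) =
              norm ((1 / h) *\<^sub>R (J (T h (pull e)) - J (pull e)) - J w)"
            using eventually_at_right_less[of "0::real"]
            by eventually_elim (simp add: quotient_norm TH pull_H that(2))
        qed
        then show ?thesis by (simp add: tendsto_norm_zero_iff LIM_zero_iff)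
      qed
      have "J (A (pull e)) = J z"
        using tendsto_unique[OF _ lim'[OF gval' A_H[OF eD]] lim'[OF gval z(1)]]
        by (simp add: trivial_limit_at_right_real)
      then show ?thesis using eD z(2) by (simp add: ext_dom_def ext_A_def)
    qed
  qed
  then have "J (T t x) = J (flow t x)" using x t by (simp add: S_def pull_J proj_JH J_flow)
  then show ?thesis using J_eqD TH flow_H t x by blast
qed

section \<open>Weak solutions on the carrier\<close>

lemma J_sum:
  assumes "finite I" "\<And>i. i \<in> I \<Longrightarrow> g i \<in> H"
  shows "sum g I \<in> H \<and> J (sum g I) = (\<Sum>i\<in>I. J (g i))"
  using assms
proof (induction I rule: finite_induct)
  case empty
  show ?case using H_ops(1) J_0 by simp
next
  case (insert i I)
  then have "g i \<in> H" "sum g I \<in> H" "J (sum g I) = (\<Sum>i\<in>I. J (g i))" by simp_all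
  then show ?case using insert(1,2) H_ops(2) J_add by simp
qed

lemma riemann_sum_norm:
  assumes P: "P tagged_division_of {0..t}" and f: "\<And>s. 0 \<le> s \<Longrightarrow> f s \<in> H" and I: "I \<in> H"
  shows "n ((\<Sum>(x, K)\<in>P. measure lborel K *\<^sub>R f x) - I) = norm ((\<Sum>(x, K)\<in>P. measure lborel K *\<^sub>R J (f x)) - J I)"
proof -
  have fP: "f (fst z) \<in> H" if "z \<in> P" for z
    using tagged_division_ofD(2,3)[OF P, of "fst z" "snd z"] that f[of "fst z"] by force
  have "(\<Sum>z\<in>P. measure lborel (snd z) *\<^sub>R f (fst z)) \<in> H \<and>
      J (\<Sum>z\<in>P. measure lborel (snd z) *\<^sub>R f (fst z)) = (\<Sum>z\<in>P. J (measure lborel (snd z) *\<^sub>R f (fst z)))"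
    using P fP by (intro J_sum) (auto intro: H_ops)
  moreover have "(\<Sum>z\<in>P. J (measure lborel (snd z) *\<^sub>R f (fst z))) = (\<Sum>z\<in>P. measure lborel (snd z) *\<^sub>R J (f (fst z)))"
    by (intro sum.cong refl J_scale fP)
  ultimately show ?thesis using I by (simp add: split_def n_diff)
qed

definition weak_sol :: "'s \<Rightarrow> (real \<Rightarrow> 's) \<Rightarrow> bool" where
  "weak_sol x f \<longleftrightarrow> norm_continuous H n f \<and>
     (\<forall>t\<ge>0. \<exists>I. has_norm_integral n f I {0..t} \<and> I \<in> D \<and> f t = x + A I)"

lemma flow_weak_sol:
  assumes x: "x \<in> H" shows "weak_sol x (\<lambda>t. flow t x)"
  unfolding weak_sol_def
proof (intro conjI allI impI flow_continuous[OF x])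
  fix t :: real assume t: "0 \<le> t"
  let ?w = "integral {0..t} (\<lambda>s. ext.sg s (J x))"
  have cont: "continuous_on {0..t} (\<lambda>s. ext.sg s (J x))" by (rule continuous_on_subset[OF ext.continuous_on_sg]) auto
  have wJ: "?w \<in> J ` H"
  proof -
    \<comment> \<open>The orbit stays in the image of \<open>J\<close>, where the projection is the
      identity; as it commutes with the integral, the integral lies in the image too.\<close>
    have "proj ?w = integral {0..t} (proj \<circ> (\<lambda>s. ext.sg s (J x)))"
      by (rule integral_linear[symmetric, OF integrable_continuous_real[OF cont] proj(1)])
    also have "\<dots> = ?w"
      by (rule Henstock_Kurzweil_Integration.integral_cong) (use sg_JH[OF _ x] proj(3) in auto)
    finally show ?thesis using proj(2)[of ?w] by simp
  qed
  have Jw: "J (pull ?w) = ?w" using wJ by (simp add: J_pull proj(3))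
  have wD: "pull ?w \<in> D" using ext.sg_integral(1)[OF t, of "J x"] by (simp add: ext_dom_def)
  have "has_norm_integral n (\<lambda>t. flow t x) (pull ?w) {0..t}"
    unfolding has_norm_integral_def
  proof (intro allI impI)
    fix \<epsilon> :: real assume "\<epsilon> > 0"
    from riemann_sums_uniform[OF cont t this] obtain \<delta> where d: "\<delta> > 0"
      "\<And>P. P tagged_division_of {0..t} \<Longrightarrow> (\<lambda>x. ball x \<delta>) fine P \<Longrightarrow>
        norm ((\<Sum>(s, K)\<in>P. measure lborel K *\<^sub>R ext.sg s (J x)) - ?w) < \<epsilon>" by blast
    have "n ((\<Sum>(s, K)\<in>P. measure lborel K *\<^sub>R flow s x) - pull ?w) < \<epsilon>"
      if P: "P tagged_division_of {0..t}" "(\<lambda>x. ball x \<delta>) fine P" for P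
    proof -
      have "(\<Sum>(s, K)\<in>P. measure lborel K *\<^sub>R J (flow s x)) = (\<Sum>(s, K)\<in>P. measure lborel K *\<^sub>R ext.sg s (J x))"
      proof (rule sum.cong[OF refl], clarify)
        fix s K assume "(s, K) \<in> P"
        then have "0 \<le> s" using tagged_division_ofD(2,3)[OF P(1)] by force
        then show "measure lborel K *\<^sub>R J (flow s x) = measure lborel K *\<^sub>R ext.sg s (J x)" by (simp add: J_flow x)
      qed
      then show ?thesis using d(2)[OF P] riemann_sum_norm[OF P(1) flow_H pull_H[of ?w]] by (simp add: Jw)
    qed
    then show "\<exists>\<delta>>0. \<forall>P. P tagged_division_of {0..t} \<and> (\<lambda>x. ball x \<delta>) fine P \<longrightarrow>
        n ((\<Sum>(s, K)\<in>P. measure lborel K *\<^sub>R flow s x) - pull ?w) < \<epsilon>" using d(1) by blast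
  qed
  moreover have "flow t x = x + A (pull ?w)"
  proof (rule J_eqD[OF flow_H])
    show "x + A (pull ?w) \<in> H" using x wD A_H H_ops by blast
    show "J (flow t x) = J (x + A (pull ?w))"
      using ext.sg_integral(2)[OF t, of "J x"] x wD t by (simp add: J_flow J_add A_H ext_A_def)
  qed
  ultimately show "\<exists>I. has_norm_integral n (\<lambda>t. flow t x) I {0..t} \<and> I \<in> D \<and> flow t x = x + A I"
    using wD by blast
qed

lemma weak_sol_unique:
  assumes x: "x \<in> H" and f: "weak_sol x f" and t: "0 \<le> t" shows "f t = flow t x"
proof -
  have fH: "f s \<in> H" if "0 \<le> s" for s using f that unfolding weak_sol_def norm_continuous_def by blast
  have "ext.mild (J x) (\<lambda>t. J (f t))" unfolding ext.mild_def
  proof (intro conjI allI impI)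
    show "continuous_on {0..} (\<lambda>t. J (f t))" unfolding continuous_on_def
    proof
      fix t :: real assume t: "t \<in> {0..}"
      have "((\<lambda>s. n (f s - f t)) \<longlongrightarrow> 0) (at t within {0..})"
        using f t unfolding weak_sol_def norm_continuous_def by auto
      then have "((\<lambda>s. norm (J (f s) - J (f t))) \<longlongrightarrow> 0) (at t within {0..})"
        by (rule Lim_transform_within[OF _ zero_less_one]) (use t in \<open>auto simp: n_diff fH\<close>)
      then show "((\<lambda>t. J (f t)) \<longlongrightarrow> J (f t)) (at t within {0..})"
        by (simp add: tendsto_norm_zero_iff LIM_zero_iff)
    qed
    fix t :: real assume t: "0 \<le> t"
    then obtain I where I: "has_norm_integral n f I {0..t}" "I \<in> D" "f t = x + A I"
      using f unfolding weak_sol_def by blast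
    have "((\<lambda>t. J (f t)) has_integral J I) {0..t}"
      unfolding has_integral_real
    proof (intro allI impI)
      fix e :: real assume "e > 0"
      then obtain \<delta> where d: "\<delta> > 0" "\<And>P. P tagged_division_of {0..t} \<Longrightarrow> (\<lambda>x. ball x \<delta>) fine P \<Longrightarrow>
        n ((\<Sum>(x, K)\<in>P. measure lborel K *\<^sub>R f x) - I) < e"
        using I(1) unfolding has_norm_integral_def by metis
      show "\<exists>\<gamma>. gauge \<gamma> \<and> (\<forall>P. P tagged_division_of {0..t} \<and> \<gamma> fine P \<longrightarrow>
          norm ((\<Sum>(x, K)\<in>P. measure lborel K *\<^sub>R J (f x)) - J I) < e)"
      proof (intro exI conjI allI impI)
        \<comment> \<open>A mesh size is a constant gauge, so the integral of the definition is a
          library integral of the embedded function.\<close>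
        show "gauge (\<lambda>x::real. ball x \<delta>)" using d(1) by (simp add: gauge_def)
        fix P assume "P tagged_division_of {0..t} \<and> (\<lambda>x. ball x \<delta>) fine P"
        then have P: "P tagged_division_of {0..t}" "(\<lambda>x. ball x \<delta>) fine P" by simp_all
        show "norm ((\<Sum>(x, K)\<in>P. measure lborel K *\<^sub>R J (f x)) - J I) < e"
          by (rule ord_eq_less_trans[OF riemann_sum_norm[OF P(1) fH D_H[OF I(2)], symmetric] d(2)[OF P]])
      qed
    qed
    then have i: "integral {0..t} (\<lambda>t. J (f t)) = J I" by (rule integral_unique)
    show "integral {0..t} (\<lambda>t. J (f t)) \<in> ext_dom" unfolding i using I(2) J_ext_dom D_H by blast
    show "J (f t) = J x + ext_A (integral {0..t} (\<lambda>t. J (f t)))"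
      unfolding i using I x D_H by (simp add: J_add A_H ext_A_J)
  qed
  from ext.sg_eq_mild[OF this t] show ?thesis using J_eqD[OF fH[OF t] flow_H] x t by (simp add: J_flow)
qed

lemma flow_domain:
  assumes x: "x \<in> D" and t: "0 \<le> t" shows "flow t x \<in> D" "A (flow t x) = flow t (A x)"
proof -
  have xH: "x \<in> H" "J x \<in> ext_dom" using x D_H J_ext_dom by auto
  show D': "flow t x \<in> D" using ext.sg_domain(1)[OF xH(2) t] by (simp add: flow_def ext_dom_def)
  show "A (flow t x) = flow t (A x)"
  proof (rule J_eqD[OF A_H[OF D'] flow_H])
    have "J (A (flow t x)) = ext_A (ext.sg t (J x))" by (simp add: ext_A_def flow_def)
    also have "\<dots> = ext.sg t (ext_A (J x))" by (rule ext.sg_domain(2)[OF xH(2) t])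
    also have "\<dots> = J (flow t (A x))" by (simp only: ext_A_J[OF xH(1)] J_flow[OF t A_H[OF x]])
    finally show "J (A (flow t x)) = J (flow t (A x))" .
  qed
qed

text \<open>Since \<open>A\<close> commutes with the flow on \<open>D\<close>, the graph norm of an
  increment is a sum of increments of two orbits, those of \<open>x\<close> and of
  \<open>A x\<close>.\<close>

lemma flow_domain_continuous:
  assumes x: "x \<in> D" shows "norm_continuous D (\<lambda>y. n y + n (A y)) (\<lambda>t. flow t x)"
  unfolding norm_continuous_def
proof (intro conjI allI impI)
  fix t :: real assume t: "0 \<le> t"
  show "flow t x \<in> D" using flow_domain(1)[OF x t] .
  have "((\<lambda>s. n (flow s x - flow t x) + n (flow s (A x) - flow t (A x))) \<longlongrightarrow> 0 + 0) (at t within {0..})"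
    using flow_continuous[OF D_H[OF x]] flow_continuous[OF A_H[OF x]] t unfolding norm_continuous_def
    by (intro tendsto_add) auto
  then have "((\<lambda>s. n (flow s x - flow t x) + n (flow s (A x) - flow t (A x))) \<longlongrightarrow> 0) (at t within {0..})" by simp
  then show "((\<lambda>s. n (flow s x - flow t x) + n (A (flow s x - flow t x))) \<longlongrightarrow> 0) (at t within {0..})"
    by (rule Lim_transform_within[OF _ zero_less_one]) (use t x in \<open>auto simp: A_diff flow_domain\<close>)
qed

lemma flow_C1:
  assumes x: "x \<in> D" shows "norm_C1 H n (\<lambda>t. flow t x)"
  unfolding norm_C1_def
proof (intro conjI allI impI flow_H exI[of _ "\<lambda>t. flow t (A x)"] flow_continuous[OF A_H[OF x]])
  fix t :: real assume t: "0 \<le> t"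
  have xH: "x \<in> H" "J x \<in> ext_dom" using x D_H J_ext_dom by auto
  have "((\<lambda>s. (1 / (s - t)) *\<^sub>R (ext.sg s (J x) - ext.sg t (J x))) \<longlongrightarrow> ext.sg t (J (A x))) (at t within {0..})"
    using ext.sg_domain(3)[OF xH(2) t] unfolding has_vector_derivative_iff_quotient by (simp add: ext_A_J xH)
  then have "((\<lambda>s. norm ((1 / (s - t)) *\<^sub>R (ext.sg s (J x) - ext.sg t (J x)) - ext.sg t (J (A x)))) \<longlongrightarrow> 0) (at t within {0..})"
    by (simp add: LIM_zero_iff tendsto_norm_zero_iff)
  then show "((\<lambda>s. n ((1 / (s - t)) *\<^sub>R (flow s x - flow t x) - flow t (A x))) \<longlongrightarrow> 0) (at t within {0..})"
    by (rule Lim_transform_within[OF _ zero_less_one])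
      (use t xH x in \<open>auto simp: quotient_norm flow_H J_flow A_H\<close>)
qed

end

section \<open>The spaces and forms of the beam\<close>

lemma test_function_lincomb:
  assumes "test_function a b \<phi>" "test_function a b \<psi>" shows "test_function a b (\<lambda>x. c * \<phi> x + \<psi> x)"
proof -
  let ?D = "\<lambda>f x. vector_derivative f (at x) :: complex"
  have d: "(?D ^^ k) \<phi> differentiable_on UNIV" "(?D ^^ k) \<psi> differentiable_on UNIV" for k
    using assms by (auto simp: test_function_def)
  have d': "((\<lambda>x. c * (?D ^^ k) \<phi> x + (?D ^^ k) \<psi> x) has_vector_derivative
      c * (?D ^^ Suc k) \<phi> x + (?D ^^ Suc k) \<psi> x) (at x)" for k x
    by (intro has_vector_derivative_add has_vector_derivative_mult_right)
      (use d[of k] in \<open>simp_all add: differentiable_on_def vector_derivative_works\<close>)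
  have iter: "(?D ^^ k) (\<lambda>x. c * \<phi> x + \<psi> x) = (\<lambda>x. c * (?D ^^ k) \<phi> x + (?D ^^ k) \<psi> x)" for k
  proof (induction k)
    case (Suc k)
    show ?case using Suc vector_derivative_at[OF d'[of k]] by auto
  qed simp
  have "(?D ^^ k) (\<lambda>x. c * \<phi> x + \<psi> x) differentiable_on UNIV" for k
    unfolding iter differentiable_on_def using differentiableI_vector[OF d'[of k]] by simp
  moreover obtain l r where lr: "a < l" "r < b" "\<And>x. x \<notin> {l..r} \<Longrightarrow> \<phi> x = 0"
    using assms(1) unfolding test_function_def by blast
  obtain l' r' where lr': "a < l'" "r' < b" "\<And>x. x \<notin> {l'..r'} \<Longrightarrow> \<psi> x = 0"
    using assms(2) unfolding test_function_def by blast
  have "c * \<phi> x + \<psi> x = 0" if "x \<notin> {min l l'..max r r'}" for x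
  proof -
    have "x \<notin> {l..r}" "x \<notin> {l'..r'}" using that by auto
    then show ?thesis using lr(3) lr'(3) by simp
  qed
  moreover have "a < min l l'" "max r r' < b" using lr lr' by auto
  ultimately show ?thesis unfolding test_function_def by blast
qed

lemma test_function_zero: "test_function a b (\<lambda>_. 0)"
proof -
  have "((\<lambda>f x. vector_derivative f (at x)) ^^ k) (\<lambda>_. 0) = (\<lambda>_::real. 0::complex)" for k
    by (induction k) auto
  then have "\<forall>k. ((\<lambda>f x. vector_derivative f (at x)) ^^ k) (\<lambda>_. 0::complex) differentiable_on (UNIV :: real set)" by simp
  moreover have "\<exists>c d. a < c \<and> d < b \<and> (\<forall>x. x \<notin> {c..d} \<longrightarrow> (0::complex) = 0)"
    by (intro exI[of _ "a + 1"] exI[of _ "b - 1"]) simp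
  ultimately show ?thesis unfolding test_function_def by blast
qed

lemma restrict_l2_lincomb:
  assumes "continuous_on UNIV \<phi>" "continuous_on UNIV \<psi>"
  shows "restrict_l2 a b (\<lambda>x. c * \<phi> x + \<psi> x) = c *\<^sub>C restrict_l2 a b \<phi> + restrict_l2 a b \<psi>"
proof (rule l2_eqI)
  have "continuous_on UNIV (\<lambda>x. c * \<phi> x + \<psi> x)" by (intro continuous_intros assms)
  from rep_restrict_l2[OF this, of a b] rep_restrict_l2[OF assms(1), of a b] rep_restrict_l2[OF assms(2), of a b]
    rep_add_l2[of "c *\<^sub>C restrict_l2 a b \<phi>" "restrict_l2 a b \<psi>"] rep_scaleC_l2[of c "restrict_l2 a b \<phi>"]
  show "AE x in lborel. rep_l2 (restrict_l2 a b (\<lambda>x. c * \<phi> x + \<psi> x)) x = rep_l2 (c *\<^sub>C restrict_l2 a b \<phi> + restrict_l2 a b \<psi>) x"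
    by eventually_elim (simp add: algebra_simps)
qed

text \<open>Test functions paired with their derivatives, so that closure in the H^1 norm becomes
  topological closure in \<open>l2 \<times> l2\<close>.\<close>

definition test_graph :: "real \<Rightarrow> real \<Rightarrow> (l2 \<times> l2) set" where
  "test_graph a b = (\<lambda>\<phi>. (restrict_l2 a b \<phi>, restrict_l2 a b (\<lambda>x. vector_derivative \<phi> (at x)))) ` Collect (test_function a b)"

lemma test_graph_lincomb:
  assumes "F \<in> test_graph a b" "G \<in> test_graph a b" shows "c *\<^sub>C F + G \<in> test_graph a b"
proof -
  obtain \<phi> \<psi> where t: "test_function a b \<phi>" "test_function a b \<psi>"
    and FG: "F = (restrict_l2 a b \<phi>, restrict_l2 a b (\<lambda>x. vector_derivative \<phi> (at x)))"
      "G = (restrict_l2 a b \<psi>, restrict_l2 a b (\<lambda>x. vector_derivative \<psi> (at x)))"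
    using assms unfolding test_graph_def by auto
  have "vector_derivative (\<lambda>x. c * \<phi> x + \<psi> x) (at x) = c * vector_derivative \<phi> (at x) + vector_derivative \<psi> (at x)" for x
    by (intro vector_derivative_at has_vector_derivative_add has_vector_derivative_mult_right
        test_function_C1(3)[OF t(1)] test_function_C1(3)[OF t(2)])
  then have "c *\<^sub>C F + G = (\<lambda>\<phi>. (restrict_l2 a b \<phi>, restrict_l2 a b (\<lambda>x. vector_derivative \<phi> (at x)))) (\<lambda>x. c * \<phi> x + \<psi> x)"
    unfolding FG by (simp add: scaleC_prod_def restrict_l2_lincomb test_function_C1[OF t(1)] test_function_C1[OF t(2)])
  then show ?thesis unfolding test_graph_def using test_function_lincomb[OF t] by blast
qed

lemma test_graph_zero: "0 \<in> test_graph a b"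
proof -
  have z: "restrict_l2 a b (\<lambda>_. 0) = 0"
    using restrict_l2_lincomb[of "\<lambda>_. 0" "\<lambda>_. 0" a b "-1"] by (simp add: scaleC_neg_one)
  have "vector_derivative (\<lambda>_::real. 0::complex) (at x) = 0" for x by simp
  then have "(0, 0) = (\<lambda>\<phi>. (restrict_l2 a b \<phi>, restrict_l2 a b (\<lambda>x. vector_derivative \<phi> (at x)))) (\<lambda>_. 0)"
    by (simp add: z)
  then show ?thesis unfolding test_graph_def zero_prod_def using test_function_zero by blast
qed

lemma bounded_linear_scaleC_l2: "bounded_linear (\<lambda>f::l2. c *\<^sub>C f)"
  by (rule bounded_linear_intro[where K = "cmod c"])
    (simp_all add: scaleC_add_right scaleR_scaleC scaleC_scaleC norm_scaleC_l2 mult.commute)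

lemma complex_subspace_closure_test_graph: "complex_subspace (closure (test_graph a b))"
proof -
  have lin: "c *\<^sub>C F + G \<in> closure (test_graph a b)"
    if F: "F \<in> closure (test_graph a b)" and G: "G \<in> closure (test_graph a b)" for c F G
  proof -
    obtain X Y where X: "\<And>n. X n \<in> test_graph a b" "X \<longlonglongrightarrow> F" and Y: "\<And>n. Y n \<in> test_graph a b" "Y \<longlonglongrightarrow> G"
      using F G unfolding closure_sequential by blast
    have "(\<lambda>n. c *\<^sub>C X n + Y n) \<longlonglongrightarrow> c *\<^sub>C F + G"
      unfolding scaleC_prod_def
      by (intro tendsto_add Y tendsto_Pair bounded_linear.tendsto[OF bounded_linear_scaleC_l2] tendsto_fst tendsto_snd X)
    then show ?thesis unfolding closure_sequential using test_graph_lincomb[OF X(1) Y(1)] by (intro exI conjI) auto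
  qed
  have zero: "0 \<in> closure (test_graph a b)" using test_graph_zero closure_subset by blast
  have one: "1 *\<^sub>C F = F" for F :: "l2 \<times> l2" by (rule scaleC_one)
  show ?thesis unfolding complex_subspace_def
    using zero lin[of _ 0] lin[of _ _ 1] zero by (simp add: one)
qed

text \<open>For a pair in \<open>wd\<close> the H^1 norm of the function is the product norm of the
  pair. Approximation by test functions in the definition of \<open>H1_0\<close> is thus membership
  in a closure.\<close>

lemma H1_0_iff: "f \<in> H1_0 a b \<longleftrightarrow> (\<exists>g. wd a b f g \<and> (f, g) \<in> closure (test_graph a b))" if ab: "a < b"
proof -
  have rep: "g = restrict_l2 a b \<phi>" if t: "test_function a b \<phi>" and g: "g \<in> H1 a b" "represented_by a b g \<phi>" for g \<phi>
  proof (rule l2_eqI_L2)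
    show "g \<in> L2 a b" using g by (simp add: H1_def)
    show "restrict_l2 a b \<phi> \<in> L2 a b" by (rule restrict_l2_in_L2[OF test_function_C1(1)[OF t]])
    show "AE x in lborel. x \<in> {a<..<b} \<longrightarrow> rep_l2 g x = rep_l2 (restrict_l2 a b \<phi>) x"
      using g(2)[unfolded represented_by_rep] rep_restrict_l2[OF test_function_C1(1)[OF t], of a b]
      by eventually_elim auto
  qed
  have rep': "represented_by a b (restrict_l2 a b \<phi>) \<phi>" if t: "test_function a b \<phi>" for \<phi>
    unfolding represented_by_rep using rep_restrict_l2[OF test_function_C1(1)[OF t], of a b]
    by eventually_elim auto
  have wdt: "wd a b (restrict_l2 a b \<phi>) (restrict_l2 a b (\<lambda>x. vector_derivative \<phi> (at x)))"
    if "test_function a b \<phi>" for \<phi> using wd_restrict_C1(1)[OF ab test_function_C1(3)[OF that] test_function_C1(2)[OF that]] .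
  have nrm: "ip_norm (H1_ip a b) f = norm (f, g)" if "wd a b f g" for f g
    using that unfolding ip_norm_def H1_ip_def weak_deriv_eq[OF that] wd_def
    by (simp add: l2_ip_eq_cip norm_prod_def power2_norm_eq_inner inner_l2_def)
  show ?thesis
  proof
    assume f: "f \<in> H1_0 a b"
    then obtain g where g: "wd a b f g" unfolding H1_0_def H1_iff_wd by blast
    have "\<exists>G\<in>test_graph a b. dist G (f, g) < e" if e: "e > 0" for e
    proof -
      obtain h \<phi> where h: "h \<in> H1 a b" "test_function a b \<phi>" "represented_by a b h \<phi>" "ip_norm (H1_ip a b) (f - h) < e"
        using f e unfolding H1_0_def by blast
      have h': "h = restrict_l2 a b \<phi>" using rep[OF h(2,1,3)] .
      have "ip_norm (H1_ip a b) (f - h) = norm ((f, g) - (h, restrict_l2 a b (\<lambda>x. vector_derivative \<phi> (at x))))"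
        using nrm[OF wd_diff[OF g wdt[OF h(2)]]] unfolding h' by simp
      then have "dist (h, restrict_l2 a b (\<lambda>x. vector_derivative \<phi> (at x))) (f, g) < e"
        using h(4) by (subst dist_commute) (simp only: dist_norm)
      moreover have "(h, restrict_l2 a b (\<lambda>x. vector_derivative \<phi> (at x))) \<in> test_graph a b"
        using h(2) unfolding h' test_graph_def by blast
      ultimately show ?thesis by blast
    qed
    then show "\<exists>g. wd a b f g \<and> (f, g) \<in> closure (test_graph a b)" using g closure_approachable by blast
  next
    assume "\<exists>g. wd a b f g \<and> (f, g) \<in> closure (test_graph a b)"
    then obtain g where g: "wd a b f g" "(f, g) \<in> closure (test_graph a b)" by blast
    have "\<exists>h\<in>H1 a b. \<exists>\<phi>. test_function a b \<phi> \<and> represented_by a b h \<phi> \<and> ip_norm (H1_ip a b) (f - h) < e" if "e > 0" for e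
    proof -
      obtain \<phi> where t: "test_function a b \<phi>"
        "dist (restrict_l2 a b \<phi>, restrict_l2 a b (\<lambda>x. vector_derivative \<phi> (at x))) (f, g) < e"
        using g(2) \<open>e > 0\<close> unfolding closure_approachable test_graph_def by blast
      have "ip_norm (H1_ip a b) (f - restrict_l2 a b \<phi>) < e"
        using nrm[OF wd_diff[OF g(1) wdt[OF t(1)]]] t(2) by (simp add: dist_norm norm_minus_commute[of "(f, g)"] flip: diff_Pair)
      then show ?thesis using rep'[OF t(1)] wd_H1[OF wdt[OF t(1)]] t(1) by blast
    qed
    then show "f \<in> H1_0 a b" unfolding H1_0_def using wd_H1[OF g(1)] by blast
  qed
qed

definition H1_0_graph :: "real \<Rightarrow> real \<Rightarrow> (l2 \<times> l2) set" where
  "H1_0_graph a b = {(f, g). wd a b f g} \<inter> closure (test_graph a b)"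

lemma complex_subspace_Int: "complex_subspace S \<Longrightarrow> complex_subspace T \<Longrightarrow> complex_subspace (S \<inter> T)"
  unfolding complex_subspace_def by blast

lemma complex_subspace_wd: "complex_subspace {(f, g). wd a b f g}"
  unfolding complex_subspace_def
  by (auto simp: zero_prod_def scaleC_prod_def intro: wd_zero wd_add wd_scaleC)

lemma closed_wd: "closed {(f, g). wd a b f g}"
  unfolding closed_sequential_limits
proof (intro allI impI, elim conjE)
  fix X l assume X: "\<forall>n. X n \<in> {(f, g). wd a b f g}" "X \<longlonglongrightarrow> l"
  have "wd a b (fst l) (snd l)"
    by (rule wd_limit[of _ _ "\<lambda>n. fst (X n)" "\<lambda>n. snd (X n)"]) (use X in \<open>auto simp: split_beta intro: tendsto_fst tendsto_snd\<close>)
  then show "l \<in> {(f, g). wd a b f g}" by (simp add: split_beta)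
qed

lemma H1_0_graph: "complex_subspace (H1_0_graph a b)" "closed (H1_0_graph a b)"
  unfolding H1_0_graph_def
  by (intro complex_subspace_Int complex_subspace_wd complex_subspace_closure_test_graph)
    (intro closed_Int closed_wd closed_closure)

lemma H1_0_iff_graph: "a < b \<Longrightarrow> f \<in> H1_0 a b \<longleftrightarrow> (f, weak_deriv a b f) \<in> H1_0_graph a b"
  using H1_0_iff[of a b f] weak_deriv_eq[of a b f] by (auto simp: H1_0_graph_def)

lemma test_in_H1_0_graph:
  assumes "a < b" "test_function a b \<phi>"
  shows "(restrict_l2 a b \<phi>, restrict_l2 a b (\<lambda>x. vector_derivative \<phi> (at x))) \<in> H1_0_graph a b"
  unfolding H1_0_graph_def
  using wd_restrict_C1(1)[OF assms(1) test_function_C1(3)[OF assms(2)] test_function_C1(2)[OF assms(2)]] assms(2)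
    closure_subset[of "test_graph a b"] by (auto simp: test_graph_def)

lemma Cauchy_if_norm_bound:
  fixes X :: "nat \<Rightarrow> 'a::real_normed_vector" and Y :: "nat \<Rightarrow> 'b::real_normed_vector"
  assumes X: "Cauchy X" and le: "\<And>m n. norm (Y m - Y n) \<le> c * norm (X m - X n)" and c: "c \<ge> 0"
  shows "Cauchy Y"
proof (rule metric_CauchyI)
  fix e :: real assume e: "e > 0"
  obtain N where N: "\<And>m n. m \<ge> N \<Longrightarrow> n \<ge> N \<Longrightarrow> dist (X m) (X n) < e / (c + 1)"
    using metric_CauchyD[OF X, of "e / (c + 1)"] e c by auto
  have "dist (Y m) (Y n) < e" if "m \<ge> N" "n \<ge> N" for m n
  proof -
    have "dist (Y m) (Y n) \<le> (c + 1) * dist (X m) (X n)"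
      using le[of m n] by (simp add: dist_norm distrib_right add_increasing2)
    also have "\<dots> < e" using N[OF that] c by (simp add: pos_less_divide_eq mult.commute)
    finally show ?thesis .
  qed
  then show "\<exists>N. \<forall>m\<ge>N. \<forall>n\<ge>N. dist (Y m) (Y n) < e" by blast
qed

locale thermoelastic_beam =
  fixes p :: beam
  assumes len: "0 < len\<^sub>0 p" "len\<^sub>0 p < len p"
    and pos: "\<rho>\<^sub>0 p > 0" "\<rho>\<^sub>1 p > 0" "\<rho>\<^sub>2 p > 0" "\<alpha>\<^sub>1 p > 0" "\<alpha>\<^sub>2 p > 0" "\<beta>\<^sub>1 p > 0" "\<beta>\<^sub>2 p > 0" "\<kappa> p > 0"
begin

abbreviation "L0 \<equiv> len\<^sub>0 p"
abbreviation "L1 \<equiv> len p"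

text \<open>The derivatives appear as extra coordinates: a condition on such quadruples is closed in
  the product topology, whereas V_1 itself is not closed in \<open>l2 \<times> l2\<close>.\<close>

definition V1_graph :: "(l2 \<times> l2 \<times> l2 \<times> l2) set" where
  "V1_graph = {(u, y, u1, y1). wd 0 L0 u u1 \<and> wd L0 L1 y y1 \<and> val 0 L0 u 0 = 0 \<and> val L0 L1 y L1 = 0 \<and>
     val 0 L0 u L0 = val L0 L1 y L0}"

section \<open>Linearity and closedness of the spaces, and sesquilinear forms in terms of
  \<open>cip\<close>\<close>

lemma complex_subspace_V1_graph: "complex_subspace V1_graph"
  unfolding complex_subspace_def
proof (intro conjI ballI allI)
  show "0 \<in> V1_graph" using len by (simp add: V1_graph_def zero_prod_def wd_zero val_zero)
  show "x + y \<in> V1_graph" if "x \<in> V1_graph" "y \<in> V1_graph" for x y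
    using that len val_add[of 0 L0] val_add[of L0 L1] by (auto simp: V1_graph_def intro!: wd_add)
  show "c *\<^sub>C x \<in> V1_graph" if "x \<in> V1_graph" for c x
    using that len val_scaleC[of 0 L0] val_scaleC[of L0 L1] by (auto simp: V1_graph_def scaleC_prod_def intro!: wd_scaleC)
qed

lemma closed_V1_graph: "closed V1_graph"
  unfolding closed_sequential_limits
proof (intro allI impI, elim conjE)
  fix X l assume X: "\<forall>n. X n \<in> V1_graph" and lim: "X \<longlonglongrightarrow> l"
  define u y u1 y1 where "u n = fst (X n)" and "y n = fst (snd (X n))" and "u1 n = fst (snd (snd (X n)))"
    and "y1 n = snd (snd (snd (X n)))" for n
  have XV: "(u n, y n, u1 n, y1 n) \<in> V1_graph" for n using X by (simp add: u_def y_def u1_def y1_def)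
  obtain U Y U1 Y1 where l: "l = (U, Y, U1, Y1)" by (cases l) auto
  have lims: "u \<longlonglongrightarrow> U" "y \<longlonglongrightarrow> Y" "u1 \<longlonglongrightarrow> U1" "y1 \<longlonglongrightarrow> Y1"
    using tendsto_fst[OF lim] tendsto_fst[OF tendsto_snd[OF lim]] tendsto_fst[OF tendsto_snd[OF tendsto_snd[OF lim]]]
      tendsto_snd[OF tendsto_snd[OF tendsto_snd[OF lim]]]
    by (simp_all add: l u_def[abs_def] y_def[abs_def] u1_def[abs_def] y1_def[abs_def])
  have w: "\<And>n. wd 0 L0 (u n) (u1 n)" "\<And>n. wd L0 L1 (y n) (y1 n)" using XV by (auto simp: V1_graph_def)
  have v: "val 0 L0 (u n) 0 = 0" "val L0 L1 (y n) L1 = 0" "val 0 L0 (u n) L0 = val L0 L1 (y n) L0" for n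
    using XV[of n] by (auto simp: V1_graph_def)
  have vu: "(\<lambda>n. val 0 L0 (u n) x) \<longlonglongrightarrow> val 0 L0 U x" if "x \<in> {0..L0}" for x
    using val_tendsto[OF len(1) w(1) lims(1,3) that] .
  have vy: "(\<lambda>n. val L0 L1 (y n) x) \<longlonglongrightarrow> val L0 L1 Y x" if "x \<in> {L0..L1}" for x
    using val_tendsto[OF len(2) w(2) lims(2,4) that] .
  have "val 0 L0 U 0 = 0" using vu[of 0] len by (simp add: v LIMSEQ_const_iff)
  moreover have "val L0 L1 Y L1 = 0" using vy[of L1] len by (simp add: v LIMSEQ_const_iff)
  moreover have "val 0 L0 U L0 = val L0 L1 Y L0"
    using LIMSEQ_unique[OF vu[of L0]] vy[of L0] len by (simp add: v)
  ultimately show "l \<in> V1_graph"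
    using wd_limit[OF w(1) lims(1,3)] wd_limit[OF w(2) lims(2,4)] by (simp add: V1_graph_def l)
qed

lemma V1_graph_bound:
  assumes "(u, y, u1, y1) \<in> V1_graph"
  shows "norm u \<le> L0 * norm u1" "norm y \<le> (L1 - L0) * norm y1"
  using poincare[OF len(1), of u u1 0] poincare[OF len(2), of y y1 L1] assms len by (auto simp: V1_graph_def)

lemma V1_graphD: "(u, y, u1, y1) \<in> V1_graph \<Longrightarrow> dl p u = u1 \<and> dr p y = y1"
  by (auto simp: V1_graph_def intro: weak_deriv_eq)

lemma V1_iff: "(u, y) \<in> V1 p \<longleftrightarrow> (u, y, dl p u, dr p y) \<in> V1_graph"
  by (auto simp: V1_def V1_graph_def intro: wd_weak_deriv wd_H1)

text \<open>The derivative pair of an element of W_1 obeys the same boundary and transmission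
  conditions as the pair itself, so W_1 is described by \<open>V1_graph\<close> used twice. This
  lets every argument for V_1 be repeated one derivative higher.\<close>

lemma W1_iff: "(u, y) \<in> W1 p \<longleftrightarrow> (u, y, dl p u, dr p y) \<in> V1_graph \<and> (dl p u, dr p y, dl p (dl p u), dr p (dr p y)) \<in> V1_graph"
  unfolding W1_def H2_def using V1_iff by (auto simp: V1_graph_def intro: wd_weak_deriv wd_H1)

lemma W1_V1: "Z \<in> W1 p \<Longrightarrow> Z \<in> V1 p"
  by (cases Z) (simp add: W1_iff V1_iff)

lemma W2_V2: "U \<in> W2 p \<Longrightarrow> U \<in> V2 p"
  using W1_V1 by (auto simp: W2_def V2_def H1_0_def H1_def)

lemmas V1_graph_ops = complex_subspaceD[OF complex_subspace_V1_graph]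

lemma V1_add:
  assumes "(u, y) \<in> V1 p" "(u', y') \<in> V1 p"
  shows "dl p (u + u') = dl p u + dl p u'" "dr p (y + y') = dr p y + dr p y'" "(u + u', y + y') \<in> V1 p"
proof -
  have *: "(u + u', y + y', dl p u + dl p u', dr p y + dr p y') \<in> V1_graph"
    using V1_graph_ops(2)[OF assms[unfolded V1_iff]] by simp
  show "dl p (u + u') = dl p u + dl p u'" "dr p (y + y') = dr p y + dr p y'" using V1_graphD[OF *] by auto
  with * show "(u + u', y + y') \<in> V1 p" by (simp add: V1_iff)
qed

lemma V1_scaleC:
  assumes "(u, y) \<in> V1 p"
  shows "dl p (c *\<^sub>C u) = c *\<^sub>C dl p u" "dr p (c *\<^sub>C y) = c *\<^sub>C dr p y" "(c *\<^sub>C u, c *\<^sub>C y) \<in> V1 p"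
proof -
  have *: "(c *\<^sub>C u, c *\<^sub>C y, c *\<^sub>C dl p u, c *\<^sub>C dr p y) \<in> V1_graph"
    using V1_graph_ops(3)[OF assms[unfolded V1_iff], of c] by (simp add: scaleC_prod_def)
  show "dl p (c *\<^sub>C u) = c *\<^sub>C dl p u" "dr p (c *\<^sub>C y) = c *\<^sub>C dr p y" using V1_graphD[OF *] by auto
  with * show "(c *\<^sub>C u, c *\<^sub>C y) \<in> V1 p" by (simp add: V1_iff)
qed

lemma dV1: "(u, y) \<in> W1 p \<Longrightarrow> (dl p u, dr p y) \<in> V1 p"
  by (simp add: W1_iff V1_iff)

lemma complex_subspace_V1: "complex_subspace (V1 p)"
  unfolding complex_subspace_def
proof (intro conjI ballI allI)
  have "(0, 0, 0, 0) \<in> V1_graph" using V1_graph_ops(1) by (simp add: zero_prod_def)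
  with V1_graphD[OF this] show "0 \<in> V1 p" by (simp add: V1_iff zero_prod_def)
qed (auto simp: scaleC_prod_def V1_add V1_scaleC)

lemma complex_subspace_W1: "complex_subspace (W1 p)"
  unfolding complex_subspace_def
proof (intro conjI ballI allI)
  have "(0, 0, 0, 0) \<in> V1_graph" using V1_graph_ops(1) by (simp add: zero_prod_def)
  with V1_graphD[OF this] show "0 \<in> W1 p" by (simp add: W1_iff zero_prod_def)
  show "x + y \<in> W1 p" if "x \<in> W1 p" "y \<in> W1 p" for x y
  proof -
    obtain u z u' z' where xy: "x = (u, z)" "y = (u', z')" by (cases x, cases y) auto
    have V: "(u, z) \<in> V1 p" "(u', z') \<in> V1 p" "(dl p u, dr p z) \<in> V1 p" "(dl p u', dr p z') \<in> V1 p"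
      using that W1_V1 dV1 by (auto simp: xy)
    show ?thesis
      using V1_add[OF V(1,2)] V1_add[OF V(3,4)] by (simp add: xy W1_iff V1_iff)
  qed
  show "c *\<^sub>C x \<in> W1 p" if "x \<in> W1 p" for c x
  proof -
    obtain u z where x: "x = (u, z)" by (cases x) auto
    have V: "(u, z) \<in> V1 p" "(dl p u, dr p z) \<in> V1 p" using that W1_V1 dV1 by (auto simp: x)
    show ?thesis
      using V1_scaleC[OF V(1), of c] V1_scaleC[OF V(2), of c] by (simp add: x scaleC_prod_def W1_iff V1_iff)
  qed
qed

lemma complex_subspace_H1_0: "complex_subspace (H1_0 0 L0)"
  and H1_0_add: "\<theta> \<in> H1_0 0 L0 \<Longrightarrow> \<theta>' \<in> H1_0 0 L0 \<Longrightarrow> dl p (\<theta> + \<theta>') = dl p \<theta> + dl p \<theta>'"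
  and H1_0_scaleC: "\<theta> \<in> H1_0 0 L0 \<Longrightarrow> dl p (c *\<^sub>C \<theta>) = c *\<^sub>C dl p \<theta>"
proof -
  note iff = H1_0_iff_graph[OF len(1)] and ops = complex_subspaceD[OF H1_0_graph(1)[of 0 L0]]
  have W: "wd 0 L0 f g" if "(f, g) \<in> H1_0_graph 0 L0" for f g using that by (simp add: H1_0_graph_def)
  have add: "(\<theta> + \<theta>', dl p \<theta> + dl p \<theta>') \<in> H1_0_graph 0 L0" if "\<theta> \<in> H1_0 0 L0" "\<theta>' \<in> H1_0 0 L0" for \<theta> \<theta>'
    using ops(2)[of "(\<theta>, dl p \<theta>)" "(\<theta>', dl p \<theta>')"] that by (simp add: iff)
  have scale: "(c *\<^sub>C \<theta>, c *\<^sub>C dl p \<theta>) \<in> H1_0_graph 0 L0" if "\<theta> \<in> H1_0 0 L0" for c \<theta>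
    using ops(3)[of "(\<theta>, dl p \<theta>)" c] that by (simp add: iff scaleC_prod_def)
  have zero: "(0, 0) \<in> H1_0_graph 0 L0" using ops(1) by (simp add: zero_prod_def)
  show add': "dl p (\<theta> + \<theta>') = dl p \<theta> + dl p \<theta>'" if "\<theta> \<in> H1_0 0 L0" "\<theta>' \<in> H1_0 0 L0" for \<theta> \<theta>'
    using weak_deriv_eq[OF W[OF add[OF that]]] .
  show scale': "dl p (c *\<^sub>C \<theta>) = c *\<^sub>C dl p \<theta>" if "\<theta> \<in> H1_0 0 L0" for c \<theta>
    using weak_deriv_eq[OF W[OF scale[OF that]]] .
  show "complex_subspace (H1_0 0 L0)"
    unfolding complex_subspace_def
    using add scale zero weak_deriv_eq[OF W[OF zero]] by (auto simp: iff add'[unfolded iff] scale'[unfolded iff])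
qed

lemma complex_subspace_L2: "complex_subspace (L2 a b)"
  unfolding complex_subspace_def using subspace_0[OF L2_subspace] subspace_add[OF L2_subspace] L2_scaleC by blast

lemma complex_subspace_V2: "complex_subspace (V2 p)"
proof -
  note ops = complex_subspaceD[OF complex_subspace_V1] complex_subspaceD[OF complex_subspace_L2[of 0 L0]]
  show ?thesis unfolding complex_subspace_def V2_def using ops
    by (auto simp: zero_prod_def scaleC_prod_def)
qed

lemma complex_subspace_W2: "complex_subspace (W2 p)"
proof -
  note ops = complex_subspaceD[OF complex_subspace_W1] complex_subspaceD[OF complex_subspace_H1_0]
  show ?thesis unfolding complex_subspace_def W2_def using ops
    by (auto simp: zero_prod_def scaleC_prod_def)
qed

text \<open>The square roots of the coefficients make the standard inner product of the image equal
  to the real part of the form \<open>a\<close>. No lower derivatives are recorded; the Poincare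
  inequality recovers them.\<close>

definition JW :: "l2 \<times> l2 \<Rightarrow> l2 \<times> l2" where
  "JW = (\<lambda>(u, y). (sqrt (\<beta>\<^sub>1 p) *\<^sub>R dl p (dl p u), sqrt (\<beta>\<^sub>2 p) *\<^sub>R dr p (dr p y)))"

definition JV :: "l2 \<times> l2 \<times> l2 \<Rightarrow> l2 \<times> l2 \<times> l2 \<times> l2 \<times> l2" where
  "JV = (\<lambda>(v, z, \<theta>). (sqrt (\<rho>\<^sub>1 p) *\<^sub>R v, sqrt (\<alpha>\<^sub>1 p) *\<^sub>R dl p v, sqrt (\<rho>\<^sub>2 p) *\<^sub>R z, sqrt (\<alpha>\<^sub>2 p) *\<^sub>R dr p z, sqrt (\<rho>\<^sub>0 p) *\<^sub>R \<theta>))"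

lemma JW_linear:
  assumes "Z \<in> W1 p" "Z' \<in> W1 p"
  shows "JW (Z + Z') = JW Z + JW Z'" "JW (c *\<^sub>C Z) = c *\<^sub>C JW Z"
proof -
  obtain u y u' y' where Z: "Z = (u, y)" "Z' = (u', y')" by (cases Z, cases Z') auto
  have V: "(u, y) \<in> V1 p" "(u', y') \<in> V1 p" "(dl p u, dr p y) \<in> V1 p" "(dl p u', dr p y') \<in> V1 p"
    using assms W1_V1 dV1 by (auto simp: Z)
  show "JW (Z + Z') = JW Z + JW Z'"
    using V1_add[OF V(1,2)] V1_add[OF V(3,4)] by (simp add: Z JW_def scaleR_add_right)
  show "JW (c *\<^sub>C Z) = c *\<^sub>C JW Z"
    using V1_scaleC[OF V(1), of c] V1_scaleC[OF V(3), of c]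
    by (simp add: Z JW_def scaleC_prod_def scaleR_scaleC scaleC_scaleC mult.commute)
qed

lemma JV_linear:
  assumes "U \<in> V2 p" "U' \<in> V2 p"
  shows "JV (U + U') = JV U + JV U'" "JV (c *\<^sub>C U) = c *\<^sub>C JV U"
proof -
  obtain u y \<theta> u' y' \<theta>' where U: "U = (u, y, \<theta>)" "U' = (u', y', \<theta>')" by (cases U, cases U') auto
  have V: "(u, y) \<in> V1 p" "(u', y') \<in> V1 p" using assms by (auto simp: U V2_def)
  show "JV (U + U') = JV U + JV U'"
    using V1_add[OF V] by (simp add: U JV_def scaleR_add_right)
  show "JV (c *\<^sub>C U) = c *\<^sub>C JV U"
    using V1_scaleC[OF V(1), of c]
    by (simp add: U JV_def scaleC_prod_def scaleR_scaleC scaleC_scaleC mult.commute)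
qed

lemma V1_L2: "(u, y) \<in> V1 p \<Longrightarrow> u \<in> L2 0 L0 \<and> y \<in> L2 L0 L1 \<and> dl p u \<in> L2 0 L0 \<and> dr p y \<in> L2 L0 L1"
  unfolding V1_iff by (simp add: V1_graph_def wd_def)

lemma form_c_cip:
  assumes "(u, y, \<theta>) \<in> V2 p"
  shows "form_c p (u, y, \<theta>) (u', y', \<theta>') =
    (\<rho>\<^sub>1 p * cip u u' + \<alpha>\<^sub>1 p * cip (dl p u) (dl p u')) + (\<rho>\<^sub>2 p * cip y y' + \<alpha>\<^sub>2 p * cip (dr p y) (dr p y')) + \<rho>\<^sub>0 p * cip \<theta> \<theta>'"
  using assms V1_L2[of u y] by (simp add: form_c_def V2_def l2_ip_eq_cip)

lemma form_a_cip:
  assumes "(u, y) \<in> W1 p"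
  shows "form_a p (u, y) (u', y') = \<beta>\<^sub>1 p * cip (dl p (dl p u)) (dl p (dl p u')) + \<beta>\<^sub>2 p * cip (dr p (dr p y)) (dr p (dr p y'))"
  using V1_L2[OF dV1[OF assms]] by (simp add: form_a_def l2_ip_eq_cip)

lemma form_b_cip:
  assumes "(u, y, \<theta>) \<in> W2 p"
  shows "form_b p (u, y, \<theta>) (u', y', \<theta>') =
    \<gamma> p * (cip (dl p u) (dl p \<theta>') - cip (dl p \<theta>) (dl p u')) + \<kappa> p * cip (dl p \<theta>) (dl p \<theta>')"
proof -
  have "(u, y) \<in> V1 p" using assms W1_V1 by (simp add: W2_def)
  moreover have "(\<theta>, dl p \<theta>) \<in> H1_0_graph 0 L0" using assms H1_0_iff_graph[OF len(1)] by (simp add: W2_def)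
  ultimately show ?thesis using V1_L2[of u y] by (simp add: form_b_def l2_ip_eq_cip H1_0_graph_def wd_def)
qed

lemma sqrt_mult_sqrt_mult: "0 < r \<Longrightarrow> sqrt r * (sqrt r * x) = r * x"
  by (simp add: mult.assoc[symmetric])

lemma Re_form_c: "U \<in> V2 p \<Longrightarrow> Re (form_c p U U') = inner (JV U) (JV U')"
  using pos by (cases U, cases U') (simp add: form_c_cip JV_def inner_prod_def inner_l2_def cip_scaleR_left cip_scaleR_right sqrt_mult_sqrt_mult)

lemma Re_form_a: "Z \<in> W1 p \<Longrightarrow> Re (form_a p Z Z') = inner (JW Z) (JW Z')"
  using pos by (cases Z, cases Z') (simp add: form_a_cip JW_def inner_prod_def inner_l2_def cip_scaleR_left cip_scaleR_right sqrt_mult_sqrt_mult)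

lemma JV_zero: "U \<in> V2 p \<Longrightarrow> JV U = 0 \<Longrightarrow> U = 0"
  using pos by (cases U) (auto simp: JV_def zero_prod_def)

text \<open>Poincare twice: vanishing second derivatives kill the first derivatives, and these kill
  the functions.\<close>

lemma JW_zero:
  assumes "Z \<in> W1 p" "JW Z = 0" shows "Z = 0"
proof -
  obtain u y where Z: "Z = (u, y)" by (cases Z) auto
  have d2: "dl p (dl p u) = 0" "dr p (dr p y) = 0" using assms pos by (auto simp: Z JW_def zero_prod_def)
  have V: "(u, y, dl p u, dr p y) \<in> V1_graph" "(dl p u, dr p y, 0, 0) \<in> V1_graph"
    using assms(1) unfolding Z W1_iff d2 by blast+
  have d1: "dl p u = 0" "dr p y = 0" using V1_graph_bound[OF V(2)] by simp_all
  show ?thesis using V1_graph_bound[OF V(1)] unfolding d1 by (simp add: Z zero_prod_def)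
qed

lemma closed_JV: "closed (JV ` V2 p)"
proof -
  define g :: "l2 \<times> l2 \<times> l2 \<times> l2 \<times> l2 \<Rightarrow> l2 \<times> l2 \<times> l2 \<times> l2" where
    "g x = ((1 / sqrt (\<rho>\<^sub>1 p)) *\<^sub>R fst x, (1 / sqrt (\<rho>\<^sub>2 p)) *\<^sub>R fst (snd (snd x)), (1 / sqrt (\<alpha>\<^sub>1 p)) *\<^sub>R fst (snd x),
        (1 / sqrt (\<alpha>\<^sub>2 p)) *\<^sub>R fst (snd (snd (snd x))))" for x
  define h :: "l2 \<times> l2 \<times> l2 \<times> l2 \<times> l2 \<Rightarrow> l2" where "h x = (1 / sqrt (\<rho>\<^sub>0 p)) *\<^sub>R snd (snd (snd (snd x)))" for x
  have "JV ` V2 p = g -` V1_graph \<inter> h -` L2 0 L0"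
  proof (intro equalityI subsetI)
    fix x assume "x \<in> JV ` V2 p"
    then show "x \<in> g -` V1_graph \<inter> h -` L2 0 L0" using pos by (auto simp: g_def h_def JV_def V2_def V1_iff)
  next
    fix x assume x: "x \<in> g -` V1_graph \<inter> h -` L2 0 L0"
    let ?U = "(fst (g x), fst (snd (g x)), h x)"
    have gx: "g x = (fst (g x), fst (snd (g x)), fst (snd (snd (g x))), snd (snd (snd (g x))))" by simp
    then have "(fst (g x), fst (snd (g x)), fst (snd (snd (g x))), snd (snd (snd (g x)))) \<in> V1_graph" using x by auto
    from V1_graphD[OF this] this have "?U \<in> V2 p" "JV ?U = x"
      using x pos by (auto simp: V2_def V1_iff JV_def g_def h_def prod_eq_iff)
    then show "x \<in> JV ` V2 p" by (metis imageI)
  qed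
  moreover have "continuous_on UNIV g" "continuous_on UNIV h"
    unfolding g_def[abs_def] h_def[abs_def] by (intro continuous_intros)+
  ultimately show ?thesis using closed_V1_graph L2_closed by (auto intro!: closed_Int closed_vimage)
qed

text \<open>Convergence is given for the second derivatives only. Poincare makes the first
  derivatives and then the functions Cauchy, after which \<open>closed_V1_graph\<close> is applied
  on both levels.\<close>

lemma closed_JW: "closed (JW ` W1 p)"
  unfolding closed_sequential_limits
proof (intro allI impI, elim conjE)
  fix X l assume "\<forall>n. X n \<in> JW ` W1 p" and lim: "X \<longlonglongrightarrow> l"
  then have "\<forall>n. \<exists>u y. (u, y) \<in> W1 p \<and> X n = JW (u, y)" by fast
  then obtain u y where W: "\<And>n. (u n, y n) \<in> W1 p" and X: "\<And>n. X n = JW (u n, y n)" by metis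
  define u2 y2 where "u2 n = dl p (dl p (u n))" and "y2 n = dr p (dr p (y n))" for n
  have V: "(u n, y n, dl p (u n), dr p (y n)) \<in> V1_graph" "(dl p (u n), dr p (y n), u2 n, y2 n) \<in> V1_graph" for n
    using W by (auto simp: W1_iff u2_def y2_def)
  define U2 Y2 where "U2 = (1 / sqrt (\<beta>\<^sub>1 p)) *\<^sub>R fst l" and "Y2 = (1 / sqrt (\<beta>\<^sub>2 p)) *\<^sub>R snd l"
  have u2: "u2 = (\<lambda>n. (1 / sqrt (\<beta>\<^sub>1 p)) *\<^sub>R fst (X n))" and y2: "y2 = (\<lambda>n. (1 / sqrt (\<beta>\<^sub>2 p)) *\<^sub>R snd (X n))"
    using pos by (auto simp: X JW_def u2_def y2_def)
  have lim2: "u2 \<longlonglongrightarrow> U2" "y2 \<longlonglongrightarrow> Y2"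
    unfolding U2_def Y2_def u2 y2 by (intro tendsto_scaleR tendsto_const tendsto_fst tendsto_snd lim)+
  have diff: "norm (u n - u m) \<le> L0 * norm (dl p (u n) - dl p (u m))" "norm (y n - y m) \<le> (L1 - L0) * norm (dr p (y n) - dr p (y m))"
    "norm (dl p (u n) - dl p (u m)) \<le> L0 * norm (u2 n - u2 m)" "norm (dr p (y n) - dr p (y m)) \<le> (L1 - L0) * norm (y2 n - y2 m)"
    for n m
    using V1_graph_bound V1_graph_ops(5)[OF V(1)[of n] V(1)[of m]] V1_graph_ops(5)[OF V(2)[of n] V(2)[of m]] by auto
  have C1: "Cauchy (\<lambda>n. dl p (u n))" "Cauchy (\<lambda>n. dr p (y n))"
    using Cauchy_if_norm_bound[OF LIMSEQ_imp_Cauchy[OF lim2(1)] diff(3)] Cauchy_if_norm_bound[OF LIMSEQ_imp_Cauchy[OF lim2(2)] diff(4)] len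
    by auto
  have C0: "Cauchy u" "Cauchy y"
    using Cauchy_if_norm_bound[OF C1(1) diff(1)] Cauchy_if_norm_bound[OF C1(2) diff(2)] len by auto
  obtain U1 Y1 U Y where lims: "(\<lambda>n. dl p (u n)) \<longlonglongrightarrow> U1" "(\<lambda>n. dr p (y n)) \<longlonglongrightarrow> Y1" "u \<longlonglongrightarrow> U" "y \<longlonglongrightarrow> Y"
    using C1 C0 by (auto simp: Cauchy_convergent_iff convergent_def)
  have VU: "(U, Y, U1, Y1) \<in> V1_graph" "(U1, Y1, U2, Y2) \<in> V1_graph"
  proof -
    have "(\<lambda>n. (u n, y n, dl p (u n), dr p (y n))) \<longlonglongrightarrow> (U, Y, U1, Y1)" by (intro tendsto_Pair lims)
    then show "(U, Y, U1, Y1) \<in> V1_graph" by (rule closed_sequentially[OF closed_V1_graph, rotated]) (use V(1) in simp)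
    have "(\<lambda>n. (dl p (u n), dr p (y n), u2 n, y2 n)) \<longlonglongrightarrow> (U1, Y1, U2, Y2)" by (intro tendsto_Pair lims lim2)
    then show "(U1, Y1, U2, Y2) \<in> V1_graph" by (rule closed_sequentially[OF closed_V1_graph, rotated]) (use V(2) in simp)
  qed
  from V1_graphD[OF VU(1)] V1_graphD[OF VU(2)] VU have "(U, Y) \<in> W1 p" "JW (U, Y) = l"
    using pos by (auto simp: W1_iff JW_def U2_def Y2_def prod_eq_iff)
  then show "l \<in> JW ` W1 p" by (metis imageI)
qed

end

lemma norm_scaleC_prod:
  fixes z :: "'a::{complex_vector,real_normed_vector} \<times> 'b::{complex_vector,real_normed_vector}"
  assumes "\<And>x::'a. norm (c *\<^sub>C x) = cmod c * norm x" "\<And>x::'b. norm (c *\<^sub>C x) = cmod c * norm x"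
  shows "norm (c *\<^sub>C z) = cmod c * norm z"
proof -
  have "(cmod c * norm (fst z))\<^sup>2 + (cmod c * norm (snd z))\<^sup>2 = (cmod c)\<^sup>2 * ((norm (fst z))\<^sup>2 + (norm (snd z))\<^sup>2)"
    by (simp add: power_mult_distrib distrib_left)
  then show ?thesis by (simp add: norm_prod_def scaleC_prod_def assms real_sqrt_mult)
qed

lemma scaleC_zero_left: "0 *\<^sub>C x = (0 :: 'a::complex_vector)"
  using scaleR_scaleC[of 0 x] by simp

text \<open>The real part of \<open>F (\<i> *\<^sub>C U)\<close> is the imaginary part of
  \<open>F U\<close>, so the real parts determine the functional. All real Hilbert space results
  return to the complex setting through this.\<close>

lemma antilinear_eqI:
  assumes S: "\<And>U. U \<in> S \<Longrightarrow> \<i> *\<^sub>C U \<in> S"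
    and F: "\<And>U. U \<in> S \<Longrightarrow> F (\<i> *\<^sub>C U) = - \<i> * F U" and G: "\<And>U. U \<in> S \<Longrightarrow> G (\<i> *\<^sub>C U) = - \<i> * G U"
    and Re: "\<And>U. U \<in> S \<Longrightarrow> Re (F U) = Re (G U)" and U: "U \<in> S"
  shows "F U = G U"
proof (rule complex_eqI)
  show "Re (F U) = Re (G U)" using Re[OF U] .
  show "Im (F U) = Im (G U)" using Re[OF S[OF U]] by (simp add: F[OF U] G[OF U])
qed

lemma test_function_deriv:
  assumes "test_function a b \<phi>" shows "test_function a b (\<lambda>x. vector_derivative \<phi> (at x))"
proof -
  let ?D = "\<lambda>f x. vector_derivative f (at x) :: complex"
  have "(?D ^^ k) (?D \<phi>) differentiable_on UNIV" for k
  proof -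
    have "(?D ^^ Suc k) \<phi> differentiable_on UNIV" using assms unfolding test_function_def by blast
    then show ?thesis by (simp only: funpow_Suc_right o_apply)
  qed
  moreover obtain c d where cd: "a < c" "d < b" "\<And>x. x \<notin> {c..d} \<Longrightarrow> \<phi> x = 0"
    using assms unfolding test_function_def by blast
  have "?D \<phi> x = 0" if "x \<notin> {c..d}" for x
  proof -
    have "((\<lambda>_. 0) has_vector_derivative 0) (at x)" by simp
    then have "(\<phi> has_vector_derivative 0) (at x)"
      by (rule has_vector_derivative_transform_within_open[where S = "- {c..d}"]) (use that cd(3) in auto)
    then show ?thesis by (rule vector_derivative_at)
  qed
  ultimately show ?thesis unfolding test_function_def using cd(1,2) by blast
qed

lemma L2_mono:
  assumes "f \<in> L2 a b" "a' \<le> a" "b \<le> b'" shows "f \<in> L2 a' b'"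
  using assms(1) unfolding L2_def mem_Collect_eq vanishes_off_rep
  by (rule eventually_mono) (use assms(2,3) in auto)

lemma cip_disjoint:
  assumes "f \<in> L2 a b" "g \<in> L2 b c" shows "cip f g = 0" "cip g f = 0"
proof -
  have "AE x in lborel. x \<notin> {a<..<b} \<longrightarrow> rep_l2 f x = 0" "AE x in lborel. x \<notin> {b<..<c} \<longrightarrow> rep_l2 g x = 0"
    using assms by (simp_all only: L2_def mem_Collect_eq vanishes_off_rep)
  then have "AE x in lborel. rep_l2 f x * cnj (rep_l2 g x) = 0"
  proof eventually_elim
    case (elim x)
    then show ?case by (cases "x < b") auto
  qed
  then have "cip f g = integral\<^sup>L lborel (\<lambda>_::real. 0)" by (rule cip_AE_cong) simp
  then show "cip f g = 0" by simp
  then show "cip g f = 0" by (subst cip_commute) simp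
qed

lemma cip_restrict_subinterval:
  assumes f: "f \<in> L2 a b" and sub: "a' \<le> a" "b \<le> b'" and \<phi>: "continuous_on UNIV \<phi>"
  shows "cip f (restrict_l2 a' b' \<phi>) = cip f (restrict_l2 a b \<phi>)"
proof -
  have v: "AE x in lborel. x \<notin> {a<..<b} \<longrightarrow> rep_l2 f x = 0"
    using f by (simp_all only: L2_def mem_Collect_eq vanishes_off_rep)
  show ?thesis unfolding cip_def[of f "restrict_l2 a b \<phi>"]
  proof (rule cip_AE_cong)
    show "AE x in lborel. rep_l2 f x * cnj (rep_l2 (restrict_l2 a' b' \<phi>) x) = rep_l2 f x * cnj (rep_l2 (restrict_l2 a b \<phi>) x)"
      using v rep_restrict_l2[OF \<phi>, of a b] rep_restrict_l2[OF \<phi>, of a' b']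
      by eventually_elim (use sub in \<open>auto simp: indicator_def\<close>)
  qed measurable
qed

lemma val_subinterval:
  assumes ab: "a < b" "a' \<le> a" "b \<le> b'" and w: "wd a' b' w w'"
    and ae: "AE x in lborel. x \<in> {a<..<b} \<longrightarrow> rep_l2 f x = rep_l2 w x" and x: "x \<in> {a..b}"
  shows "val a b f x = val a' b' w x"
proof (rule val_eqI[OF ab(1) _ _ x])
  have ab': "a' < b'" using ab by simp
  show "continuous_on {a..b} (val a' b' w)"
    by (rule continuous_on_subset[OF wd_val(3)[OF ab' w]]) (use ab in auto)
  show "AE x in lborel. x \<in> {a<..<b} \<longrightarrow> rep_l2 f x = val a' b' w x"
    using ae wd_val(2)[OF ab' w] by eventually_elim (use ab in auto)
qed

context thermoelastic_beam
begin

section \<open>Sesquilinearity of the forms and the Riesz isomorphism of V_2\<close>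

lemma form_c_right:
  assumes "U \<in> V2 p" "U' \<in> V2 p" "U'' \<in> V2 p"
  shows "form_c p U (U' + U'') = form_c p U U' + form_c p U U''" "form_c p U (c *\<^sub>C U') = cnj c * form_c p U U'"
proof -
  obtain u y t u' y' t' u'' y'' t'' where U: "U = (u, y, t)" "U' = (u', y', t')" "U'' = (u'', y'', t'')"
    by (cases U, cases U', cases U'') auto
  have V: "(u', y') \<in> V1 p" "(u'', y'') \<in> V1 p" using assms by (auto simp: U V2_def)
  show "form_c p U (U' + U'') = form_c p U U' + form_c p U U''"
    using assms V1_add[OF V] by (simp add: U form_c_cip cip_add_right algebra_simps)
  show "form_c p U (c *\<^sub>C U') = cnj c * form_c p U U'"
    using assms V1_scaleC[OF V(1), of c] by (simp add: U scaleC_prod_def form_c_cip cip_scaleC_right algebra_simps)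
qed

lemma form_c_left:
  assumes "U \<in> V2 p" "U' \<in> V2 p"
  shows "form_c p (U + U') W = form_c p U W + form_c p U' W" "form_c p (c *\<^sub>C U) W = c * form_c p U W"
proof -
  obtain u y t u' y' t' u'' y'' t'' where U: "U = (u, y, t)" "U' = (u', y', t')" "W = (u'', y'', t'')"
    by (cases U, cases U', cases W) auto
  have V: "(u, y) \<in> V1 p" "(u', y') \<in> V1 p" using assms by (auto simp: U V2_def)
  have V2: "U + U' \<in> V2 p" "c *\<^sub>C U \<in> V2 p" using complex_subspaceD[OF complex_subspace_V2] assms by blast+
  show "form_c p (U + U') W = form_c p U W + form_c p U' W"
    using assms V2(1) V1_add[OF V] by (simp add: U form_c_cip cip_add_left algebra_simps)
  show "form_c p (c *\<^sub>C U) W = c * form_c p U W"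
    using assms V2(2) V1_scaleC[OF V(1), of c] by (simp add: U scaleC_prod_def form_c_cip cip_scaleC_left algebra_simps)
qed

lemma form_a_right:
  assumes "Z \<in> W1 p" "Z' \<in> W1 p" shows "form_a p Z (c *\<^sub>C Z') = cnj c * form_a p Z Z'"
proof -
  obtain u y u' y' where Z: "Z = (u, y)" "Z' = (u', y')" by (cases Z, cases Z') auto
  have V: "(u', y') \<in> V1 p" "(dl p u', dr p y') \<in> V1 p" using assms W1_V1 dV1 by (auto simp: Z)
  show ?thesis using assms V1_scaleC[OF V(1), of c] V1_scaleC[OF V(2), of c]
    by (simp add: Z scaleC_prod_def form_a_cip cip_scaleC_right algebra_simps)
qed

lemma form_a_left:
  assumes "Z \<in> W1 p" "Z' \<in> W1 p"
  shows "form_a p (Z + Z') X = form_a p Z X + form_a p Z' X" "form_a p (c *\<^sub>C Z) X = c * form_a p Z X"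
proof -
  obtain u y u' y' u'' y'' where Z: "Z = (u, y)" "Z' = (u', y')" "X = (u'', y'')" by (cases Z, cases Z', cases X) auto
  have V: "(u, y) \<in> V1 p" "(u', y') \<in> V1 p" "(dl p u, dr p y) \<in> V1 p" "(dl p u', dr p y') \<in> V1 p"
    using assms W1_V1 dV1 by (auto simp: Z)
  have W: "Z + Z' \<in> W1 p" "c *\<^sub>C Z \<in> W1 p" using complex_subspaceD[OF complex_subspace_W1] assms by blast+
  show "form_a p (Z + Z') X = form_a p Z X + form_a p Z' X"
    using assms W(1) V1_add[OF V(1,2)] V1_add[OF V(3,4)] by (simp add: Z form_a_cip cip_add_left algebra_simps)
  show "form_a p (c *\<^sub>C Z) X = c * form_a p Z X"
    using assms W(2) V1_scaleC[OF V(1), of c] V1_scaleC[OF V(3), of c]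
    by (simp add: Z scaleC_prod_def form_a_cip cip_scaleC_left algebra_simps)
qed

lemma form_b_right:
  assumes "U \<in> W2 p" "U' \<in> W2 p" shows "form_b p U (c *\<^sub>C U') = cnj c * form_b p U U'"
proof -
  obtain u y t u' y' t' where U: "U = (u, y, t)" "U' = (u', y', t')" by (cases U, cases U') auto
  have V: "(u', y') \<in> V1 p" "t' \<in> H1_0 0 L0" using assms W1_V1 by (auto simp: U W2_def)
  show ?thesis using assms V1_scaleC[OF V(1), of c] H1_0_scaleC[OF V(2), of c]
    by (simp add: U scaleC_prod_def form_b_cip cip_scaleC_right algebra_simps)
qed

lemma form_b_left:
  assumes "U \<in> W2 p" "U' \<in> W2 p"
  shows "form_b p (U + U') W = form_b p U W + form_b p U' W" "form_b p (c *\<^sub>C U) W = c * form_b p U W"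
proof -
  obtain u y t u' y' t' u'' y'' t'' where U: "U = (u, y, t)" "U' = (u', y', t')" "W = (u'', y'', t'')"
    by (cases U, cases U', cases W) auto
  have V: "(u, y) \<in> V1 p" "(u', y') \<in> V1 p" "t \<in> H1_0 0 L0" "t' \<in> H1_0 0 L0" using assms W1_V1 by (auto simp: U W2_def)
  have W2: "U + U' \<in> W2 p" "c *\<^sub>C U \<in> W2 p" using complex_subspaceD[OF complex_subspace_W2] assms by blast+
  show "form_b p (U + U') W = form_b p U W + form_b p U' W"
    using assms W2(1) V1_add[OF V(1,2)] H1_0_add[OF V(3,4)] by (simp add: U form_b_cip cip_add_left cip_add_right algebra_simps)
  show "form_b p (c *\<^sub>C U) W = c * form_b p U W"
    using assms W2(2) V1_scaleC[OF V(1), of c] H1_0_scaleC[OF V(3), of c]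
    by (simp add: U scaleC_prod_def form_b_cip cip_scaleC_left algebra_simps)
qed

lemmas V2_ops = complex_subspaceD[OF complex_subspace_V2]
lemmas W1_ops = complex_subspaceD[OF complex_subspace_W1]
lemmas W2_ops = complex_subspaceD[OF complex_subspace_W2]

lemma JV_scaleR: "U \<in> V2 p \<Longrightarrow> JV (r *\<^sub>R U) = r *\<^sub>R JV U"
  using JV_linear(2)[of U U "complex_of_real r"] by (simp add: scaleR_scaleC)

lemma JW_scaleR: "Z \<in> W1 p \<Longrightarrow> JW (r *\<^sub>R Z) = r *\<^sub>R JW Z"
  using JW_linear(2)[of Z Z "complex_of_real r"] by (simp add: scaleR_scaleC)

lemma inj_JV: "inj_on JV (V2 p)"
proof (rule inj_onI)
  fix U U' assume U: "U \<in> V2 p" "U' \<in> V2 p" "JV U = JV U'"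
  have "JV (U - U' + U') = JV (U - U') + JV U'" using U V2_ops by (intro JV_linear) auto
  then have "JV (U - U') = 0" using U(3) by simp
  then show "U = U'" using JV_zero[of "U - U'"] U V2_ops(5) by simp
qed

lemma ip_norm_form_c: "U \<in> V2 p \<Longrightarrow> ip_norm (form_c p) U = norm (JV U)"
  by (simp add: ip_norm_def Re_form_c norm_eq_sqrt_inner)

lemma op_C_in_dual:
  assumes U: "U \<in> V2 p" shows "op_C p U \<in> V2_dual p"
proof -
  \<comment> \<open>The second summand accounts for imaginary parts, since
    \<open>Im (form_c p U X)\<close> is the real part with \<open>(- \<i>) *\<^sub>C U\<close> in
    place of \<open>U\<close>.\<close>
  define K where "K = norm (JV U) + norm (JV ((- \<i>) *\<^sub>C U))"
  have "cmod (form_c p U X) \<le> K * ip_norm (form_c p) X" if X: "X \<in> V2 p" for X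
  proof -
    have "\<bar>Re (form_c p U X)\<bar> \<le> norm (JV U) * norm (JV X)"
      unfolding Re_form_c[OF U] by (rule Cauchy_Schwarz_ineq2)
    moreover have "\<bar>Im (form_c p U X)\<bar> \<le> norm (JV ((- \<i>) *\<^sub>C U)) * norm (JV X)"
    proof -
      have "Im (form_c p U X) = Re (form_c p ((- \<i>) *\<^sub>C U) X)" by (simp add: form_c_left(2)[OF U U])
      also have "\<dots> = inner (JV ((- \<i>) *\<^sub>C U)) (JV X)" by (rule Re_form_c[OF V2_ops(3)[OF U]])
      finally show ?thesis by (simp add: Cauchy_Schwarz_ineq2)
    qed
    ultimately show ?thesis
      using cmod_le[of "form_c p U X"] unfolding ip_norm_form_c[OF X] K_def distrib_right by linarith
  qed
  then have "\<forall>X\<in>V2 p. cmod (op_C p U X) \<le> K * ip_norm (form_c p) X" by (simp add: op_C_def)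
  moreover have "antilinear_on (V2 p) (op_C p U)"
    unfolding antilinear_on_def
  proof (intro conjI ballI allI)
    show "op_C p U (x + y) = op_C p U x + op_C p U y" if "x \<in> V2 p" "y \<in> V2 p" for x y
      using that form_c_right(1)[OF U that] V2_ops(2)[OF that] by (simp only: op_C_def restrict_apply' if_True)
    show "op_C p U (c *\<^sub>C x) = cnj c * op_C p U x" if "x \<in> V2 p" for c x
      using that form_c_right(2)[OF U that that, of c] V2_ops(3)[OF that, of c] by (simp only: op_C_def restrict_apply')
  qed
  moreover have "op_C p U \<in> extensional (V2 p)" by (simp add: op_C_def)
  ultimately show ?thesis unfolding V2_dual_def antidual_def by blast
qed

lemma riesz_V2:
  assumes F: "F \<in> V2_dual p"
  obtains V where "V \<in> V2 p" "F = op_C p V"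
proof -
  have ext: "F \<in> extensional (V2 p)" and add: "\<And>U X. U \<in> V2 p \<Longrightarrow> X \<in> V2 p \<Longrightarrow> F (U + X) = F U + F X"
    and scale: "\<And>c U. U \<in> V2 p \<Longrightarrow> F (c *\<^sub>C U) = cnj c * F U"
    using F unfolding V2_dual_def antidual_def antilinear_on_def by auto
  obtain K where "\<forall>U\<in>V2 p. cmod (F U) \<le> K * ip_norm (form_c p) U"
    using F unfolding V2_dual_def antidual_def by blast
  then have K: "cmod (F U) \<le> K * norm (JV U)" if "U \<in> V2 p" for U
    using that unfolding ip_norm_form_c[OF that, symmetric] by blast
  define f where "f x = Re (F (inv_into (V2 p) JV x))" for x
  have fJ: "f (JV U) = Re (F U)" if "U \<in> V2 p" for U
    unfolding f_def using inv_into_f_f[OF inj_JV that] by simp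
  have sub: "subspace (JV ` V2 p)"
    unfolding subspace_def
  proof (intro conjI ballI allI)
    have "JV 0 = 0" using JV_scaleR[OF V2_ops(1), of 0] by simp
    then show "0 \<in> JV ` V2 p" using imageI[OF V2_ops(1), of JV] by simp
    fix x y and c :: real assume x: "x \<in> JV ` V2 p" and y: "y \<in> JV ` V2 p"
    obtain U X where UX: "U \<in> V2 p" "X \<in> V2 p" "x = JV U" "y = JV X" using x y by blast
    show "x + y \<in> JV ` V2 p"
      unfolding UX(3,4) JV_linear(1)[OF UX(1,2), symmetric] by (rule imageI[OF V2_ops(2)[OF UX(1,2)]])
  next
    fix x and c :: real assume x: "x \<in> JV ` V2 p"
    obtain U where U: "U \<in> V2 p" "x = JV U" using x by blast
    show "c *\<^sub>R x \<in> JV ` V2 p"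
      unfolding U(2) JV_scaleR[OF U(1), symmetric] by (rule imageI[OF V2_ops(4)[OF U(1)]])
  qed
  obtain v where v: "v \<in> JV ` V2 p" "\<And>y. y \<in> JV ` V2 p \<Longrightarrow> inner v y = f y"
  proof (rule riesz_on_closed_subspace[OF sub closed_JV, of f K])
    fix x y assume "x \<in> JV ` V2 p" "y \<in> JV ` V2 p"
    then obtain U X where UX: "U \<in> V2 p" "X \<in> V2 p" "x = JV U" "y = JV X" by blast
    show "f (x + y) = f x + f y"
      unfolding UX(3,4) JV_linear(1)[OF UX(1,2), symmetric] fJ[OF V2_ops(2)[OF UX(1,2)]] fJ[OF UX(1)] fJ[OF UX(2)]
        add[OF UX(1,2)] by simp
  next
    fix x and c :: real assume "x \<in> JV ` V2 p"
    then obtain U where U: "U \<in> V2 p" "x = JV U" by blast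
    show "f (c *\<^sub>R x) = c * f x"
      unfolding U(2) JV_scaleR[OF U(1), symmetric] fJ[OF V2_ops(4)[OF U(1)]] fJ[OF U(1)]
      unfolding scaleR_scaleC scale[OF U(1)] by simp
  next
    fix x assume "x \<in> JV ` V2 p"
    then obtain U where U: "U \<in> V2 p" "x = JV U" by blast
    show "\<bar>f x\<bar> \<le> K * norm x"
      unfolding U(2) fJ[OF U(1)] using K[OF U(1)] abs_Re_le_cmod[of "F U"] by linarith
  qed blast
  obtain V where V: "V \<in> V2 p" "v = JV V" using v(1) by blast
  have "F U = form_c p V U" if U: "U \<in> V2 p" for U
  proof (rule antilinear_eqI[where S = "V2 p", OF _ _ _ _ U])
    show "Re (F U) = Re (form_c p V U)" if "U \<in> V2 p" for U
      using v(2)[of "JV U"] that unfolding V(2) Re_form_c[OF V(1)] by (simp add: fJ)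
    show "\<i> *\<^sub>C U \<in> V2 p" if "U \<in> V2 p" for U by (rule V2_ops(3)[OF that])
    show "F (\<i> *\<^sub>C U) = - \<i> * F U" if "U \<in> V2 p" for U by (simp add: scale[OF that])
    show "form_c p V (\<i> *\<^sub>C U) = - \<i> * form_c p V U" if "U \<in> V2 p" for U
      by (simp add: form_c_right(2)[OF V(1) that that])
  qed
  then have "F = op_C p V" unfolding op_C_def by (intro extensionalityI[OF ext]) auto
  then show ?thesis using that V(1) by blast
qed

text \<open>With extension by zero the sum \<open>f + g\<close> is the glued function. Integrating
  by parts on the two parts produces interface terms at \<open>L0\<close> that cancel because the
  traces agree.\<close>

lemma glue_V1_graph:
  assumes V: "(f, g, f1, g1) \<in> V1_graph" shows "wd 0 L1 (f + g) (f1 + g1)"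
proof -
  have W: "wd 0 L0 f f1" "wd L0 L1 g g1" using V by (auto simp: V1_graph_def)
  then have L2: "f \<in> L2 0 L0" "g \<in> L2 L0 L1" "f1 \<in> L2 0 L0" "g1 \<in> L2 L0 L1" by (auto simp: wd_def)
  have "cip (f + g) (restrict_l2 0 L1 (\<lambda>x. cnj (vector_derivative \<phi> (at x)))) =
       - cip (f1 + g1) (restrict_l2 0 L1 (\<lambda>x. cnj (\<phi> x)))" if t: "test_function 0 L1 \<phi>" for \<phi>
  proof -
    let ?\<psi> = "\<lambda>x. cnj (\<phi> x)" and ?\<psi>' = "\<lambda>x. cnj (vector_derivative \<phi> (at x))"
    have d: "(?\<psi> has_vector_derivative ?\<psi>' x) (at x)" for x
      by (intro has_vector_derivative_cnj test_function_C1(3)[OF t])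
    have c: "continuous_on UNIV ?\<psi>'" "continuous_on UNIV ?\<psi>"
      by (intro continuous_intros test_function_C1[OF t])+
    note r = wd_restrict_C1[OF len(1) d c(1)] wd_restrict_C1[OF len(2) d c(1)]
    have "cip f1 (restrict_l2 0 L0 ?\<psi>) + cip f (restrict_l2 0 L0 ?\<psi>') = val 0 L0 f L0 * \<phi> L0 - val 0 L0 f 0 * \<phi> 0"
      using wd_by_parts[OF len(1) W(1) r(1)] len by (simp add: r(2))
    moreover have "cip g1 (restrict_l2 L0 L1 ?\<psi>) + cip g (restrict_l2 L0 L1 ?\<psi>') = val L0 L1 g L1 * \<phi> L1 - val L0 L1 g L0 * \<phi> L0"
      using wd_by_parts[OF len(2) W(2) r(3)] len by (simp add: r(4))
    moreover have "val 0 L0 f L0 = val L0 L1 g L0" "\<phi> 0 = 0" "\<phi> L1 = 0"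
      using V test_function_C1(4,5)[OF t] by (auto simp: V1_graph_def)
    ultimately have "(cip f1 (restrict_l2 0 L0 ?\<psi>) + cip f (restrict_l2 0 L0 ?\<psi>')) +
        (cip g1 (restrict_l2 L0 L1 ?\<psi>) + cip g (restrict_l2 L0 L1 ?\<psi>')) = 0" by simp
    moreover have "cip h (restrict_l2 0 L1 \<xi>) = cip h (restrict_l2 0 L0 \<xi>)" if "h \<in> L2 0 L0" "continuous_on UNIV \<xi>" for h \<xi>
      by (rule cip_restrict_subinterval[OF that(1) _ _ that(2)]) (use len in simp_all)
    moreover have "cip h (restrict_l2 0 L1 \<xi>) = cip h (restrict_l2 L0 L1 \<xi>)" if "h \<in> L2 L0 L1" "continuous_on UNIV \<xi>" for h \<xi>
      by (rule cip_restrict_subinterval[OF that(1) _ _ that(2)]) (use len in simp_all)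
    ultimately show ?thesis unfolding eq_neg_iff_add_eq_0 using L2 c by (simp add: cip_add_left add_ac)
  qed
  moreover have "f + g \<in> L2 0 L1" "f1 + g1 \<in> L2 0 L1"
    using len by (intro subspace_add[OF L2_subspace] L2_mono[OF L2(1)] L2_mono[OF L2(2)] L2_mono[OF L2(3)] L2_mono[OF L2(4)]; simp)+
  ultimately show ?thesis unfolding wd_def has_weak_deriv_cip by blast
qed

text \<open>A smooth function across \<open>L0\<close> satisfies the transmission conditions
  automatically; applying the same remark to its derivative gives the second level of
  \<open>W1_iff\<close>.\<close>

lemma test_in_W1:
  assumes t: "test_function 0 L1 \<phi>"
  shows "(restrict_l2 0 L0 \<phi>, restrict_l2 L0 L1 \<phi>) \<in> W1 p"
    and "dl p (restrict_l2 0 L0 \<phi>) = restrict_l2 0 L0 (\<lambda>x. vector_derivative \<phi> (at x))"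
    and "dr p (restrict_l2 L0 L1 \<phi>) = restrict_l2 L0 L1 (\<lambda>x. vector_derivative \<phi> (at x))"
proof -
  have V: "(restrict_l2 0 L0 \<phi>, restrict_l2 L0 L1 \<phi>, restrict_l2 0 L0 (\<lambda>x. vector_derivative \<phi> (at x)),
      restrict_l2 L0 L1 (\<lambda>x. vector_derivative \<phi> (at x))) \<in> V1_graph" if t: "test_function 0 L1 \<phi>" for \<phi>
  proof -
    note C1 = test_function_C1[OF t]
    note r = wd_restrict_C1[OF len(1) C1(3) C1(2)] wd_restrict_C1[OF len(2) C1(3) C1(2)]
    show ?thesis using len by (simp add: V1_graph_def r C1(4,5))
  qed
  note V1 = V[OF t] and V2 = V[OF test_function_deriv[OF t]]
  show d: "dl p (restrict_l2 0 L0 \<phi>) = restrict_l2 0 L0 (\<lambda>x. vector_derivative \<phi> (at x))"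
    "dr p (restrict_l2 L0 L1 \<phi>) = restrict_l2 L0 L1 (\<lambda>x. vector_derivative \<phi> (at x))"
    using V1_graphD[OF V1] by auto
  show "(restrict_l2 0 L0 \<phi>, restrict_l2 L0 L1 \<phi>) \<in> W1 p"
    unfolding W1_iff d using V1 V2 V1_graphD[OF V2] by simp
qed

lemma zero_in_W1: "(0, 0) \<in> W1 p"
  using W1_ops(1) by (simp add: zero_prod_def)

text \<open>Testing with \<open>C\<^sub>c\<^sup>\<infinity>(0,L)\<close> shows that \<open>Q = (\<alpha>\<^sub>1 f\<^sub>x, \<alpha>\<^sub>2 g\<^sub>x)\<close> is in \<open>H\<^sup>1(0,L)\<close> with derivative
  \<open>R = (\<rho>\<^sub>1 f, \<rho>\<^sub>2 g)\<close>, so \<open>(f, g)\<close> is itself admissible as a test function; a density theorem for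
  \<open>W\<^sub>1\<close> in \<open>V\<^sub>1\<close> is not needed.\<close>

lemma W2_dense:
  assumes V: "V \<in> V2 p" and orth: "\<And>U. U \<in> W2 p \<Longrightarrow> form_c p V U = 0"
  shows "V = 0"
proof -
  obtain f g \<eta> where V': "V = (f, g, \<eta>)" by (cases V) auto
  have V1: "(f, g, dl p f, dr p g) \<in> V1_graph" and \<eta>: "\<eta> \<in> L2 0 L0" using V by (auto simp: V' V2_def V1_iff)
  let ?f1 = "dl p f" and ?g1 = "dr p g"
  have L2: "f \<in> L2 0 L0" "g \<in> L2 L0 L1" "?f1 \<in> L2 0 L0" "?g1 \<in> L2 L0 L1"
    using V1 by (auto simp: V1_graph_def wd_def)
  have d0: "dl p 0 = 0" "dr p 0 = 0" by (auto intro: weak_deriv_eq wd_zero)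
  have "\<eta> = 0"
  proof (rule L2_orthogonal_to_test_functions[OF \<eta>])
    fix \<phi> assume "test_function 0 L0 \<phi>"
    then have "(0, 0, restrict_l2 0 L0 \<phi>) \<in> W2 p"
      using test_in_H1_0_graph[OF len(1)] zero_in_W1 H1_0_iff_graph[OF len(1)] weak_deriv_eq
      by (fastforce simp: W2_def H1_0_graph_def)
    from orth[OF this] show "cip \<eta> (restrict_l2 0 L0 \<phi>) = 0"
      using V pos by (simp add: V' form_c_cip d0)
  qed
  define Q where "Q = \<alpha>\<^sub>1 p *\<^sub>R ?f1 + \<alpha>\<^sub>2 p *\<^sub>R ?g1"
  define R where "R = \<rho>\<^sub>1 p *\<^sub>R f + \<rho>\<^sub>2 p *\<^sub>R g"
  have QR: "wd 0 L1 Q R"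
  proof -
    have "cip Q (restrict_l2 0 L1 (\<lambda>x. cnj (vector_derivative \<phi> (at x)))) = - cip R (restrict_l2 0 L1 (\<lambda>x. cnj (\<phi> x)))"
      if t: "test_function 0 L1 \<phi>" for \<phi>
    proof -
      let ?\<psi> = "\<lambda>x. cnj (\<phi> x)" and ?\<psi>' = "\<lambda>x. cnj (vector_derivative \<phi> (at x))"
      note t' = test_function_cnj[OF t]
      have "vector_derivative ?\<psi> (at x) = ?\<psi>' x" for x
        by (intro vector_derivative_at has_vector_derivative_cnj test_function_C1(3)[OF t])
      note T = test_in_W1[OF t', unfolded this]
      have z: "(0, 0) \<in> H1_0_graph 0 L0" using complex_subspaceD(1)[OF H1_0_graph(1)[of 0 L0]] by (simp add: zero_prod_def)
      have "(restrict_l2 0 L0 ?\<psi>, restrict_l2 L0 L1 ?\<psi>, 0) \<in> W2 p"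
        using T(1) z d0 H1_0_iff_graph[OF len(1)] by (simp add: W2_def)
      from orth[OF this] have e: "\<rho>\<^sub>1 p * cip f (restrict_l2 0 L0 ?\<psi>) + \<alpha>\<^sub>1 p * cip ?f1 (restrict_l2 0 L0 ?\<psi>') +
          (\<rho>\<^sub>2 p * cip g (restrict_l2 L0 L1 ?\<psi>) + \<alpha>\<^sub>2 p * cip ?g1 (restrict_l2 L0 L1 ?\<psi>')) = 0"
        using V by (simp add: V' form_c_cip T)
      have c: "continuous_on UNIV ?\<psi>'" "continuous_on UNIV ?\<psi>"
        by (intro continuous_intros test_function_C1[OF t])+
      have "cip h (restrict_l2 0 L1 \<xi>) = cip h (restrict_l2 0 L0 \<xi>)" if "h \<in> L2 0 L0" "continuous_on UNIV \<xi>" for h \<xi>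
        by (rule cip_restrict_subinterval[OF that(1) _ _ that(2)]) (use len in simp_all)
      moreover have "cip h (restrict_l2 0 L1 \<xi>) = cip h (restrict_l2 L0 L1 \<xi>)" if "h \<in> L2 L0 L1" "continuous_on UNIV \<xi>" for h \<xi>
        by (rule cip_restrict_subinterval[OF that(1) _ _ that(2)]) (use len in simp_all)
      ultimately show ?thesis unfolding eq_neg_iff_add_eq_0 using L2 c e
        by (simp add: Q_def R_def cip_add_left cip_scaleR_left add_ac)
    qed
    moreover have "Q \<in> L2 0 L1" "R \<in> L2 0 L1"
      unfolding Q_def R_def using len
      by (intro subspace_add[OF L2_subspace] subspace_scale[OF L2_subspace]
          L2_mono[OF L2(1)] L2_mono[OF L2(2)] L2_mono[OF L2(3)] L2_mono[OF L2(4)]; simp)+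
    ultimately show ?thesis unfolding wd_def has_weak_deriv_cip by blast
  qed
  have w: "wd 0 L1 (f + g) (?f1 + ?g1)" by (rule glue_V1_graph[OF V1])
  have f0: "AE x in lborel. x \<notin> {0<..<L0} \<longrightarrow> rep_l2 f x = 0" and g0: "AE x in lborel. x \<notin> {L0<..<L1} \<longrightarrow> rep_l2 g x = 0"
    using L2 by (simp_all only: L2_def mem_Collect_eq vanishes_off_rep)
  have "val 0 L0 f 0 = val 0 L1 (f + g) 0"
  proof (rule val_subinterval[OF len(1) order_refl less_imp_le[OF len(2)] w])
    show "AE x in lborel. x \<in> {0<..<L0} \<longrightarrow> rep_l2 f x = rep_l2 (f + g) x"
      using rep_add_l2[of f g] g0 by eventually_elim auto
  qed (use len in simp)
  moreover have "val L0 L1 g L1 = val 0 L1 (f + g) L1"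
  proof (rule val_subinterval[OF len(2) less_imp_le[OF len(1)] order_refl w])
    show "AE x in lborel. x \<in> {L0<..<L1} \<longrightarrow> rep_l2 g x = rep_l2 (f + g) x"
      using rep_add_l2[of f g] f0 by eventually_elim auto
  qed (use len in simp)
  ultimately have "val 0 L1 (f + g) 0 = 0" "val 0 L1 (f + g) L1 = 0" using V1 by (auto simp: V1_graph_def)
  \<comment> \<open>Integration by parts of \<open>Q\<close> against the glued function, whose
    values at 0 and \<open>L1\<close> vanish. The left side is the form \<open>c\<close> evaluated
    at \<open>(f, g, 0)\<close> in both arguments, all mixed terms being products over disjoint
    intervals.\<close>
  then have "cip R (f + g) + cip Q (?f1 + ?g1) = 0" using wd_by_parts[OF _ QR w] len by simp
  then have "\<rho>\<^sub>1 p * cip f f + \<rho>\<^sub>2 p * cip g g + (\<alpha>\<^sub>1 p * cip ?f1 ?f1 + \<alpha>\<^sub>2 p * cip ?g1 ?g1) = 0"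
    using cip_disjoint[OF L2(1,2)] cip_disjoint[OF L2(3,4)]
    by (simp add: Q_def R_def cip_add_left cip_add_right cip_scaleR_left)
  then have "Re (\<rho>\<^sub>1 p * cip f f + \<rho>\<^sub>2 p * cip g g + (\<alpha>\<^sub>1 p * cip ?f1 ?f1 + \<alpha>\<^sub>2 p * cip ?g1 ?g1)) = Re 0" by (rule arg_cong)
  then have "\<rho>\<^sub>1 p * inner f f + \<rho>\<^sub>2 p * inner g g + (\<alpha>\<^sub>1 p * inner ?f1 ?f1 + \<alpha>\<^sub>2 p * inner ?g1 ?g1) = 0"
    by (simp add: inner_l2_def)
  moreover have "0 \<le> \<rho>\<^sub>1 p * inner f f" "0 \<le> \<rho>\<^sub>2 p * inner g g" "0 \<le> \<alpha>\<^sub>1 p * inner ?f1 ?f1" "0 \<le> \<alpha>\<^sub>2 p * inner ?g1 ?g1"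
    using pos by simp_all
  ultimately have "\<rho>\<^sub>1 p * inner f f = 0" "\<rho>\<^sub>2 p * inner g g = 0" by linarith+
  then show ?thesis using pos \<open>\<eta> = 0\<close> by (simp add: V' zero_prod_def)
qed

text \<open>The graph of \<open>\<A>\<close> in weak form, free of the choices (\<open>THE\<close>, \<open>the_inv_into\<close>) in \<open>op_A\<close>.\<close>

definition op_A_rel :: "state \<Rightarrow> state \<Rightarrow> bool" where
  "op_A_rel \<Phi> \<Psi> \<longleftrightarrow> fst \<Phi> \<in> W1 p \<and> snd \<Phi> \<in> W2 p \<and> snd \<Psi> \<in> V2 p \<and> fst \<Psi> = (fst (snd \<Phi>), fst (snd (snd \<Phi>))) \<and>
     (\<forall>U\<in>W2 p. form_c p (snd \<Psi>) U = - (form_b p (snd \<Phi>) U + form_a p (fst \<Phi>) (fst U, fst (snd U))))"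

section \<open>The operator in weak form\<close>

lemma op_BA_apply: "U \<in> W2 p \<Longrightarrow> op_BA p \<Phi> U = form_b p (snd \<Phi>) U + form_a p (fst \<Phi>) (fst U, fst (snd U))"
  by (cases U) (simp add: op_BA_def op_B_def op_A1_def)

lemma op_C_apply: "U \<in> V2 p \<Longrightarrow> op_C p V U = form_c p V U"
  by (simp add: op_C_def)

lemma op_C_eqI:
  assumes "V \<in> V2 p" "V' \<in> V2 p" "\<And>U. U \<in> W2 p \<Longrightarrow> form_c p V U = form_c p V' U" shows "V = V'"
proof -
  have "form_c p (V - V') U = 0" if "U \<in> W2 p" for U
    using form_c_left(1)[OF V2_ops(5)[OF assms(1,2)] assms(2), of U] assms(3)[OF that] by simp
  then show ?thesis using W2_dense[OF V2_ops(5)[OF assms(1,2)]] by simp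
qed

text \<open>Both descriptions in \<open>op_A\<close> are resolved here: every bounded extension is
  \<open>op_C\<close> of some vector by Riesz, and the values on W_2 determine this vector by
  density.\<close>

lemma op_A_rel_imp:
  assumes "op_A_rel \<Phi> \<Psi>" shows "\<Phi> \<in> dom_A p" "op_A p \<Phi> = \<Psi>"
proof -
  have V: "- snd \<Psi> \<in> V2 p" using assms V2_ops(4)[of "snd \<Psi>" "-1"] by (simp add: op_A_rel_def)
  have neg: "form_c p (- snd \<Psi>) U = - form_c p (snd \<Psi>) U" for U
    using form_c_left(2)[of "snd \<Psi>" "snd \<Psi>" "-1" U] assms by (simp add: op_A_rel_def scaleC_neg_one)
  have ext: "extends_to p (op_BA p \<Phi>) (op_C p (- snd \<Psi>))"
    unfolding extends_to_def
  proof (intro conjI ballI op_C_in_dual[OF V])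
    fix U assume U: "U \<in> W2 p"
    then have "form_c p (snd \<Psi>) U = - (form_b p (snd \<Phi>) U + form_a p (fst \<Phi>) (fst U, fst (snd U)))"
      using assms unfolding op_A_rel_def by blast
    then show "op_C p (- snd \<Psi>) U = op_BA p \<Phi> U" by (simp add: op_C_apply W2_V2 U op_BA_apply neg)
  qed
  have uniq: "F = op_C p (- snd \<Psi>)" if F: "extends_to p (op_BA p \<Phi>) F" for F
  proof -
    obtain V' where V': "V' \<in> V2 p" "F = op_C p V'" using F riesz_V2 unfolding extends_to_def by blast
    have "form_c p V' U = form_c p (- snd \<Psi>) U" if "U \<in> W2 p" for U
      using F ext that W2_V2[OF that] unfolding extends_to_def V'(2) by (metis op_C_apply)
    then show ?thesis using op_C_eqI[OF V'(1) V] V'(2) by simp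
  qed
  show "\<Phi> \<in> dom_A p"
    using assms ext by (cases \<Phi>) (auto simp: dom_A_def op_A_rel_def)
  have "(THE F. extends_to p (op_BA p \<Phi>) F) = op_C p (- snd \<Psi>)" using ext uniq by (rule the_equality)
  moreover have "the_inv_into (V2 p) (op_C p) (op_C p (- snd \<Psi>)) = - snd \<Psi>"
  proof (rule the_inv_into_f_f[OF _ V])
    show "inj_on (op_C p) (V2 p)"
      by (rule inj_onI) (metis op_C_eqI op_C_apply W2_V2)
  qed
  ultimately show "op_A p \<Phi> = \<Psi>"
    using assms by (cases \<Phi>, cases \<Psi>) (auto simp: op_A_def op_A_rel_def)
qed

lemma dom_A_op_A_rel: "\<Phi> \<in> dom_A p \<Longrightarrow> op_A_rel \<Phi> (op_A p \<Phi>)"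
proof -
  assume D: "\<Phi> \<in> dom_A p"
  then obtain F where F: "extends_to p (op_BA p \<Phi>) F" unfolding dom_A_def by blast
  then obtain V where V: "V \<in> V2 p" "F = op_C p V" using riesz_V2 unfolding extends_to_def by blast
  have neg: "form_c p (- V) U = - form_c p V U" for U
    using form_c_left(2)[OF V(1) V(1), of "-1" U] by (simp add: scaleC_neg_one)
  have "op_A_rel \<Phi> ((fst (snd \<Phi>), fst (snd (snd \<Phi>))), - V)"
    unfolding op_A_rel_def fst_conv snd_conv
  proof (intro conjI ballI refl)
    show "fst \<Phi> \<in> W1 p" "snd \<Phi> \<in> W2 p" using D by (auto simp: dom_A_def)
    show "- V \<in> V2 p" using V2_ops(4)[OF V(1), of "-1"] by simp
    fix U assume U: "U \<in> W2 p"
    then have "form_c p V U = op_BA p \<Phi> U"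
      using F op_C_apply[OF W2_V2[OF U], of V] unfolding extends_to_def V(2) by metis
    then show "form_c p (- V) U = - (form_b p (snd \<Phi>) U + form_a p (fst \<Phi>) (fst U, fst (snd U)))"
      by (simp add: neg op_BA_apply[OF U])
  qed
  then show ?thesis using op_A_rel_imp(2) by metis
qed

lemma W2_W1: "U \<in> W2 p \<Longrightarrow> (fst U, fst (snd U)) \<in> W1 p"
  by (auto simp: W2_def)

lemma op_A_rel_add: "op_A_rel \<Phi> \<Psi> \<Longrightarrow> op_A_rel \<Phi>' \<Psi>' \<Longrightarrow> op_A_rel (\<Phi> + \<Phi>') (\<Psi> + \<Psi>')"
  unfolding op_A_rel_def by (auto simp: W1_ops W2_ops V2_ops form_c_left form_b_left form_a_left)

lemma fst_scaleC: "fst (c *\<^sub>C x) = c *\<^sub>C fst x" and snd_scaleC: "snd (c *\<^sub>C x) = c *\<^sub>C snd x"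
  by (simp_all add: scaleC_prod_def)

lemma op_A_rel_scaleC:
  assumes g: "op_A_rel \<Phi> \<Psi>" shows "op_A_rel (c *\<^sub>C \<Phi>) (c *\<^sub>C \<Psi>)"
proof -
  have m: "fst \<Phi> \<in> W1 p" "snd \<Phi> \<in> W2 p" "snd \<Psi> \<in> V2 p" "fst \<Psi> = (fst (snd \<Phi>), fst (snd (snd \<Phi>)))"
    using g by (auto simp: op_A_rel_def)
  have "c *\<^sub>C fst \<Psi> = (fst (c *\<^sub>C snd \<Phi>), fst (snd (c *\<^sub>C snd \<Phi>)))"
    unfolding m(4) by (simp add: scaleC_prod_def)
  moreover have "form_c p (c *\<^sub>C snd \<Psi>) U =
      - (form_b p (c *\<^sub>C snd \<Phi>) U + form_a p (c *\<^sub>C fst \<Phi>) (fst U, fst (snd U)))" if "U \<in> W2 p" for U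
  proof -
    have "form_c p (snd \<Psi>) U = - (form_b p (snd \<Phi>) U + form_a p (fst \<Phi>) (fst U, fst (snd U)))"
      using g that unfolding op_A_rel_def by blast
    then show ?thesis
      unfolding form_c_left(2)[OF m(3,3)] form_b_left(2)[OF m(2,2)] form_a_left(2)[OF m(1,1)]
      by (simp only: mult_minus_right distrib_left)
  qed
  ultimately show ?thesis unfolding op_A_rel_def fst_scaleC snd_scaleC
    using W1_ops(3)[OF m(1)] W2_ops(3)[OF m(2)] V2_ops(3)[OF m(3)] by (simp only: snd_scaleC fst_scaleC) blast
qed

definition J :: "state \<Rightarrow> (l2 \<times> l2) \<times> (l2 \<times> l2 \<times> l2 \<times> l2 \<times> l2)" where
  "J \<Phi> = (JW (fst \<Phi>), JV (snd \<Phi>))"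

lemma op_A_rel_dissipative:
  assumes g: "op_A_rel \<Phi> \<Psi>" shows "inner (J \<Psi>) (J \<Phi>) \<le> 0"
proof -
  obtain Z v z \<theta> \<Psi>2 where P: "\<Phi> = (Z, v, z, \<theta>)" "\<Psi> = ((v, z), \<Psi>2)"
    using g by (cases \<Phi>, cases \<Psi>) (auto simp: op_A_rel_def)
  have m: "Z \<in> W1 p" "(v, z, \<theta>) \<in> W2 p" "\<Psi>2 \<in> V2 p" "(v, z) \<in> W1 p" using g by (auto simp: P op_A_rel_def W2_def)
  have "form_c p \<Psi>2 (v, z, \<theta>) = - (form_b p (v, z, \<theta>) (v, z, \<theta>) + form_a p Z (v, z))"
    using g m(2) unfolding op_A_rel_def P by fastforce
  then have "inner (JV \<Psi>2) (JV (v, z, \<theta>)) = - Re (form_b p (v, z, \<theta>) (v, z, \<theta>)) - inner (JW Z) (JW (v, z))"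
    using Re_form_c[OF m(3), of "(v, z, \<theta>)"] Re_form_a[OF m(1), of "(v, z)"] by simp
  \<comment> \<open>The coupling contributes \<open>\<gamma>\<close> times a complex number minus
    its conjugate, hence nothing to the real part.\<close>
  moreover have "Re (form_b p (v, z, \<theta>) (v, z, \<theta>)) = \<kappa> p * inner (dl p \<theta>) (dl p \<theta>)"
    using inner_commute[of "dl p v" "dl p \<theta>"] by (simp add: form_b_cip[OF m(2)] inner_l2_def)
  ultimately have "inner (J \<Psi>) (J \<Phi>) = - (\<kappa> p * inner (dl p \<theta>) (dl p \<theta>))"
    by (simp add: P J_def inner_prod_def[of "(_, _)"] inner_commute)
  then show ?thesis using pos by simp
qed

end

section \<open>Generation of the semigroup\<close>

text \<open>\<open>semigroup_A\<close> agrees with the constructed flow for nonnegative times only;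
  this and the next lemmas show that the notions involved see no other times.\<close>

lemma norm_continuous_cong:
  assumes f: "norm_continuous S n f" and eq: "\<And>t. 0 \<le> t \<Longrightarrow> g t = f t" shows "norm_continuous S n g"
  unfolding norm_continuous_def
proof (intro conjI allI impI)
  fix t :: real assume t: "0 \<le> t"
  show "g t \<in> S" using f t unfolding norm_continuous_def by (simp add: eq)
  have "((\<lambda>s. n (f s - f t)) \<longlongrightarrow> 0) (at t within {0..})" using f t unfolding norm_continuous_def by blast
  then show "((\<lambda>s. n (g s - g t)) \<longlongrightarrow> 0) (at t within {0..})"
    by (rule Lim_transform_eventually) (auto simp: eventually_at_filter eq t)
qed

lemma norm_C1_cong:
  assumes f: "norm_C1 S n f" and eq: "\<And>t. 0 \<le> t \<Longrightarrow> g t = f t" shows "norm_C1 S n g"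
proof -
  obtain f' where fS: "\<And>t. 0 \<le> t \<Longrightarrow> f t \<in> S" and f': "norm_continuous S n f'"
    "\<And>t. 0 \<le> t \<Longrightarrow> ((\<lambda>s. n ((1 / (s - t)) *\<^sub>R (f s - f t) - f' t)) \<longlongrightarrow> 0) (at t within {0..})"
    using f unfolding norm_C1_def by blast
  have "((\<lambda>s. n ((1 / (s - t)) *\<^sub>R (g s - g t) - f' t)) \<longlongrightarrow> 0) (at t within {0..})" if t: "0 \<le> t" for t
    using f'(2)[OF t] by (rule Lim_transform_eventually) (auto simp: eventually_at_filter eq t)
  then show ?thesis unfolding norm_C1_def using fS f'(1) by (auto simp: eq)
qed

lemma has_norm_integral_cong:
  assumes f: "has_norm_integral n f I S" and eq: "\<And>x. x \<in> S \<Longrightarrow> g x = f x" shows "has_norm_integral n g I S"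
proof -
  have "(\<Sum>(x, K)\<in>P. measure lborel K *\<^sub>R g x) = (\<Sum>(x, K)\<in>P. measure lborel K *\<^sub>R f x)"
    if "P tagged_division_of S" for P
  proof (rule sum.cong[OF refl])
    fix q assume q: "q \<in> P"
    obtain x K where xK: "q = (x, K)" by (cases q)
    have "x \<in> S" using tagged_division_ofD(2,3)[OF that] q unfolding xK by blast
    then show "(case q of (x, K) \<Rightarrow> measure lborel K *\<^sub>R g x) = (case q of (x, K) \<Rightarrow> measure lborel K *\<^sub>R f x)"
      by (simp add: xK eq)
  qed
  then show ?thesis using f unfolding has_norm_integral_def by simp
qed

lemma weak_solution_cong:
  assumes f: "weak_solution p x f" and eq: "\<And>t. 0 \<le> t \<Longrightarrow> g t = f t" shows "weak_solution p x g"
  unfolding weak_solution_def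
proof (intro conjI allI impI)
  show "norm_continuous (energy_space p) (energy_norm p) g"
    using norm_continuous_cong[of _ _ f g] eq f unfolding weak_solution_def by blast
  fix t :: real assume t: "0 \<le> t"
  then obtain I where I: "has_norm_integral (energy_norm p) f I {0..t}" "I \<in> dom_A p" "f t = x + op_A p I"
    using f unfolding weak_solution_def by blast
  have "has_norm_integral (energy_norm p) g I {0..t}"
    using I(1) by (rule has_norm_integral_cong) (simp add: eq)
  then show "\<exists>I. has_norm_integral (energy_norm p) g I {0..t} \<and> I \<in> dom_A p \<and> g t = x + op_A p I"
    by (intro exI[of _ I]) (simp add: I eq t)
qed

context thermoelastic_beam
begin

abbreviation "pr1 (x :: l2 \<times> l2 \<times> l2 \<times> l2 \<times> l2 \<times> l2 \<times> l2 \<times> l2) \<equiv>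
  (fst x, fst (snd x), fst (snd (snd x)), fst (snd (snd (snd x))))"
abbreviation "pr2 (x :: l2 \<times> l2 \<times> l2 \<times> l2 \<times> l2 \<times> l2 \<times> l2 \<times> l2) \<equiv>
  (fst (snd (snd x)), fst (snd (snd (snd x))), fst (snd (snd (snd (snd x)))), fst (snd (snd (snd (snd (snd x))))))"
abbreviation "pr3 (x :: l2 \<times> l2 \<times> l2 \<times> l2 \<times> l2 \<times> l2 \<times> l2 \<times> l2) \<equiv> snd (snd (snd (snd (snd (snd x)))))"

text \<open>The image of \<open>W\<^sub>2\<close> under \<open>(v, z, \<theta>) \<mapsto> (v, z, v\<^sub>x, z\<^sub>x, v\<^sub>x\<^sub>x, z\<^sub>x\<^sub>x, \<theta>, \<theta>\<^sub>x)\<close>.\<close>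

definition "jets = {x. pr1 x \<in> V1_graph \<and> pr2 x \<in> V1_graph \<and> pr3 x \<in> H1_0_graph 0 L0}"

lemma jets: "subspace jets" "closed jets"
proof -
  note h = complex_subspaceD[OF H1_0_graph(1)[of 0 L0]]
  show "subspace jets"
  proof (rule subspaceI)
    show "0 \<in> jets" using V1_graph_ops(1) h(1) by (simp add: jets_def zero_prod_def)
    show "x + y \<in> jets" if x: "x \<in> jets" and y: "y \<in> jets" for x y
    proof -
      have "pr1 x + pr1 y \<in> V1_graph" "pr2 x + pr2 y \<in> V1_graph" "pr3 x + pr3 y \<in> H1_0_graph 0 L0"
        using x y V1_graph_ops(2)[of "pr1 x" "pr1 y"] V1_graph_ops(2)[of "pr2 x" "pr2 y"] h(2)[of "pr3 x" "pr3 y"]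
        unfolding jets_def by blast+
      then show ?thesis by (simp add: jets_def)
    qed
    show "r *\<^sub>R x \<in> jets" if x: "x \<in> jets" for r :: real and x
    proof -
      have "r *\<^sub>R pr1 x \<in> V1_graph" "r *\<^sub>R pr2 x \<in> V1_graph" "r *\<^sub>R pr3 x \<in> H1_0_graph 0 L0"
        using x V1_graph_ops(4)[of "pr1 x" r] V1_graph_ops(4)[of "pr2 x" r] h(4)[of "pr3 x" r]
        unfolding jets_def by blast+
      then show ?thesis by (simp add: jets_def)
    qed
  qed
  have "jets = (\<lambda>x. pr1 x) -` V1_graph \<inter> (\<lambda>x. pr2 x) -` V1_graph \<inter> (\<lambda>x. pr3 x) -` H1_0_graph 0 L0" by (auto simp: jets_def)
  moreover have "continuous_on UNIV (\<lambda>x. pr1 x)" "continuous_on UNIV (\<lambda>x. pr2 x)" "continuous_on UNIV (\<lambda>x. pr3 x)"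
    by (intro continuous_intros)+
  ultimately show "closed jets"
    using closed_V1_graph H1_0_graph(2) by (auto intro!: closed_Int closed_vimage)
qed

lemma jets_W2:
  assumes "(v, z, v1, z1, v2, z2, \<theta>, \<theta>1) \<in> jets"
  shows "(v, z, \<theta>) \<in> W2 p" "dl p v = v1" "dr p z = z1" "dl p v1 = v2" "dr p z1 = z2" "dl p \<theta> = \<theta>1"
proof -
  have m: "(v, z, v1, z1) \<in> V1_graph" "(v1, z1, v2, z2) \<in> V1_graph" "(\<theta>, \<theta>1) \<in> H1_0_graph 0 L0" using assms by (simp_all add: jets_def)
  show d: "dl p v = v1" "dr p z = z1" "dl p v1 = v2" "dr p z1 = z2" using V1_graphD[OF m(1)] V1_graphD[OF m(2)] by auto
  show d': "dl p \<theta> = \<theta>1" using m(3) by (auto simp: H1_0_graph_def intro: weak_deriv_eq)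
  show "(v, z, \<theta>) \<in> W2 p" using m by (simp add: W2_def W1_iff d H1_0_iff_graph[OF len(1)] d')
qed

lemma W2_jets: "(u, y, t) \<in> W2 p \<Longrightarrow> (u, y, dl p u, dr p y, dl p (dl p u), dr p (dr p y), t, dl p t) \<in> jets"
  by (simp add: W2_def W1_iff H1_0_iff_graph[OF len(1)] jets_def)

text \<open>On jets the sesquilinear form is given by a bounded matrix \<open>G\<close> with
  constant coefficients. Its diagonal is positive in each of the eight coordinates and its
  off-diagonal part is skew, so it is coercive on the whole product.\<close>

lemma solve_weak_form:
  fixes l :: real
  assumes l: "l > 0" and F1: "F1 \<in> W1 p" and F2: "F2 \<in> V2 p"
  obtains V where "V \<in> W2 p"
    "\<And>U. U \<in> W2 p \<Longrightarrow> form_c p V U + l * form_b p V U + l\<^sup>2 * form_a p (fst V, fst (snd V)) (fst U, fst (snd U))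
       = form_c p F2 U - l * form_a p F1 (fst U, fst (snd U))"
proof -
  obtain w q where F1': "F1 = (w, q)" by (cases F1)
  obtain f g \<eta> where F2': "F2 = (f, g, \<eta>)" by (cases F2) auto
  \<comment> \<open>Component by component, what multiplies \<open>u\<close>, \<open>y\<close>,
    their first and second derivatives, \<open>t\<close> and its derivative in the test jet. The two
    entries with \<open>l * \<gamma> p\<close> have opposite signs and cancel in
    \<open>inner (G x) x\<close>.\<close>
  define G :: "l2 \<times> l2 \<times> l2 \<times> l2 \<times> l2 \<times> l2 \<times> l2 \<times> l2 \<Rightarrow> l2 \<times> l2 \<times> l2 \<times> l2 \<times> l2 \<times> l2 \<times> l2 \<times> l2" where
    "G x = (\<rho>\<^sub>1 p *\<^sub>R fst x, \<rho>\<^sub>2 p *\<^sub>R fst (snd x),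
       \<alpha>\<^sub>1 p *\<^sub>R fst (snd (snd x)) - (l * \<gamma> p) *\<^sub>R snd (pr3 x), \<alpha>\<^sub>2 p *\<^sub>R fst (snd (snd (snd x))),
       (l\<^sup>2 * \<beta>\<^sub>1 p) *\<^sub>R fst (snd (snd (snd (snd x)))), (l\<^sup>2 * \<beta>\<^sub>2 p) *\<^sub>R fst (snd (snd (snd (snd (snd x))))),
       \<rho>\<^sub>0 p *\<^sub>R fst (pr3 x), (l * \<gamma> p) *\<^sub>R fst (snd (snd x)) + (l * \<kappa> p) *\<^sub>R snd (pr3 x))" for x
  define h where "h = (\<rho>\<^sub>1 p *\<^sub>R f, \<rho>\<^sub>2 p *\<^sub>R g, \<alpha>\<^sub>1 p *\<^sub>R dl p f, \<alpha>\<^sub>2 p *\<^sub>R dr p g,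
    - (l * \<beta>\<^sub>1 p) *\<^sub>R dl p (dl p w), - (l * \<beta>\<^sub>2 p) *\<^sub>R dr p (dr p q), \<rho>\<^sub>0 p *\<^sub>R \<eta>, 0 :: l2)"
  \<comment> \<open>The smallest of the eight diagonal coefficients of \<open>G\<close>.\<close>
  define c where "c = Min {\<rho>\<^sub>1 p, \<rho>\<^sub>2 p, \<alpha>\<^sub>1 p, \<alpha>\<^sub>2 p, l\<^sup>2 * \<beta>\<^sub>1 p, l\<^sup>2 * \<beta>\<^sub>2 p, \<rho>\<^sub>0 p, l * \<kappa> p}"
  have c: "c > 0" unfolding c_def using pos l by (subst Min_gr_iff) auto
  have cle: "c \<le> \<rho>\<^sub>1 p" "c \<le> \<rho>\<^sub>2 p" "c \<le> \<alpha>\<^sub>1 p" "c \<le> \<alpha>\<^sub>2 p" "c \<le> l\<^sup>2 * \<beta>\<^sub>1 p" "c \<le> l\<^sup>2 * \<beta>\<^sub>2 p" "c \<le> \<rho>\<^sub>0 p" "c \<le> l * \<kappa> p"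
    unfolding c_def by (rule Min_le; simp)+
  have G: "bounded_linear G"
    unfolding G_def[abs_def]
    by (intro bounded_linear_Pair bounded_linear_add bounded_linear_sub bounded_linear_const_scaleR
        bounded_linear_fst_comp bounded_linear_snd_comp bounded_linear_ident)
  have coercive: "c * (norm x)\<^sup>2 \<le> inner (G x) x" for x
  proof -
    obtain v z v1 z1 v2 z2 \<theta> \<theta>1 where x: "x = (v, z, v1, z1, v2, z2, \<theta>, \<theta>1)" by (cases x) auto
    have k: "c * inner a a \<le> k * inner a a" if "c \<le> k" for k and a :: l2
      using that by (intro mult_right_mono) auto
    show ?thesis
      using k[OF cle(1), of v] k[OF cle(2), of z] k[OF cle(3), of v1] k[OF cle(4), of z1]
        k[OF cle(5), of v2] k[OF cle(6), of z2] k[OF cle(7), of \<theta>] k[OF cle(8), of \<theta>1]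
      by (simp add: x G_def power2_norm_eq_inner inner_diff_left inner_add_left inner_commute[of \<theta>1 v1] distrib_left)
  qed
  obtain X where X: "X \<in> jets" "\<And>y. y \<in> jets \<Longrightarrow> inner (G X) y = inner h y"
    by (rule lax_milgram_on_closed_subspace[OF jets G c coercive]) blast
  obtain v z v1 z1 v2 z2 \<theta> \<theta>1 where X': "X = (v, z, v1, z1, v2, z2, \<theta>, \<theta>1)" by (cases X) auto
  note d = jets_W2[OF X(1)[unfolded X']]
  let ?V = "(v, z, \<theta>)"
  have V: "?V \<in> V2 p" "(v, z) \<in> W1 p" using W2_V2[OF d(1)] d(1) by (simp_all add: W2_def)
  let ?L = "\<lambda>U. form_c p ?V U + l * form_b p ?V U + l\<^sup>2 * form_a p (fst ?V, fst (snd ?V)) (fst U, fst (snd U))"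
  let ?R = "\<lambda>U. form_c p F2 U - l * form_a p F1 (fst U, fst (snd U))"
  have "?L U = ?R U" if U: "U \<in> W2 p" for U
  proof (rule antilinear_eqI[where S = "W2 p" and F = ?L and G = ?R, OF _ _ _ _ U])
    show "\<i> *\<^sub>C U \<in> W2 p" if "U \<in> W2 p" for U by (rule W2_ops(3)[OF that])
    show "?L (\<i> *\<^sub>C U) = - \<i> * ?L U" if U: "U \<in> W2 p" for U
    proof -
      have "form_a p (v, z) (\<i> *\<^sub>C (fst U, fst (snd U))) = cnj \<i> * form_a p (v, z) (fst U, fst (snd U))"
        by (rule form_a_right[OF V(2) W2_W1[OF U]])
      then show ?thesis
        unfolding form_c_right(2)[OF V(1) W2_V2[OF U] W2_V2[OF U]] form_b_right[OF d(1) U]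
        by (simp add: fst_scaleC snd_scaleC scaleC_prod_def[of _ "(_, _)"] algebra_simps)
    qed
    show "?R (\<i> *\<^sub>C U) = - \<i> * ?R U" if U: "U \<in> W2 p" for U
    proof -
      have "form_a p F1 (\<i> *\<^sub>C (fst U, fst (snd U))) = cnj \<i> * form_a p F1 (fst U, fst (snd U))"
        by (rule form_a_right[OF F1 W2_W1[OF U]])
      then show ?thesis
        unfolding form_c_right(2)[OF F2 W2_V2[OF U] W2_V2[OF U]]
        by (simp add: fst_scaleC snd_scaleC scaleC_prod_def[of _ "(_, _)"] algebra_simps)
    qed
    show "Re (?L U) = Re (?R U)" if U: "U \<in> W2 p" for U
    proof -
      obtain u y t where U': "U = (u, y, t)" by (cases U) auto
      let ?Y = "(u, y, dl p u, dr p y, dl p (dl p u), dr p (dr p y), t, dl p t)"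
      have "inner (G X) ?Y = inner h ?Y" by (rule X(2)[OF W2_jets[OF U[unfolded U']]])
      moreover have rb: "Re (form_b p (v, z, \<theta>) (u, y, t)) =
          \<gamma> p * (inner v1 (dl p t) - inner \<theta>1 (dl p u)) + \<kappa> p * inner \<theta>1 (dl p t)"
        by (simp add: form_b_cip[OF d(1)] d inner_l2_def)
      have "Re (?L U) = inner (G X) ?Y"
        using form_c_cip[OF V(1), of u y t] form_a_cip[OF V(2), of u y]
        by (simp add: rb U' X' G_def d inner_l2_def[symmetric] inner_diff_left inner_add_left algebra_simps)
      moreover have "Re (?R U) = inner h ?Y"
        using form_c_cip[OF F2[unfolded F2'], of u y t] form_a_cip[OF F1[unfolded F1'], of u y]
        by (simp add: U' F1' F2' h_def inner_l2_def[symmetric] algebra_simps)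
      ultimately show ?thesis by simp
    qed
  qed
  with d(1) show ?thesis using that by blast
qed

lemma op_A_rel_range:
  fixes l :: real
  assumes l: "l > 0" and F: "F \<in> energy_space p"
  obtains \<Phi> \<Psi> where "op_A_rel \<Phi> \<Psi>" "\<Phi> - l *\<^sub>R \<Psi> = F"
proof -
  have F12: "fst F \<in> W1 p" "snd F \<in> V2 p" using F by (auto simp: energy_space_def)
  obtain V where V: "V \<in> W2 p" and eq: "\<And>U. U \<in> W2 p \<Longrightarrow>
      form_c p V U + l * form_b p V U + l\<^sup>2 * form_a p (fst V, fst (snd V)) (fst U, fst (snd U))
       = form_c p (snd F) U - l * form_a p (fst F) (fst U, fst (snd U))"
    by (rule solve_weak_form[OF l F12]) blast
  let ?Z = "(fst V, fst (snd V))"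
  \<comment> \<open>The second component of \<open>op_A\<close> at the solution, read off from the
    resolvent equation \<open>V - l *\<^sub>R W = snd F\<close>.\<close>
  define W where "W = complex_of_real (1 / l) *\<^sub>C (V + (- 1) *\<^sub>C snd F)"
  note V2 = W2_V2[OF V] and Z = W2_W1[OF V]
  note n = V2_ops(3)[OF F12(2), of "-1"]
  note lZ = W1_ops(3)[OF Z, of "complex_of_real l"]
  have W: "W \<in> V2 p" unfolding W_def by (rule V2_ops(3)[OF V2_ops(2)[OF V2 n]])
  have "form_c p W U = - (form_b p V U + form_a p (fst F + complex_of_real l *\<^sub>C ?Z) (fst U, fst (snd U)))"
    if U: "U \<in> W2 p" for U
  proof -
    let ?U = "(fst U, fst (snd U))"
    have "form_c p W U = (form_c p V U - form_c p (snd F) U) / l"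
      unfolding W_def form_c_left(2)[OF V2_ops(2)[OF V2 n] V2] form_c_left(1)[OF V2 n] form_c_left(2)[OF F12(2) F12(2)]
      by simp
    also have "form_c p V U - form_c p (snd F) U = - l * (form_b p V U + (form_a p (fst F) ?U + l * form_a p ?Z ?U))"
      using eq[OF U] by (simp add: algebra_simps power2_eq_square)
    finally show ?thesis
      unfolding form_a_left(1)[OF F12(1) lZ] form_a_left(2)[OF Z Z] using l by simp
  qed
  then have "op_A_rel (fst F + complex_of_real l *\<^sub>C ?Z, V) (?Z, W)"
    unfolding op_A_rel_def fst_conv snd_conv using W1_ops(2)[OF F12(1) lZ] V W by blast
  moreover have "(fst F + complex_of_real l *\<^sub>C ?Z, V) - l *\<^sub>R (?Z, W) = F"
  proof -
    have "l *\<^sub>R W = V - snd F"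
      unfolding W_def using l by (simp add: scaleR_scaleC scaleC_scaleC scaleC_one scaleC_neg_one)
    moreover have "complex_of_real l *\<^sub>C ?Z = l *\<^sub>R ?Z" by (simp only: scaleR_scaleC)
    ultimately show ?thesis by (simp add: diff_diff_eq2)
  qed
  ultimately show ?thesis using that by blast
qed

lemma op_A_dissipative_transfer: "dissipative_transfer (energy_space p) (energy_norm p) J (dom_A p) (op_A p)"
proof
  have H: "fst \<Phi> \<in> W1 p" "snd \<Phi> \<in> V2 p" if "\<Phi> \<in> energy_space p" for \<Phi> using that by (auto simp: energy_space_def)
  show ES: "complex_subspace (energy_space p)"
    unfolding complex_subspace_def
  proof (intro conjI ballI allI)
    show "0 \<in> energy_space p" using W1_ops(1) V2_ops(1) by (simp add: energy_space_def zero_prod_def)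
    show "x + y \<in> energy_space p" if "x \<in> energy_space p" "y \<in> energy_space p" for x y
      using W1_ops(2)[OF H(1)[OF that(1)] H(1)[OF that(2)]] V2_ops(2)[OF H(2)[OF that(1)] H(2)[OF that(2)]]
      by (simp add: energy_space_def mem_Times_iff)
    show "c *\<^sub>C x \<in> energy_space p" if "x \<in> energy_space p" for c x
      using W1_ops(3)[OF H(1)[OF that]] V2_ops(3)[OF H(2)[OF that]]
      by (simp add: energy_space_def mem_Times_iff fst_scaleC snd_scaleC)
  qed
  show "complex_subspace (dom_A p)"
    unfolding complex_subspace_def
  proof (intro conjI ballI allI)
    \<comment> \<open>The range result provides some element of the domain; its multiple by 0 shows
      that 0 belongs to it.\<close>
    obtain \<Phi> \<Psi> where g: "op_A_rel \<Phi> \<Psi>" using op_A_rel_range[OF zero_less_one complex_subspaceD(1)[OF ES]] by metis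
    from op_A_rel_imp(1)[OF op_A_rel_scaleC[OF g, of 0]] show "0 \<in> dom_A p" by (simp only: scaleC_zero_left)
    show "x + y \<in> dom_A p" if "x \<in> dom_A p" "y \<in> dom_A p" for x y
      by (rule op_A_rel_imp(1)[OF op_A_rel_add[OF dom_A_op_A_rel[OF that(1)] dom_A_op_A_rel[OF that(2)]]])
    show "c *\<^sub>C x \<in> dom_A p" if "x \<in> dom_A p" for c x
      by (rule op_A_rel_imp(1)[OF op_A_rel_scaleC[OF dom_A_op_A_rel[OF that]]])
  qed
  show "dom_A p \<subseteq> energy_space p" using W2_V2 by (auto simp: dom_A_def energy_space_def)
  show "J (x + y) = J x + J y" if "x \<in> energy_space p" "y \<in> energy_space p" for x y
    using JW_linear(1)[OF H(1)[OF that(1)] H(1)[OF that(2)]] JV_linear(1)[OF H(2)[OF that(1)] H(2)[OF that(2)]]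
    by (simp add: J_def)
  show "J (r *\<^sub>R x) = r *\<^sub>R J x" if "x \<in> energy_space p" for r x
    using JW_scaleR[OF H(1)[OF that]] JV_scaleR[OF H(2)[OF that]] by (simp add: J_def)
  show "norm (J (c *\<^sub>C x)) = cmod c * norm (J x)" if "x \<in> energy_space p" for c x
  proof -
    have "J (c *\<^sub>C x) = c *\<^sub>C J x"
      unfolding J_def fst_scaleC snd_scaleC JW_linear(2)[OF H(1)[OF that] H(1)[OF that]]
        JV_linear(2)[OF H(2)[OF that] H(2)[OF that]] by (simp add: scaleC_prod_def)
    moreover have "norm (c *\<^sub>C J x) = cmod c * norm (J x)"
      by (intro norm_scaleC_prod norm_scaleC_l2)
    ultimately show ?thesis by simp
  qed
  show "x = 0" if "x \<in> energy_space p" "J x = 0" for x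
    using JW_zero[OF H(1)[OF that(1)]] JV_zero[OF H(2)[OF that(1)]] that(2) by (simp add: J_def prod_eq_iff zero_prod_def)
  show "energy_norm p x = norm (J x)" if "x \<in> energy_space p" for x
    by (simp add: ip_norm_def energy_ip_def Re_form_a[OF H(1)[OF that]] Re_form_c[OF H(2)[OF that]] J_def norm_eq_sqrt_inner)
  have "J ` energy_space p = (JW ` W1 p) \<times> (JV ` V2 p)"
    by (auto simp: J_def energy_space_def image_iff)
  then show "closed (J ` energy_space p)" by (simp add: closed_Times closed_JW closed_JV)
  show "op_A p x \<in> energy_space p" if "x \<in> dom_A p" for x
  proof -
    have "fst (op_A p x) \<in> W1 p" "snd (op_A p x) \<in> V2 p"
      using dom_A_op_A_rel[OF that] W2_W1[of "snd x"] unfolding op_A_rel_def by metis+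
    then show ?thesis by (simp add: energy_space_def mem_Times_iff)
  qed
  show "op_A p (x + y) = op_A p x + op_A p y" if "x \<in> dom_A p" "y \<in> dom_A p" for x y
    by (rule op_A_rel_imp(2)[OF op_A_rel_add[OF dom_A_op_A_rel[OF that(1)] dom_A_op_A_rel[OF that(2)]]])
  show "op_A p (c *\<^sub>C x) = c *\<^sub>C op_A p x" if "x \<in> dom_A p" for c x
    by (rule op_A_rel_imp(2)[OF op_A_rel_scaleC[OF dom_A_op_A_rel[OF that]]])
  show "inner (J (op_A p x)) (J x) \<le> 0" if "x \<in> dom_A p" for x
    by (rule op_A_rel_dissipative[OF dom_A_op_A_rel[OF that]])
  show "\<exists>x\<in>dom_A p. x - l *\<^sub>R op_A p x = f" if "l > 0" "f \<in> energy_space p" for l f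
    using op_A_rel_range[OF that] op_A_rel_imp by metis
qed

end

theorem theorem3p2:
  fixes p :: beam
  assumes "0 < len\<^sub>0 p" and "len\<^sub>0 p < len p"
    and "\<rho>\<^sub>0 p > 0" and "\<rho>\<^sub>1 p > 0" and "\<rho>\<^sub>2 p > 0"
    and "\<alpha>\<^sub>1 p > 0" and "\<alpha>\<^sub>2 p > 0" and "\<beta>\<^sub>1 p > 0" and "\<beta>\<^sub>2 p > 0"
    and "\<kappa> p > 0" and "\<gamma> p \<noteq> 0"
  shows "generated_semigroup p (semigroup_A p) \<and>
    (\<forall>\<Phi>\<^sub>0 \<in> energy_space p.
       weak_solution p \<Phi>\<^sub>0 (\<lambda>t. semigroup_A p t \<Phi>\<^sub>0) \<and>
       (\<forall>\<Psi>. weak_solution p \<Phi>\<^sub>0 \<Psi> \<longrightarrow> (\<forall>t\<ge>0. \<Psi> t = semigroup_A p t \<Phi>\<^sub>0)) \<and>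
       (\<Phi>\<^sub>0 \<in> dom_A p \<longrightarrow>
          norm_continuous (dom_A p) (graph_norm p) (\<lambda>t. semigroup_A p t \<Phi>\<^sub>0) \<and>
          norm_C1 (energy_space p) (energy_norm p) (\<lambda>t. semigroup_A p t \<Phi>\<^sub>0)))"
proof -
  interpret thermoelastic_beam p by unfold_locales (use assms in auto)
  interpret E: dissipative_transfer "energy_space p" "energy_norm p" J "dom_A p" "op_A p" by (rule op_A_dissipative_transfer)
  \<comment> \<open>The flow is the witness that the choice in \<open>semigroup_A\<close>
    succeeds.\<close>
  have gen: "generated_semigroup p (semigroup_A p)"
    unfolding semigroup_A_def
    by (rule someI[of "generated_semigroup p" E.flow]) (simp add: generated_semigroup_def E.flow_is_generated)
  \<comment> \<open>Whichever semigroup was chosen, the generator determines it at nonnegative times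
    on the energy space, so everything proved for the flow carries over.\<close>
  have eq: "semigroup_A p t x = E.flow t x" if "x \<in> energy_space p" "0 \<le> t" for t x
    using E.semigroup_eq_flow[OF _ _ that(2,1)] gen unfolding generated_semigroup_def by blast
  have ws: "weak_solution p x f \<longleftrightarrow> E.weak_sol x f" for x f
    unfolding weak_solution_def E.weak_sol_def ..
  have gn: "graph_norm p = (\<lambda>y. energy_norm p y + energy_norm p (op_A p y))"
    by (rule ext) (simp add: graph_norm_def)
  show ?thesis
  proof (intro conjI ballI allI impI gen)
    fix x assume x: "x \<in> energy_space p"
    show "weak_solution p x (\<lambda>t. semigroup_A p t x)"
      using E.flow_weak_sol[OF x] unfolding ws[symmetric] by (rule weak_solution_cong) (rule eq[OF x])
    show "\<Psi> t = semigroup_A p t x" if "weak_solution p x \<Psi>" "0 \<le> t" for \<Psi> t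
      using E.weak_sol_unique[OF x that(1)[unfolded ws] that(2)] eq[OF x that(2)] by simp
    assume D: "x \<in> dom_A p"
    show "norm_continuous (dom_A p) (graph_norm p) (\<lambda>t. semigroup_A p t x)"
      using E.flow_domain_continuous[OF D] unfolding gn by (rule norm_continuous_cong) (rule eq[OF x])
    show "norm_C1 (energy_space p) (energy_norm p) (\<lambda>t. semigroup_A p t x)"
      using E.flow_C1[OF D] by (rule norm_C1_cong) (rule eq[OF x])
  qed
qed

end
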